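(* Consider the rescaled trigonometric $q$-Racah ensembles described in the context, with $q=e^{ig_q}$, $\alpha=q^{g_\alpha}$, $\beta=q^{g_\beta}$, $\delta=q^{g_\delta}$, $\gamma=q^{g_\gamma}$. Assume there exist $k_1,k_2\in\mathbb Z$ such that $$\frac{2k_1\pi}{g_q}<g_\alpha+g_\beta<\frac{2\pi(k_1+1)}{g_q}+2g_\gamma,\qquad \frac{2k_2\pi}{g_q}\le g_\gamma+g_\delta\le\frac{2\pi(k_2+1)}{g_q}+2g_\gamma .$$ If $\mu'(x)\ne0$, then there are two real solutions $\xi_\pm(x)$ to $4a(\xi)^2-(\mu(x)-b(\xi))^2=0$, where $a(\xi),b(\xi)$ are the limits of the recurrence coefficients, ordered as $\xi_-(x)\le\xi_+(x)$. Then, as $n\to\infty$, the limiting density for the rescaled $q$-Racah ensembles is given by $$\rho(x)=\begin{cases}1,&\xi_-(x)<\xi_+(x)\le1,\\[2pt] \dfrac1\pi\arccos\left(\dfrac{2\tilde y(1)-\tilde y(\xi_-(x))-\tilde y(\xi_+(x))}{\left|\tilde y(\xi_-(x))-\tilde y(\xi_+(x))\right|}\right),&\xi_-(x)<1<\xi_+(x),\\[8pt] 0,&1\le\xi_-(x)<\xi_+(x),\end{cases}$$ where $\tilde y(\xi)=2\cos\left(g_q\left(\frac{g_\alpha+g_\beta}2+\xi\right)\right)$.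
   Context: Here $q^s:=e^{ig_qs}$ for real $s$ and $0<g_q<\pi$. For $n\in\mathbb N$ let $\mathbf q=q^{1/n}=e^{ig_q/n}$; let $M=M_n\ge n$ be integers, $g_{\gamma_n}<0$ with $-ng_{\gamma_n}=M+1$, $\gamma_n=q^{g_{\gamma_n}}$, and assume $g_{\gamma_n}\to g_\gamma\in(-\pi/g_q,0)$ as $n\to\infty$. The real numbers $g_\alpha,g_\beta,g_\delta$ do not depend on $n$. Standing restrictions: $$-\frac\pi{g_q}\le g_{\gamma_n}\le-1,\quad \frac{2\pi j}{g_q}\le g_\alpha\le g_{\gamma_n}+\frac{2\pi(j+1)}{g_q},\quad \frac{2\pi j}{g_q}\le g_\beta\le g_{\gamma_n}+\frac{2\pi(j+1)}{g_q},$$ $$\frac{2\pi k}{g_q}\le g_\alpha+g_\beta\le2g_{\gamma_n}+\frac{2\pi(k+1)}{g_q},\quad \frac{2\pi l}{g_q}\le g_\beta+g_\delta\le\frac{2\pi(l+1)}{g_q}+g_\gamma,\quad \frac{2\pi m}{g_q}\le g_\alpha-g_\delta\le\frac{2\pi(m+1)}{g_q}+g_\gamma$$ for some $j,k,l,m\in\mathbb Z$ with $|l-m|$ odd; under these the weight below is nonnegative for $y=0,\dots,M$. The ensemble of size $n$ is the probability measure on $y_1,\dots,y_n\in\{0,\dots,M\}$ proportional to $\prod_{i<j}(\tilde\nu_n(y_i)-\tilde\nu_n(y_j))^2\prod_jw(y_j)$, where $\tilde\nu_n=(\gamma_n\delta\mathbf q)^{-1/2}\nu_n$ is real-valued, $\nu_n(y)=\mathbf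 q^{-y}+\delta\gamma_n\mathbf q^{y+1}$, and $$w(y)=\frac{(\alpha\mathbf q,\beta\delta\mathbf q,\gamma_n\mathbf q,\gamma_n\delta\mathbf q;\mathbf q)_y\,(1-\gamma_n\delta\mathbf q^{2y+1})}{(\mathbf q,\alpha^{-1}\gamma_n\delta\mathbf q,\beta^{-1}\gamma_n\mathbf q,\delta\mathbf q;\mathbf q)_y\,(\alpha\beta\mathbf q)^y(1-\gamma_n\delta\mathbf q)},$$ with $(x_1,\dots,x_r;\mathbf q)_k=\prod_i\prod_{s=0}^{k-1}(1-x_i\mathbf q^s)$. The rescaled ensemble is $x_j=y_j/n$. Limits: $\mu(x)=q^{-x}+\gamma\delta q^x$, $a(\xi)^2=A(\xi)C(\xi)$, $b(\xi)=1+\gamma\delta-A(\xi)-C(\xi)$ with $$A(\xi)=\frac{(1-\gamma q^\xi)(1-\alpha q^\xi)(1-\alpha\beta q^\xi)(1-\beta\delta q^\xi)}{(1-\alpha\beta q^{2\xi})^2},\qquad C(\xi)=\frac{(1-q^\xi)(1-\beta q^\xi)(\delta-\alpha q^\xi)(\gamma-\alpha\beta q^\xi)}{(1-\alpha\beta q^{2\xi})^2}.$$ Here $x$ ranges over $[0,-g_\gamma]$, and solutions $\xi$ are sought in $[0,-g_\gamma]$. "Limiting density $\rho$" means that, almost surely (the ensembles for different $n$ being defined on a common probability space), $\frac1n\sum_{j=1}^nf(x_j)\to\int_0^{-g_\gamma}f(x)\rho(x)\,dx$ for every continuous $f$.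
   Formalization: For odd k_1 the argument of the arccos is multiplied by -1 (i.e. ỹ is replaced by -ỹ), since ỹ is then increasing and the displayed formula gives one minus the true density; for even k_1 the formula is as displayed. *)

theory Defs
  imports "HOL-Probability.Probability"
begin

text \<open>
  Throughout, \<open>gq, ga, gb, gd, gg\<close> are the real exponents \<open>g_q, g_alpha, g_beta, g_delta, g_gamma\<close>
  (the last one possibly for a fixed \<open>n\<close>), so that \<open>alpha = qpow gq ga\<close> and so on.
  \<open>qpow\<close> takes the real exponent as argument, because \<open>q\<^sup>s = exp (\<i> gq s)\<close> is not a function of
  the complex number \<open>q\<close> alone.
\<close>

definition qpow :: "real \<Rightarrow> real \<Rightarrow> complex" where
  "qpow gq s = cis (gq * s)"

definition qpoch :: "complex list \<Rightarrow> complex \<Rightarrow> nat \<Rightarrow> complex" where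
  "qpoch xs q k = (\<Prod>x\<leftarrow>xs. \<Prod>s<k. 1 - x * q ^ s)"

definition qRacah_weight ::
  "complex \<Rightarrow> complex \<Rightarrow> complex \<Rightarrow> complex \<Rightarrow> complex \<Rightarrow> nat \<Rightarrow> complex" where
  "qRacah_weight q \<alpha> \<beta> \<gamma> \<delta> y =
     qpoch [\<alpha> * q, \<beta> * \<delta> * q, \<gamma> * q, \<gamma> * \<delta> * q] q y * (1 - \<gamma> * \<delta> * q ^ (2 * y + 1)) /
     (qpoch [q, inverse \<alpha> * \<gamma> * \<delta> * q, inverse \<beta> * \<gamma> * q, \<delta> * q] q y
        * (\<alpha> * \<beta> * q) ^ y * (1 - \<gamma> * \<delta> * q))"

definition nu :: "complex \<Rightarrow> complex \<Rightarrow> complex \<Rightarrow> nat \<Rightarrow> complex" where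
  "nu q \<gamma> \<delta> y = inverse (q ^ y) + \<delta> * \<gamma> * q ^ (y + 1)"

text \<open>The ensemble of size \<open>n\<close> uses the base \<open>qpow gq (1/n)\<close>.\<close>

definition w_n :: "real \<Rightarrow> real \<Rightarrow> real \<Rightarrow> real \<Rightarrow> real \<Rightarrow> nat \<Rightarrow> nat \<Rightarrow> complex" where
  "w_n gq ga gb gd gg n y =
     qRacah_weight (qpow gq (1 / real n)) (qpow gq ga) (qpow gq gb) (qpow gq gg) (qpow gq gd) y"

text \<open>The prefactor is \<open>(gamma delta q)\<close> to the power \<open>-1/2\<close>, at base \<open>qpow gq (1/n)\<close>.\<close>

definition nu_tilde :: "real \<Rightarrow> real \<Rightarrow> real \<Rightarrow> nat \<Rightarrow> nat \<Rightarrow> complex" where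
  "nu_tilde gq gd gg n y =
     qpow gq (- (gg + gd + 1 / real n) / 2)
       * nu (qpow gq (1 / real n)) (qpow gq gg) (qpow gq gd) y"

definition configs :: "nat \<Rightarrow> nat \<Rightarrow> (nat \<Rightarrow> nat) set" where
  "configs n M = {1..n} \<rightarrow>\<^sub>E {0..M}"

text \<open>All factors below are real, as the phases cancel; \<open>Re\<close> only changes the type.\<close>

definition config_weight ::
  "real \<Rightarrow> real \<Rightarrow> real \<Rightarrow> real \<Rightarrow> real \<Rightarrow> nat \<Rightarrow> (nat \<Rightarrow> nat) \<Rightarrow> real" where
  "config_weight gq ga gb gd gg n y =
     Re ((\<Prod>j\<in>{1..n}. \<Prod>i\<in>{1..<j}. (nu_tilde gq gd gg n (y i) - nu_tilde gq gd gg n (y j))\<^sup>2)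
           * (\<Prod>j\<in>{1..n}. w_n gq ga gb gd gg n (y j)))"

definition ensemble_prob ::
  "real \<Rightarrow> real \<Rightarrow> real \<Rightarrow> real \<Rightarrow> real \<Rightarrow> nat \<Rightarrow> nat \<Rightarrow> (nat \<Rightarrow> nat) \<Rightarrow> real" where
  "ensemble_prob gq ga gb gd gg n M y =
     config_weight gq ga gb gd gg n y / (\<Sum>z\<in>configs n M. config_weight gq ga gb gd gg n z)"

text \<open>
  If some weights had opposite signs, truncation by \<open>ennreal\<close> would give a density of mass
  different from \<open>1\<close>, so no random variable on a probability space would satisfy this.
\<close>

definition is_qRacah_ensemble ::
  "'w measure \<Rightarrow> real \<Rightarrow> real \<Rightarrow> real \<Rightarrow> real \<Rightarrow> real \<Rightarrow> nat \<Rightarrow> nat \<Rightarrow> ('w \<Rightarrow> nat \<Rightarrow> nat) \<Rightarrow> bool" where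
  "is_qRacah_ensemble P gq ga gb gd gg n M Y \<longleftrightarrow>
     distributed P (count_space (configs n M)) Y
       (\<lambda>y. ennreal (ensemble_prob gq ga gb gd gg n M y))"

definition mu :: "real \<Rightarrow> real \<Rightarrow> real \<Rightarrow> real \<Rightarrow> complex" where
  "mu gq gd gg x = qpow gq (- x) + qpow gq gg * qpow gq gd * qpow gq x"

definition lim_A :: "real \<Rightarrow> real \<Rightarrow> real \<Rightarrow> real \<Rightarrow> real \<Rightarrow> real \<Rightarrow> complex" where
  "lim_A gq ga gb gd gg \<xi> =
     (let \<alpha> = qpow gq ga; \<beta> = qpow gq gb; \<delta> = qpow gq gd; \<gamma> = qpow gq gg; u = qpow gq \<xi> in
      (1 - \<gamma> * u) * (1 - \<alpha> * u) * (1 - \<alpha> * \<beta> * u) * (1 - \<beta> * \<delta> * u) / (1 - \<alpha> * \<beta> * u\<^sup>2)\<^sup>2)"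

definition lim_C :: "real \<Rightarrow> real \<Rightarrow> real \<Rightarrow> real \<Rightarrow> real \<Rightarrow> real \<Rightarrow> complex" where
  "lim_C gq ga gb gd gg \<xi> =
     (let \<alpha> = qpow gq ga; \<beta> = qpow gq gb; \<delta> = qpow gq gd; \<gamma> = qpow gq gg; u = qpow gq \<xi> in
      (1 - u) * (1 - \<beta> * u) * (\<delta> - \<alpha> * u) * (\<gamma> - \<alpha> * \<beta> * u) / (1 - \<alpha> * \<beta> * u\<^sup>2)\<^sup>2)"

definition lim_a_sq :: "real \<Rightarrow> real \<Rightarrow> real \<Rightarrow> real \<Rightarrow> real \<Rightarrow> real \<Rightarrow> complex" where
  "lim_a_sq gq ga gb gd gg \<xi> = lim_A gq ga gb gd gg \<xi> * lim_C gq ga gb gd gg \<xi>"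

definition lim_b :: "real \<Rightarrow> real \<Rightarrow> real \<Rightarrow> real \<Rightarrow> real \<Rightarrow> real \<Rightarrow> complex" where
  "lim_b gq ga gb gd gg \<xi> =
     1 + qpow gq gg * qpow gq gd - lim_A gq ga gb gd gg \<xi> - lim_C gq ga gb gd gg \<xi>"

definition y_tilde :: "real \<Rightarrow> real \<Rightarrow> real \<Rightarrow> real \<Rightarrow> real" where
  "y_tilde gq ga gb \<xi> = 2 * cos (gq * ((ga + gb) / 2 + \<xi>))"

text \<open>
  \<open>xm\<close> and \<open>xp\<close> are the values of \<open>xi_-\<close> and \<open>xi_+\<close> at a point. The hypothesis on \<open>k1\<close> makes
  \<open>y_tilde\<close> strictly monotone on \<open>[0, -gg]\<close>: decreasing for even \<open>k1\<close>, increasing for odd \<open>k1\<close>.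
  The arccos formula is that of the decreasing case. The sign replaces \<open>y_tilde\<close> by \<open>- y_tilde\<close>
  in the increasing case; without it the formula would there give one minus the density, and tend
  to \<open>1\<close> instead of \<open>0\<close> as \<open>xm\<close> tends to \<open>1\<close> from below.
  The last branch also covers \<open>xm = xp\<close>, where the density is not specified.
\<close>

definition lim_rho :: "int \<Rightarrow> real \<Rightarrow> real \<Rightarrow> real \<Rightarrow> real \<Rightarrow> real \<Rightarrow> real" where
  "lim_rho k1 gq ga gb xm xp =
     (let Y = y_tilde gq ga gb; \<sigma> = (if even k1 then 1 else - 1) in
      if xm < xp \<and> xp \<le> 1 then 1
      else if xm < 1 \<and> 1 < xp
        then 1 / pi * arccos (\<sigma> * ((2 * Y 1 - Y xm - Y xp) / \<bar>Y xm - Y xp\<bar>))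
      else 0)"

definition has_limiting_density ::
  "'w measure \<Rightarrow> (nat \<Rightarrow> 'w \<Rightarrow> nat \<Rightarrow> nat) \<Rightarrow> real \<Rightarrow> (real \<Rightarrow> real) \<Rightarrow> bool" where
  "has_limiting_density P Y L \<rho> \<longleftrightarrow>
     (AE \<omega> in P. \<forall>f::real \<Rightarrow> real. continuous_on UNIV f \<longrightarrow>
        (\<lambda>n. 1 / real n * (\<Sum>j = 1..n. f (real (Y n \<omega> j) / real n)))
          \<longlonglongrightarrow> (LINT x:{0..L}|lborel. f x * \<rho> x))"

end

theory Submission
  imports Defs
begin

text \<open>
  The squared Vandermonde factor makes the ensemble a Coulomb gas on the sites \<open>x = y/n\<close>, with particle
  density at most \<open>1\<close>. In the angles \<open>p\<close>, \<open>s\<close>, \<open>a\<close>, which are \<open>g\<^sub>q/2\<close> times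
  \<open>g\<^sub>\<gamma> + g\<^sub>\<delta>\<close>, \<open>g\<^sub>\<alpha> + g\<^sub>\<beta>\<close>, \<open>g\<^sub>\<alpha>\<close> reduced modulo \<open>\<pi>\<close>, the particles sit at
  \<open>2 cos (p + 2 h x)\<close>, and \<open>4 a(\<xi>)\<^sup>2 - (\<mu>(x) - b(\<xi>))\<^sup>2\<close> is, up to a phase and squares of sines, invariant under
  exchanging \<open>(p, x)\<close> with \<open>(s, \<xi>)\<close>. For fixed \<open>\<xi>\<close> the points \<open>x\<close> where it is positive form a band carrying
  an arccosine density; \<open>\<rho>\<close> is the integral of these densities over \<open>\<xi> \<in> [0, 1]\<close>, so that its logarithmic
  potential is an integral of arcosh terms. The limit \<open>V\<close> of \<open>- ln w / n\<close> satisfies \<open>V' = ln (C/A)\<close>, which integrates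
  the same terms over \<open>\<xi> \<in> [0, L]\<close>. Comparing the integrands gives the Euler--Lagrange conditions of the
  constrained equilibrium problem.

  For finite \<open>n\<close>, a configuration is compared with the one in which the particles away from the end points are
  moved to sites selected according to \<open>\<rho>\<close>. The logarithmic kernel, regularized as a Poisson kernel, is
  conditionally definite with a gap in each cosine mode; hence a configuration has probability at most
  \<open>exp (- c n\<^sup>2)\<close> unless its cosine moments are close to those of \<open>\<rho>\<close>. There are only \<open>(M + 1)\<^sup>n\<close>
  configurations, so the Borel--Cantelli lemma and the Weierstrass theorem give the almost sure limit.
\<close>

text \<open>The comparison configuration is built from the given one, so only a ratio of two weights
  is ever estimated and the partition function never is: a weight at most exp (- c n^2) times that
  of another configuration belongs to a configuration of probability at most exp (- c n^2). The end
  points shape the argument. There \<open>ln (C/A)\<close> may be unbounded, the map from x to 2 cos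
  (p + 2 h x) may degenerate, and the angles at finite n may leave [0, \<pi>]. Hence the estimates
  concern the sites between \<epsilon> n and (L - \<epsilon>) n. The at most 3 \<epsilon> n other
  particles stay where they are: their mutual energy cancels, and their interaction with the rest
  costs O(sqrt \<epsilon>) n^2. The regularization takes r = 1 - \<epsilon>^2, so that its error is
  again small with \<epsilon>. Since \<epsilon> is fixed before n tends to infinity, factors such as
  \<epsilon>^-4 are harmless: they multiply only terms of order n or the error of the angles.
  Logarithmic singularities are bounded by inverse square roots throughout, because these have
  explicit integrals and lattice sums.\<close>

section \<open>Trigonometric identities behind the duality\<close>

lemma sin_quadruple_product_sum:
  fixes T x1 x2 x3 x4 :: real
  defines "t \<equiv> 2 * T"
  shows "8 * (sin (T + x1) * sin (T + x2) * sin (T + x3) * sin (T + x4)) =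
    cos (2*t + (x1+x2+x3+x4)) - cos (t + (x1+x2+x3-x4)) - cos (t + (x1+x2-x3+x4))
    - cos (t + (x1-x2+x3+x4)) - cos (t + (-x1+x2+x3+x4))
    + cos (x1+x2-x3-x4) + cos (x1-x2+x3-x4) + cos (x1-x2-x3+x4)"
proof -
  have 1: "2 * (sin (T + x1) * sin (T + x2)) = cos (x1 - x2) - cos (t + (x1 + x2))"
    using sin_times_sin[of "T + x1" "T + x2"] by (simp add: t_def algebra_simps)
  have 2: "2 * (sin (T + x3) * sin (T + x4)) = cos (x3 - x4) - cos (t + (x3 + x4))"
    using sin_times_sin[of "T + x3" "T + x4"] by (simp add: t_def algebra_simps)
  have c: "2 * (cos u * cos v) = cos (u - v) + cos (u + v)" for u v :: real
    using cos_times_cos[of u v] by simp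
  have "8 * (sin (T + x1) * sin (T + x2) * sin (T + x3) * sin (T + x4)) =
      2 * ((2 * (sin (T + x1) * sin (T + x2))) * (2 * (sin (T + x3) * sin (T + x4))))"
    by simp
  also have "\<dots> = 2 * (cos (x1 - x2) * cos (x3 - x4)) - 2 * (cos (x1 - x2) * cos (t + (x3 + x4)))
      - 2 * (cos (t + (x1 + x2)) * cos (x3 - x4)) + 2 * (cos (t + (x1 + x2)) * cos (t + (x3 + x4)))"
    unfolding 1 2 by (simp add: algebra_simps)
  also have "\<dots> = (cos (x1 - x2 - (x3 - x4)) + cos (x1 - x2 + (x3 - x4)))
      - (cos (x1 - x2 - (t + (x3 + x4))) + cos (x1 - x2 + (t + (x3 + x4))))
      - (cos (t + (x1 + x2) - (x3 - x4)) + cos (t + (x1 + x2) + (x3 - x4)))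
      + (cos (t + (x1 + x2) - (t + (x3 + x4))) + cos (t + (x1 + x2) + (t + (x3 + x4))))"
    unfolding c by simp
  also have "cos (x1 - x2 - (t + (x3 + x4))) = cos (t + (-x1+x2+x3+x4))"
    by (subst cos_minus[symmetric]) (simp add: algebra_simps)
  finally show ?thesis
    by (simp add: algebra_simps)
qed

lemma cos_even_sign_sum:
  fixes x1 x2 x3 x4 :: real
  shows "4 * (cos x1 * cos x2 * cos x3 * cos x4 + sin x1 * sin x2 * sin x3 * sin x4) =
    cos (x1+x2+x3+x4) + cos (x1+x2-x3-x4) + cos (x1-x2+x3-x4) + cos (x1-x2-x3+x4)"
  by (simp add: cos_add cos_diff sin_add sin_diff algebra_simps)

lemma cos_odd_sign_sum:
  fixes x1 x2 x3 x4 :: real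
  shows "4 * (cos x1 * cos x2 * cos x3 * cos x4 - sin x1 * sin x2 * sin x3 * sin x4) =
    cos (x1+x2+x3-x4) + cos (x1+x2-x3+x4) + cos (x1-x2+x3+x4) + cos (-x1+x2+x3+x4)"
  by (simp add: cos_add cos_diff sin_add sin_diff algebra_simps)

text \<open>With the shifts of \<open>cA_cC_angles\<close>, -4 P and -4 M are the numerators of
  \<open>cA\<close> and \<open>cC\<close>. In their sum the second harmonic in 2T is compensated by
  2 cos (x1+x2+x3+x4) sin^2 (2T), which leaves an affine function of cos (2T). The difference is odd
  in T and therefore divisible by sin (2T).\<close>

lemma sin_quadruple_symmetrized:
  fixes T x1 x2 x3 x4 :: real
  defines "P \<equiv> \<lambda>T. sin (T + x1) * sin (T + x2) * sin (T + x3) * sin (T + x4)"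
    and "M \<equiv> \<lambda>T. sin (T - x1) * sin (T - x2) * sin (T - x3) * sin (T - x4)"
    and "c \<equiv> cos x1 * cos x2 * cos x3 * cos x4"
    and "d \<equiv> sin x1 * sin x2 * sin x3 * sin x4"
  shows "2 * cos (x1+x2+x3+x4) * (sin (2*T))\<^sup>2 + 4 * P T + 4 * M T =
           4 * (c + d) - cos (2*T) * (4 * (c - d))"
    and "4 * M T - 4 * P T = sin (2*T) * (2 * cos (2*T) * sin (x1+x2+x3+x4) -
           (sin (x1+x2+x3-x4) + sin (x1+x2-x3+x4) + sin (x1-x2+x3+x4) + sin (-x1+x2+x3+x4)))"
proof -
  define t where "t = 2 * T"
  define S where "S = x1+x2+x3+x4"
  define y1 where "y1 = x1+x2+x3-x4"
  define y2 where "y2 = x1+x2-x3+x4"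
  define y3 where "y3 = x1-x2+x3+x4"
  define y4 where "y4 = -x1+x2+x3+x4"
  define z where "z = cos (x1+x2-x3-x4) + cos (x1-x2+x3-x4) + cos (x1-x2-x3+x4)"
  have z': "z = cos (-x1-x2+x3+x4) + cos (-x1+x2-x3+x4) + cos (-x1+x2+x3-x4)"
    unfolding z_def by (simp add: cos_add cos_diff sin_add sin_diff algebra_simps)
  have P: "8 * P T = cos (2*t + S) - cos (t + y1) - cos (t + y2) - cos (t + y3) - cos (t + y4) + z"
    using sin_quadruple_product_sum[of T x1 x2 x3 x4]
    unfolding P_def t_def S_def y1_def y2_def y3_def y4_def z_def by simp
  have n: "- x1 - x2 - x3 - x4 = - S" "- x1 - x2 - x3 + x4 = - y1" "- x1 - x2 + x3 - x4 = - y2"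
    "- x1 + x2 - x3 - x4 = - y3" "x1 - x2 - x3 - x4 = - y4"
    unfolding S_def y1_def y2_def y3_def y4_def by simp_all
  have M: "8 * M T = cos (2*t - S) - cos (t - y1) - cos (t - y2) - cos (t - y3) - cos (t - y4) + z"
    using sin_quadruple_product_sum[of T "-x1" "-x2" "-x3" "-x4"] n
    unfolding M_def t_def z' by simp
  have E: "4 * (c + d) = cos S + z" "4 * (c - d) = cos y1 + cos y2 + cos y3 + cos y4"
    unfolding c_def d_def cos_even_sign_sum cos_odd_sign_sum S_def z_def y1_def y2_def y3_def y4_def
    by simp_all
  have s2: "(sin t)\<^sup>2 = 1 - (cos t)\<^sup>2" by (simp add: sin_squared_eq)
  have "4 * P T + 4 * M T = cos (2*t) * cos S - cos t * (cos y1 + cos y2 + cos y3 + cos y4) + z"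
    using P M by (simp add: cos_add cos_diff algebra_simps)
  moreover have "cos (2*t) * cos S = cos S - 2 * cos S * (sin t)\<^sup>2"
    unfolding cos_double_sin by (simp add: algebra_simps)
  ultimately show "2 * cos (x1+x2+x3+x4) * (sin (2*T))\<^sup>2 + 4 * P T + 4 * M T =
           4 * (c + d) - cos (2*T) * (4 * (c - d))"
    unfolding E S_def[symmetric] t_def[symmetric] by linarith
  have "4 * M T - 4 * P T = sin (2*t) * sin S - sin t * (sin y1 + sin y2 + sin y3 + sin y4)"
    using P M by (simp add: cos_add cos_diff algebra_simps)
  then show "4 * M T - 4 * P T = sin (2*T) * (2 * cos (2*T) * sin (x1+x2+x3+x4) -
           (sin (x1+x2+x3-x4) + sin (x1+x2-x3+x4) + sin (x1-x2+x3+x4) + sin (-x1+x2+x3+x4)))"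
    unfolding S_def[symmetric] y1_def[symmetric] y2_def[symmetric] y3_def[symmetric] y4_def[symmetric]
      t_def[symmetric] sin_double by (simp add: algebra_simps)
qed

text \<open>Yields the product of \<open>cA\<close> and \<open>cC\<close> as a quartic polynomial in
  cos (2T) over sin^4 (2T).\<close>

lemma sin_quadruple_norm:
  fixes T x1 x2 x3 x4 :: real
  shows "16 * ((sin (T + x1) * sin (T + x2) * sin (T + x3) * sin (T + x4)) *
          (sin (T - x1) * sin (T - x2) * sin (T - x3) * sin (T - x4))) =
         (cos (2*x1) - cos (2*T)) * (cos (2*x2) - cos (2*T)) * (cos (2*x3) - cos (2*T)) * (cos (2*x4) - cos (2*T))"
proof -
  have 1: "cos (2*x) - cos (2*T) = 2 * (sin (T + x) * sin (T - x))" for x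
    using sin_times_sin[of "T + x" "T - x"] by (simp add: algebra_simps)
  show ?thesis unfolding 1 by (simp add: algebra_simps)
qed

text \<open>The coefficients \<open>A\<close> and \<open>C\<close> of the paper after removal of the common phase, written in the
  dual variable \<open>x\<close>. Exchanging \<open>p\<close> and \<open>s\<close> gives them in the variable \<open>\<xi>\<close>.\<close>

definition cA :: "real \<Rightarrow> real \<Rightarrow> real \<Rightarrow> real \<Rightarrow> real \<Rightarrow> real \<Rightarrow> real" where
  "cA h L a p s x = 4 * sin (h * (L - x)) * sin (a + h * x) * sin (p + h * x) * sin (p + s + h * L - a + h * x)
     / (sin (p + 2 * h * x))\<^sup>2"

definition cC :: "real \<Rightarrow> real \<Rightarrow> real \<Rightarrow> real \<Rightarrow> real \<Rightarrow> real \<Rightarrow> real" where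
  "cC h L a p s x = 4 * sin (h * x) * sin (p + h * L + h * x) * sin (h * L + s - a - h * x) * sin (p - a + h * x)
     / (sin (p + 2 * h * x))\<^sup>2"

definition cB :: "real \<Rightarrow> real \<Rightarrow> real \<Rightarrow> real \<Rightarrow> real \<Rightarrow> real \<Rightarrow> real" where
  "cB h L a p s x = 2 * cos s - cA h L a p s x - cC h L a p s x"

text \<open>With exactly one factor sin^2 the expression is a polynomial in cos (p + 2 h x) and cos
  (s + 2 h \<xi>), see \<open>disc_polynomial\<close>; this is the normalization that is
  self-dual.\<close>

definition disc :: "real \<Rightarrow> real \<Rightarrow> real \<Rightarrow> real \<Rightarrow> real \<Rightarrow> real \<Rightarrow> real \<Rightarrow> real" where
  "disc h L a p s x \<xi> = (sin (p + 2 * h * x))\<^sup>2 *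
     (4 * cA h L a p s x * cC h L a p s x - (2 * cos (s + 2 * h * \<xi>) - cB h L a p s x)\<^sup>2)"

text \<open>Centred at T, half of p + 2 h x, the four sines in the numerator of \<open>cA\<close>
  have the shifts x1, ..., x4, whose sum is s, and those of \<open>cC\<close> have the opposite
  shifts. The minus sign comes from sin (h (L - x)) in \<open>cA\<close> and from sin (h L + s - a -
  h x) in \<open>cC\<close>, whose orientation is reversed.\<close>

lemma cA_cC_angles:
  fixes h L a p s x :: real
  defines "T \<equiv> p / 2 + h * x"
    and "x1 \<equiv> a - p / 2" and "x2 \<equiv> - p / 2 - h * L" and "x3 \<equiv> p / 2" and "x4 \<equiv> p / 2 + h * L + s - a"
  shows "cA h L a p s x = - 4 * (sin (T + x1) * sin (T + x2) * sin (T + x3) * sin (T + x4)) / (sin (2*T))\<^sup>2"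
    and "cC h L a p s x = - 4 * (sin (T - x1) * sin (T - x2) * sin (T - x3) * sin (T - x4)) / (sin (2*T))\<^sup>2"
proof -
  have e: "T + x1 = a + h * x" "T + x2 = - (h * (L - x))" "T + x3 = p + h * x"
    "T + x4 = p + s + h * L - a + h * x"
    "T - x1 = p - a + h * x" "T - x2 = p + h * L + h * x" "T - x3 = h * x"
    "T - x4 = - (h * L + s - a - h * x)" "2 * T = p + 2 * h * x"
    by (simp_all add: T_def x1_def x2_def x3_def x4_def field_simps)
  show "cA h L a p s x = - 4 * (sin (T + x1) * sin (T + x2) * sin (T + x3) * sin (T + x4)) / (sin (2*T))\<^sup>2"
    unfolding e cA_def sin_minus by (simp add: algebra_simps)
  show "cC h L a p s x = - 4 * (sin (T - x1) * sin (T - x2) * sin (T - x3) * sin (T - x4)) / (sin (2*T))\<^sup>2"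
    unfolding e cC_def sin_minus by (simp add: algebra_simps)
qed

text \<open>Products of the cosines and of the sines of the four shifts in
  \<open>cA_cC_angles\<close>.\<close>

definition pC where "pC h L a p s = cos (a - p/2) * cos (- p/2 - h*L) * cos (p/2) * cos (p/2 + h*L + s - a :: real)"
definition pS where "pS h L a p s = sin (a - p/2) * sin (- p/2 - h*L) * sin (p/2) * sin (p/2 + h*L + s - a :: real)"

lemma cA_cC_times_sin2:
  fixes h L a p s x :: real
  assumes "sin (p + 2 * h * x) \<noteq> 0"
  defines "T \<equiv> p / 2 + h * x"
    and "x1 \<equiv> a - p / 2" and "x2 \<equiv> - p / 2 - h * L" and "x3 \<equiv> p / 2" and "x4 \<equiv> p / 2 + h * L + s - a"
  shows "cA h L a p s x * (sin (p + 2 * h * x))\<^sup>2 = - 4 * (sin (T + x1) * sin (T + x2) * sin (T + x3) * sin (T + x4))"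
    and "cC h L a p s x * (sin (p + 2 * h * x))\<^sup>2 = - 4 * (sin (T - x1) * sin (T - x2) * sin (T - x3) * sin (T - x4))"
proof -
  have T: "2 * T = p + 2 * h * x" by (simp add: T_def)
  have div: "u / v\<^sup>2 * v\<^sup>2 = u" if "v \<noteq> 0" for u v :: real using that by simp
  show "cA h L a p s x * (sin (p + 2 * h * x))\<^sup>2 = - 4 * (sin (T + x1) * sin (T + x2) * sin (T + x3) * sin (T + x4))"
    unfolding cA_cC_angles(1)[of h L a p s x, folded T_def x1_def x2_def x3_def x4_def] T
    by (rule div[OF assms(1)])
  show "cC h L a p s x * (sin (p + 2 * h * x))\<^sup>2 = - 4 * (sin (T - x1) * sin (T - x2) * sin (T - x3) * sin (T - x4))"
    unfolding cA_cC_angles(2)[of h L a p s x, folded T_def x1_def x2_def x3_def x4_def] T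
    by (rule div[OF assms(1)])
qed

lemma cB_sin:
  assumes nz: "sin (p + 2 * h * x) \<noteq> 0"
  shows "cB h L a p s x * (sin (p + 2 * h * x))\<^sup>2 = 4 * (pC h L a p s + pS h L a p s) - cos (p + 2 * h * x) * (4 * (pC h L a p s - pS h L a p s))"
proof -
  define T where "T = p / 2 + h * x"
  have T: "2 * T = p + 2 * h * x" by (simp add: T_def)
  have S: "(a - p/2) + (- p/2 - h*L) + p/2 + (p/2 + h*L + s - a) = s" by simp
  show ?thesis
    using sin_quadruple_symmetrized(1)[of "a - p/2" "- p/2 - h*L" "p/2" "p/2 + h*L + s - a" T]
      cA_cC_times_sin2[OF nz, of L a s]
    unfolding cB_def T_def[symmetric] T S pC_def[symmetric] pS_def[symmetric] left_diff_distrib by linarith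
qed

text \<open>Flipping the signs of the two shifts - p/2 - h L and p/2 changes neither
  \<open>pC\<close> nor \<open>pS\<close>, hence not \<open>cB\<close>, but replaces the sum s of
  the shifts by s + 2 h L. So \<open>cB\<close> has a second expression attached to the end \<xi> =
  L, as its definition is to \<xi> = 0.\<close>

lemma cB_lower_form:
  fixes h L a p s x :: real
  assumes "sin (p + 2 * h * x) \<noteq> 0"
  defines "A' \<equiv> 4 * sin (h * x) * sin (p + h * L + h * x) * sin (a + h * x) * sin (p + s + h * L - a + h * x) / (sin (p + 2 * h * x))\<^sup>2"
    and "C' \<equiv> 4 * sin (h * (L - x)) * sin (p + h * x) * sin (h * L + s - a - h * x) * sin (p - a + h * x) / (sin (p + 2 * h * x))\<^sup>2"
  shows "cB h L a p s x = 2 * cos (s + 2 * h * L) + A' + C'" and "A' * C' = cA h L a p s x * cC h L a p s x"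
proof -
  define T where "T = p / 2 + h * x"
  have e: "T + (a - p/2) = a + h * x" "T + (p/2 + h*L) = p + h * L + h * x" "T + - (p/2) = h * x" "T + (p/2 + h*L + s - a) = p + s + h * L - a + h * x"
   "T - (a - p/2) = p - a + h * x" "T - (p/2 + h*L) = - (h * (L - x))" "T - - (p/2) = p + h * x" "T - (p/2 + h*L + s - a) = - (h * L + s - a - h * x)"
   "2 * T = p + 2 * h * x"
    by (simp_all add: T_def field_simps)
  have S: "(a - p/2) + (p/2 + h*L) + - (p/2) + (p/2 + h*L + s - a) = s + 2 * h * L" by simp
  have p2: "cos (- p/2 - h*L) = cos (p/2 + h*L)" "sin (- p/2 - h*L) = - sin (p/2 + h*L)"
    using cos_minus[of "p/2 + h*L"] sin_minus[of "p/2 + h*L"] by simp_all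
  have "2 * cos (s + 2 * h * L) * (sin (p + 2 * h * x))\<^sup>2 + A' * (sin (p + 2 * h * x))\<^sup>2 + C' * (sin (p + 2 * h * x))\<^sup>2
     = 4 * (pC h L a p s + pS h L a p s) - cos (p + 2 * h * x) * (4 * (pC h L a p s - pS h L a p s))"
    using sin_quadruple_symmetrized(1)[of "a - p/2" "p/2 + h*L" "- (p/2)" "p/2 + h*L + s - a" T] assms(1)
    unfolding A'_def C'_def S e pC_def pS_def p2 sin_minus cos_minus
    by (simp add: ac_simps)
  also have "\<dots> = cB h L a p s x * (sin (p + 2 * h * x))\<^sup>2" by (rule cB_sin[OF assms(1), symmetric])
  finally have "(cB h L a p s x - (2 * cos (s + 2 * h * L) + A' + C')) * (sin (p + 2 * h * x))\<^sup>2 = 0"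
    by (simp add: algebra_simps)
  then show "cB h L a p s x = 2 * cos (s + 2 * h * L) + A' + C'" using assms(1) by simp
  show "A' * C' = cA h L a p s x * cC h L a p s x"
    unfolding A'_def C'_def cA_def cC_def by (simp add: ac_simps)
qed

section \<open>The discriminant as a symmetric polynomial in two cosines\<close>

text \<open>\<open>kap1\<close> to \<open>kap4\<close> are the cosines of twice the four shifts in
  \<open>cA_cC_angles\<close>. All carry the full list of arguments, so that exchanging p and s is
  one uniform substitution.\<close>

definition kap1 where "kap1 h L a p s = cos (2*a - p :: real)"
definition kap2 where "kap2 h L a p s = cos (p + 2*h*L :: real)"
definition kap3 where "kap3 h L a p s = cos (p :: real)"
definition kap4 where "kap4 h L a p s = cos (p + 2*h*L + 2 * s - 2*a :: real)"
lemmas kap_defs = kap1_def kap2_def kap3_def kap4_def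

text \<open>The source of the duality: the four combinations of the shifts for (p, s) with an even
  number of minus signs are, up to sign, the doubled shifts for (s, p).\<close>

lemma pC_pS_even: "4 * (pC h L a p s + pS h L a p s) =
    kap1 h L a s p + kap2 h L a s p + kap3 h L a s p + kap4 h L a s p"
proof -
  have e: "(a - p/2) + (- p/2 - h*L) + p/2 + (p/2 + h*L + s - a) = s"
    "(a - p/2) + (- p/2 - h*L) - p/2 - (p/2 + h*L + s - a) = - (s + 2*h*L + 2*p - 2*a)"
    "(a - p/2) - (- p/2 - h*L) + p/2 - (p/2 + h*L + s - a) = 2*a - s"
    "(a - p/2) - (- p/2 - h*L) - p/2 + (p/2 + h*L + s - a) = s + 2*h*L"
    by simp_all
  show ?thesis
    unfolding pC_def pS_def kap_defs
      cos_even_sign_sum[of "a - p/2" "- p/2 - h*L" "p/2" "p/2 + h*L + s - a"] e cos_minus by simp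
qed

lemma pC_pS_odd: "4 * (pC h L a p s - pS h L a p s) = 4 * (pC h L a s p - pS h L a s p)"
proof -
  have *: "4 * (pC h L a p s - pS h L a p s) = cos (s + p - 2*a) + cos (s + p + 2*h*L) + cos (s - p) + cos (s + p + 2*h*L - 2*a)" for s p
  proof -
    have e: "(a - p/2) + (- p/2 - h*L) + p/2 - (p/2 + h*L + s - a) = - (s + p + 2*h*L - 2*a)"
      "(a - p/2) + (- p/2 - h*L) - p/2 + (p/2 + h*L + s - a) = s - p"
      "(a - p/2) - (- p/2 - h*L) + p/2 + (p/2 + h*L + s - a) = s + p + 2*h*L"
      "- (a - p/2) + (- p/2 - h*L) + p/2 + (p/2 + h*L + s - a) = s + p - 2*a"
      by (simp_all add: field_simps)
    show ?thesis
      unfolding pC_def pS_def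
        cos_odd_sign_sum[of "a - p/2" "- p/2 - h*L" "p/2" "p/2 + h*L + s - a"] e cos_minus by simp
  qed
  have "cos (s - p) = cos (p - s)" by (metis cos_minus minus_diff_eq)
  then show ?thesis unfolding * by (simp add: add.commute)
qed

lemma kap_half:
  "kap1 h L a p s = 2 * (cos (a - p/2))\<^sup>2 - 1" "kap1 h L a p s = 1 - 2 * (sin (a - p/2))\<^sup>2"
  "kap2 h L a p s = 2 * (cos (- p/2 - h*L))\<^sup>2 - 1" "kap2 h L a p s = 1 - 2 * (sin (- p/2 - h*L))\<^sup>2"
  "kap3 h L a p s = 2 * (cos (p/2))\<^sup>2 - 1" "kap3 h L a p s = 1 - 2 * (sin (p/2))\<^sup>2"
  "kap4 h L a p s = 2 * (cos (p/2 + h*L + s - a))\<^sup>2 - 1" "kap4 h L a p s = 1 - 2 * (sin (p/2 + h*L + s - a))\<^sup>2"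
proof -
  have e: "2*a - p = 2 * (a - p/2)" "p + 2*h*L = - (2 * (- p/2 - h*L))" "p + 2*h*L + 2 * s - 2*a = 2 * (p/2 + h*L + s - a)"
    by simp_all
  have e3: "cos p = cos (2 * (p/2))" by simp
  show "kap1 h L a p s = 2 * (cos (a - p/2))\<^sup>2 - 1" "kap1 h L a p s = 1 - 2 * (sin (a - p/2))\<^sup>2"
    unfolding kap1_def e(1) by (rule cos_double_cos, rule cos_double_sin)
  show "kap2 h L a p s = 2 * (cos (- p/2 - h*L))\<^sup>2 - 1" "kap2 h L a p s = 1 - 2 * (sin (- p/2 - h*L))\<^sup>2"
    unfolding kap2_def e(2) cos_minus by (rule cos_double_cos, rule cos_double_sin)
  show "kap3 h L a p s = 2 * (cos (p/2))\<^sup>2 - 1" "kap3 h L a p s = 1 - 2 * (sin (p/2))\<^sup>2"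
    unfolding kap3_def e3 by (rule cos_double_cos, rule cos_double_sin)
  show "kap4 h L a p s = 2 * (cos (p/2 + h*L + s - a))\<^sup>2 - 1" "kap4 h L a p s = 1 - 2 * (sin (p/2 + h*L + s - a))\<^sup>2"
    unfolding kap4_def e(3) by (rule cos_double_cos, rule cos_double_sin)
qed

lemma kap_products:
  fixes h L a p s
  defines "k1 \<equiv> kap1 h L a p s" and "k2 \<equiv> kap2 h L a p s" and "k3 \<equiv> kap3 h L a p s" and "k4 \<equiv> kap4 h L a p s"
  shows "16 * (pC h L a p s)\<^sup>2 = (1 + k1) * (1 + k2) * (1 + k3) * (1 + k4)"
    and "16 * (pS h L a p s)\<^sup>2 = (1 - k1) * (1 - k2) * (1 - k3) * (1 - k4)"
proof -
  have c: "1 + k1 = 2 * (cos (a - p/2))\<^sup>2" "1 + k2 = 2 * (cos (- p/2 - h*L))\<^sup>2" "1 + k3 = 2 * (cos (p/2))\<^sup>2" "1 + k4 = 2 * (cos (p/2 + h*L + s - a))\<^sup>2"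
    unfolding k1_def k2_def k3_def k4_def kap_half(1,3,5,7) by simp_all
  have d: "1 - k1 = 2 * (sin (a - p/2))\<^sup>2" "1 - k2 = 2 * (sin (- p/2 - h*L))\<^sup>2" "1 - k3 = 2 * (sin (p/2))\<^sup>2" "1 - k4 = 2 * (sin (p/2 + h*L + s - a))\<^sup>2"
    unfolding k1_def k2_def k3_def k4_def kap_half(2,4,6,8) by simp_all
  show "16 * (pC h L a p s)\<^sup>2 = (1 + k1) * (1 + k2) * (1 + k3) * (1 + k4)"
    unfolding c pC_def by (simp add: power_mult_distrib)
  show "16 * (pS h L a p s)\<^sup>2 = (1 - k1) * (1 - k2) * (1 - k3) * (1 - k4)"
    unfolding d pS_def by (simp add: power_mult_distrib)
qed

text \<open>After expansion into twelve cosines, exchanging p and s only permutes the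
  angles.\<close>

lemma kap_pairs:
  fixes h L a p s
  defines "e2 \<equiv> \<lambda>p s. kap1 h L a p s * kap2 h L a p s + kap1 h L a p s * kap3 h L a p s + kap1 h L a p s * kap4 h L a p s
    + kap2 h L a p s * kap3 h L a p s + kap2 h L a p s * kap4 h L a p s + kap3 h L a p s * kap4 h L a p s"
  shows "e2 p s = e2 s p"
proof -
  have c: "cos u * cos v = (cos (u - v) + cos (u + v)) / 2" for u v :: real
    using cos_times_cos[of u v] by simp
  have *: "2 * e2 p s = (cos (2*p + 2*h*L - 2*a) + cos (2*a + 2*h*L)) + (cos (2*a - 2*p) + cos (2*a))
     + (cos (2*p + 2*h*L + 2 * s - 4*a) + cos (2*h*L + 2 * s)) + (cos (2*h*L) + cos (2*p + 2*h*L))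
     + (cos (2 * s - 2*a) + cos (2*p + 4*h*L + 2 * s - 2*a)) + (cos (2*h*L + 2 * s - 2*a) + cos (2*p + 2*h*L + 2 * s - 2*a))" for p s
  proof -
    have e: "2*a - p - (p + 2*h*L) = - (2*p + 2*h*L - 2*a)" "2*a - p - (p + 2*h*L + 2 * s - 2*a) = - (2*p + 2*h*L + 2 * s - 4*a)"
      "p + 2*h*L - (p + 2*h*L + 2 * s - 2*a) = - (2 * s - 2*a)" "p - (p + 2*h*L + 2 * s - 2*a) = - (2*h*L + 2 * s - 2*a)"
      "2*a - p + (p + 2*h*L) = 2*a + 2*h*L" "2*a - p - p = 2*a-2*p" "2*a - p + p = 2*a" "2*a - p + (p + 2*h*L + 2 * s - 2*a) = 2*h*L + 2 * s"
      "p + 2*h*L - p = 2*h*L" "p + 2*h*L + p = 2*p + 2*h*L" "p + 2*h*L + (p + 2*h*L + 2 * s - 2*a) = 2*p + 4*h*L + 2 * s - 2*a"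
      "p + (p + 2*h*L + 2 * s - 2*a) = 2*p + 2*h*L + 2 * s - 2*a"
      by simp_all
    have half: "2 * (y1/2 + y2/2 + y3/2 + y4/2 + y5/2 + y6/2) = y1 + y2 + y3 + y4 + y5 + y6"
      for y1 y2 y3 y4 y5 y6 :: real by simp
    show ?thesis unfolding e2_def kap_defs c e cos_minus by (rule half)
  qed
  have m: "cos (2*a - 2*p) = cos (2*p - 2*a)" for p by (metis cos_minus minus_diff_eq)
  have "2 * e2 p s = 2 * e2 s p" unfolding * m by (simp add: algebra_simps)
  then show ?thesis by simp
qed

text \<open>Clearing denominators takes sin^4, while \<open>disc\<close> carries only sin^2. The
  remaining factor 1 - c^2 divides the numerator because 4 (k1 - c)(k2 - c)(k3 - c)(k4 - c) - (e - c
  f)^2 vanishes at c = 1 and c = -1; this is the content of \<open>kap_products\<close>, used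
  through e^2 + f^2 and e f.\<close>

lemma disc_polynomial:
  fixes h L a p s x \<xi> :: real
  assumes nz: "sin (p + 2*h*x) \<noteq> 0"
  defines "k1 \<equiv> kap1 h L a p s" and "k2 \<equiv> kap2 h L a p s" and "k3 \<equiv> kap3 h L a p s" and "k4 \<equiv> kap4 h L a p s"
    and "c \<equiv> cos (p + 2*h*x)" and "d \<equiv> cos (s + 2*h*\<xi>)"
    and "e \<equiv> 4 * (pC h L a p s + pS h L a p s)" and "f \<equiv> 4 * (pC h L a p s - pS h L a p s)"
  shows "disc h L a p s x \<xi> = - 4*c\<^sup>2 + 4*(k1+k2+k3+k4)*c + (f\<^sup>2 - 4 - 4*(k1*k2+k1*k3+k1*k4+k2*k3+k2*k4+k3*k4)) + 4*(e - c*f)*d - 4*(1 - c\<^sup>2)*d\<^sup>2"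
proof -
  define S where "S = (sin (p + 2*h*x))\<^sup>2"
  have S: "S = 1 - c\<^sup>2" "S \<noteq> 0"
    unfolding S_def c_def by (rule sin_squared_eq, use nz in simp)
  define A where "A = cA h L a p s x"
  define C where "C = cC h L a p s x"
  define B where "B = cB h L a p s x"
  have B: "B * S = e - c * f" using cB_sin[OF nz] unfolding B_def S_def e_def f_def c_def .
  have T2: "p + 2*h*x = 2 * (p/2 + h*x)" by simp
  have AC: "A * C * S\<^sup>2 = (k1 - c) * (k2 - c) * (k3 - c) * (k4 - c)"
  proof -
    have k: "2 * (a - p/2) = 2*a - p" "2 * (- p/2 - h*L) = - (p + 2*h*L)" "2 * (p/2) = p" "2 * (p/2 + h*L + s - a) = p + 2*h*L + 2 * s - 2*a"
      by simp_all
    have "A * C * S\<^sup>2 = (A * S) * (C * S)" by (simp add: power2_eq_square)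
    also have "\<dots> = 16 * ((sin (p/2 + h*x + (a - p/2)) * sin (p/2 + h*x + (- p/2 - h*L)) * sin (p/2 + h*x + p/2) * sin (p/2 + h*x + (p/2 + h*L + s - a)))
      * (sin (p/2 + h*x - (a - p/2)) * sin (p/2 + h*x - (- p/2 - h*L)) * sin (p/2 + h*x - p/2) * sin (p/2 + h*x - (p/2 + h*L + s - a))))"
      unfolding A_def C_def S_def cA_cC_times_sin2[OF nz] by simp
    finally show ?thesis
      unfolding sin_quadruple_norm k cos_minus k1_def k2_def k3_def k4_def kap_defs c_def T2[symmetric] .
  qed
  define P where "P = pC h L a p s"
  define Q where "Q = pS h L a p s"
  have PQ: "16 * P\<^sup>2 = (1 + k1) * (1 + k2) * (1 + k3) * (1 + k4)" "16 * Q\<^sup>2 = (1 - k1) * (1 - k2) * (1 - k3) * (1 - k4)"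
    unfolding P_def Q_def k1_def k2_def k3_def k4_def by (rule kap_products)+
  have ef: "e = 4 * (P + Q)" "f = 4 * (P - Q)" by (simp_all add: e_def f_def P_def Q_def)
  have e2f2: "e\<^sup>2 + f\<^sup>2 = 4 * (1 + (k1*k2+k1*k3+k1*k4+k2*k3+k2*k4+k3*k4) + k1*k2*k3*k4)"
  proof -
    have "e\<^sup>2 + f\<^sup>2 = 2 * (16 * P\<^sup>2) + 2 * (16 * Q\<^sup>2)" unfolding ef by (simp add: power2_eq_square algebra_simps)
    then show ?thesis unfolding PQ by (simp add: algebra_simps)
  qed
  have efp: "e * f = 2 * ((k1+k2+k3+k4) + (k1*k2*k3+k1*k2*k4+k1*k3*k4+k2*k3*k4))"
  proof -
    have "e * f = 16 * P\<^sup>2 - 16 * Q\<^sup>2" unfolding ef by (simp add: power2_eq_square algebra_simps)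
    then show ?thesis unfolding PQ by (simp add: algebra_simps)
  qed
  define e1 where "e1 = k1+k2+k3+k4"
  define e2 where "e2 = k1*k2+k1*k3+k1*k4+k2*k3+k2*k4+k3*k4"
  define e3 where "e3 = k1*k2*k3+k1*k2*k4+k1*k3*k4+k2*k3*k4"
  define e4 where "e4 = k1*k2*k3*k4"
  have prod: "(k1 - c) * (k2 - c) * (k3 - c) * (k4 - c) = c^4 - e1*c^3 + e2*c\<^sup>2 - e3*c + e4"
    by (simp add: e1_def e2_def e3_def e4_def power2_eq_square power3_eq_cube power4_eq_xxxx algebra_simps)
  have D: "disc h L a p s x \<xi> = S * (4 * A * C - (2*d - B)\<^sup>2)"
    by (simp add: disc_def S_def A_def C_def B_def d_def)
  have "disc h L a p s x \<xi> * S = 4 * (A * C * S\<^sup>2) - (2*d*S - B*S)\<^sup>2"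
    unfolding D by (simp add: power2_eq_square algebra_simps)
  also have "\<dots> = 4 * (c^4 - e1*c^3 + e2*c\<^sup>2 - e3*c + e4) - (2*d*S - (e - c*f))\<^sup>2"
    unfolding AC prod B ..
  also have "\<dots> = S * (- 4*c\<^sup>2 + 4*e1*c + (f\<^sup>2 - 4 - 4*e2) + 4*(e - c*f)*d - 4*(1 - c\<^sup>2)*d\<^sup>2)"
  proof -
    have 1: "4 * e4 = e\<^sup>2 + f\<^sup>2 - 4 - 4 * e2" using e2f2 by (simp add: e2_def e4_def)
    have 2: "2 * e3 = e * f - 2 * e1" using efp by (simp add: e1_def e3_def)
    have "4 * (c^4 - e1*c^3 + e2*c\<^sup>2 - e3*c + e4) - (2*d*S - (e - c*f))\<^sup>2
        = 4*c^4 - 4*e1*c^3 + 4*e2*c\<^sup>2 - 2*(2*e3)*c + 4*e4 - (2*d*S - (e - c*f))\<^sup>2" by simp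
    then show ?thesis unfolding 1 2 S(1)
      by (simp add: power2_eq_square power3_eq_cube power4_eq_xxxx algebra_simps)
  qed
  finally have "disc h L a p s x \<xi> = - 4*c\<^sup>2 + 4*e1*c + (f\<^sup>2 - 4 - 4*e2) + 4*(e - c*f)*d - 4*(1 - c\<^sup>2)*d\<^sup>2"
    using S(2) by (simp add: mult.commute)
  then show ?thesis unfolding e1_def e2_def .
qed

text \<open>In \<open>disc_polynomial\<close> the terms in c^2, d^2 and c^2 d^2 are symmetric by
  inspection, f and the pair sums are invariant, and the coefficients of c and d, namely 4
  (k1+k2+k3+k4) and 4 e, are exchanged by \<open>pC_pS_even\<close>.\<close>

lemma disc_dual:
  assumes "sin (p + 2*h*x) \<noteq> 0" "sin (s + 2*h*\<xi>) \<noteq> 0"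
  shows "disc h L a p s x \<xi> = disc h L a s p \<xi> x"
  unfolding disc_polynomial[OF assms(1)] disc_polynomial[OF assms(2)] pC_pS_even
    pC_pS_odd[of h L a p s] kap_pairs[of h L a p s]
  by (simp add: algebra_simps)

text \<open>Squared, this is \<open>disc_dual\<close> at \<xi> = 0: there - \<open>disc\<close>
  equals sin^2 (p + 2 h x) (A - C)^2 on one side and, as the dual \<open>cC\<close> vanishes at 0, a
  single square on the other. The sign lost in the square is what decides the sign of
  \<open>ln (C/A)\<close>.\<close>

lemma cA_minus_cC:
  assumes nz: "sin (p + 2*h*x) \<noteq> 0" and ns: "sin s \<noteq> 0"
  shows "(cA h L a p s x - cC h L a p s x) * sin (p + 2*h*x) = sin s * (2 * cos (p + 2*h*x) - cB h L a s p 0)"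
proof -
  define t where "t = p + 2*h*x"
  define T where "T = p/2 + h*x"
  have T2: "2 * T = t" by (simp add: T_def t_def)
  have S: "(a - p/2) + (- p/2 - h*L) + p/2 + (p/2 + h*L + s - a) = s" by simp
  define v1 where "v1 = 2*a - p"
  define v2 where "v2 = - (p + 2*h*L)"
  define v4 where "v4 = p + 2*h*L + 2 * s - 2*a"
  have y: "(a - p/2) + (- p/2 - h*L) + p/2 - (p/2 + h*L + s - a) = s - v4"
      "(a - p/2) + (- p/2 - h*L) - p/2 + (p/2 + h*L + s - a) = s - p"
      "(a - p/2) - (- p/2 - h*L) + p/2 + (p/2 + h*L + s - a) = s - v2"
      "- (a - p/2) + (- p/2 - h*L) + p/2 + (p/2 + h*L + s - a) = s - v1"
    by (simp_all add: field_simps v1_def v2_def v4_def)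
  have 1: "(cA h L a p s x - cC h L a p s x) * (sin t)\<^sup>2 = sin t * (2 * cos t * sin s - (sin (s - v4) + sin (s - p) + sin (s - v2) + sin (s - v1)))"
    using sin_quadruple_symmetrized(2)[of T "a - p/2" "- p/2 - h*L" "p/2" "p/2 + h*L + s - a"]
      cA_cC_times_sin2[OF nz, of L a s]
    unfolding T_def[symmetric] T2 S y t_def[symmetric] left_diff_distrib by linarith
  then have 2: "(cA h L a p s x - cC h L a p s x) * sin t = 2 * cos t * sin s - (sin (s - v4) + sin (s - p) + sin (s - v2) + sin (s - v1))"
    using nz unfolding t_def[symmetric] power2_eq_square by (simp add: mult.assoc[symmetric])
  have ns0: "sin (s + 2*h*0) \<noteq> 0" using ns by simp
  have "cB h L a s p 0 * (sin s)\<^sup>2 = (cos v1 + cos v2 + cos p + cos v4) - cos s * (cos (s - v4) + cos (s - p) + cos (s - v2) + cos (s - v1))"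
    using cB_sin[OF ns0, where L=L and a=a and s=p]
    unfolding pC_pS_even pC_pS_odd[of h L a s p] kap_defs
    unfolding pC_def pS_def cos_odd_sign_sum y v1_def v2_def v4_def cos_minus by simp
  also have "\<dots> = sin s * (sin (s - v4) + sin (s - p) + sin (s - v2) + sin (s - v1))"
  proof -
    have "cos v - cos s * cos (s - v) = sin s * sin (s - v)" for v
    proof -
      have "cos v = cos (s - (s - v))" by simp
      also have "\<dots> = cos s * cos (s - v) + sin s * sin (s - v)" by (rule cos_diff)
      finally show ?thesis by simp
    qed
    from this[of v1] this[of v2] this[of p] this[of v4] show ?thesis by (simp add: algebra_simps)
  qed
  finally have "cB h L a s p 0 * sin s = sin (s - v4) + sin (s - p) + sin (s - v2) + sin (s - v1)"
    using ns by (simp add: power2_eq_square)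
  with 2 show ?thesis unfolding t_def by (simp add: algebra_simps)
qed

subsection \<open>Elementary inequalities\<close>

lemma sin_ge_half:
  fixes x :: real
  assumes "0 \<le> x" "x \<le> pi / 2"
  shows "x / 2 \<le> sin x"
proof (cases "x \<le> pi / 3")
  case True
  show ?thesis
  proof (cases "x = 0")
    case False
    with assms have "0 < x" by simp
    then obtain z where z: "0 < z" "z < x" "sin x - sin 0 = (x - 0) * cos z"
      using MVT2[of 0 x sin cos] by (auto intro: DERIV_sin)
    have "cos (pi / 3) \<le> cos z"
      using z True by (intro cos_monotone_0_pi_le) auto
    then have "x * (1 / 2) \<le> x * cos z"
      using \<open>0 < x\<close> by (intro mult_left_mono) (auto simp: cos_60)
    then show ?thesis using z by simp
  qed simp
next
  case False
  have "sin (pi / 3) \<le> sin x"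
    using False assms by (intro sin_monotone_2pi_le) auto
  moreover have "sqrt 3 / 2 \<ge> 17 / 20"
    using real_le_rsqrt[of "17/10" 3] by (simp add: power2_eq_square)
  moreover have "x / 2 \<le> 16 / 20" using assms pi_approx by simp
  ultimately show ?thesis by (simp add: sin_60)
qed

text \<open>In the factorization \<open>cos_diff_as_sin\<close> the half-sum factor dominates the
  half-difference factor, so the edges 0 and \<pi> produce no singularity worse than the square of
  the diagonal one.\<close>

lemma sin_half_sum_ge:
  fixes t u :: real
  assumes "0 \<le> t" "t \<le> pi" "0 \<le> u" "u \<le> pi"
  shows "sin (\<bar>t - u\<bar> / 2) \<le> sin ((t + u) / 2)"
proof -
  have "sin ((t + u) / 2) - sin ((t - u) / 2) = 2 * cos (t / 2) * sin (u / 2)"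
    using sin_diff_sin[of "(t + u) / 2" "(t - u) / 2"] by (simp add: add_divide_distrib diff_divide_distrib)
  moreover have "sin ((t + u) / 2) - sin ((u - t) / 2) = 2 * cos (u / 2) * sin (t / 2)"
    using sin_diff_sin[of "(t + u) / 2" "(u - t) / 2"] by (simp add: add_divide_distrib diff_divide_distrib)
  moreover have "0 \<le> cos (t / 2)" "0 \<le> cos (u / 2)" using assms by (auto intro!: cos_ge_zero)
  moreover have "0 \<le> sin (t / 2)" "0 \<le> sin (u / 2)" using assms by (auto intro!: sin_ge_zero)
  ultimately have "sin ((t - u) / 2) \<le> sin ((t + u) / 2)" "sin ((u - t) / 2) \<le> sin ((t + u) / 2)"
    using mult_nonneg_nonneg[of "2 * cos (t / 2)" "sin (u / 2)"] mult_nonneg_nonneg[of "2 * cos (u / 2)" "sin (t / 2)"]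
    by linarith+
  then show ?thesis by (cases "u \<le> t") (auto simp: abs_if)
qed

lemma cos_diff_as_sin:
  fixes t u :: real
  shows "\<bar>2 * cos t - 2 * cos u\<bar> = \<bar>2 * sin ((t - u) / 2)\<bar> * \<bar>2 * sin ((t + u) / 2)\<bar>"
proof -
  have "cos t - cos u = - 2 * (sin ((t + u) / 2) * sin ((t - u) / 2))"
    using cos_diff_cos[of t u] sin_minus[of "(t - u) / 2"] by (simp add: minus_divide_left)
  then have "2 * cos t - 2 * cos u = - ((2 * sin ((t - u) / 2)) * (2 * sin ((t + u) / 2)))"
    using right_diff_distrib[of 2 "cos t" "cos u"] by (simp only: mult_ac)
  then show ?thesis by (simp only: abs_minus_cancel abs_mult)
qed

lemma sin_half_abs:
  fixes v :: real
  assumes "\<bar>v\<bar> \<le> pi"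
  shows "\<bar>v\<bar> / 2 \<le> \<bar>2 * sin (v / 2)\<bar>"
proof -
  have "\<bar>v\<bar> / 4 \<le> sin (\<bar>v\<bar> / 2)" using sin_ge_half[of "\<bar>v\<bar> / 2"] assms by simp
  then show ?thesis by (cases "0 \<le> v") (auto simp: abs_if)
qed

lemma cos_diff_lower:
  fixes t u :: real
  assumes "0 \<le> t" "t \<le> pi" "0 \<le> u" "u \<le> pi"
  shows "(\<bar>t - u\<bar> / 2)\<^sup>2 \<le> \<bar>2 * cos t - 2 * cos u\<bar>"
proof -
  have 1: "\<bar>t - u\<bar> / 2 \<le> \<bar>2 * sin ((t - u) / 2)\<bar>" using assms by (intro sin_half_abs) auto
  have 2: "\<bar>t - u\<bar> / 2 \<le> 2 * sin (\<bar>t - u\<bar> / 2)" using sin_ge_half[of "\<bar>t - u\<bar> / 2"] assms by (simp add: abs_le_iff)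
  have 3: "\<bar>t - u\<bar> / 2 \<le> \<bar>2 * sin ((t + u) / 2)\<bar>" using 2 sin_half_sum_ge[OF assms] by auto
  show ?thesis unfolding cos_diff_as_sin power2_eq_square by (intro mult_mono 1 3) auto
qed

text \<open>The device by which every logarithmic singularity is traded for an inverse square
  root.\<close>

lemma ln_le_two_sqrt:
  fixes y :: real
  assumes "0 < y"
  shows "ln y \<le> 2 * sqrt y"
proof -
  have "ln y = 2 * ln (sqrt y)" using assms by (simp add: ln_sqrt)
  also have "\<dots> \<le> 2 * (sqrt y - 1)" using ln_le_minus_one[of "sqrt y"] assms by simp
  finally show ?thesis by simp
qed

lemma ln_ge_minus_sqrt:
  fixes y :: real
  assumes "0 < y"
  shows "- ln y \<le> 2 / sqrt y"
  using ln_le_two_sqrt[of "1 / y"] assms by (simp add: ln_div real_sqrt_divide)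

lemma ln_cos_diff_bounds:
  fixes t u :: real
  assumes "0 \<le> t" "t \<le> pi" "0 \<le> u" "u \<le> pi"
  shows "\<bar>ln \<bar>2 * cos t - 2 * cos u\<bar>\<bar> \<le> 2 + 6 / sqrt \<bar>t - u\<bar>"
proof (cases "t = u")
  case False
  define v where "v = \<bar>t - u\<bar>"
  have v: "v > 0" using False by (simp add: v_def)
  have l: "(v / 2)\<^sup>2 \<le> \<bar>2 * cos t - 2 * cos u\<bar>" unfolding v_def by (rule cos_diff_lower[OF assms])
  then have pos: "0 < \<bar>2 * cos t - 2 * cos u\<bar>" using v by (smt (verit) zero_less_power half_gt_zero)
  have "\<bar>2 * cos t - 2 * cos u\<bar> \<le> 4"
    using cos_le_one[of t] cos_le_one[of u] cos_ge_minus_one[of t] cos_ge_minus_one[of u] by linarith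
  then have "ln \<bar>2 * cos t - 2 * cos u\<bar> \<le> ln 4" using pos by (subst ln_le_cancel_iff) auto
  also have "ln 4 = 2 * ln (2::real)" using ln_realpow[of "2::real" 2] by simp
  also have "\<dots> \<le> 2 * 1" using ln_2_less_1 by linarith
  finally have up: "ln \<bar>2 * cos t - 2 * cos u\<bar> \<le> 2" by simp
  have "- ln \<bar>2 * cos t - 2 * cos u\<bar> \<le> - ln ((v/2)\<^sup>2)" using l v pos
    by (intro le_imp_neg_le) (subst ln_le_cancel_iff, auto)
  also have "\<dots> = 2 * (- ln (v / 2))" using v ln_realpow[of "v/2" 2] by simp
  also have "\<dots> \<le> 2 * (2 / sqrt (v / 2))" using ln_ge_minus_sqrt[of "v/2"] v by linarith
  also have "\<dots> \<le> 6 / sqrt v"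
  proof -
    have "sqrt 2 \<le> 3 / 2" by (rule real_le_lsqrt) (auto simp: power2_eq_square)
    then have "4 * sqrt 2 / sqrt v \<le> 6 / sqrt v" using v by (intro divide_right_mono) auto
    then show ?thesis by (simp add: real_sqrt_divide)
  qed
  finally have "- ln \<bar>2 * cos t - 2 * cos u\<bar> \<le> 6 / sqrt v" .
  moreover have "0 \<le> 6 / sqrt v" using v by simp
  ultimately show ?thesis using up unfolding v_def[symmetric] abs_le_iff by linarith
qed simp

lemma has_integral_inverse_sqrt:
  fixes a b c :: real
  assumes "a \<le> b"
  shows "((\<lambda>x. 1 / sqrt \<bar>x - c\<bar>) has_integral
     sgn (b - c) * (2 * sqrt \<bar>b - c\<bar>) - sgn (a - c) * (2 * sqrt \<bar>a - c\<bar>)) {a..b}"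
proof -
  define f where "f = (\<lambda>x::real. sgn x * (2 * sqrt \<bar>x\<bar>))"
  have f: "f x = 2 * sqrt (max 0 x) - 2 * sqrt (max 0 (- x))" for x
    by (auto simp: f_def sgn_if max_def)
  have cont: "continuous_on {a..b} (\<lambda>x. f (x - c))"
    unfolding f by (intro continuous_intros)
  have der: "((\<lambda>x. f (x - c)) has_vector_derivative 1 / sqrt \<bar>x - c\<bar>) (at x)" if "x \<noteq> c" for x
  proof (cases "x > c")
    case True
    have "((\<lambda>x. 2 * sqrt (x - c)) has_field_derivative 1 / sqrt \<bar>x - c\<bar>) (at x)"
      using True by (auto intro!: derivative_eq_intros simp: field_simps)
    moreover have "open {c<..}" "x \<in> {c<..}" using True by auto
    ultimately have "((\<lambda>x. f (x - c)) has_field_derivative 1 / sqrt \<bar>x - c\<bar>) (at x)"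
      by (rule has_field_derivative_transform_within_open) (auto simp: f_def)
    then show ?thesis by (simp add: has_real_derivative_iff_has_vector_derivative)
  next
    case False
    with that have "x < c" by simp
    have "((\<lambda>x. - 2 * sqrt (c - x)) has_field_derivative 1 / sqrt \<bar>x - c\<bar>) (at x)"
      using \<open>x < c\<close> by (auto intro!: derivative_eq_intros simp: field_simps)
    moreover have "open {..<c}" "x \<in> {..<c}" using \<open>x < c\<close> by auto
    ultimately have "((\<lambda>x. f (x - c)) has_field_derivative 1 / sqrt \<bar>x - c\<bar>) (at x)"
      by (rule has_field_derivative_transform_within_open) (auto simp: f_def)
    then show ?thesis by (simp add: has_real_derivative_iff_has_vector_derivative)
  qed
  show ?thesis
    using fundamental_theorem_of_calculus_interior_strong[of "{c}" a b "\<lambda>x. f (x - c)"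
        "\<lambda>x. 1 / sqrt \<bar>x - c\<bar>"] assms der cont by (auto simp: f_def)
qed

lemma inverse_sqrt_integral_bound:
  fixes a b c :: real
  assumes "a \<le> b"
  shows "(\<lambda>x. 1 / sqrt \<bar>x - c\<bar>) integrable_on {a..b}"
    and "integral {a..b} (\<lambda>x. 1 / sqrt \<bar>x - c\<bar>) \<le> 4 * sqrt (b - a)"
proof -
  show "(\<lambda>x. 1 / sqrt \<bar>x - c\<bar>) integrable_on {a..b}"
    using has_integral_inverse_sqrt[OF assms] by blast
  have d: "sqrt u - sqrt v \<le> sqrt (u - v)" if "0 \<le> v" "v \<le> u" for u v :: real
    using sqrt_add_le_add_sqrt[of v "u - v"] that by simp
  have m: "sqrt u \<le> sqrt v" if "u \<le> v" for u v :: real using that by simp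
  have "sgn (b - c) * (2 * sqrt \<bar>b - c\<bar>) - sgn (a - c) * (2 * sqrt \<bar>a - c\<bar>) \<le> 4 * sqrt (b - a)"
  proof -
    have nn: "0 \<le> sqrt (b - a)" using assms by simp
    have pos: "sgn x * (2 * sqrt \<bar>x\<bar>) = 2 * sqrt x" if "0 \<le> x" for x :: real
      using that by (cases "x = 0") auto
    have neg: "sgn x * (2 * sqrt \<bar>x\<bar>) = - (2 * sqrt (- x))" if "x \<le> 0" for x :: real
      using that by (cases "x = 0") auto
    consider "c \<le> a" | "a < c" "c < b" | "b \<le> c" by linarith
    then show ?thesis
    proof cases
      case 1
      have "sqrt (b - c) - sqrt (a - c) \<le> sqrt (b - a)" using d[of "a - c" "b - c"] 1 assms by simp
      moreover have "0 \<le> b - c" "0 \<le> a - c" using 1 assms by simp_all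
      ultimately show ?thesis unfolding pos[OF \<open>0 \<le> b - c\<close>] pos[OF \<open>0 \<le> a - c\<close>] using nn by linarith
    next
      case 2
      have "sqrt (b - c) \<le> sqrt (b - a)" "sqrt (c - a) \<le> sqrt (b - a)" using 2 by auto
      moreover have "0 \<le> b - c" "a - c \<le> 0" using 2 by simp_all
      ultimately show ?thesis unfolding pos[OF \<open>0 \<le> b - c\<close>] neg[OF \<open>a - c \<le> 0\<close>] minus_diff_eq by linarith
    next
      case 3
      have "sqrt (c - a) - sqrt (c - b) \<le> sqrt (b - a)" using d[of "c - b" "c - a"] 3 assms by simp
      moreover have "b - c \<le> 0" "a - c \<le> 0" using 3 assms by simp_all
      ultimately show ?thesis unfolding neg[OF \<open>b - c \<le> 0\<close>] neg[OF \<open>a - c \<le> 0\<close>] minus_diff_eq using nn by linarith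
    qed
  qed
  then show "integral {a..b} (\<lambda>x. 1 / sqrt \<bar>x - c\<bar>) \<le> 4 * sqrt (b - a)"
    using integral_unique[OF has_integral_inverse_sqrt[OF assms, of c]] by simp
qed

subsection \<open>The logarithmic integral over a half period\<close>

lemma ln_cos_absolutely_integrable:
  fixes c :: real
  shows "(\<lambda>t. ln \<bar>2 * c - 2 * cos t\<bar>) absolutely_integrable_on {0..pi}"
    and "\<bar>c\<bar> \<le> 1 \<Longrightarrow> \<bar>integral {0..pi} (\<lambda>t. ln \<bar>2 * c - 2 * cos t\<bar>)\<bar> \<le> 2 * pi + 24 * sqrt pi"
proof -
  define f where "f = (\<lambda>t. ln \<bar>2 * c - 2 * cos t\<bar>)"
  have meas: "f \<in> borel_measurable (lebesgue_on {0..pi})"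
    unfolding f_def by (rule measurable_restrict_space1) (simp add: measurable_completion)
  have 1: "f absolutely_integrable_on {0..pi} \<and> \<bar>integral {0..pi} f\<bar> \<le> 2 * pi + 24 * sqrt pi" if "\<bar>c\<bar> \<le> 1"
  proof -
    define u where "u = arccos c"
    have c: "c = cos u" and u: "0 \<le> u" "u \<le> pi"
      using that unfolding u_def by (auto simp: cos_arccos arccos_lbound arccos_ubound)
    define g where "g = (\<lambda>t::real. 2 + 6 * (1 / sqrt \<bar>t - u\<bar>))"
    have b: "norm (f t) \<le> g t" if "t \<in> {0..pi}" for t
      using ln_cos_diff_bounds[of u t] u that unfolding f_def g_def c
      by (simp add: abs_minus_commute)
    have g1: "(\<lambda>t::real. 6 * (1 / sqrt \<bar>t - u\<bar>)) integrable_on {0..pi}"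
      using integrable_on_cmult_left[OF inverse_sqrt_integral_bound(1)[of 0 pi u], of 6] by simp
    have g2: "g integrable_on {0..pi}"
      unfolding g_def by (intro integrable_add g1 integrable_const_ivl)
    note g = g1 g2
    have ai: "f absolutely_integrable_on {0..pi}"
      by (rule measurable_bounded_by_integrable_imp_absolutely_integrable[OF meas _ g(2)]) (use b in auto)
    have "norm (integral {0..pi} f) \<le> integral {0..pi} g"
      by (rule integral_norm_bound_integral) (use ai b g in \<open>auto simp: absolutely_integrable_on_def\<close>)
    also have "\<dots> = 2 * pi + integral {0..pi} (\<lambda>t. 6 * (1 / sqrt \<bar>t - u\<bar>))"
      unfolding g_def by (subst Henstock_Kurzweil_Integration.integral_add[OF integrable_const_ivl g(1)]) simp
    also have "\<dots> = 2 * pi + 6 * integral {0..pi} (\<lambda>t. 1 / sqrt \<bar>t - u\<bar>)"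
      by (simp only: integral_mult_right)
    also have "\<dots> \<le> 2 * pi + 6 * (4 * sqrt (pi - 0))"
      by (intro add_left_mono mult_left_mono inverse_sqrt_integral_bound) auto
    finally show ?thesis using ai by simp
  qed
  show "\<bar>c\<bar> \<le> 1 \<Longrightarrow> \<bar>integral {0..pi} (\<lambda>t. ln \<bar>2 * c - 2 * cos t\<bar>)\<bar> \<le> 2 * pi + 24 * sqrt pi"
    using 1 unfolding f_def by blast
  show "(\<lambda>t. ln \<bar>2 * c - 2 * cos t\<bar>) absolutely_integrable_on {0..pi}"
  proof (cases "\<bar>c\<bar> \<le> 1")
    case False
    then have "2 * c - 2 * cos t \<noteq> 0" for t
      using cos_le_one[of t] cos_ge_minus_one[of t] by (auto simp: abs_if split: if_splits)
    then show ?thesis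
      by (intro absolutely_integrable_continuous_real continuous_intros) auto
  qed (use 1 in \<open>simp add: f_def\<close>)
qed

definition lnint :: "real \<Rightarrow> real" where
  "lnint c = integral {0..pi} (\<lambda>t. ln \<bar>2 * c - 2 * cos t\<bar>)"

lemma has_integral_lnint: "((\<lambda>t. ln \<bar>2 * c - 2 * cos t\<bar>) has_integral lnint c) {0..pi}"
  unfolding lnint_def using ln_cos_absolutely_integrable(1)[of c]
  by (simp add: absolutely_integrable_on_def integrable_integral)

lemma has_integral_lnint_reflect: "((\<lambda>t. ln \<bar>2 * c + 2 * cos t\<bar>) has_integral lnint c) {0..pi}"
proof -
  have "((\<lambda>t. ln \<bar>2 * c - 2 * cos ((-1) *\<^sub>R t + pi)\<bar>) has_integral (1 / \<bar>-1\<bar> ^ DIM(real)) *\<^sub>R lnint c)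
     ((\<lambda>x. (1 / -1) *\<^sub>R x + - ((1 / -1) *\<^sub>R pi)) ` cbox 0 pi)"
    by (rule has_integral_affinity) (use has_integral_lnint in \<open>simp_all add: cbox_interval\<close>)
  moreover have "(\<lambda>x. (1 / -1) *\<^sub>R x + - ((1 / -1) *\<^sub>R pi)) ` cbox 0 pi = {0..pi}"
  proof -
    have "(\<lambda>x::real. (1 / -1) *\<^sub>R x + - ((1 / -1) *\<^sub>R pi)) = (\<lambda>x. pi - x)" by auto
    then show ?thesis by (simp add: cbox_interval)
  qed
  ultimately show ?thesis by (simp add: cos_diff)
qed

lemma lnint_minus: "lnint (- c) = lnint c"
proof -
  have "\<bar>2 * (- c) - 2 * cos t\<bar> = \<bar>2 * c + 2 * cos t\<bar>" for t :: real by linarith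
  then show ?thesis
    using has_integral_unique[OF has_integral_lnint[of "-c"]] has_integral_lnint_reflect[of c] by simp
qed

text \<open>The factorization 2 (2 c^2 - 1) - 2 cos (2 t) = (2 c - 2 cos t)(2 c + 2 cos t),
  integrated over t. Both factors have the same integral by the reflection t to \<pi> - t, and
  doubling t covers the half period twice.\<close>

lemma lnint_double: "lnint (2 * c\<^sup>2 - 1) = 2 * lnint c"
proof -
  define T where "T = 2 * c\<^sup>2 - 1"
  define f where "f = (\<lambda>t::real. ln \<bar>2 * T - 2 * cos t\<bar>)"
  have f: "(f has_integral lnint T) (cbox 0 pi)"
    using has_integral_lnint[of T] by (simp add: f_def cbox_interval)
  have "((\<lambda>t. f (2 *\<^sub>R t + 0)) has_integral (1 / \<bar>2\<bar> ^ DIM(real)) *\<^sub>R lnint T)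
     ((\<lambda>x. (1 / 2) *\<^sub>R x + - ((1 / 2) *\<^sub>R 0)) ` cbox 0 pi)"
    by (rule has_integral_affinity[OF f]) simp
  moreover have "(\<lambda>x::real. (1 / 2) *\<^sub>R x + - ((1 / 2) *\<^sub>R 0)) ` cbox 0 pi = {0..pi/2}"
  proof -
    have "(\<lambda>x::real. (1 / 2) *\<^sub>R x + - ((1 / 2) *\<^sub>R 0)) = (\<lambda>x. (1/2) * x)" by auto
    then show ?thesis by (simp add: cbox_interval)
  qed
  ultimately have h1: "((\<lambda>t. f (2 * t)) has_integral lnint T / 2) {0..pi/2}" by simp
  have "((\<lambda>t. f ((-2) *\<^sub>R t + 2 * pi)) has_integral (1 / \<bar>-2\<bar> ^ DIM(real)) *\<^sub>R lnint T)
     ((\<lambda>x. (1 / -2) *\<^sub>R x + - ((1 / -2) *\<^sub>R (2 * pi))) ` cbox 0 pi)"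
    by (rule has_integral_affinity[OF f]) simp
  moreover have "(\<lambda>x::real. (1 / -2) *\<^sub>R x + - ((1 / -2) *\<^sub>R (2 * pi))) ` cbox 0 pi = {pi/2..pi}"
  proof -
    have "(\<lambda>x::real. (1 / -2) *\<^sub>R x + - ((1 / -2) *\<^sub>R (2 * pi))) = (\<lambda>x. (- 1 / 2) * x + pi)" by auto
    then show ?thesis
      by (simp only: cbox_interval image_affinity_atLeastAtMost) simp
  qed
  moreover have "f ((-2) *\<^sub>R t + 2 * pi) = f (2 * t)" for t
    by (simp add: f_def cos_diff)
  ultimately have h2: "((\<lambda>t. f (2 * t)) has_integral lnint T / 2) {pi/2..pi}" by simp
  have A: "((\<lambda>t. f (2 * t)) has_integral (lnint T / 2 + lnint T / 2)) {0..pi}"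
    by (rule has_integral_combine[OF _ _ h1 h2]) auto
  \<comment> \<open>Where a factor vanishes, ln 0 = 0 and the logarithm of the product need not be
    the sum of the logarithms; these t are removed as a finite set.\<close>
  define S where "S = {t \<in> {0..pi}. cos t = c} \<union> {t \<in> {0..pi}. cos t = - c}"
  have fin: "finite {t \<in> {0..pi}. cos t = d}" for d
  proof (rule finite_subset)
    show "{t \<in> {0..pi}. cos t = d} \<subseteq> {arccos d}" using arccos_cos by auto
  qed simp
  have "((\<lambda>t. ln \<bar>2 * c - 2 * cos t\<bar> + ln \<bar>2 * c + 2 * cos t\<bar>) has_integral (lnint c + lnint c)) {0..pi}"
    by (intro has_integral_add has_integral_lnint has_integral_lnint_reflect)
  then have B: "((\<lambda>t. f (2 * t)) has_integral (lnint c + lnint c)) {0..pi}"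
  proof (rule has_integral_spike_finite[rotated 2])
    show "finite S" unfolding S_def using fin by blast
    fix t assume t: "t \<in> {0..pi} - S"
    then have "2 * c - 2 * cos t \<noteq> 0" "2 * c + 2 * cos t \<noteq> 0" by (auto simp: S_def)
    then have "ln \<bar>2 * c - 2 * cos t\<bar> + ln \<bar>2 * c + 2 * cos t\<bar> = ln (\<bar>(2 * c - 2 * cos t) * (2 * c + 2 * cos t)\<bar>)"
      by (simp add: ln_mult abs_mult)
    also have "(2 * c - 2 * cos t) * (2 * c + 2 * cos t) = 2 * T - 2 * cos (2 * t)"
      unfolding T_def cos_double_cos by (simp add: power2_eq_square algebra_simps)
    finally show "f (2 * t) = ln \<bar>2 * c - 2 * cos t\<bar> + ln \<bar>2 * c + 2 * cos t\<bar>" by (simp add: f_def)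
  qed
  show ?thesis using has_integral_unique[OF A B] by (simp add: T_def)
qed

text \<open>The map c to 2 c^2 - 1 preserves [-1, 1] and doubles \<open>lnint\<close>, which is
  bounded on [-1, 1]; iterating forces the value 0.\<close>

lemma lnint_inside:
  assumes "\<bar>c\<bar> \<le> 1"
  shows "lnint c = 0"
proof -
  define K where "K = 2 * pi + 24 * sqrt pi"
  have b: "\<bar>lnint c\<bar> * 2 ^ n \<le> K" if "\<bar>c\<bar> \<le> 1" for n c
    using that
  proof (induction n arbitrary: c)
    case 0
    then show ?case using ln_cos_absolutely_integrable(2)[of c] by (simp add: lnint_def K_def)
  next
    case (Suc n)
    have "c\<^sup>2 \<le> 1" using Suc.prems by (simp add: abs_square_le_1)
    then have "\<bar>2 * c\<^sup>2 - 1\<bar> \<le> 1" by (simp add: abs_le_iff)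
    from Suc.IH[OF this] show ?case by (simp add: lnint_double abs_mult mult_ac)
  qed
  show ?thesis
  proof (rule ccontr)
    assume "lnint c \<noteq> 0"
    then obtain n where "K / \<bar>lnint c\<bar> < 2 ^ n" using real_arch_pow[of 2 "K / \<bar>lnint c\<bar>"] by auto
    then have "K < 2 ^ n * \<bar>lnint c\<bar>" using \<open>lnint c \<noteq> 0\<close> by (simp add: pos_divide_less_eq)
    with b[OF assms, of n] show False by (simp add: mult.commute)
  qed
qed

text \<open>Doubling x doubles \<open>lnint (cosh x) - pi * x\<close> by
  \<open>lnint_double\<close>, while for large x the integrand is within ln 4 of x; a nonzero
  difference would outgrow this bound.\<close>

lemma lnint_cosh:
  assumes "0 < x"
  shows "lnint (cosh x) = pi * x"
proof -
  have crude: "\<bar>lnint (cosh x) - pi * x\<bar> \<le> pi * ln 4" if "2 \<le> cosh x" "0 \<le> x" for x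
  proof -
    have e: "cosh x \<le> exp x" "exp x \<le> 2 * cosh x"
      using that by (auto simp: cosh_def)
    have bnd: "\<bar>ln \<bar>2 * cosh x - 2 * cos t\<bar> - x\<bar> \<le> ln 4" for t :: real
    proof -
      have "cosh x \<le> 2 * cosh x - 2 * cos t" "2 * cosh x - 2 * cos t \<le> 4 * cosh x"
        using that(1) cos_le_one[of t] cos_ge_minus_one[of t] by linarith+
      then have "exp x \<le> 2 * (2 * cosh x - 2 * cos t)" "2 * cosh x - 2 * cos t \<le> 4 * exp x" "0 < 2 * cosh x - 2 * cos t"
        using e that by auto
      then have "x \<le> ln (2 * (2 * cosh x - 2 * cos t))" "ln (2 * cosh x - 2 * cos t) \<le> ln (4 * exp x)"
        by (auto simp: ln_ge_iff)
      moreover have "ln (2 * (2 * cosh x - 2 * cos t)) = ln 2 + ln (2 * cosh x - 2 * cos t)"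
        by (rule ln_mult_pos) (use \<open>0 < 2 * cosh x - 2 * cos t\<close> in auto)
      moreover have "ln (4 * exp x) = ln 4 + x" by (simp add: ln_mult)
      ultimately have "x \<le> ln 2 + ln (2 * cosh x - 2 * cos t)" "ln (2 * cosh x - 2 * cos t) \<le> ln 4 + x"
        by linarith+
      moreover have "ln 2 \<le> ln (4::real)" by simp
      moreover have a: "\<bar>2 * cosh x - 2 * cos t\<bar> = 2 * cosh x - 2 * cos t"
        using \<open>0 < 2 * cosh x - 2 * cos t\<close> by simp
      ultimately show ?thesis unfolding abs_le_iff a by linarith
    qed
    have "((\<lambda>t. ln \<bar>2 * cosh x - 2 * cos t\<bar> - x) has_integral (lnint (cosh x) - pi * x)) {0..pi}"
      by (intro has_integral_diff has_integral_lnint) (use has_integral_const_real[of x 0 pi] in \<open>simp add: mult.commute\<close>)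
    then have "norm (lnint (cosh x) - pi * x) \<le> ln 4 * measure lborel {0..pi}"
      using bnd by (intro has_integral_bound_real) auto
    then show ?thesis by (simp add: mult.commute)
  qed
  have scale: "lnint (cosh (2 ^ n * x)) - pi * (2 ^ n * x) = 2 ^ n * (lnint (cosh x) - pi * x)" for n
  proof (induction n)
    case (Suc n)
    have "lnint (cosh (2 ^ Suc n * x)) = 2 * lnint (cosh (2 ^ n * x))"
      using lnint_double[of "cosh (2 ^ n * x)"] cosh_double_cosh[of "2 ^ n * x"] by (simp add: mult_ac)
    with Suc show ?case by (simp add: algebra_simps)
  qed simp
  show ?thesis
  proof (rule ccontr)
    define d where "d = \<bar>lnint (cosh x) - pi * x\<bar>"
    assume "lnint (cosh x) \<noteq> pi * x"
    then have d: "0 < d" by (simp add: d_def)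
    obtain n1 where n1: "pi * ln 4 / d < 2 ^ n1" using real_arch_pow[of 2 "pi * ln 4 / d"] by auto
    obtain n2 where n2: "4 / x < 2 ^ n2" using real_arch_pow[of 2 "4 / x"] by auto
    define n where "n = max n1 n2"
    have "(2::real) ^ n1 \<le> 2 ^ n" "(2::real) ^ n2 \<le> 2 ^ n" by (auto simp: n_def)
    with n1 n2 have n: "pi * ln 4 / d < 2 ^ n" "4 / x < 2 ^ n" by linarith+
    then have "4 < 2 ^ n * x" using assms by (simp add: pos_divide_less_eq)
    moreover from this have "2 \<le> cosh (2 ^ n * x)"
    proof -
      have "1 + 2 ^ n * x \<le> exp (2 ^ n * x)" by (rule exp_ge_add_one_self)
      then have "4 \<le> exp (2 ^ n * x) + exp (- (2 ^ n * x))"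
        using \<open>4 < 2 ^ n * x\<close> exp_gt_zero[of "- (2 ^ n * x)"] by linarith
      then show ?thesis by (simp add: cosh_def)
    qed
    ultimately have "2 ^ n * d \<le> pi * ln 4"
      using crude[of "2 ^ n * x"] unfolding scale d_def by (simp add: abs_mult)
    moreover have "pi * ln 4 < 2 ^ n * d" using n(1) d by (simp add: pos_divide_less_eq)
    ultimately show False by simp
  qed
qed

lemma lnint_eq: "lnint c = pi * arcosh (max 1 \<bar>c\<bar>)"
proof (cases "\<bar>c\<bar> \<le> 1")
  case True
  then show ?thesis by (simp add: lnint_inside)
next
  case False
  have "lnint c = lnint \<bar>c\<bar>" using lnint_minus[of c] by (auto simp: abs_if)
  also have "\<dots> = lnint (cosh (arcosh \<bar>c\<bar>))" using False by simp
  also have "\<dots> = pi * arcosh \<bar>c\<bar>" by (rule lnint_cosh) (use False in simp)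
  finally show ?thesis using False by (simp add: max_def)
qed

subsection \<open>Band integrals in a cosine variable\<close>

text \<open>Outside the band the clamped arccos is constant, as suits the distribution function of a
  law carried by the band.\<close>

definition clamp1 :: "real \<Rightarrow> real" where "clamp1 q = max (- 1) (min 1 q)"

lemma clamp1_bounds [simp]: "- 1 \<le> clamp1 q" "clamp1 q \<le> 1"
  by (auto simp: clamp1_def)

lemma finite_cos_level:
  fixes p g d x1 x2 :: real
  assumes "0 < g" "0 \<le> p + g * x1" "p + g * x2 \<le> pi"
  shows "finite {x \<in> {x1..x2}. 2 * cos (p + g * x) = d}"
proof (rule finite_subset)
  show "{x \<in> {x1..x2}. 2 * cos (p + g * x) = d} \<subseteq> {(arccos (d / 2) - p) / g}"
  proof
    fix x assume x: "x \<in> {x \<in> {x1..x2}. 2 * cos (p + g * x) = d}"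
    then have "g * x1 \<le> g * x" "g * x \<le> g * x2" using assms(1) by auto
    then have "arccos (cos (p + g * x)) = p + g * x" using assms by (intro arccos_cos) linarith+
    moreover have "cos (p + g * x) = d / 2" using x by auto
    ultimately show "x \<in> {(arccos (d / 2) - p) / g}" using assms(1) by (simp add: field_simps)
  qed
qed simp

text \<open>The affine coordinate that carries the band (\<alpha>, \<beta>) of the variable 2 cos (p
  + g x) to (-1, 1).\<close>

definition qq :: "real \<Rightarrow> real \<Rightarrow> real \<Rightarrow> real \<Rightarrow> real \<Rightarrow> real" where
  "qq p g \<alpha> \<beta> x = (2 * (2 * cos (p + g * x)) - \<alpha> - \<beta>) / (\<beta> - \<alpha>)"

context
  fixes p g \<alpha> \<beta> :: real
  assumes g: "0 < g" and ab: "\<alpha> < \<beta>"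
begin

lemma qq_iff: "(qq p g \<alpha> \<beta>) x < 1 \<longleftrightarrow> 2 * cos (p + g * x) < \<beta>" "- 1 < (qq p g \<alpha> \<beta>) x \<longleftrightarrow> \<alpha> < 2 * cos (p + g * x)"
    "(qq p g \<alpha> \<beta>) x > 1 \<longleftrightarrow> 2 * cos (p + g * x) > \<beta>" "- 1 > (qq p g \<alpha> \<beta>) x \<longleftrightarrow> \<alpha> > 2 * cos (p + g * x)"
    "(qq p g \<alpha> \<beta>) x = 1 \<longleftrightarrow> 2 * cos (p + g * x) = \<beta>" "(qq p g \<alpha> \<beta>) x = - 1 \<longleftrightarrow> 2 * cos (p + g * x) = \<alpha>"
  using ab by (auto simp: qq_def field_simps)

lemma qq_mult: "(qq p g \<alpha> \<beta>) x * (\<beta> - \<alpha>) = 2 * (2 * cos (p + g * x)) - \<alpha> - \<beta>"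
  using ab by (simp add: qq_def)

lemma qq_cont: "continuous_on A (qq p g \<alpha> \<beta>)"
  unfolding qq_def using ab by (intro continuous_intros) auto

lemma qq_deriv: "((qq p g \<alpha> \<beta>) has_field_derivative - (4 * g * sin (p + g * x) / (\<beta> - \<alpha>))) (at x within A)"
proof -
  have "((\<lambda>x. 2 * (2 * cos (p + g * x)) - \<alpha> - \<beta>) has_field_derivative - (4 * g * sin (p + g * x))) (at x within A)"
    by (auto intro!: derivative_eq_intros)
  from DERIV_cdivide[OF this, of "\<beta> - \<alpha>"] show ?thesis by (simp add: qq_def[abs_def])
qed

lemma qq_square: "1 - ((qq p g \<alpha> \<beta>) x)\<^sup>2 = 4 * ((2 * cos (p + g * x) - \<alpha>) * (\<beta> - 2 * cos (p + g * x))) / (\<beta> - \<alpha>)\<^sup>2"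
proof -
  have "1 - ((qq p g \<alpha> \<beta>) x)\<^sup>2 = ((\<beta> - \<alpha>)\<^sup>2 - (2 * (2 * cos (p + g * x)) - \<alpha> - \<beta>)\<^sup>2) / (\<beta> - \<alpha>)\<^sup>2"
  proof -
    have "1 = (\<beta> - \<alpha>)\<^sup>2 / (\<beta> - \<alpha>)\<^sup>2" using ab by simp
    then show ?thesis unfolding qq_def power_divide by (metis diff_divide_distrib)
  qed
  also have "(\<beta> - \<alpha>)\<^sup>2 - (2 * (2 * cos (p + g * x)) - \<alpha> - \<beta>)\<^sup>2 = 4 * ((2 * cos (p + g * x) - \<alpha>) * (\<beta> - 2 * cos (p + g * x)))"
    by (simp add: power2_eq_square algebra_simps)
  finally show ?thesis .
qed

text \<open>The clamped \<open>arccos\<close> of \<open>qq\<close> is a primitive: by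
  \<open>qq_square\<close>, 1 - q^2 is the product of the distances to the two edges up to a
  constant. It is continuous everywhere and fails to be differentiable at most at the finitely many
  edge points.\<close>

lemma arccos_band_integral:
  assumes x: "0 \<le> p + g * x1" "p + g * x2 \<le> pi" "x1 \<le> x2"
  shows "((\<lambda>x. if \<alpha> < 2 * cos (p + g * x) \<and> 2 * cos (p + g * x) < \<beta>
      then 2 * g * sin (p + g * x) / sqrt ((2 * cos (p + g * x) - \<alpha>) * (\<beta> - 2 * cos (p + g * x))) else 0)
    has_integral arccos (clamp1 ((qq p g \<alpha> \<beta>) x2)) - arccos (clamp1 ((qq p g \<alpha> \<beta>) x1))) {x1..x2}"
proof (rule fundamental_theorem_of_calculus_interior_strong)
  let ?S = "{x \<in> {x1..x2}. 2 * cos (p + g * x) = \<alpha>} \<union> {x \<in> {x1..x2}. 2 * cos (p + g * x) = \<beta>}"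
  show "finite ?S" using finite_cos_level[OF g x(1,2)] by simp
  show "x1 \<le> x2" by fact
  show "continuous_on {x1..x2} (\<lambda>x. arccos (clamp1 ((qq p g \<alpha> \<beta>) x)))"
    unfolding clamp1_def by (intro continuous_on_arccos continuous_intros qq_cont) auto
  fix x assume "x \<in> {x1<..<x2} - ?S"
  then have nx: "2 * cos (p + g * x) \<noteq> \<alpha>" "2 * cos (p + g * x) \<noteq> \<beta>" by auto
  have "((\<lambda>x. arccos (clamp1 ((qq p g \<alpha> \<beta>) x))) has_field_derivative (if \<alpha> < 2 * cos (p + g * x) \<and> 2 * cos (p + g * x) < \<beta>
      then 2 * g * sin (p + g * x) / sqrt ((2 * cos (p + g * x) - \<alpha>) * (\<beta> - 2 * cos (p + g * x))) else 0)) (at x)"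
  proof -
    consider "(qq p g \<alpha> \<beta>) x > 1" | "(qq p g \<alpha> \<beta>) x < - 1" | "- 1 < (qq p g \<alpha> \<beta>) x" "(qq p g \<alpha> \<beta>) x < 1"
      using nx qq_iff(5,6)[of x] by fastforce
    then show ?thesis
    proof cases
      case 1
      then have "\<not> 2 * cos (p + g * x) < \<beta>" using qq_iff(1)[of x] by simp
      moreover have "open {x. (qq p g \<alpha> \<beta>) x > 1}" using open_Collect_less[OF continuous_on_const qq_cont] by auto
      then have "((\<lambda>x. arccos (clamp1 ((qq p g \<alpha> \<beta>) x))) has_field_derivative 0) (at x)"
        using 1 by (intro has_field_derivative_transform_within_open[OF DERIV_const[of "arccos 1"]])
          (auto simp: clamp1_def)
      ultimately show ?thesis by simp
    next
      case 2
      then have "\<not> \<alpha> < 2 * cos (p + g * x)" using qq_iff(2)[of x] by simp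
      moreover have "open {x. (qq p g \<alpha> \<beta>) x < - 1}" using open_Collect_less[OF qq_cont continuous_on_const] by auto
      then have "((\<lambda>x. arccos (clamp1 ((qq p g \<alpha> \<beta>) x))) has_field_derivative 0) (at x)"
        using 2 by (intro has_field_derivative_transform_within_open[OF DERIV_const[of "arccos (- 1)"]])
          (auto simp: clamp1_def)
      ultimately show ?thesis by simp
    next
      case 3
      then have in_band: "\<alpha> < 2 * cos (p + g * x)" "2 * cos (p + g * x) < \<beta>" using qq_iff[of x] by auto
      have op: "open ({x. (qq p g \<alpha> \<beta>) x < 1} \<inter> {x. - 1 < (qq p g \<alpha> \<beta>) x})"
        by (intro open_Int open_Collect_less qq_cont continuous_on_const)
      have "((\<lambda>x. arccos ((qq p g \<alpha> \<beta>) x)) has_field_derivative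
          (inverse (- sqrt (1 - ((qq p g \<alpha> \<beta>) x)\<^sup>2)) * - (4 * g * sin (p + g * x) / (\<beta> - \<alpha>)))) (at x)"
        using 3 by (intro DERIV_chain2[OF DERIV_arccos] qq_deriv)
      moreover have "inverse (- sqrt (1 - ((qq p g \<alpha> \<beta>) x)\<^sup>2)) * - (4 * g * sin (p + g * x) / (\<beta> - \<alpha>))
         = 2 * g * sin (p + g * x) / sqrt ((2 * cos (p + g * x) - \<alpha>) * (\<beta> - 2 * cos (p + g * x)))"
        unfolding qq_square real_sqrt_divide real_sqrt_mult[of 4] using ab
        by (simp add: divide_simps)
      ultimately have "((\<lambda>x. arccos ((qq p g \<alpha> \<beta>) x)) has_field_derivative
          2 * g * sin (p + g * x) / sqrt ((2 * cos (p + g * x) - \<alpha>) * (\<beta> - 2 * cos (p + g * x)))) (at x)" by simp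
      then have "((\<lambda>x. arccos (clamp1 ((qq p g \<alpha> \<beta>) x))) has_field_derivative
          2 * g * sin (p + g * x) / sqrt ((2 * cos (p + g * x) - \<alpha>) * (\<beta> - 2 * cos (p + g * x)))) (at x)"
        by (rule has_field_derivative_transform_within_open[OF _ op]) (use 3 in \<open>auto simp: clamp1_def\<close>)
      then show ?thesis using in_band by simp
    qed
  qed
  then show "((\<lambda>x. arccos (clamp1 ((qq p g \<alpha> \<beta>) x))) has_vector_derivative (if \<alpha> < 2 * cos (p + g * x) \<and> 2 * cos (p + g * x) < \<beta>
      then 2 * g * sin (p + g * x) / sqrt ((2 * cos (p + g * x) - \<alpha>) * (\<beta> - 2 * cos (p + g * x))) else 0)) (at x)"
    by (simp add: has_real_derivative_iff_has_vector_derivative)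
qed

text \<open>The counterpart outside the band, where arccos turns into arcosh.
  \<open>\<sigma>\<close> = 1 selects the side on which the cosine variable exceeds \<beta>,
  \<open>\<sigma>\<close> = -1 the side on which it is below \<alpha>.\<close>

lemma arcosh_tail_integral:
  assumes x: "0 \<le> p + g * x1" "p + g * x2 \<le> pi" "x1 \<le> x2" and \<sigma>: "\<sigma> = 1 \<or> \<sigma> = - 1"
  shows "((\<lambda>x. if \<sigma> * (qq p g \<alpha> \<beta>) x > 1
      then - \<sigma> * (2 * g * sin (p + g * x)) / sqrt ((2 * cos (p + g * x) - \<alpha>) * (2 * cos (p + g * x) - \<beta>)) else 0)
    has_integral arcosh (max 1 (\<sigma> * (qq p g \<alpha> \<beta>) x2)) - arcosh (max 1 (\<sigma> * (qq p g \<alpha> \<beta>) x1))) {x1..x2}"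
proof (rule fundamental_theorem_of_calculus_interior_strong)
  let ?S = "{x \<in> {x1..x2}. 2 * cos (p + g * x) = \<alpha>} \<union> {x \<in> {x1..x2}. 2 * cos (p + g * x) = \<beta>}"
  show "finite ?S" using finite_cos_level[OF g x(1,2)] by simp
  show "x1 \<le> x2" by fact
  show "continuous_on {x1..x2} (\<lambda>x. arcosh (max 1 (\<sigma> * (qq p g \<alpha> \<beta>) x)))"
    by (intro continuous_on_arcosh' continuous_intros qq_cont) auto
  fix x assume "x \<in> {x1<..<x2} - ?S"
  then have "(qq p g \<alpha> \<beta>) x \<noteq> 1" "(qq p g \<alpha> \<beta>) x \<noteq> - 1" using qq_iff(5,6)[of x] by auto
  then have nx: "\<sigma> * (qq p g \<alpha> \<beta>) x \<noteq> 1" using \<sigma> by (auto simp: minus_equation_iff)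
  have cont: "continuous_on UNIV (\<lambda>x. \<sigma> * (qq p g \<alpha> \<beta>) x)" by (intro continuous_intros qq_cont)
  have "((\<lambda>x. arcosh (max 1 (\<sigma> * (qq p g \<alpha> \<beta>) x))) has_field_derivative (if \<sigma> * (qq p g \<alpha> \<beta>) x > 1
      then - \<sigma> * (2 * g * sin (p + g * x)) / sqrt ((2 * cos (p + g * x) - \<alpha>) * (2 * cos (p + g * x) - \<beta>)) else 0)) (at x)"
  proof (cases "\<sigma> * (qq p g \<alpha> \<beta>) x > 1")
    case True
    have op: "open {x. \<sigma> * (qq p g \<alpha> \<beta>) x > 1}" using open_Collect_less[OF continuous_on_const cont] by auto
    have sq: "(\<sigma> * (qq p g \<alpha> \<beta>) x)\<^sup>2 - 1 = 4 * ((2 * cos (p + g * x) - \<alpha>) * (2 * cos (p + g * x) - \<beta>)) / (\<beta> - \<alpha>)\<^sup>2"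
    proof -
      have "(\<sigma> * (qq p g \<alpha> \<beta>) x)\<^sup>2 - 1 = - (1 - ((qq p g \<alpha> \<beta>) x)\<^sup>2)" using \<sigma> by auto
      also have "\<dots> = 4 * ((2 * cos (p + g * x) - \<alpha>) * (2 * cos (p + g * x) - \<beta>)) / (\<beta> - \<alpha>)\<^sup>2"
        unfolding qq_square by (simp add: algebra_simps minus_divide_left diff_divide_distrib add_divide_distrib)
      finally show ?thesis .
    qed
    have "((\<lambda>x. arcosh (\<sigma> * (qq p g \<alpha> \<beta>) x)) has_field_derivative
          (1 / sqrt ((\<sigma> * (qq p g \<alpha> \<beta>) x)\<^sup>2 - 1) * (\<sigma> * - (4 * g * sin (p + g * x) / (\<beta> - \<alpha>))))) (at x)"
      by (rule DERIV_chain2[OF arcosh_real_has_field_derivative[OF True] DERIV_cmult[OF qq_deriv]])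
    moreover have "1 / sqrt ((\<sigma> * (qq p g \<alpha> \<beta>) x)\<^sup>2 - 1) * (\<sigma> * - (4 * g * sin (p + g * x) / (\<beta> - \<alpha>)))
       = - \<sigma> * (2 * g * sin (p + g * x)) / sqrt ((2 * cos (p + g * x) - \<alpha>) * (2 * cos (p + g * x) - \<beta>))"
      unfolding sq real_sqrt_divide real_sqrt_mult[of 4] using ab by (simp add: divide_simps)
    ultimately have "((\<lambda>x. arcosh (\<sigma> * (qq p g \<alpha> \<beta>) x)) has_field_derivative
       - \<sigma> * (2 * g * sin (p + g * x)) / sqrt ((2 * cos (p + g * x) - \<alpha>) * (2 * cos (p + g * x) - \<beta>))) (at x)" by simp
    then have "((\<lambda>x. arcosh (max 1 (\<sigma> * (qq p g \<alpha> \<beta>) x))) has_field_derivative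
       - \<sigma> * (2 * g * sin (p + g * x)) / sqrt ((2 * cos (p + g * x) - \<alpha>) * (2 * cos (p + g * x) - \<beta>))) (at x)"
      by (rule has_field_derivative_transform_within_open[OF _ op]) (use True in auto)
    then show ?thesis using True by simp
  next
    case False
    with nx have lt: "\<sigma> * (qq p g \<alpha> \<beta>) x < 1" by simp
    have "open {x. \<sigma> * (qq p g \<alpha> \<beta>) x < 1}" using open_Collect_less[OF cont continuous_on_const] by auto
    then have "((\<lambda>x. arcosh (max 1 (\<sigma> * (qq p g \<alpha> \<beta>) x))) has_field_derivative 0) (at x)"
      using lt by (intro has_field_derivative_transform_within_open[OF DERIV_const[of "arcosh 1"]]) auto
    then show ?thesis using lt by simp
  qed
  then show "((\<lambda>x. arcosh (max 1 (\<sigma> * (qq p g \<alpha> \<beta>) x))) has_vector_derivative (if \<sigma> * (qq p g \<alpha> \<beta>) x > 1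
      then - \<sigma> * (2 * g * sin (p + g * x)) / sqrt ((2 * cos (p + g * x) - \<alpha>) * (2 * cos (p + g * x) - \<beta>)) else 0)) (at x)"
    by (simp add: has_real_derivative_iff_has_vector_derivative)
qed

text \<open>Substitution \<open>2 cos (p + g x) = (\<alpha> + \<beta>)/2 + (\<beta> - \<alpha>)/2 cos t\<close> turns the band density into Lebesgue
  measure in \<open>t\<close>.\<close>

lemma log_band_integral:
  fixes z x1 x2 :: real
  assumes x: "0 \<le> p + g * x1" "p + g * x2 \<le> pi" "x1 \<le> x2"
    and edges: "\<beta> \<le> 2 * cos (p + g * x1)" "2 * cos (p + g * x2) \<le> \<alpha>"
  shows "((\<lambda>x. (if \<alpha> < 2 * cos (p + g * x) \<and> 2 * cos (p + g * x) < \<beta>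
      then 2 * g * sin (p + g * x) / sqrt ((2 * cos (p + g * x) - \<alpha>) * (\<beta> - 2 * cos (p + g * x))) else 0)
      * ln \<bar>2 * cos (p + g * x) - z\<bar>)
    has_integral pi * (ln ((\<beta> - \<alpha>) / 4) + arcosh (max 1 \<bar>(2 * z - \<alpha> - \<beta>) / (\<beta> - \<alpha>)\<bar>))) {x1..x2}"
proof -
  define c where "c = (2 * z - \<alpha> - \<beta>) / (\<beta> - \<alpha>)"
  define k where "k = (\<lambda>x. 2 * g * sin (p + g * x) / sqrt ((2 * cos (p + g * x) - \<alpha>) * (\<beta> - 2 * cos (p + g * x))))"
  define S where "S = {x \<in> {x1..x2}. - 1 < (qq p g \<alpha> \<beta>) x \<and> (qq p g \<alpha> \<beta>) x < 1}"
  define f where "f = (\<lambda>t. ln ((\<beta> - \<alpha>) / 4 * \<bar>2 * c - 2 * cos t\<bar>))"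
  have cz: "2 * cos (p + g * x) - z = - ((\<beta> - \<alpha>) / 4 * (2 * c - 2 * (qq p g \<alpha> \<beta>) x))" for x
  proof -
    have 1: "(\<beta> - \<alpha>) * c = 2 * z - \<alpha> - \<beta>" "(\<beta> - \<alpha>) * (qq p g \<alpha> \<beta>) x = 2 * (2 * cos (p + g * x)) - \<alpha> - \<beta>"
      using ab by (simp_all add: c_def qq_def)
    have "d / 4 * (2 * u - 2 * v) = (d * u - d * v) / 2" for d u v :: real
      by (simp add: field_simps)
    then have 2: "(\<beta> - \<alpha>) / 4 * (2 * c - 2 * (qq p g \<alpha> \<beta>) x) = ((\<beta> - \<alpha>) * c - (\<beta> - \<alpha>) * (qq p g \<alpha> \<beta>) x) / 2" .
    show ?thesis unfolding 2 1 by (simp add: diff_divide_distrib)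
  qed
  have S_eq: "S = {x1..x2} \<inter> {x. - 1 < (qq p g \<alpha> \<beta>) x} \<inter> {x. (qq p g \<alpha> \<beta>) x < 1}" by (auto simp: S_def)
  \<comment> \<open>The edge hypotheses exclude x1 and x2, so S is open; they also make the
    substitution cover all of (0, \<pi>).\<close>
  have S_open: "S = {x1<..<x2} \<inter> {x. - 1 < (qq p g \<alpha> \<beta>) x} \<inter> {x. (qq p g \<alpha> \<beta>) x < 1}"
  proof -
    have "\<not> (qq p g \<alpha> \<beta>) x1 < 1" "\<not> - 1 < (qq p g \<alpha> \<beta>) x2" using edges qq_iff(1)[of x1] qq_iff(2)[of x2] by auto
    then show ?thesis unfolding S_eq by (auto simp: less_le)
  qed
  have S_op: "open S"
    unfolding S_open by (intro open_Int open_greaterThanLessThan open_Collect_less qq_cont continuous_on_const)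
  have S_meas: "S \<in> sets lebesgue" using borel_open[OF S_op] by (simp add: sets_completionI_sets)
  have der: "((\<lambda>x. arccos ((qq p g \<alpha> \<beta>) x)) has_field_derivative k x) (at x within S)" if "x \<in> S" for x
  proof -
    have 3: "- 1 < (qq p g \<alpha> \<beta>) x" "(qq p g \<alpha> \<beta>) x < 1" using that by (auto simp: S_def)
    have "((\<lambda>x. arccos ((qq p g \<alpha> \<beta>) x)) has_field_derivative
          (inverse (- sqrt (1 - ((qq p g \<alpha> \<beta>) x)\<^sup>2)) * - (4 * g * sin (p + g * x) / (\<beta> - \<alpha>)))) (at x within S)"
      using 3 by (intro DERIV_chain2[OF DERIV_arccos] qq_deriv)
    moreover have "inverse (- sqrt (1 - ((qq p g \<alpha> \<beta>) x)\<^sup>2)) * - (4 * g * sin (p + g * x) / (\<beta> - \<alpha>)) = k x"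
      unfolding k_def qq_square real_sqrt_divide real_sqrt_mult[of 4] using ab by (simp add: divide_simps)
    ultimately show ?thesis by simp
  qed
  have ang: "0 \<le> p + g * x \<and> p + g * x \<le> pi" if "x \<in> {x1..x2}" for x
  proof -
    have "g * x1 \<le> g * x" "g * x \<le> g * x2" using that g by auto
    then show ?thesis using x by linarith
  qed
  have inj: "inj_on (\<lambda>x. arccos ((qq p g \<alpha> \<beta>) x)) S"
  proof (rule inj_onI)
    fix x y assume xy: "x \<in> S" "y \<in> S" "arccos ((qq p g \<alpha> \<beta>) x) = arccos ((qq p g \<alpha> \<beta>) y)"
    have "cos (arccos ((qq p g \<alpha> \<beta>) x)) = (qq p g \<alpha> \<beta>) x" "cos (arccos ((qq p g \<alpha> \<beta>) y)) = (qq p g \<alpha> \<beta>) y"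
      using xy(1,2) by (auto simp: S_def intro!: cos_arccos)
    with xy(3) have "(qq p g \<alpha> \<beta>) x = (qq p g \<alpha> \<beta>) y" by metis
    then have "2 * (2 * cos (p + g * x)) - \<alpha> - \<beta> = 2 * (2 * cos (p + g * y)) - \<alpha> - \<beta>"
      unfolding qq_mult[symmetric] by (rule arg_cong)
    then have "cos (p + g * x) = cos (p + g * y)" by simp
    moreover have "x \<in> {x1..x2}" "y \<in> {x1..x2}" using xy(1,2) by (auto simp: S_def)
    ultimately have "p + g * x = p + g * y"
      using ang[of x] ang[of y] cos_inj_pi[of "p + g * x" "p + g * y"] by blast
    then show "x = y" using g by simp
  qed
  have img: "(\<lambda>x. arccos ((qq p g \<alpha> \<beta>) x)) ` S = {0<..<pi}"
  proof (intro subset_antisym subsetI)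
    fix t assume "t \<in> (\<lambda>x. arccos ((qq p g \<alpha> \<beta>) x)) ` S"
    then obtain x where "- 1 < (qq p g \<alpha> \<beta>) x" "(qq p g \<alpha> \<beta>) x < 1" "t = arccos ((qq p g \<alpha> \<beta>) x)" by (auto simp: S_def)
    then show "t \<in> {0<..<pi}" using arccos_lt_bounded[of "(qq p g \<alpha> \<beta>) x"] by auto
  next
    fix t assume t: "t \<in> {0<..<pi}"
    have "(qq p g \<alpha> \<beta>) x2 \<le> cos t" "cos t \<le> (qq p g \<alpha> \<beta>) x1"
      using edges qq_iff(1)[of x1] qq_iff(2)[of x2] cos_le_one[of t] cos_ge_minus_one[of t] by linarith+
    then obtain x where x: "x1 \<le> x" "x \<le> x2" "(qq p g \<alpha> \<beta>) x = cos t"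
      using IVT2'[of "qq p g \<alpha> \<beta>" x2 "cos t" x1] x(3) qq_cont by blast
    have "cos t < 1" "- 1 < cos t"
      using t cos_monotone_0_pi[of 0 t] cos_monotone_0_pi[of t pi] by auto
    then have "x \<in> S" using x by (auto simp: S_def)
    moreover have "arccos ((qq p g \<alpha> \<beta>) x) = t" using t x by (simp add: arccos_cos)
    ultimately show "t \<in> (\<lambda>x. arccos ((qq p g \<alpha> \<beta>) x)) ` S" by force
  qed
  have F: "f absolutely_integrable_on {0..pi}" "integral {0..pi} f = pi * ln ((\<beta> - \<alpha>) / 4) + lnint c"
  proof -
    define f0 where "f0 = (\<lambda>t. ln ((\<beta> - \<alpha>) / 4) + ln \<bar>2 * c - 2 * cos t\<bar>)"
    have f0: "f0 absolutely_integrable_on {0..pi}"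
      unfolding f0_def by (intro set_integral_add ln_cos_absolutely_integrable absolutely_integrable_on_const) auto
    have f0i: "(f0 has_integral (pi * ln ((\<beta> - \<alpha>) / 4) + lnint c)) {0..pi}"
      unfolding f0_def using has_integral_const_real[of "ln ((\<beta> - \<alpha>) / 4)" 0 pi]
      by (intro has_integral_add has_integral_lnint) simp
    \<comment> \<open>Where cos t = c the convention ln 0 = 0 breaks the product rule of the
      logarithm; this happens at finitely many t only.\<close>
    have N: "finite {t \<in> {0..pi}. 2 * cos (0 + 1 * t) = 2 * c}" by (rule finite_cos_level) auto
    have eq: "f t = f0 t" if "t \<in> {0..pi} - {t \<in> {0..pi}. 2 * cos (0 + 1 * t) = 2 * c}" for t
    proof -
      have "2 * c - 2 * cos t \<noteq> 0" using that by auto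
      then show ?thesis unfolding f_def f0_def using ab by (subst ln_mult_pos) auto
    qed
    have fi: "(f has_integral (pi * ln ((\<beta> - \<alpha>) / 4) + lnint c)) {0..pi}"
      by (rule has_integral_spike_finite[OF N _ f0i]) (use eq in auto)
    show "integral {0..pi} f = pi * ln ((\<beta> - \<alpha>) / 4) + lnint c" using fi by (rule integral_unique)
    show "f absolutely_integrable_on {0..pi}"
      by (rule absolutely_integrable_spike[OF f0 negligible_finite[OF N]]) (use eq in auto)
  qed
  have F': "f absolutely_integrable_on {0<..<pi}" "integral {0<..<pi} f = pi * ln ((\<beta> - \<alpha>) / 4) + lnint c"
  proof -
    show "f absolutely_integrable_on {0<..<pi}"
      using F(1) unfolding absolutely_integrable_on_def integrable_on_open_interval_real .
    show "integral {0<..<pi} f = pi * ln ((\<beta> - \<alpha>) / 4) + lnint c"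
      using F(2) integral_open_interval_real[of 0 pi f] by simp
  qed
  have "(\<lambda>x. \<bar>k x\<bar> * f (arccos ((qq p g \<alpha> \<beta>) x))) absolutely_integrable_on S \<and>
      integral S (\<lambda>x. \<bar>k x\<bar> * f (arccos ((qq p g \<alpha> \<beta>) x))) = pi * ln ((\<beta> - \<alpha>) / 4) + lnint c"
    using has_absolute_integral_change_of_variables_1'[OF S_meas der inj, where f=f] F' unfolding img by blast
  then have "((\<lambda>x. \<bar>k x\<bar> * f (arccos ((qq p g \<alpha> \<beta>) x))) has_integral (pi * ln ((\<beta> - \<alpha>) / 4) + lnint c)) S"
    by (auto simp: has_integral_iff absolutely_integrable_on_def)
  then have "((\<lambda>x. if x \<in> S then \<bar>k x\<bar> * f (arccos ((qq p g \<alpha> \<beta>) x)) else 0) has_integral (pi * ln ((\<beta> - \<alpha>) / 4) + lnint c)) {x1..x2}"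
    by (subst has_integral_restrict) (auto simp: S_def)
  moreover have eq: "(if x \<in> S then \<bar>k x\<bar> * f (arccos ((qq p g \<alpha> \<beta>) x)) else 0) = (if \<alpha> < 2 * cos (p + g * x) \<and> 2 * cos (p + g * x) < \<beta>
      then 2 * g * sin (p + g * x) / sqrt ((2 * cos (p + g * x) - \<alpha>) * (\<beta> - 2 * cos (p + g * x))) else 0)
      * ln \<bar>2 * cos (p + g * x) - z\<bar>" if "x \<in> {x1..x2}" for x
  proof (cases "x \<in> S")
    case True
    then have b: "- 1 < (qq p g \<alpha> \<beta>) x" "(qq p g \<alpha> \<beta>) x < 1" by (auto simp: S_def)
    have "0 \<le> sin (p + g * x)" using ang[OF that] by (intro sin_ge_zero) auto
    then have "\<bar>k x\<bar> = k x" using g b qq_iff[of x] unfolding k_def by (intro abs_of_nonneg divide_nonneg_nonneg) auto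
    moreover have "f (arccos ((qq p g \<alpha> \<beta>) x)) = ln \<bar>2 * cos (p + g * x) - z\<bar>"
      unfolding f_def cz using b ab by (simp add: abs_mult)
    ultimately show ?thesis using True b qq_iff[of x] by (simp add: k_def)
  next
    case False
    then have "\<not> (- 1 < (qq p g \<alpha> \<beta>) x \<and> (qq p g \<alpha> \<beta>) x < 1)" using that by (simp add: S_def)
    then show ?thesis using False qq_iff[of x] by auto
  qed
  ultimately show ?thesis
    unfolding c_def[symmetric] distrib_left lnint_eq[of c, symmetric]
    by (rule has_integral_eq[rotated])
qed

end

subsection \<open>The spectral curve\<close>

text \<open>\<open>rtp\<close> and \<open>rtm\<close> are the edges of the band at x: the values of
  2 cos (s + 2 h \<xi>) at which \<open>disc\<close> changes sign, see
  \<open>disc_factor\<close>.\<close>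

definition rtp :: "real \<Rightarrow> real \<Rightarrow> real \<Rightarrow> real \<Rightarrow> real \<Rightarrow> real \<Rightarrow> real" where
  "rtp h L a p s x = cB h L a p s x + 2 * sqrt (cA h L a p s x * cC h L a p s x)"

definition rtm :: "real \<Rightarrow> real \<Rightarrow> real \<Rightarrow> real \<Rightarrow> real \<Rightarrow> real \<Rightarrow> real" where
  "rtm h L a p s x = cB h L a p s x - 2 * sqrt (cA h L a p s x * cC h L a p s x)"

lemma disc_factor:
  assumes "0 \<le> cA h L a p s x * cC h L a p s x"
  shows "disc h L a p s x \<xi> = (sin (p + 2 * h * x))\<^sup>2 *
    ((2 * cos (s + 2 * h * \<xi>) - rtm h L a p s x) * (rtp h L a p s x - 2 * cos (s + 2 * h * \<xi>)))"
proof -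
  define r where "r = sqrt (cA h L a p s x * cC h L a p s x)"
  define Y where "Y = 2 * cos (s + 2 * h * \<xi>)"
  define B where "B = cB h L a p s x"
  have "cA h L a p s x * cC h L a p s x = r * r" using assms by (simp add: r_def)
  then have *: "4 * cA h L a p s x * cC h L a p s x - (Y - B)\<^sup>2 = (Y - (B - 2 * r)) * (B + 2 * r - Y)"
    by (simp add: power2_eq_square algebra_simps)
  show ?thesis
    using * unfolding disc_def rtm_def rtp_def r_def[symmetric] Y_def[symmetric] B_def[symmetric] by simp
qed

text \<open>The list of assumptions is stable under exchanging p and s, so every fact about the
  sections in x is also one about the sections in \<xi>. The sines of \<open>nonneg1\<close> and
  \<open>pos1\<close> are assumed positive only as a product, since the reduction modulo \<pi> may
  make both negative.\<close>

locale racah_curve =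
  fixes h L a p s :: real
  assumes h: "0 < h" and L: "0 < L"
    and p0: "0 \<le> p" and pL: "p + 2 * h * L \<le> pi"
    and s0: "0 \<le> s" and sL: "s + 2 * h * L \<le> pi"
    and nonneg1: "\<And>x. 0 \<le> x \<Longrightarrow> x \<le> L \<Longrightarrow> 0 \<le> sin (a + h * x) * sin (p + s + h * L - a + h * x)"
    and nonneg2: "\<And>x. 0 \<le> x \<Longrightarrow> x \<le> L \<Longrightarrow> 0 \<le> sin (s - a + h * x)"
    and nonneg3: "\<And>x. 0 \<le> x \<Longrightarrow> x \<le> L \<Longrightarrow> 0 \<le> sin (p - a + h * x)"
    and pos1: "\<And>x. 0 < x \<Longrightarrow> x < L \<Longrightarrow> 0 < sin (a + h * x) * sin (p + s + h * L - a + h * x)"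
    and pos2: "\<And>x. 0 < x \<Longrightarrow> x < L \<Longrightarrow> 0 < sin (s - a + h * x)"
    and pos3: "\<And>x. 0 < x \<Longrightarrow> x < L \<Longrightarrow> 0 < sin (p - a + h * x)"
begin

lemma dual: "racah_curve h L a s p"
proof
  fix x :: real
  have e: "s + p + h * L - a + h * x = p + s + h * L - a + h * x" by simp
  show "0 \<le> sin (a + h * x) * sin (s + p + h * L - a + h * x)" if "0 \<le> x" "x \<le> L"
    unfolding e by (rule nonneg1[OF that])
  show "0 < sin (a + h * x) * sin (s + p + h * L - a + h * x)" if "0 < x" "x < L"
    unfolding e by (rule pos1[OF that])
qed (use h L p0 pL s0 sL nonneg2 nonneg3 pos2 pos3 in auto)

lemma ang:
  assumes "0 \<le> x" "x \<le> L"
  shows "0 \<le> p + 2 * h * x" "p + 2 * h * x \<le> pi" "0 \<le> h * x" "h * x \<le> h * L" "h * L \<le> pi / 2"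
proof -
  show "0 \<le> h * x" "h * x \<le> h * L" using assms h by auto
  then show "0 \<le> p + 2 * h * x" "p + 2 * h * x \<le> pi" "h * L \<le> pi / 2" using p0 pL by auto
qed

lemma ang_strict:
  assumes "0 < x" "x < L"
  shows "0 < p + 2 * h * x" "p + 2 * h * x < pi" "0 < h * x" "h * x < h * L"
proof -
  show "0 < h * x" "h * x < h * L" using assms h by auto
  then show "0 < p + 2 * h * x" "p + 2 * h * x < pi" using p0 pL by auto
qed

lemma sin_pos: "0 < x \<Longrightarrow> x < L \<Longrightarrow> 0 < sin (p + 2 * h * x)"
  using ang_strict by (intro sin_gt_zero) auto

lemma sin_nonneg: "0 \<le> x \<Longrightarrow> x \<le> L \<Longrightarrow> 0 \<le> sin (p + 2 * h * x)"
  using ang by (intro sin_ge_zero) auto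

lemma factor_nonneg:
  assumes "0 \<le> x" "x \<le> L"
  shows "0 \<le> sin (h * x)" "0 \<le> sin (h * (L - x))" "0 \<le> sin (p + h * x)" "0 \<le> sin (p + h * L + h * x)"
    "0 \<le> sin (h * L + s - a - h * x)"
proof -
  note * = ang[OF assms] p0 pL h
  show "0 \<le> sin (h * x)" "0 \<le> sin (p + h * x)" "0 \<le> sin (p + h * L + h * x)"
    using * by (intro sin_ge_zero; linarith)+
  have "h * (L - x) = h * L - h * x" by (simp add: algebra_simps)
  then show "0 \<le> sin (h * (L - x))" using * by (intro sin_ge_zero; linarith)
  have e: "h * L + s - a - h * x = s - a + h * (L - x)" by (simp add: algebra_simps)
  show "0 \<le> sin (h * L + s - a - h * x)" unfolding e using nonneg2[of "L - x"] assms by simp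
qed

lemma factor_pos:
  assumes "0 < x" "x < L"
  shows "0 < sin (h * x)" "0 < sin (h * (L - x))" "0 < sin (p + h * x)" "0 < sin (p + h * L + h * x)"
    "0 < sin (h * L + s - a - h * x)"
proof -
  note * = ang_strict[OF assms] p0 pL h ang(5)[of x] assms
  show "0 < sin (h * x)" "0 < sin (p + h * x)" "0 < sin (p + h * L + h * x)"
    using * by (intro sin_gt_zero; linarith)+
  have "h * (L - x) = h * L - h * x" by (simp add: algebra_simps)
  then show "0 < sin (h * (L - x))" using * by (intro sin_gt_zero; linarith)
  have e: "h * L + s - a - h * x = s - a + h * (L - x)" by (simp add: algebra_simps)
  show "0 < sin (h * L + s - a - h * x)" unfolding e using pos2[of "L - x"] assms by simp
qed

lemma cA_nonneg: assumes "0 \<le> x" "x \<le> L" shows "0 \<le> cA h L a p s x"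
proof -
  have "cA h L a p s x = 4 * sin (h * (L - x)) * sin (p + h * x) * (sin (a + h * x) * sin (p + s + h * L - a + h * x)) / (sin (p + 2 * h * x))\<^sup>2"
    by (simp add: cA_def mult_ac)
  then show ?thesis using factor_nonneg[OF assms] nonneg1[OF assms] by simp
qed

lemma cC_nonneg: assumes "0 \<le> x" "x \<le> L" shows "0 \<le> cC h L a p s x"
  unfolding cC_def using factor_nonneg[OF assms] nonneg3[OF assms] by simp

lemma cA_pos: assumes "0 < x" "x < L" shows "0 < cA h L a p s x"
proof -
  have "cA h L a p s x = 4 * sin (h * (L - x)) * sin (p + h * x) * (sin (a + h * x) * sin (p + s + h * L - a + h * x)) / (sin (p + 2 * h * x))\<^sup>2"
    by (simp add: cA_def mult_ac)
  then show ?thesis using factor_pos[OF assms] pos1[OF assms] sin_pos[OF assms] by simp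
qed

lemma cC_pos: assumes "0 < x" "x < L" shows "0 < cC h L a p s x"
  unfolding cC_def using factor_pos[OF assms] pos3[OF assms] sin_pos[OF assms] by simp

lemma cAC_nonneg: "0 \<le> x \<Longrightarrow> x \<le> L \<Longrightarrow> 0 \<le> cA h L a p s x * cC h L a p s x"
  by (intro mult_nonneg_nonneg cA_nonneg cC_nonneg)

lemma disc_eq:
  assumes "0 \<le> x" "x \<le> L"
  shows "disc h L a p s x \<xi> = (sin (p + 2 * h * x))\<^sup>2 *
    ((2 * cos (s + 2 * h * \<xi>) - rtm h L a p s x) * (rtp h L a p s x - 2 * cos (s + 2 * h * \<xi>)))"
  by (rule disc_factor) (rule cAC_nonneg[OF assms])

lemma root_upper:
  assumes "0 \<le> x" "x \<le> L"
  shows "rtp h L a p s x \<le> 2 * cos s"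
proof -
  have "0 \<le> (sqrt (cA h L a p s x) - sqrt (cC h L a p s x))\<^sup>2" by simp
  also have "\<dots> = cA h L a p s x + cC h L a p s x - 2 * sqrt (cA h L a p s x * cC h L a p s x)"
    using cA_nonneg[OF assms] cC_nonneg[OF assms] by (simp add: power2_diff real_sqrt_mult)
  finally show ?thesis unfolding rtp_def cB_def by linarith
qed

text \<open>The square used in \<open>root_upper\<close>, now for the expression of
  \<open>cB\<close> attached to the other end; its two terms have the same product A C, so the
  square root is the same.\<close>

lemma root_lower:
  assumes "0 \<le> x" "x \<le> L" and nz: "sin (p + 2 * h * x) \<noteq> 0"
  shows "2 * cos (s + 2 * h * L) \<le> rtm h L a p s x"
proof -
  define A' where "A' = 4 * sin (h * x) * sin (p + h * L + h * x) * sin (a + h * x) * sin (p + s + h * L - a + h * x) / (sin (p + 2 * h * x))\<^sup>2"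
  define C' where "C' = 4 * sin (h * (L - x)) * sin (p + h * x) * sin (h * L + s - a - h * x) * sin (p - a + h * x) / (sin (p + 2 * h * x))\<^sup>2"
  have "A' = 4 * sin (h * x) * sin (p + h * L + h * x) * (sin (a + h * x) * sin (p + s + h * L - a + h * x)) / (sin (p + 2 * h * x))\<^sup>2"
    by (simp add: A'_def mult_ac)
  then have A': "0 \<le> A'" using factor_nonneg[OF assms(1,2)] nonneg1[OF assms(1,2)] by simp
  have C': "0 \<le> C'"
    unfolding C'_def using factor_nonneg[OF assms(1,2)] nonneg3[OF assms(1,2)] by simp
  have "0 \<le> (sqrt A' - sqrt C')\<^sup>2" by simp
  also have "\<dots> = A' + C' - 2 * sqrt (A' * C')"
    using A' C' by (simp add: power2_diff real_sqrt_mult)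
  finally show ?thesis
    unfolding rtm_def using cB_lower_form[OF nz, of L a s, folded A'_def C'_def] by simp
qed

lemma roots_less: "0 < x \<Longrightarrow> x < L \<Longrightarrow> rtm h L a p s x < rtp h L a p s x"
  unfolding rtm_def rtp_def using cA_pos cC_pos by simp

lemma roots_le: "0 \<le> x \<Longrightarrow> x \<le> L \<Longrightarrow> rtm h L a p s x \<le> rtp h L a p s x"
  unfolding rtm_def rtp_def using cAC_nonneg by simp

text \<open>Inverse of \<xi> to 2 cos (s + 2 h \<xi>), which decreases on {0..L}.\<close>

definition level :: "real \<Rightarrow> real" where "level y = (arccos (y / 2) - s) / (2 * h)"

lemma cos_mono_iff:
  assumes "0 \<le> x" "x \<le> L" "0 \<le> y" "y \<le> L"
  shows "2 * cos (s + 2 * h * x) < 2 * cos (s + 2 * h * y) \<longleftrightarrow> y < x"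
    and "2 * cos (s + 2 * h * x) = 2 * cos (s + 2 * h * y) \<longleftrightarrow> x = y"
    and "2 * cos (s + 2 * h * x) \<le> 2 * cos (s + 2 * h * y) \<longleftrightarrow> y \<le> x"
proof -
  interpret D: racah_curve h L a s p by (rule dual)
  have *: "cos (s + 2 * h * x) < cos (s + 2 * h * y)" if "y < x" "0 \<le> x" "x \<le> L" "0 \<le> y" "y \<le> L" for x y
    using D.ang[of x] D.ang[of y] that h by (intro cos_monotone_0_pi) auto
  show "2 * cos (s + 2 * h * x) < 2 * cos (s + 2 * h * y) \<longleftrightarrow> y < x"
    using *[of x y] *[of y x] assms by (cases x y rule: linorder_cases) auto
  show "2 * cos (s + 2 * h * x) = 2 * cos (s + 2 * h * y) \<longleftrightarrow> x = y"
    using *[of x y] *[of y x] assms by (cases x y rule: linorder_cases) auto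
  show "2 * cos (s + 2 * h * x) \<le> 2 * cos (s + 2 * h * y) \<longleftrightarrow> y \<le> x"
    using *[of x y] *[of y x] assms by (cases x y rule: linorder_cases) auto
qed

lemma level:
  assumes "2 * cos (s + 2 * h * L) \<le> y" "y \<le> 2 * cos s"
  shows "0 \<le> level y" "level y \<le> L" "2 * cos (s + 2 * h * level y) = y"
proof -
  interpret D: racah_curve h L a s p by (rule dual)
  have sL: "0 \<le> s + 2 * h * L" "s + 2 * h * L \<le> pi" using D.ang[of L] L by auto
  have y: "- 1 \<le> y / 2" "y / 2 \<le> 1"
    using assms cos_ge_minus_one[of "s + 2 * h * L"] cos_le_one[of s] by linarith+
  have "arccos (cos s) \<le> arccos (y / 2)"
    using assms y by (subst arccos_le_mono) auto
  moreover have "arccos (cos s) = s" using s0 sL h L by (intro arccos_cos) (auto intro: order_trans[of _ "s + 2 * h * L"])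
  moreover have "arccos (y / 2) \<le> arccos (cos (s + 2 * h * L))"
    using assms y by (subst arccos_le_mono) auto
  moreover have "arccos (cos (s + 2 * h * L)) = s + 2 * h * L" using sL by (intro arccos_cos) auto
  ultimately have b: "s \<le> arccos (y / 2)" "arccos (y / 2) \<le> s + 2 * h * L" by auto
  show "0 \<le> level y" unfolding level_def using b h by simp
  show "level y \<le> L" unfolding level_def using b h by (simp add: divide_le_eq algebra_simps)
  have "s + 2 * h * level y = arccos (y / 2)" unfolding level_def using h by simp
  then show "2 * cos (s + 2 * h * level y) = y" using y by (simp add: cos_arccos)
qed

text \<open>\<open>root_lower\<close> and \<open>root_upper\<close> put both band edges in the range
  of the cosine over {0..L}, so each is attained exactly once. As the cosine decreases, the upper
  edge gives the smaller solution.\<close>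

lemma disc_zero_set:
  assumes "0 \<le> x" "x \<le> L" and nz: "sin (p + 2 * h * x) \<noteq> 0"
  shows "{\<xi> \<in> {0..L}. disc h L a p s x \<xi> = 0} = {level (rtp h L a p s x), level (rtm h L a p s x)}"
    and "level (rtp h L a p s x) \<le> level (rtm h L a p s x)"
proof -
  have p: "2 * cos (s + 2 * h * L) \<le> rtp h L a p s x" "rtp h L a p s x \<le> 2 * cos s"
    using root_lower[OF assms] root_upper[OF assms(1,2)] roots_le[OF assms(1,2)] by auto
  have m: "2 * cos (s + 2 * h * L) \<le> rtm h L a p s x" "rtm h L a p s x \<le> 2 * cos s"
    using root_lower[OF assms] root_upper[OF assms(1,2)] roots_le[OF assms(1,2)] by auto
  have eq: "2 * cos (s + 2 * h * \<xi>) = y \<longleftrightarrow> \<xi> = level y"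
    if "\<xi> \<in> {0..L}" "2 * cos (s + 2 * h * L) \<le> y" "y \<le> 2 * cos s" for \<xi> y
    using level[OF that(2,3)] cos_mono_iff(2)[of \<xi> "level y"] that(1) by auto
  have "disc h L a p s x \<xi> = 0 \<longleftrightarrow> \<xi> = level (rtp h L a p s x) \<or> \<xi> = level (rtm h L a p s x)"
    if "\<xi> \<in> {0..L}" for \<xi>
  proof -
    have "disc h L a p s x \<xi> = 0 \<longleftrightarrow> 2 * cos (s + 2 * h * \<xi>) = rtp h L a p s x \<or> 2 * cos (s + 2 * h * \<xi>) = rtm h L a p s x"
      unfolding disc_eq[OF assms(1,2)] using nz by auto
    then show ?thesis unfolding eq[OF that p] eq[OF that m] .
  qed
  then show "{\<xi> \<in> {0..L}. disc h L a p s x \<xi> = 0} = {level (rtp h L a p s x), level (rtm h L a p s x)}"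
    using level(1,2)[OF p] level(1,2)[OF m] by (safe; simp)
  show "level (rtp h L a p s x) \<le> level (rtm h L a p s x)"
    using level[OF p] level[OF m] cos_mono_iff(3)[of "level (rtm h L a p s x)" "level (rtp h L a p s x)"]
      roots_le[OF assms(1,2)] by auto
qed

lemma disc_sym:
  assumes "0 < x" "x < L" "sin (s + 2 * h * \<xi>) \<noteq> 0"
  shows "disc h L a p s x \<xi> = disc h L a s p \<xi> x"
  using sin_pos[OF assms(1,2)] assms(3) by (intro disc_dual) auto

lemma cont_cA: "continuous_on {0<..<L} (cA h L a p s)"
  unfolding cA_def using sin_pos by (intro continuous_intros) force

lemma cont_cC: "continuous_on {0<..<L} (cC h L a p s)"
  unfolding cC_def using sin_pos by (intro continuous_intros) force

lemma cont_rtp: "continuous_on {0<..<L} (rtp h L a p s)"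
  unfolding rtp_def cB_def by (intro continuous_intros cont_cA cont_cC)

end

subsection \<open>The limiting density as a superposition of arcsine laws\<close>

text \<open>The strict bounds on s keep sin (s + 2 h \<xi>) positive up to the end points, so only
  the x side can degenerate; L \<ge> 1 leaves room for the filling \<xi> \<in> {0..1}.\<close>

locale racah_band = racah_curve +
  assumes L1: "1 \<le> L" and s_pos: "0 < s" and s_lt: "s + 2 * h * L < pi"
begin

interpretation D: racah_curve h L a s p by (rule dual)

definition X :: "real \<Rightarrow> real" where "X x = 2 * cos (p + 2 * h * x)"
definition Yv :: "real \<Rightarrow> real" where "Yv \<xi> = 2 * cos (s + 2 * h * \<xi>)"
definition qx :: "real \<Rightarrow> real \<Rightarrow> real" where
  "qx x \<xi> = qq s (2 * h) (rtm h L a p s x) (rtp h L a p s x) \<xi>"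
definition qxi :: "real \<Rightarrow> real \<Rightarrow> real" where
  "qxi \<xi> x = qq p (2 * h) (rtm h L a s p \<xi>) (rtp h L a s p \<xi>) x"
definition amp :: "real \<Rightarrow> real \<Rightarrow> real" where "amp x \<xi> = 4 * h * sin (p + 2 * h * x) * sin (s + 2 * h * \<xi>)"
text \<open>One expression serves both variables. By \<open>disc_dual\<close> it is, inside the
  band, the \<xi>-derivative of arccos (\<open>qx x \<xi>\<close>) for fixed x and the x-derivative
  of arccos (\<open>qxi \<xi> x\<close>) for fixed \<xi>; see \<open>kb_eq\<close> and
  \<open>kb_eq'\<close>.\<close>

definition kb :: "real \<Rightarrow> real \<Rightarrow> real" where
  "kb x \<xi> = (if 0 < disc h L a p s x \<xi> then amp x \<xi> / sqrt (disc h L a p s x \<xi>) else 0)"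
text \<open>The analogue of \<open>kb\<close> outside the band, kept only for \<xi> before the band
  of x, where the cosine is above the upper edge.\<close>

definition kt :: "real \<Rightarrow> real \<Rightarrow> real" where
  "kt x \<xi> = (if disc h L a p s x \<xi> < 0 \<and> rtp h L a p s x < Yv \<xi>
     then amp x \<xi> / sqrt (- disc h L a p s x \<xi>) else 0)"
text \<open>The clamping merges the three cases of the density: band entirely before 1 (value 1),
  across 1, entirely after 1 (value 0).\<close>

definition rho :: "real \<Rightarrow> real" where "rho x = arccos (clamp1 (qx x 1)) / pi"

lemma h2: "0 < 2 * h" using h by simp

lemma sin_s_pos: "0 \<le> \<xi> \<Longrightarrow> \<xi> \<le> L \<Longrightarrow> 0 < sin (s + 2 * h * \<xi>)"
proof -
  assume "0 \<le> \<xi>" "\<xi> \<le> L"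
  then have "0 \<le> h * \<xi>" "h * \<xi> \<le> h * L" using h by auto
  then show "0 < sin (s + 2 * h * \<xi>)" using s_pos s_lt by (intro sin_gt_zero) auto
qed

lemma band_measurable [measurable]:
  "(\<lambda>(x, \<xi>). kb x \<xi>) \<in> borel_measurable (borel \<Otimes>\<^sub>M borel)"
  "(\<lambda>(x, \<xi>). kt x \<xi>) \<in> borel_measurable (borel \<Otimes>\<^sub>M borel)"
  "(\<lambda>x. rtp h L a p s x) \<in> borel_measurable borel"
  "(\<lambda>x. rtm h L a p s x) \<in> borel_measurable borel"
  "(\<lambda>x. rtp h L a s p x) \<in> borel_measurable borel"
  "(\<lambda>x. rtm h L a s p x) \<in> borel_measurable borel"
  "X \<in> borel_measurable borel" "Yv \<in> borel_measurable borel"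
  unfolding kb_def kt_def amp_def disc_def rtp_def rtm_def cB_def cA_def cC_def X_def Yv_def
  by measurable

lemma arccos_clamp_measurable [measurable]: "(\<lambda>q. arccos (clamp1 q)) \<in> borel_measurable borel"
  unfolding clamp1_def
  by (intro borel_measurable_continuous_onI continuous_on_arccos continuous_intros) auto

lemma arcosh_max_measurable [measurable]: "(\<lambda>q::real. arcosh (max 1 q)) \<in> borel_measurable borel"
  by (intro borel_measurable_continuous_onI continuous_on_arcosh' continuous_intros) auto

lemma qx_measurable [measurable]: "(\<lambda>x. qx x \<xi>) \<in> borel_measurable borel"
  unfolding qx_def qq_def by measurable

lemma qxi_measurable [measurable]: "(\<lambda>\<xi>. qxi \<xi> x) \<in> borel_measurable borel"
  unfolding qxi_def qq_def by measurable

lemma rho_measurable [measurable]: "rho \<in> borel_measurable borel"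
  unfolding rho_def by measurable

lemma rho_bounds: "0 \<le> rho x" "rho x \<le> 1"
  unfolding rho_def using arccos_lbound[of "clamp1 (qx x 1)"] arccos_ubound[of "clamp1 (qx x 1)"] by auto

lemma between_pos_iff: "0 < (u - v) * (w - u) \<longleftrightarrow> v < u \<and> u < w" if "v < w" for u v w :: real
  using that by (auto simp: zero_less_mult_iff)

lemma
  assumes x: "0 < x" "x < L" and xi: "0 \<le> \<xi>" "\<xi> \<le> L"
  shows kb_eq: "kb x \<xi> = (if rtm h L a p s x < 2 * cos (s + 2 * h * \<xi>) \<and> 2 * cos (s + 2 * h * \<xi>) < rtp h L a p s x
      then 2 * (2 * h) * sin (s + 2 * h * \<xi>) / sqrt ((2 * cos (s + 2 * h * \<xi>) - rtm h L a p s x) * (rtp h L a p s x - 2 * cos (s + 2 * h * \<xi>))) else 0)"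
    and kt_eq: "kt x \<xi> = (if 1 < qx x \<xi>
      then 2 * (2 * h) * sin (s + 2 * h * \<xi>) / sqrt ((2 * cos (s + 2 * h * \<xi>) - rtm h L a p s x) * (2 * cos (s + 2 * h * \<xi>) - rtp h L a p s x)) else 0)"
    and disc_neg_iff: "disc h L a p s x \<xi> < 0 \<longleftrightarrow> 1 < \<bar>qx x \<xi>\<bar>"
proof -
  define Y where "Y = 2 * cos (s + 2 * h * \<xi>)"
  define S where "S = sin (p + 2 * h * x)"
  define u where "u = rtm h L a p s x"
  define v where "v = rtp h L a p s x"
  have S: "0 < S" using sin_pos[OF x] by (simp add: S_def)
  have uv: "u < v" using roots_less[OF x] by (simp add: u_def v_def)
  have d: "disc h L a p s x \<xi> = S\<^sup>2 * ((Y - u) * (v - Y))"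
    using disc_eq[of x \<xi>] x by (simp add: S_def u_def v_def Y_def)
  have pos: "0 < disc h L a p s x \<xi> \<longleftrightarrow> u < Y \<and> Y < v"
    unfolding d using S between_pos_iff[OF uv, of Y] by (simp add: zero_less_mult_iff)
  have "sqrt (S\<^sup>2 * ((Y - u) * (v - Y))) = S * sqrt ((Y - u) * (v - Y))"
    using S by (simp add: real_sqrt_mult)
  then show "kb x \<xi> = (if rtm h L a p s x < 2 * cos (s + 2 * h * \<xi>) \<and> 2 * cos (s + 2 * h * \<xi>) < rtp h L a p s x
      then 2 * (2 * h) * sin (s + 2 * h * \<xi>) / sqrt ((2 * cos (s + 2 * h * \<xi>) - rtm h L a p s x) * (rtp h L a p s x - 2 * cos (s + 2 * h * \<xi>))) else 0)"
    using S unfolding kb_def pos unfolding d amp_def u_def[symmetric] v_def[symmetric] Y_def[symmetric] S_def[symmetric] by simp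
  have q: "1 < qx x \<xi> \<longleftrightarrow> v < Y" "qx x \<xi> < - 1 \<longleftrightarrow> Y < u"
    unfolding qx_def v_def u_def Y_def using qq_iff(3,4)[OF h2 uv[unfolded u_def v_def]] by auto
  have neg: "disc h L a p s x \<xi> < 0 \<longleftrightarrow> Y < u \<or> v < Y"
    unfolding d using S uv by (auto simp: mult_less_0_iff zero_less_mult_iff)
  show "disc h L a p s x \<xi> < 0 \<longleftrightarrow> 1 < \<bar>qx x \<xi>\<bar>"
    unfolding neg using q by (auto simp: abs_if)
  have "- (S\<^sup>2 * ((Y - u) * (v - Y))) = S\<^sup>2 * ((Y - u) * (Y - v))" by (simp add: algebra_simps)
  then have "sqrt (- disc h L a p s x \<xi>) = S * sqrt ((Y - u) * (Y - v))"
    unfolding d using S by (simp add: real_sqrt_mult)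
  moreover have "disc h L a p s x \<xi> < 0 \<and> rtp h L a p s x < Yv \<xi> \<longleftrightarrow> 1 < qx x \<xi>"
    unfolding neg q by (auto simp: Yv_def Y_def v_def)
  ultimately show "kt x \<xi> = (if 1 < qx x \<xi>
      then 2 * (2 * h) * sin (s + 2 * h * \<xi>) / sqrt ((2 * cos (s + 2 * h * \<xi>) - rtm h L a p s x) * (2 * cos (s + 2 * h * \<xi>) - rtp h L a p s x)) else 0)"
    using S unfolding kt_def amp_def u_def[symmetric] v_def[symmetric] Y_def[symmetric] S_def[symmetric] by simp
qed

lemma qx_ends: assumes "0 < x" "x < L" shows "1 \<le> qx x 0" "qx x L \<le> - 1"
proof -
  have nz: "sin (p + 2 * h * x) \<noteq> 0" using sin_pos[OF assms] by simp
  have "rtp h L a p s x \<le> 2 * cos s" "2 * cos (s + 2 * h * L) \<le> rtm h L a p s x"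
    using root_upper[of x] root_lower[of x] nz assms by auto
  then show "1 \<le> qx x 0" "qx x L \<le> - 1"
    using qq_iff(1)[OF h2 roots_less[OF assms], of s 0] qq_iff(2)[OF h2 roots_less[OF assms], of s L]
    unfolding qx_def by auto
qed

text \<open>No band starts before \<xi> = 0 (\<open>qx_ends\<close>), so the lower boundary term is
  arccos 1 = 0.\<close>

lemma kb_int_xi:
  assumes x: "0 < x" "x < L"
  shows "(kb x has_integral pi * rho x) {0..1}"
proof -
  have ang: "0 \<le> s + 2 * h * 0" "s + 2 * h * 1 \<le> pi"
  proof -
    have "2 * h * 1 \<le> 2 * h * L" using L1 h by (intro mult_left_mono) auto
    then show "0 \<le> s + 2 * h * 0" "s + 2 * h * 1 \<le> pi" using s_pos s_lt by linarith+
  qed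
  have "((\<lambda>\<xi>. if rtm h L a p s x < 2 * cos (s + 2 * h * \<xi>) \<and> 2 * cos (s + 2 * h * \<xi>) < rtp h L a p s x
      then 2 * (2 * h) * sin (s + 2 * h * \<xi>) / sqrt ((2 * cos (s + 2 * h * \<xi>) - rtm h L a p s x) * (rtp h L a p s x - 2 * cos (s + 2 * h * \<xi>))) else 0)
     has_integral arccos (clamp1 (qx x 1)) - arccos (clamp1 (qx x 0))) {0..1}"
    unfolding qx_def by (rule arccos_band_integral[OF h2 roots_less[OF x] ang]) simp
  moreover have "clamp1 (qx x 0) = 1" using qx_ends[OF x] by (simp add: clamp1_def)
  ultimately show ?thesis
    by (subst has_integral_cong[OF kb_eq[OF x]]) (use L1 in \<open>auto simp: rho_def\<close>)
qed

lemma kt_int_xi: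
  assumes x: "0 < x" "x < L"
  shows "(kt x has_integral arcosh (max 1 (qx x 0))) {0..L}"
proof -
  have ang: "0 \<le> s + 2 * h * 0" "s + 2 * h * L \<le> pi" using s_pos s_lt by auto
  have "((\<lambda>\<xi>. if 1 * qx x \<xi> > 1
      then - 1 * (2 * (2 * h) * sin (s + 2 * h * \<xi>)) / sqrt ((2 * cos (s + 2 * h * \<xi>) - rtm h L a p s x) * (2 * cos (s + 2 * h * \<xi>) - rtp h L a p s x)) else 0)
     has_integral arcosh (max 1 (1 * qx x L)) - arcosh (max 1 (1 * qx x 0))) {0..L}"
    unfolding qx_def by (rule arcosh_tail_integral[OF h2 roots_less[OF x] ang]) (use L in auto)
  from has_integral_neg[OF this] have "((\<lambda>\<xi>. - (if 1 * qx x \<xi> > 1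
      then - 1 * (2 * (2 * h) * sin (s + 2 * h * \<xi>)) / sqrt ((2 * cos (s + 2 * h * \<xi>) - rtm h L a p s x) * (2 * cos (s + 2 * h * \<xi>) - rtp h L a p s x)) else 0))
     has_integral arcosh (max 1 (qx x 0)) - arcosh (max 1 (qx x L))) {0..L}" by simp
  moreover have "max 1 (qx x L) = 1" using qx_ends[OF x] by simp
  ultimately show ?thesis
    by (subst has_integral_cong[OF kt_eq[OF x]]) (auto elim!: has_integral_eq[rotated])
qed

lemma disc_sym_band:
  assumes "0 \<le> \<xi>" "\<xi> \<le> L" "0 < x" "x < L"
  shows "disc h L a p s x \<xi> = disc h L a s p \<xi> x"
  using disc_sym[OF assms(3,4)] sin_s_pos[OF assms(1,2)] by simp

lemma
  assumes xi: "0 < \<xi>" "\<xi> < L" and x: "0 < x" "x < L"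
  shows kb_eq': "kb x \<xi> = (if rtm h L a s p \<xi> < 2 * cos (p + 2 * h * x) \<and> 2 * cos (p + 2 * h * x) < rtp h L a s p \<xi>
      then 2 * (2 * h) * sin (p + 2 * h * x) / sqrt ((2 * cos (p + 2 * h * x) - rtm h L a s p \<xi>) * (rtp h L a s p \<xi> - 2 * cos (p + 2 * h * x))) else 0)"
    and disc_neg_iff': "disc h L a p s x \<xi> < 0 \<longleftrightarrow> 1 < \<bar>qxi \<xi> x\<bar>"
    and disc_neg_sqrt: "disc h L a p s x \<xi> < 0 \<Longrightarrow> amp x \<xi> / sqrt (- disc h L a p s x \<xi>) =
      2 * (2 * h) * sin (p + 2 * h * x) / sqrt ((2 * cos (p + 2 * h * x) - rtm h L a s p \<xi>) * (2 * cos (p + 2 * h * x) - rtp h L a s p \<xi>))"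
proof -
  define Y where "Y = 2 * cos (p + 2 * h * x)"
  define S where "S = sin (s + 2 * h * \<xi>)"
  define u where "u = rtm h L a s p \<xi>"
  define v where "v = rtp h L a s p \<xi>"
  have S: "0 < S" using sin_s_pos[of \<xi>] xi by (simp add: S_def)
  have uv: "u < v" using D.roots_less[OF xi] by (simp add: u_def v_def)
  have d: "disc h L a p s x \<xi> = S\<^sup>2 * ((Y - u) * (v - Y))"
    using D.disc_eq[of \<xi> x] disc_sym_band[of \<xi> x] x xi by (simp add: S_def u_def v_def Y_def)
  have pos: "0 < disc h L a p s x \<xi> \<longleftrightarrow> u < Y \<and> Y < v"
    unfolding d using S between_pos_iff[OF uv, of Y] by (simp add: zero_less_mult_iff)
  have "sqrt (S\<^sup>2 * ((Y - u) * (v - Y))) = S * sqrt ((Y - u) * (v - Y))"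
    using S by (simp add: real_sqrt_mult)
  then show "kb x \<xi> = (if rtm h L a s p \<xi> < 2 * cos (p + 2 * h * x) \<and> 2 * cos (p + 2 * h * x) < rtp h L a s p \<xi>
      then 2 * (2 * h) * sin (p + 2 * h * x) / sqrt ((2 * cos (p + 2 * h * x) - rtm h L a s p \<xi>) * (rtp h L a s p \<xi> - 2 * cos (p + 2 * h * x))) else 0)"
    using S unfolding kb_def pos unfolding d amp_def u_def[symmetric] v_def[symmetric] Y_def[symmetric] S_def[symmetric] by simp
  have q: "1 < qxi \<xi> x \<longleftrightarrow> v < Y" "qxi \<xi> x < - 1 \<longleftrightarrow> Y < u"
    unfolding qxi_def v_def u_def Y_def using qq_iff(3,4)[OF h2 uv[unfolded u_def v_def]] by auto
  have neg: "disc h L a p s x \<xi> < 0 \<longleftrightarrow> Y < u \<or> v < Y"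
    unfolding d using S uv by (auto simp: mult_less_0_iff zero_less_mult_iff)
  show "disc h L a p s x \<xi> < 0 \<longleftrightarrow> 1 < \<bar>qxi \<xi> x\<bar>"
    unfolding neg using q by (auto simp: abs_if)
  have "- (S\<^sup>2 * ((Y - u) * (v - Y))) = S\<^sup>2 * ((Y - u) * (Y - v))" by (simp add: algebra_simps)
  then have "sqrt (- disc h L a p s x \<xi>) = S * sqrt ((Y - u) * (Y - v))"
    unfolding d using S by (simp add: real_sqrt_mult)
  then show "amp x \<xi> / sqrt (- disc h L a p s x \<xi>) =
      2 * (2 * h) * sin (p + 2 * h * x) / sqrt ((2 * cos (p + 2 * h * x) - rtm h L a s p \<xi>) * (2 * cos (p + 2 * h * x) - rtp h L a s p \<xi>))"
    using S unfolding amp_def u_def[symmetric] v_def[symmetric] Y_def[symmetric] S_def[symmetric] by simp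
qed

section \<open>Logarithmic potentials of the bands and of the density\<close>

text \<open>The logarithmic potential at z of the arcsine law on the band of \<xi>: a quarter of the
  length is the capacity of the interval, and the arcosh term is its Green function, which vanishes
  on the band.\<close>

definition Pot :: "real \<Rightarrow> real \<Rightarrow> real" where
  "Pot \<xi> z = ln ((rtp h L a s p \<xi> - rtm h L a s p \<xi>) / 4)
     + arcosh (max 1 \<bar>(2 * z - rtm h L a s p \<xi> - rtp h L a s p \<xi>) / (rtp h L a s p \<xi> - rtm h L a s p \<xi>)\<bar>)"

lemma Pot_measurable [measurable]: "(\<lambda>\<xi>. Pot \<xi> z) \<in> borel_measurable borel"
  unfolding Pot_def by measurable

lemma Pot_X: "Pot \<xi> (X x) = ln ((rtp h L a s p \<xi> - rtm h L a s p \<xi>) / 4) + arcosh (max 1 \<bar>qxi \<xi> x\<bar>)"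
  unfolding Pot_def X_def qxi_def qq_def by simp

lemma p_ang: "0 \<le> p + 2 * h * 0" "p + 2 * h * L \<le> pi"
  using p0 pL by auto

lemma dual_edges:
  assumes "0 < \<xi>" "\<xi> < L"
  shows "rtp h L a s p \<xi> \<le> 2 * cos (p + 2 * h * 0)" "2 * cos (p + 2 * h * L) \<le> rtm h L a s p \<xi>"
  using D.root_upper[of \<xi>] D.root_lower[of \<xi>] sin_s_pos[of \<xi>] assms by auto

text \<open>By \<open>dual_edges\<close> the whole band lies in the range of 2 cos (p + 2 h x), so
  the full mass \<pi> is collected.\<close>

lemma kb_int_x:
  assumes xi: "0 < \<xi>" "\<xi> < L"
  shows "((\<lambda>x. kb x \<xi>) has_integral pi) {0..L}"
proof -
  have "((\<lambda>x. if rtm h L a s p \<xi> < 2 * cos (p + 2 * h * x) \<and> 2 * cos (p + 2 * h * x) < rtp h L a s p \<xi>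
      then 2 * (2 * h) * sin (p + 2 * h * x) / sqrt ((2 * cos (p + 2 * h * x) - rtm h L a s p \<xi>) * (rtp h L a s p \<xi> - 2 * cos (p + 2 * h * x))) else 0)
     has_integral arccos (clamp1 (qxi \<xi> L)) - arccos (clamp1 (qxi \<xi> 0))) {0..L}"
    unfolding qxi_def by (rule arccos_band_integral[OF h2 D.roots_less[OF xi] p_ang]) (use L in auto)
  moreover have "\<not> qxi \<xi> 0 < 1" "\<not> - 1 < qxi \<xi> L"
    unfolding qxi_def using dual_edges[OF xi] qq_iff(1)[OF h2 D.roots_less[OF xi], of p 0]
      qq_iff(2)[OF h2 D.roots_less[OF xi], of p L] by auto
  then have "arccos (clamp1 (qxi \<xi> L)) - arccos (clamp1 (qxi \<xi> 0)) = pi"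
    by (simp add: clamp1_def max_def min_def)
  ultimately show ?thesis
    by (intro has_integral_spike_finite[of "{0, L}" "{0..L}" "\<lambda>x. kb x \<xi>"]) (use kb_eq'[OF xi] in auto)
qed

lemma kb_int_x_ln:
  assumes xi: "0 < \<xi>" "\<xi> < L"
  shows "((\<lambda>x. kb x \<xi> * ln \<bar>X x - z\<bar>) has_integral pi * Pot \<xi> z) {0..L}"
proof -
  have "((\<lambda>x. (if rtm h L a s p \<xi> < 2 * cos (p + 2 * h * x) \<and> 2 * cos (p + 2 * h * x) < rtp h L a s p \<xi>
      then 2 * (2 * h) * sin (p + 2 * h * x) / sqrt ((2 * cos (p + 2 * h * x) - rtm h L a s p \<xi>) * (rtp h L a s p \<xi> - 2 * cos (p + 2 * h * x))) else 0)
      * ln \<bar>2 * cos (p + 2 * h * x) - z\<bar>) has_integral pi * Pot \<xi> z) {0..L}"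
    unfolding Pot_def by (rule log_band_integral[OF h2 D.roots_less[OF xi] p_ang _ dual_edges[OF xi]]) (use L in auto)
  then show ?thesis
    by (rule has_integral_spike_finite[of "{0, L}", rotated 2]) (use kb_eq'[OF xi] in \<open>auto simp: X_def\<close>)
qed

lemma kb_nonneg: "0 \<le> x \<Longrightarrow> x \<le> L \<Longrightarrow> 0 \<le> \<xi> \<Longrightarrow> \<xi> \<le> L \<Longrightarrow> 0 \<le> kb x \<xi>"
  unfolding kb_def amp_def using h sin_nonneg[of x] D.sin_nonneg[of \<xi>] by simp

lemma kt_nonneg: "0 \<le> x \<Longrightarrow> x \<le> L \<Longrightarrow> 0 \<le> \<xi> \<Longrightarrow> \<xi> \<le> L \<Longrightarrow> 0 \<le> kt x \<xi>"
  unfolding kt_def amp_def using h sin_nonneg[of x] D.sin_nonneg[of \<xi>] by simp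

lemma AE_not: "AE x in lborel. x \<noteq> (c::real)"
  by (rule AE_lborel_singleton)

text \<open>Writes an integral against \<open>rho\<close> as an integral over the filling \<xi>
  \<in> {0..1} of integrals over single bands. Nonnegativity allows the exchange before any
  integrability is known.\<close>

lemma band_Tonelli:
  assumes F [measurable]: "F \<in> borel_measurable borel" and Fnn: "\<And>x. x \<in> {0..L} \<Longrightarrow> 0 \<le> F x"
    and G: "\<And>\<xi>. 0 < \<xi> \<Longrightarrow> \<xi> < 1 \<Longrightarrow> ((\<lambda>x. kb x \<xi> * F x) has_integral G \<xi>) {0..L}"
  shows "(\<integral>\<^sup>+x. ennreal (indicator {0..L} x * (pi * rho x * F x)) \<partial>lborel) =
     (\<integral>\<^sup>+\<xi>. ennreal (indicator {0..1} \<xi> * G \<xi>) \<partial>lborel)"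
proof -
  define T where "T = (\<lambda>x \<xi>. ennreal (kb x \<xi> * F x) * (indicator {0..L} x * indicator {0..1} \<xi>))"
  have meas: "case_prod T \<in> borel_measurable (lborel \<Otimes>\<^sub>M lborel)"
    unfolding T_def by measurable
  have 1: "AE x in lborel. (\<integral>\<^sup>+\<xi>. T x \<xi> \<partial>lborel) = ennreal (indicator {0..L} x * (pi * rho x * F x))"
    using AE_not[of 0] AE_not[of L]
  proof eventually_elim
    case (elim x)
    show ?case
    proof (cases "x \<in> {0..L}")
      case True
      with elim have x: "0 < x" "x < L" by auto
      have "((\<lambda>\<xi>. kb x \<xi> * F x) has_integral pi * rho x * F x) {0..1}"
        by (rule has_integral_mult_left[OF kb_int_xi[OF x]])
      moreover have "0 \<le> kb x \<xi> * F x" if "\<xi> \<in> {0..1}" for \<xi>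
        using that x L1 Fnn[OF True] kb_nonneg[of x \<xi>] by simp
      ultimately have "(\<integral>\<^sup>+\<xi>. ennreal (kb x \<xi> * F x) * indicator {0..1} \<xi> \<partial>lborel) = ennreal (pi * rho x * F x)"
        by (intro nn_integral_has_integral_lebesgue')
      then show ?thesis using True by (simp add: T_def)
    qed (simp add: T_def)
  qed
  have 2: "AE \<xi> in lborel. (\<integral>\<^sup>+x. T x \<xi> \<partial>lborel) = ennreal (indicator {0..1} \<xi> * G \<xi>)"
    using AE_not[of 0] AE_not[of 1]
  proof eventually_elim
    case (elim \<xi>)
    show ?case
    proof (cases "\<xi> \<in> {0..1}")
      case True
      with elim have xi: "0 < \<xi>" "\<xi> < 1" by auto
      have "0 \<le> kb x \<xi> * F x" if "x \<in> {0..L}" for x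
        using that xi L1 Fnn[OF that] kb_nonneg[of x \<xi>] by simp
      then have "(\<integral>\<^sup>+x. ennreal (kb x \<xi> * F x) * indicator {0..L} x \<partial>lborel) = ennreal (G \<xi>)"
        by (intro nn_integral_has_integral_lebesgue' G[OF xi])
      then show ?thesis using True by (simp add: T_def)
    qed (simp add: T_def)
  qed
  have "(\<integral>\<^sup>+x. ennreal (indicator {0..L} x * (pi * rho x * F x)) \<partial>lborel) = (\<integral>\<^sup>+x. \<integral>\<^sup>+\<xi>. T x \<xi> \<partial>lborel \<partial>lborel)"
    by (rule nn_integral_cong_AE) (use 1 in \<open>auto elim: eventually_mono\<close>)
  also have "\<dots> = (\<integral>\<^sup>+\<xi>. \<integral>\<^sup>+x. T x \<xi> \<partial>lborel \<partial>lborel)"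
    by (rule lborel_pair.Fubini'[OF meas, symmetric])
  also have "\<dots> = (\<integral>\<^sup>+\<xi>. ennreal (indicator {0..1} \<xi> * G \<xi>) \<partial>lborel)"
    by (rule nn_integral_cong_AE) (use 2 in auto)
  finally show ?thesis .
qed

text \<open>Every band has mass \<pi> and the filling has length 1.\<close>

lemma rho_integrable: "integrable lborel (\<lambda>x. indicator {0..L} x * rho x)"
  and rho_integral: "(LINT x|lborel. indicator {0..L} x * rho x) = 1"
proof -
  have "(\<integral>\<^sup>+x. ennreal (indicator {0..L} x * (pi * rho x * 1)) \<partial>lborel) =
     (\<integral>\<^sup>+\<xi>. ennreal (indicator {0..1::real} \<xi> * pi) \<partial>lborel)"
    by (rule band_Tonelli[of "\<lambda>_. 1" "\<lambda>_. pi"]) (use kb_int_x L1 in auto)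
  also have "\<dots> = (\<integral>\<^sup>+\<xi>. ennreal pi * indicator {0..1::real} \<xi> \<partial>lborel)"
    by (intro nn_integral_cong) (auto simp: indicator_def)
  also have "\<dots> = ennreal pi" by (simp add: nn_integral_cmult_indicator)
  finally have "integrable lborel (\<lambda>x. indicator {0..L} x * (pi * rho x * 1)) \<and>
      (LINT x|lborel. indicator {0..L} x * (pi * rho x * 1)) = pi"
    by (intro iffD1[OF nn_integral_eq_integrable]) (auto simp: rho_bounds)
  moreover have "(\<lambda>x. indicator {0..L} x * (pi * rho x * 1)) = (\<lambda>x. pi * (indicator {0..L} x * rho x))"
    by (auto simp: mult_ac)
  ultimately show "integrable lborel (\<lambda>x. indicator {0..L} x * rho x)"
    "(LINT x|lborel. indicator {0..L} x * rho x) = 1"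
    by (auto dest: integrable_mult_right_iff[THEN iffD1, rotated])
qed

end

lemma lborel_integral_of_has_integral:
  fixes f :: "real \<Rightarrow> real"
  assumes [measurable]: "f \<in> borel_measurable borel"
    and nn: "\<And>x. x \<in> {a..b} \<Longrightarrow> 0 \<le> f x" and I: "(f has_integral I) {a..b}"
  shows "integrable lborel (\<lambda>x. indicator {a..b} x * f x)"
    and "(LINT x|lborel. indicator {a..b} x * f x) = I"
proof -
  have "0 \<le> I" using has_integral_nonneg[OF I nn] by simp
  moreover have "(\<integral>\<^sup>+x. ennreal (indicator {a..b} x * f x) \<partial>lborel) = ennreal I"
    by (rule nn_integral_has_integral_lebesgue[OF nn I])
  ultimately have "integrable lborel (\<lambda>x. indicator {a..b} x * f x) \<and> (LINT x|lborel. indicator {a..b} x * f x) = I"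
    by (intro iffD1[OF nn_integral_eq_integrable]) (auto simp: indicator_def nn)
  then show "integrable lborel (\<lambda>x. indicator {a..b} x * f x)"
    and "(LINT x|lborel. indicator {a..b} x * f x) = I" by auto
qed

lemma sgn_eq_if_nonzero:
  fixes f :: "real \<Rightarrow> real"
  assumes "continuous_on {a..b} f" "a \<le> b" "\<And>x. x \<in> {a..b} \<Longrightarrow> f x \<noteq> 0"
  shows "sgn (f a) = sgn (f b)"
proof (rule ccontr)
  assume "sgn (f a) \<noteq> sgn (f b)"
  moreover have "f a \<noteq> 0" "f b \<noteq> 0" using assms by auto
  ultimately have "(f a \<le> 0 \<and> 0 \<le> f b) \<or> (f b \<le> 0 \<and> 0 \<le> f a)"
    by (auto simp: sgn_if split: if_splits)
  then obtain x where "a \<le> x" "x \<le> b" "f x = 0"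
    using IVT'[of f a 0 b] IVT2'[of f b 0 a] assms by blast
  then show False using assms(3) by auto
qed

context racah_band
begin

interpretation D: racah_curve h L a s p by (rule dual)

lemma ln_X_bound:
  assumes "x \<in> {0..L}" "x0 \<in> {0..L}"
  shows "\<bar>ln \<bar>X x - X x0\<bar>\<bar> \<le> 2 + (6 / sqrt (2 * h)) * (1 / sqrt \<bar>x - x0\<bar>)"
proof -
  have "\<bar>ln \<bar>X x - X x0\<bar>\<bar> \<le> 2 + 6 / sqrt \<bar>(p + 2 * h * x) - (p + 2 * h * x0)\<bar>"
    unfolding X_def using ang[of x] ang[of x0] assms by (intro ln_cos_diff_bounds) auto
  also have "(p + 2 * h * x) - (p + 2 * h * x0) = 2 * h * (x - x0)" by (simp add: algebra_simps)
  also have "\<bar>2 * h * (x - x0)\<bar> = 2 * h * \<bar>x - x0\<bar>" using h by (simp add: abs_mult)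
  finally show ?thesis by (simp add: real_sqrt_mult)
qed

lemma X_diff_le: "\<bar>X x - X y\<bar> \<le> 4"
  unfolding X_def
  using cos_le_one[of "p + 2 * h * x"] cos_le_one[of "p + 2 * h * y"]
    cos_ge_minus_one[of "p + 2 * h * x"] cos_ge_minus_one[of "p + 2 * h * y"] by linarith

lemma rho_ln_integrable:
  assumes x0: "x0 \<in> {0..L}"
  shows "integrable lborel (\<lambda>x. indicator {0..L} x * (rho x * ln \<bar>X x - X x0\<bar>))"
proof -
  define g where "g = (\<lambda>x. 2 + (6 / sqrt (2 * h)) * (1 / sqrt \<bar>x - x0\<bar>))"
  have gnn: "0 \<le> g x" for x using h by (simp add: g_def)
  have [measurable]: "g \<in> borel_measurable borel" unfolding g_def by measurable
  obtain I where "((\<lambda>x. 1 / sqrt \<bar>x - x0\<bar>) has_integral I) {0..L}"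
    using inverse_sqrt_integral_bound(1)[of 0 L x0] L by (auto simp: integrable_on_def)
  then have "(g has_integral (L * 2 + (6 / sqrt (2 * h)) * I)) {0..L}"
    unfolding g_def using has_integral_const_real[of "2::real" 0 L] L
    by (intro has_integral_add has_integral_mult_right) auto
  then have gi: "integrable lborel (\<lambda>x. indicator {0..L} x * g x)"
    by (rule lborel_integral_of_has_integral(1)[rotated 2]) (auto simp: gnn)
  show ?thesis
  proof (rule Bochner_Integration.integrable_bound[OF gi])
    show "(\<lambda>x. indicator {0..L} x * (rho x * ln \<bar>X x - X x0\<bar>)) \<in> borel_measurable lborel" by measurable
    have "norm (indicator {0..L} x * (rho x * ln \<bar>X x - X x0\<bar>)) \<le> norm (indicator {0..L} x * g x)" for x
    proof (cases "x \<in> {0..L}")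
      case True
      have "\<bar>rho x * ln \<bar>X x - X x0\<bar>\<bar> \<le> 1 * \<bar>ln \<bar>X x - X x0\<bar>\<bar>"
        unfolding abs_mult using rho_bounds[of x] by (intro mult_right_mono) auto
      also have "\<dots> \<le> g x" unfolding g_def using ln_X_bound[OF True x0] by simp
      finally show ?thesis using True gnn by simp
    qed simp
    then show "AE x in lborel. norm (indicator {0..L} x * (rho x * ln \<bar>X x - X x0\<bar>)) \<le> norm (indicator {0..L} x * g x)"
      by simp
  qed
qed

definition Ulog :: "real \<Rightarrow> real" where
  "Ulog x0 = (LINT x|lborel. indicator {0..L} x * (rho x * ln \<bar>X x - X x0\<bar>))"

lemma Ulog_formula:
  assumes x0: "x0 \<in> {0..L}"
  shows "integrable lborel (\<lambda>\<xi>. indicator {0..1} \<xi> * Pot \<xi> (X x0))"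
    and "Ulog x0 = (LINT \<xi>|lborel. indicator {0..1} \<xi> * Pot \<xi> (X x0))"
proof -
  \<comment> \<open>|X x - X x0| \<le> 4, so subtracting from ln 4 gives a nonnegative function to
    which \<open>band_Tonelli\<close> applies; the constant is removed again with
    \<open>rho_integral\<close>.\<close>
  define F where "F = (\<lambda>x. ln 4 - ln \<bar>X x - X x0\<bar>)"
  define G where "G = (\<lambda>\<xi>. pi * ln 4 - pi * Pot \<xi> (X x0))"
  have [measurable]: "F \<in> borel_measurable borel" "G \<in> borel_measurable borel"
    unfolding F_def G_def by measurable
  have Fnn: "0 \<le> F x" for x
  proof (cases "X x = X x0")
    case False
    then have "ln \<bar>X x - X x0\<bar> \<le> ln 4" using X_diff_le[of x x0] by (subst ln_le_cancel_iff) auto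
    then show ?thesis by (simp add: F_def)
  qed (simp add: F_def)
  have FG: "((\<lambda>x. kb x \<xi> * F x) has_integral G \<xi>) {0..L}" if "0 < \<xi>" "\<xi> < 1" for \<xi>
  proof -
    have "((\<lambda>x. kb x \<xi> * ln 4 - kb x \<xi> * ln \<bar>X x - X x0\<bar>) has_integral (pi * ln 4 - pi * Pot \<xi> (X x0))) {0..L}"
      using that L1 by (intro has_integral_diff has_integral_mult_left kb_int_x kb_int_x_ln) auto
    then show ?thesis unfolding F_def G_def by (simp add: right_diff_distrib)
  qed
  have Gnn: "0 \<le> G \<xi>" if "0 < \<xi>" "\<xi> < 1" for \<xi>
    by (rule has_integral_nonneg[OF FG[OF that]]) (use that L1 Fnn kb_nonneg in auto)
  have eq: "(\<integral>\<^sup>+x. ennreal (indicator {0..L} x * (pi * rho x * F x)) \<partial>lborel) =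
     (\<integral>\<^sup>+\<xi>. ennreal (indicator {0..1} \<xi> * G \<xi>) \<partial>lborel)"
    by (rule band_Tonelli[OF _ Fnn FG]) auto
  have e: "indicator {0..L} x * (pi * rho x * F x) =
      pi * ln 4 * (indicator {0..L} x * rho x) - pi * (indicator {0..L} x * (rho x * ln \<bar>X x - X x0\<bar>))" for x
    by (simp add: F_def algebra_simps)
  have "integrable lborel (\<lambda>x. indicator {0..L} x * (pi * rho x * F x))"
    unfolding e using rho_integrable rho_ln_integrable[OF x0] by simp
  moreover have "(LINT x|lborel. indicator {0..L} x * (pi * rho x * F x)) = pi * ln 4 - pi * Ulog x0"
    unfolding e using rho_integrable rho_ln_integrable[OF x0] rho_integral by (simp add: Ulog_def)
  moreover have nn1: "0 \<le> indicator {0..L} x * (pi * rho x * F x)" for x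
    using Fnn rho_bounds by (simp add: indicator_def)
  moreover have "0 \<le> (LINT x|lborel. indicator {0..L} x * (pi * rho x * F x))"
    by (rule Bochner_Integration.integral_nonneg) (rule nn1)
  ultimately have "(\<integral>\<^sup>+x. ennreal (indicator {0..L} x * (pi * rho x * F x)) \<partial>lborel) = ennreal (pi * ln 4 - pi * Ulog x0)"
    and nnU: "0 \<le> pi * ln 4 - pi * Ulog x0"
    by (simp_all add: nn_integral_eq_integral)
  then have "(\<integral>\<^sup>+\<xi>. ennreal (indicator {0..1} \<xi> * G \<xi>) \<partial>lborel) = ennreal (pi * ln 4 - pi * Ulog x0)"
    using eq by simp
  moreover have "AE \<xi> in lborel. 0 \<le> indicator {0..1} \<xi> * G \<xi>"
    using AE_not[of 0] AE_not[of 1] by eventually_elim (auto simp: indicator_def Gnn)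
  ultimately have G: "integrable lborel (\<lambda>\<xi>. indicator {0..1} \<xi> * G \<xi>)"
     "(LINT \<xi>|lborel. indicator {0..1} \<xi> * G \<xi>) = pi * ln 4 - pi * Ulog x0"
    using nn_integral_eq_integrable[of "\<lambda>\<xi>. indicator {0..1} \<xi> * G \<xi>" lborel "pi * ln 4 - pi * Ulog x0"] nnU
    by auto
  have c: "integrable lborel (\<lambda>\<xi>. ln 4 * indicator {0..1::real} \<xi> :: real)" by simp
  have e2: "indicator {0..1} \<xi> * Pot \<xi> (X x0) = ln 4 * indicator {0..1} \<xi> - (1 / pi) * (indicator {0..1} \<xi> * G \<xi>)" for \<xi>
    by (simp add: G_def field_simps)
  show "integrable lborel (\<lambda>\<xi>. indicator {0..1} \<xi> * Pot \<xi> (X x0))"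
    unfolding e2 by (intro Bochner_Integration.integrable_diff c integrable_mult_right G(1))
  have "(LINT \<xi>|lborel. indicator {0..1} \<xi> * Pot \<xi> (X x0)) =
     (LINT \<xi>|lborel. ln 4 * indicator {0..1::real} \<xi>) - (LINT \<xi>|lborel. (1 / pi) * (indicator {0..1} \<xi> * G \<xi>))"
    unfolding e2 by (intro Bochner_Integration.integral_diff c integrable_mult_right G(1))
  also have "\<dots> = ln 4 - (1 / pi) * (pi * ln 4 - pi * Ulog x0)"
    unfolding integral_mult_right_zero G(2) by simp
  also have "\<dots> = Ulog x0" by (simp add: right_diff_distrib)
  finally show "Ulog x0 = (LINT \<xi>|lborel. indicator {0..1} \<xi> * Pot \<xi> (X x0))" ..
qed

subsection \<open>Euler--Lagrange conditions\<close>

text \<open>The part of \<open>Pot \<xi> (X x)\<close> that depends on x, by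
  \<open>Pot_X\<close>.\<close>

definition Hf :: "real \<Rightarrow> real \<Rightarrow> real" where "Hf \<xi> x = arcosh (max 1 \<bar>qxi \<xi> x\<bar>)"
text \<open>The condition says that \<xi> lies before the band of x. The potential of
  \<open>rho\<close> integrates \<open>Hf\<close> over \<xi> \<in> {0..1} only, whereas V/2
  integrates this truncation over all of {0..L} (\<open>Hlow_diff_integral\<close>); the two agree
  where it matters.\<close>

definition Hlow :: "real \<Rightarrow> real \<Rightarrow> real" where "Hlow \<xi> x = (if rtp h L a p s x < Yv \<xi> then Hf \<xi> x else 0)"
text \<open>The dual band at \<xi> = 0 collapses to this point, because
  \<open>cC h L a s p 0\<close> is 0.\<close>

definition b0 :: real where "b0 = cB h L a s p 0"

lemma Hf_measurable [measurable]: "(\<lambda>\<xi>. Hf \<xi> x) \<in> borel_measurable borel"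
  unfolding Hf_def by measurable

lemma Hlow_measurable [measurable]: "(\<lambda>\<xi>. Hlow \<xi> x) \<in> borel_measurable borel"
  unfolding Hlow_def by measurable

lemma kt_section_measurable: "kt y \<in> borel_measurable borel"
  unfolding kt_def[abs_def] amp_def disc_def Yv_def by measurable

lemma Hf_nonneg: "0 \<le> Hf \<xi> x"
  unfolding Hf_def by simp

lemma disc_neg_above:
  assumes "0 < x" "x < L" "rtp h L a p s x < Yv \<xi>"
  shows "disc h L a p s x \<xi> < 0"
proof -
  have "rtm h L a p s x < rtp h L a p s x" using roots_less[OF assms(1,2)] .
  then show ?thesis
    using disc_eq[of x \<xi>] assms sin_pos[OF assms(1,2)] by (simp add: Yv_def mult_pos_neg)
qed

text \<open>For fixed x, as \<xi> decreases to 0 the point stays before the band, so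
  \<open>disc\<close> stays negative; a zero of cB - X would make \<open>disc\<close> nonnegative.
  Hence the sign does not change on the way to \<xi> = 0.\<close>

lemma sgn_b0:
  assumes xi: "0 < \<xi>" "\<xi> < L" and x: "0 < x" "x < L" and low: "rtp h L a p s x < Yv \<xi>"
  shows "sgn (b0 - X x) = sgn (cB h L a s p \<xi> - X x)"
  unfolding b0_def
proof (rule sgn_eq_if_nonzero[where f = "\<lambda>\<xi>. cB h L a s p \<xi> - X x"])
  have "sin (s + 2 * h * y) \<noteq> 0" if "y \<in> {0..\<xi>}" for y
    using sin_s_pos[of y] that xi by auto
  then show "continuous_on {0..\<xi>} (\<lambda>\<xi>. cB h L a s p \<xi> - X x)"
    unfolding cB_def cA_def cC_def by (intro continuous_intros) auto
  show "0 \<le> \<xi>" using xi by simp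
  fix y assume y: "y \<in> {0..\<xi>}"
  have "Yv \<xi> \<le> Yv y" unfolding Yv_def using cos_mono_iff(3)[of \<xi> y] y xi by auto
  then have "disc h L a p s x y < 0" using low x by (intro disc_neg_above) auto
  then have neg: "disc h L a s p y x < 0" using disc_sym_band[of y x] y xi x by auto
  show "cB h L a s p y - X x \<noteq> 0"
  proof
    assume "cB h L a s p y - X x = 0"
    then have "disc h L a s p y x = (sin (s + 2 * h * y))\<^sup>2 * (4 * (cA h L a s p y * cC h L a s p y))"
      unfolding disc_def X_def by simp
    also have "\<dots> \<ge> 0" using D.cAC_nonneg[of y] y xi by simp
    finally show False using neg by simp
  qed
qed

text \<open>On one tail outside the band of \<xi> the function \<open>disc\<close> is negative,
  whereas it vanishes where \<open>rtp h L a p s x\<close> = \<open>Yv \<xi>\<close>. So the tail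
  lies entirely on one side of that condition.\<close>

lemma low_const:
  assumes xi: "0 < \<xi>" "\<xi> < L" and x: "0 < x" "x < L" and y: "0 < y" "y < L"
    and \<sigma>: "\<sigma> = 1 \<or> \<sigma> = - 1" and q: "1 < \<sigma> * qxi \<xi> x" "1 < \<sigma> * qxi \<xi> y"
  shows "rtp h L a p s x < Yv \<xi> \<longleftrightarrow> rtp h L a p s y < Yv \<xi>"
proof -
  have *: "rtp h L a p s x < Yv \<xi> \<longleftrightarrow> rtp h L a p s y < Yv \<xi>"
    if "x \<le> y" "0 < x" "x < L" "0 < y" "y < L" "1 < \<sigma> * qxi \<xi> x" "1 < \<sigma> * qxi \<xi> y" for x y
  proof -
    have mono: "qxi \<xi> v \<le> qxi \<xi> u" if "u \<le> v" "0 \<le> u" "v \<le> L" for u v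
    proof -
      have "2 * cos (p + 2 * h * v) \<le> 2 * cos (p + 2 * h * u)"
        using D.cos_mono_iff(3)[of v u] that by auto
      then show ?thesis unfolding qxi_def qq_def
        using D.roots_less[OF xi] by (intro divide_right_mono) auto
    qed
    have "sgn (rtp h L a p s x - Yv \<xi>) = sgn (rtp h L a p s y - Yv \<xi>)"
    proof (rule sgn_eq_if_nonzero[where f = "\<lambda>x. rtp h L a p s x - Yv \<xi>"])
      show "continuous_on {x..y} (\<lambda>x. rtp h L a p s x - Yv \<xi>)"
        by (intro continuous_intros continuous_on_subset[OF cont_rtp]) (use that in auto)
      show "x \<le> y" by fact
      fix z assume z: "z \<in> {x..y}"
      then have zL: "0 < z" "z < L" using that by auto
      have "qxi \<xi> z \<le> qxi \<xi> x" "qxi \<xi> y \<le> qxi \<xi> z" using mono[of x z] mono[of z y] z that by auto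
      then have "1 < \<sigma> * qxi \<xi> z" using \<sigma> that by auto
      then have "1 < \<bar>qxi \<xi> z\<bar>" using \<sigma> by auto
      then have "disc h L a p s z \<xi> < 0" using disc_neg_iff'[OF xi zL] by simp
      moreover have "disc h L a p s z \<xi> = (sin (p + 2 * h * z))\<^sup>2 * ((Yv \<xi> - rtm h L a p s z) * (rtp h L a p s z - Yv \<xi>))"
        using disc_eq[of z \<xi>] zL unfolding Yv_def by simp
      ultimately show "rtp h L a p s z - Yv \<xi> \<noteq> 0" by force
    qed
    then have "sgn (rtp h L a p s x - Yv \<xi>) < 0 \<longleftrightarrow> sgn (rtp h L a p s y - Yv \<xi>) < 0" by (rule arg_cong)
    then show ?thesis unfolding sgn_less diff_less_0_iff_less .
  qed
  show ?thesis
  proof (cases "x \<le> y")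
    case True
    show ?thesis by (rule *[OF True x y q])
  next
    case False
    then have "y \<le> x" by simp
    show ?thesis using *[OF \<open>y \<le> x\<close> y x q(2) q(1)] by (rule sym)
  qed
qed

text \<open>On each tail the sign of the derivative of \<open>Hf\<close> is that of the band centre
  \<open>cB h L a s p \<xi>\<close> minus X x. By \<open>sgn_b0\<close> it equals a sign independent
  of \<xi>, which can later be pulled out of the integral over \<xi>.\<close>

lemma Hlow_int:
  assumes xi: "0 < \<xi>" "\<xi> < L" and x: "0 < x1" "x1 \<le> x2" "x2 < L"
  shows "((\<lambda>x. sgn (b0 - X x) * kt x \<xi>) has_integral (Hlow \<xi> x2 - Hlow \<xi> x1)) {x1..x2}"
proof -
  \<comment> \<open>Tells for each of the two tails whether \<xi> lies before the band of its
    points; by \<open>low_const\<close> one witness decides for the whole tail.\<close>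
  define e where "e = (\<lambda>\<sigma>::real. if \<exists>x. 0 < x \<and> x < L \<and> 1 < \<sigma> * qxi \<xi> x \<and> rtp h L a p s x < Yv \<xi> then 1 else 0 :: real)"
  define tl where "tl = (\<lambda>\<sigma> x. if \<sigma> * qxi \<xi> x > 1
      then - \<sigma> * (2 * (2 * h) * sin (p + 2 * h * x)) / sqrt ((2 * cos (p + 2 * h * x) - rtm h L a s p \<xi>) * (2 * cos (p + 2 * h * x) - rtp h L a s p \<xi>)) else 0)"
  have e: "e \<sigma> = (if rtp h L a p s x < Yv \<xi> then 1 else 0)" if "0 < x" "x < L" "1 < \<sigma> * qxi \<xi> x" "\<sigma> = 1 \<or> \<sigma> = - 1" for \<sigma> x
  proof (cases "rtp h L a p s x < Yv \<xi>")
    case True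
    then have "\<exists>x. 0 < x \<and> x < L \<and> 1 < \<sigma> * qxi \<xi> x \<and> rtp h L a p s x < Yv \<xi>" using that(1,2,3) by blast
    then show ?thesis unfolding e_def using True by (simp only: if_True)
  next
    case False
    then have "\<not> (\<exists>x. 0 < x \<and> x < L \<and> 1 < \<sigma> * qxi \<xi> x \<and> rtp h L a p s x < Yv \<xi>)"
      using low_const[OF xi that(1,2) _ _ that(4,3)] by blast
    then show ?thesis unfolding e_def using False by (simp only: if_False)
  qed
  have pang: "0 \<le> p + 2 * h * x1" "p + 2 * h * x2 \<le> pi" using ang[of x1] ang[of x2] x by auto
  have T: "(tl \<sigma> has_integral arcosh (max 1 (\<sigma> * qxi \<xi> x2)) - arcosh (max 1 (\<sigma> * qxi \<xi> x1))) {x1..x2}"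
    if "\<sigma> = 1 \<or> \<sigma> = - 1" for \<sigma>
    unfolding tl_def qxi_def by (rule arcosh_tail_integral[OF h2 D.roots_less[OF xi] pang x(2) that])
  have I: "((\<lambda>x. e 1 * tl 1 x + e (-1) * tl (-1) x) has_integral
     (e 1 * (arcosh (max 1 (1 * qxi \<xi> x2)) - arcosh (max 1 (1 * qxi \<xi> x1))) +
      e (-1) * (arcosh (max 1 ((-1) * qxi \<xi> x2)) - arcosh (max 1 ((-1) * qxi \<xi> x1))))) {x1..x2}"
    by (intro has_integral_add has_integral_mult_right T) auto
  have Hl: "Hlow \<xi> x = e 1 * arcosh (max 1 (1 * qxi \<xi> x)) + e (-1) * arcosh (max 1 ((-1) * qxi \<xi> x))"
    if "0 < x" "x < L" for x
  proof -
    consider "1 < qxi \<xi> x" | "1 < - qxi \<xi> x" | "\<bar>qxi \<xi> x\<bar> \<le> 1" by linarith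
    then show ?thesis
    proof cases
      case 1
      then have "max 1 ((-1) * qxi \<xi> x) = 1" "\<bar>qxi \<xi> x\<bar> = qxi \<xi> x" by auto
      then show ?thesis using e[OF that, of 1] 1 by (simp add: Hlow_def Hf_def)
    next
      case 2
      then have "max 1 (1 * qxi \<xi> x) = 1" "\<bar>qxi \<xi> x\<bar> = (-1) * qxi \<xi> x" by auto
      then show ?thesis using e[OF that, of "-1"] 2 unfolding Hlow_def Hf_def by simp
    next
      case 3
      then have "max 1 (1 * qxi \<xi> x) = 1" "max 1 ((-1) * qxi \<xi> x) = 1" "max 1 \<bar>qxi \<xi> x\<bar> = 1" by auto
      then show ?thesis unfolding Hlow_def Hf_def by simp
    qed
  qed
  have K: "sgn (b0 - X x) * kt x \<xi> = e 1 * tl 1 x + e (-1) * tl (-1) x" if "0 < x" "x < L" for x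
  proof (cases "\<bar>qxi \<xi> x\<bar> \<le> 1")
    case True
    then have "kt x \<xi> = 0" using disc_neg_iff'[OF xi that] by (simp add: kt_def)
    moreover have "tl 1 x = 0" "tl (-1) x = 0" using True by (auto simp: tl_def)
    ultimately show ?thesis by simp
  next
    case False
    then have neg: "disc h L a p s x \<xi> < 0" using disc_neg_iff'[OF xi that] by simp
    define K0 where "K0 = 2 * (2 * h) * sin (p + 2 * h * x) / sqrt ((2 * cos (p + 2 * h * x) - rtm h L a s p \<xi>) * (2 * cos (p + 2 * h * x) - rtp h L a s p \<xi>))"
    have kt: "kt x \<xi> = (if rtp h L a p s x < Yv \<xi> then K0 else 0)"
      using neg disc_neg_sqrt[OF xi that neg] by (simp add: kt_def K0_def)
    have mid: "cB h L a s p \<xi> = (rtm h L a s p \<xi> + rtp h L a s p \<xi>) / 2" by (simp add: rtm_def rtp_def)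
    note lt = D.roots_less[OF xi]
    show ?thesis
    proof (cases "1 < qxi \<xi> x")
      case True
      then have "X x > rtp h L a s p \<xi>" unfolding X_def qxi_def using qq_iff(3)[OF h2 lt] by auto
      then have s1: "sgn (cB h L a s p \<xi> - X x) = - 1" using lt by (simp add: mid)
      have "tl 1 x = - K0" "tl (-1) x = 0" using True by (auto simp: tl_def K0_def)
      then show ?thesis
        using e[OF that, of 1] True kt sgn_b0[OF xi that] s1 by simp
    next
      case F: False
      with False have q: "1 < - qxi \<xi> x" by linarith
      then have "X x < rtm h L a s p \<xi>" unfolding X_def qxi_def using qq_iff(4)[OF h2 lt] by auto
      then have s1: "sgn (cB h L a s p \<xi> - X x) = 1" using lt by (simp add: mid)
      have "tl 1 x = 0" "tl (-1) x = K0" using q by (auto simp: tl_def K0_def)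
      then show ?thesis
        using e[OF that, of "-1"] q kt sgn_b0[OF xi that] s1 by simp
    qed
  qed
  have "((\<lambda>x. e 1 * tl 1 x + e (-1) * tl (-1) x) has_integral (Hlow \<xi> x2 - Hlow \<xi> x1)) {x1..x2}"
    using I unfolding Hl[of x1] Hl[of x2] using x by (simp add: Hl algebra_simps)
  then show ?thesis
    by (rule has_integral_eq[rotated]) (use K x in auto)
qed

text \<open>Since 2 cos s - B = A + C, the coordinate \<open>qx x 0\<close> is (A + C) / (2 sqrt (A
  C)) = cosh (ln (C/A) / 2). The sign is supplied by \<open>cA_minus_cC\<close>.\<close>

lemma tail_start:
  assumes x: "0 < x" "x < L"
  shows "sgn (b0 - X x) * arcosh (max 1 (qx x 0)) = ln (cC h L a p s x / cA h L a p s x) / 2"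
    and "arcosh (max 1 (qx x 0)) = \<bar>ln (cC h L a p s x / cA h L a p s x)\<bar> / 2"
proof -
  define A where "A = cA h L a p s x"
  define C where "C = cC h L a p s x"
  have A: "0 < A" and C: "0 < C" using cA_pos[OF x] cC_pos[OF x] by (auto simp: A_def C_def)
  define y where "y = ln (C / A) / 2"
  have "exp y = sqrt C / sqrt A"
  proof -
    have "exp y = exp (ln (sqrt (C / A)))" using A C by (simp add: y_def ln_sqrt)
    then show ?thesis using A C by (simp add: real_sqrt_divide)
  qed
  then have "cosh y = (sqrt C / sqrt A + sqrt A / sqrt C) / 2" by (simp add: cosh_def exp_minus)
  also have "\<dots> = (C + A) / (2 * sqrt (A * C))"
    using A C by (simp add: field_simps real_sqrt_mult)
  also have "\<dots> = qx x 0"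
  proof -
    have "qx x 0 = (2 * (A + C)) / (4 * sqrt (A * C))"
      unfolding qx_def qq_def rtp_def rtm_def cB_def A_def[symmetric] C_def[symmetric] by (simp add: algebra_simps)
    moreover have "(2 * (A + C)) / (2 * (2 * sqrt (A * C))) = (A + C) / (2 * sqrt (A * C))"
      by (rule mult_divide_mult_cancel_left) simp
    ultimately show ?thesis by (simp add: add.commute)
  qed
  finally have ch: "qx x 0 = cosh \<bar>y\<bar>" by simp
  have mx: "max 1 (qx x 0) = cosh \<bar>y\<bar>" unfolding ch using cosh_real_ge_1[of "\<bar>y\<bar>"] by simp
  have ar: "arcosh (max 1 (qx x 0)) = \<bar>y\<bar>" unfolding mx by (rule arcosh_cosh_real) simp
  show "arcosh (max 1 (qx x 0)) = \<bar>ln (cC h L a p s x / cA h L a p s x)\<bar> / 2"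
    unfolding ar by (simp add: y_def A_def C_def)
  have S: "0 < sin (p + 2 * h * x)" "0 < sin s" using sin_pos[OF x] sin_s_pos[of 0] L by auto
  have "(A - C) * sin (p + 2 * h * x) = sin s * (X x - b0)"
    using cA_minus_cC[of p h x s L a] S by (simp add: A_def C_def X_def b0_def)
  then have "sgn ((C - A) * sin (p + 2 * h * x)) = sgn (sin s * (b0 - X x))"
    by (metis minus_diff_eq mult_minus_left mult_minus_right)
  then have "sgn (C - A) = sgn (b0 - X x)" using S by (simp add: sgn_mult)
  moreover have "sgn (C - A) = sgn y"
    using A C by (auto simp: y_def sgn_if ln_less_zero_iff ln_gt_zero_iff)
  ultimately show "sgn (b0 - X x) * arcosh (max 1 (qx x 0)) = ln (cC h L a p s x / cA h L a p s x) / 2"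
    unfolding ar by (simp add: sgn_mult_abs mult_sgn_abs y_def A_def C_def)
qed

context
  fixes V :: "real \<Rightarrow> real"
  assumes V: "\<And>x. 0 < x \<Longrightarrow> x < L \<Longrightarrow> (V has_real_derivative ln (cC h L a p s x / cA h L a p s x)) (at x)"
begin

text \<open>Fubini on {x1..x2} times {0..L} for the signed \<open>kt\<close>: integrating over \<xi>
  first gives V'/2 by \<open>kt_int_xi\<close> and \<open>tail_start\<close>, integrating over x
  first gives the difference of \<open>Hlow\<close>.\<close>

lemma Hlow_diff_integral:
  assumes x: "0 < x1" "x1 \<le> x2" "x2 < L"
  shows "integrable lborel (\<lambda>\<xi>. indicator {0..L} \<xi> * (Hlow \<xi> x2 - Hlow \<xi> x1))"
    and "(LINT \<xi>|lborel. indicator {0..L} \<xi> * (Hlow \<xi> x2 - Hlow \<xi> x1)) = (V x2 - V x1) / 2"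
proof -
  define r where "r = (\<lambda>x. ln (cC h L a p s x / cA h L a p s x) / 2)"
  define S where "S = (\<lambda>(x, \<xi>). indicator {x1..x2} x * indicator {0..L} \<xi> * (sgn (b0 - X x) * kt x \<xi>))"
  have [measurable]: "S \<in> borel_measurable (lborel \<Otimes>\<^sub>M lborel)" unfolding S_def by measurable
  have cr: "continuous_on {x1..x2} r"
  proof -
    have "continuous_on {x1..x2} (cA h L a p s)" "continuous_on {x1..x2} (cC h L a p s)"
      by (rule continuous_on_subset[OF cont_cA], use x in force) (rule continuous_on_subset[OF cont_cC], use x in force)
    moreover have "cA h L a p s y \<noteq> 0" "cC h L a p s y \<noteq> 0" if "y \<in> {x1..x2}" for y
      using cA_pos[of y] cC_pos[of y] that x by auto
    ultimately show ?thesis unfolding r_def by (intro continuous_intros) auto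
  qed
  have inner: "integrable lborel (\<lambda>\<xi>. S (y, \<xi>))" "(LINT \<xi>|lborel. norm (S (y, \<xi>))) \<le> indicator {x1..x2} y * \<bar>r y\<bar>"
     "(LINT \<xi>|lborel. S (y, \<xi>)) = indicator {x1..x2} y * r y" for y
  proof -
    have *: "integrable lborel (\<lambda>\<xi>. S (y, \<xi>)) \<and> (LINT \<xi>|lborel. norm (S (y, \<xi>))) \<le> indicator {x1..x2} y * \<bar>r y\<bar>
       \<and> (LINT \<xi>|lborel. S (y, \<xi>)) = indicator {x1..x2} y * r y"
    proof (cases "y \<in> {x1..x2}")
      case True
      then have y: "0 < y" "y < L" using x by auto
      have [measurable]: "kt y \<in> borel_measurable borel" by (rule kt_section_measurable)
      have k: "integrable lborel (\<lambda>\<xi>. indicator {0..L} \<xi> * kt y \<xi>)"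
        "(LINT \<xi>|lborel. indicator {0..L} \<xi> * kt y \<xi>) = arcosh (max 1 (qx y 0))"
        using lborel_integral_of_has_integral[OF _ _ kt_int_xi[OF y]] kt_nonneg y by auto
      have e: "S (y, \<xi>) = sgn (b0 - X y) * (indicator {0..L} \<xi> * kt y \<xi>)" for \<xi>
        using True by (simp add: S_def mult_ac)
      have "norm (S (y, \<xi>)) = \<bar>sgn (b0 - X y)\<bar> * (indicator {0..L} \<xi> * kt y \<xi>)" for \<xi>
        unfolding e using kt_nonneg[of y \<xi>] y by (auto simp: abs_mult indicator_def)
      then have "(LINT \<xi>|lborel. norm (S (y, \<xi>))) = \<bar>sgn (b0 - X y)\<bar> * arcosh (max 1 (qx y 0))"
        using k by simp
      also have "\<dots> \<le> 1 * arcosh (max 1 (qx y 0))"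
        by (intro mult_right_mono) (auto simp: abs_sgn_eq)
      also have "\<dots> = \<bar>r y\<bar>" using tail_start(2)[OF y] by (simp add: r_def)
      finally have "(LINT \<xi>|lborel. norm (S (y, \<xi>))) \<le> \<bar>r y\<bar>" .
      moreover have "(LINT \<xi>|lborel. S (y, \<xi>)) = r y"
        unfolding e using k tail_start(1)[OF y] by (simp add: r_def)
      ultimately show ?thesis using True k(1) unfolding e by auto
    qed (simp add: S_def)
    then show "integrable lborel (\<lambda>\<xi>. S (y, \<xi>))" "(LINT \<xi>|lborel. norm (S (y, \<xi>))) \<le> indicator {x1..x2} y * \<bar>r y\<bar>"
     "(LINT \<xi>|lborel. S (y, \<xi>)) = indicator {x1..x2} y * r y" by auto
  qed
  have ri: "set_integrable lborel {x1..x2} r" by (rule borel_integrable_atLeastAtMost') (rule cr)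
  have int: "integrable (lborel \<Otimes>\<^sub>M lborel) S"
  proof (rule lborel_pair.Fubini_integrable)
    show "integrable lborel (\<lambda>y. LINT \<xi>|lborel. norm (S (y, \<xi>)))"
    proof (rule Bochner_Integration.integrable_bound)
      show "integrable lborel (\<lambda>y. indicator {x1..x2} y * \<bar>r y\<bar>)"
        using set_integrable_abs[OF ri] by (simp add: set_integrable_def)
      show "AE y in lborel. norm (LINT \<xi>|lborel. norm (S (y, \<xi>))) \<le> norm (indicator {x1..x2} y * \<bar>r y\<bar>)"
        using inner(2) by (intro AE_I2) (smt (verit) Bochner_Integration.integral_nonneg norm_ge_zero real_norm_def)
    qed measurable
    show "AE y in lborel. integrable lborel (\<lambda>\<xi>. S (y, \<xi>))" using inner(1) by simp
  qed measurable
  have int': "integrable (lborel \<Otimes>\<^sub>M lborel) (case_prod (\<lambda>y \<xi>. S (y, \<xi>)))" using int by simp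
  have fub: "(LINT \<xi>|lborel. LINT y|lborel. S (y, \<xi>)) = (LINT y|lborel. LINT \<xi>|lborel. S (y, \<xi>))"
    by (rule lborel_pair.Fubini_integral[OF int'])
  have outer: "AE \<xi> in lborel. (LINT y|lborel. S (y, \<xi>)) = indicator {0..L} \<xi> * (Hlow \<xi> x2 - Hlow \<xi> x1)"
    using AE_not[of 0] AE_not[of L] lborel_pair.AE_integrable_snd[OF int']
  proof eventually_elim
    case (elim \<xi>)
    show ?case
    proof (cases "\<xi> \<in> {0..L}")
      case True
      with elim have xi: "0 < \<xi>" "\<xi> < L" by auto
      have e: "S (y, \<xi>) = indicator {x1..x2} y *\<^sub>R (sgn (b0 - X y) * kt y \<xi>)" for y
        using True by (simp add: S_def)
      have "set_integrable lborel {x1..x2} (\<lambda>y. sgn (b0 - X y) * kt y \<xi>)"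
        using elim(3) unfolding set_integrable_def e .
      from set_borel_integral_eq_integral(2)[OF this]
      have "(LINT y|lborel. S (y, \<xi>)) = integral {x1..x2} (\<lambda>y. sgn (b0 - X y) * kt y \<xi>)"
        unfolding set_lebesgue_integral_def e .
      also have "\<dots> = Hlow \<xi> x2 - Hlow \<xi> x1" by (rule integral_unique[OF Hlow_int[OF xi x]])
      finally show ?thesis using True by simp
    qed (simp add: S_def)
  qed
  have m: "(\<lambda>\<xi>. indicator {0..L} \<xi> * (Hlow \<xi> x2 - Hlow \<xi> x1)) \<in> borel_measurable lborel" by measurable
  have mo: "(\<lambda>\<xi>. LINT y|lborel. S (y, \<xi>)) \<in> borel_measurable lborel" by measurable
  have "integrable lborel (\<lambda>\<xi>. LINT y|lborel. S (y, \<xi>))" by (rule lborel_pair.integrable_snd[OF int'])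
  then show "integrable lborel (\<lambda>\<xi>. indicator {0..L} \<xi> * (Hlow \<xi> x2 - Hlow \<xi> x1))"
    using integrable_cong_AE[OF mo m outer] by simp
  have "(LINT \<xi>|lborel. indicator {0..L} \<xi> * (Hlow \<xi> x2 - Hlow \<xi> x1)) = (LINT \<xi>|lborel. LINT y|lborel. S (y, \<xi>))"
    by (rule integral_cong_AE[OF m mo]) (use outer in auto)
  also have "\<dots> = (LINT y|lborel. indicator {x1..x2} y * r y)" unfolding fub inner(3) ..
  also have "\<dots> = integral {x1..x2} r"
    using set_borel_integral_eq_integral(2)[OF ri] by (simp add: set_lebesgue_integral_def)
  also have "\<dots> = V x2 / 2 - V x1 / 2"
  proof (rule integral_unique, rule fundamental_theorem_of_calculus[OF x(2)])
    fix y assume "y \<in> {x1..x2}"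
    then have "((\<lambda>x. V x / 2) has_real_derivative r y) (at y)"
      unfolding r_def using x by (intro DERIV_cdivide V) auto
    then show "((\<lambda>x. V x / 2) has_vector_derivative r y) (at y within {x1..x2})"
      by (simp add: has_real_derivative_iff_has_vector_derivative has_vector_derivative_at_within)
  qed
  finally show "(LINT \<xi>|lborel. indicator {0..L} \<xi> * (Hlow \<xi> x2 - Hlow \<xi> x1)) = (V x2 - V x1) / 2"
    by (simp add: diff_divide_distrib)
qed

lemma Hlow_diff_integral':
  assumes x: "0 < x1" "x1 < L" "0 < x2" "x2 < L"
  shows "integrable lborel (\<lambda>\<xi>. indicator {0..L} \<xi> * (Hlow \<xi> x2 - Hlow \<xi> x1))"
    and "(LINT \<xi>|lborel. indicator {0..L} \<xi> * (Hlow \<xi> x2 - Hlow \<xi> x1)) = (V x2 - V x1) / 2"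
proof -
  have e: "indicator {0..L} \<xi> * (Hlow \<xi> x2 - Hlow \<xi> x1) = - (indicator {0..L} \<xi> * (Hlow \<xi> x1 - Hlow \<xi> x2))" for \<xi>
    by (simp add: algebra_simps)
  have "integrable lborel (\<lambda>\<xi>. indicator {0..L} \<xi> * (Hlow \<xi> x2 - Hlow \<xi> x1)) \<and>
    (LINT \<xi>|lborel. indicator {0..L} \<xi> * (Hlow \<xi> x2 - Hlow \<xi> x1)) = (V x2 - V x1) / 2"
  proof (cases "x1 \<le> x2")
    case True
    then show ?thesis using Hlow_diff_integral[of x1 x2] x by simp
  next
    case False
    then have "integrable lborel (\<lambda>\<xi>. - (indicator {0..L} \<xi> * (Hlow \<xi> x1 - Hlow \<xi> x2)))"
      "(LINT \<xi>|lborel. - (indicator {0..L} \<xi> * (Hlow \<xi> x1 - Hlow \<xi> x2))) = - ((V x1 - V x2) / 2)"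
      using Hlow_diff_integral[of x2 x1] x by auto
    then show ?thesis unfolding e by (simp add: diff_divide_distrib)
  qed
  then show "integrable lborel (\<lambda>\<xi>. indicator {0..L} \<xi> * (Hlow \<xi> x2 - Hlow \<xi> x1))"
    and "(LINT \<xi>|lborel. indicator {0..L} \<xi> * (Hlow \<xi> x2 - Hlow \<xi> x1)) = (V x2 - V x1) / 2" by auto
qed

text \<open>Both differences are integrals over the filling \<open>\<xi>\<close>, and the integrands compare pointwise.\<close>

lemma Euler_Lagrange:
  assumes x1: "0 < x1" "x1 < L" "0 < rho x1" and x2: "0 < x2" "x2 < L" "rho x2 < 1"
  shows "2 * Ulog x2 - V x2 \<le> 2 * Ulog x1 - V x1"
proof -
  have xx: "x1 \<in> {0..L}" "x2 \<in> {0..L}" using x1 x2 by auto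
  have q1: "qx x1 1 < 1"
  proof (rule ccontr)
    assume "\<not> qx x1 1 < 1"
    then have "clamp1 (qx x1 1) = 1" by (simp add: clamp1_def)
    then show False using x1(3) by (simp add: rho_def)
  qed
  have q2: "- 1 < qx x2 1"
  proof (rule ccontr)
    assume "\<not> - 1 < qx x2 1"
    then have "clamp1 (qx x2 1) = - 1" by (simp add: clamp1_def)
    then show False using x2(3) by (simp add: rho_def)
  qed
  have Y1: "Yv 1 < rtp h L a p s x1" using q1 qq_iff(1)[OF h2 roots_less[OF x1(1,2)]] by (simp add: qx_def Yv_def)
  have Y2: "rtm h L a p s x2 < Yv 1" using q2 qq_iff(2)[OF h2 roots_less[OF x2(1,2)]] by (simp add: qx_def Yv_def)
  define Pd where "Pd = (\<lambda>\<xi>. indicator {0..1} \<xi> * Pot \<xi> (X x1) - indicator {0..1} \<xi> * Pot \<xi> (X x2))"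
  define Hd where "Hd = (\<lambda>\<xi>. indicator {0..L} \<xi> * (Hlow \<xi> x1 - Hlow \<xi> x2))"
  have Pd: "integrable lborel Pd" "(LINT \<xi>|lborel. Pd \<xi>) = Ulog x1 - Ulog x2"
    unfolding Pd_def using Ulog_formula[OF xx(1)] Ulog_formula[OF xx(2)] by auto
  have Hd: "integrable lborel Hd" "(LINT \<xi>|lborel. Hd \<xi>) = (V x1 - V x2) / 2"
    unfolding Hd_def using Hlow_diff_integral'[of x2 x1] x1 x2 by auto
  have "(LINT \<xi>|lborel. Hd \<xi>) \<le> (LINT \<xi>|lborel. Pd \<xi>)"
  proof (rule integral_mono_AE[OF Hd(1) Pd(1)])
    show "AE \<xi> in lborel. Hd \<xi> \<le> Pd \<xi>"
      using AE_not[of 0] AE_not[of 1] AE_not[of L]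
    proof eventually_elim
      case (elim \<xi>)
      show ?case
      proof (cases "\<xi> \<in> {0..L}")
        case False
        then show ?thesis using L1 by (auto simp: Hd_def Pd_def)
      next
        case True
        with elim have xi: "0 < \<xi>" "\<xi> < L" by auto
        show ?thesis
        proof (cases "\<xi> \<le> 1")
          case T1: True
          \<comment> \<open>The capacity term of \<open>Pot\<close> does not depend on x and
            cancels.\<close>
          have "Pd \<xi> = Hf \<xi> x1 - Hf \<xi> x2" using T1 xi by (simp add: Pd_def Pot_X Hf_def)
          moreover have "Hlow \<xi> x1 \<le> Hf \<xi> x1" using Hf_nonneg by (simp add: Hlow_def)
          \<comment> \<open>x2 is not saturated, so its band does not end before 1; a \<xi> \<le> 1
            is before it or inside it, and inside \<open>Hf\<close> vanishes.\<close>
          moreover have "Hlow \<xi> x2 = Hf \<xi> x2"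
          proof (cases "rtp h L a p s x2 < Yv \<xi>")
            case True
            then show ?thesis by (simp add: Hlow_def)
          next
            case False
            have "Yv 1 \<le> Yv \<xi>" unfolding Yv_def using cos_mono_iff(3)[of 1 \<xi>] T1 xi L1 by auto
            then have "0 \<le> (Yv \<xi> - rtm h L a p s x2) * (rtp h L a p s x2 - Yv \<xi>)" using Y2 False by simp
            then have "0 \<le> (sin (p + 2 * h * x2))\<^sup>2 * ((Yv \<xi> - rtm h L a p s x2) * (rtp h L a p s x2 - Yv \<xi>))"
              by (rule mult_nonneg_nonneg[OF zero_le_power2])
            also have "\<dots> = disc h L a p s x2 \<xi>" using disc_eq[of x2 \<xi>] xx(2) by (simp add: Yv_def)
            finally have "\<not> disc h L a p s x2 \<xi> < 0" by simp
            then have "\<not> 1 < \<bar>qxi \<xi> x2\<bar>" using disc_neg_iff'[OF xi x2(1,2)] by simp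
            then show ?thesis using False by (simp add: Hlow_def Hf_def max_def)
          qed
          ultimately show ?thesis using True by (simp add: Hd_def)
        next
          case F1: False
          \<comment> \<open>x1 has positive density, so its band starts before 1 and no \<xi> > 1
            lies before that band.\<close>
          have "Yv \<xi> \<le> Yv 1" unfolding Yv_def using cos_mono_iff(3)[of \<xi> 1] F1 xi L1 by auto
          then have "Hlow \<xi> x1 = 0" using Y1 by (simp add: Hlow_def)
          moreover have "0 \<le> Hlow \<xi> x2" using Hf_nonneg by (simp add: Hlow_def)
          ultimately show ?thesis using True F1 by (simp add: Hd_def Pd_def)
        qed
      qed
    qed
  qed
  then show ?thesis unfolding Pd(2) Hd(2) by (simp add: field_simps)
qed

end

end

subsection \<open>A regularized logarithmic kernel\<close>

text \<open>\<open>ell r t\<close> is the logarithm of the modulus of \<open>1 - r e\<^sup>i\<^sup>t\<close>; at \<open>r = 1\<close> the kernel \<open>lk\<close> would be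
  the logarithm of \<open>\<bar>2 cos t - 2 cos u\<bar>\<close>.\<close>

definition ell :: "real \<Rightarrow> real \<Rightarrow> real" where "ell r t = ln (1 - 2 * r * cos t + r\<^sup>2) / 2"

definition lk :: "real \<Rightarrow> real \<Rightarrow> real \<Rightarrow> real" where "lk r t u = ell r (t - u) + ell r (t + u)"

lemma ell_arg: "1 - 2 * r * cos t + r\<^sup>2 = (1 - r)\<^sup>2 + r * (2 - 2 * cos t)" for r t :: real
  by (simp add: power2_eq_square algebra_simps)

lemma ell_sin: "2 - 2 * cos t = (2 * sin (t / 2))\<^sup>2" for t :: real
proof -
  have "cos t = cos (2 * (t / 2))" by simp
  also have "\<dots> = 1 - 2 * (sin (t / 2))\<^sup>2" by (rule cos_double_sin)
  finally show ?thesis by (simp add: power_mult_distrib)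
qed

lemma ell_arg_bounds:
  fixes r t :: real
  assumes "0 \<le> r" "r < 1"
  shows "(1 - r)\<^sup>2 \<le> 1 - 2 * r * cos t + r\<^sup>2" "1 - 2 * r * cos t + r\<^sup>2 \<le> 4" "0 < 1 - 2 * r * cos t + r\<^sup>2"
proof -
  show 1: "(1 - r)\<^sup>2 \<le> 1 - 2 * r * cos t + r\<^sup>2"
    unfolding ell_arg using assms cos_le_one[of t] by simp
  have "0 < (1 - r)\<^sup>2" using assms by simp
  with 1 show "0 < 1 - 2 * r * cos t + r\<^sup>2" by linarith
  have "2 - 2 * cos t \<le> 4" using cos_ge_minus_one[of t] by linarith
  then have "r * (2 - 2 * cos t) \<le> r * 4" using assms by (intro mult_left_mono) auto
  moreover have "(1 - r)\<^sup>2 + r * 4 = (1 + r)\<^sup>2" by (simp add: power2_eq_square algebra_simps)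
  moreover have "(1 + r)\<^sup>2 \<le> 2\<^sup>2" using assms by (intro power_mono) auto
  ultimately show "1 - 2 * r * cos t + r\<^sup>2 \<le> 4" unfolding ell_arg by simp
qed

lemma ell_bounds:
  assumes "0 \<le> r" "r < 1"
  shows "ln (1 - r) \<le> ell r t" "ell r t \<le> ln 2"
proof -
  have "ln ((1 - r)\<^sup>2) \<le> ln (1 - 2 * r * cos t + r\<^sup>2)"
    using ell_arg_bounds[OF assms, of t] assms by (subst ln_le_cancel_iff) auto
  then show "ln (1 - r) \<le> ell r t" using assms ln_realpow[of "1 - r" 2] by (simp add: ell_def)
  have "ln (1 - 2 * r * cos t + r\<^sup>2) \<le> ln (2\<^sup>2)"
    using ell_arg_bounds[OF assms, of t] by (subst ln_le_cancel_iff) auto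
  then show "ell r t \<le> ln 2" using ln_realpow[of "2::real" 2] by (simp add: ell_def)
qed

lemma lk_bounds:
  assumes "0 \<le> r" "r < 1"
  shows "2 * ln (1 - r) \<le> lk r t u" "lk r t u \<le> 2 * ln 2" "\<bar>lk r t u\<bar> \<le> 2 - 2 * ln (1 - r)"
proof -
  show 1: "2 * ln (1 - r) \<le> lk r t u" "lk r t u \<le> 2 * ln 2"
    using ell_bounds[OF assms, of "t - u"] ell_bounds[OF assms, of "t + u"] by (auto simp: lk_def)
  have "ln (1 - r) \<le> 0" using assms by simp
  then show "\<bar>lk r t u\<bar> \<le> 2 - 2 * ln (1 - r)" using 1 ln_2_less_1 by linarith
qed

lemma lk_commute: "lk r t u = lk r u t"
proof -
  have "cos (t - u) = cos (u - t)" by (metis cos_minus minus_diff_eq)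
  then show ?thesis by (simp add: lk_def ell_def add.commute)
qed

text \<open>Rests on |1 - r e^(it)| \<ge> (1 + r)/2 |1 - e^(it)|; in this direction the error 1 - r
  is uniform in t.\<close>

lemma ell_lower:
  assumes "0 < r" "r < 1" "sin (t / 2) \<noteq> 0"
  shows "ln \<bar>2 * sin (t / 2)\<bar> \<le> ell r t + (1 - r)"
proof -
  define m where "m = \<bar>2 * sin (t / 2)\<bar>"
  have m: "0 < m" "m\<^sup>2 = 2 - 2 * cos t" using assms(3) by (auto simp: m_def ell_sin)
  have "m\<^sup>2 \<le> 4" using m(2) cos_ge_minus_one[of t] by linarith
  then have "(1 - r)\<^sup>2 * m\<^sup>2 \<le> (1 - r)\<^sup>2 * 4" by (intro mult_left_mono) auto
  then have le: "((1 + r) / 2)\<^sup>2 * m\<^sup>2 \<le> 1 - 2 * r * cos t + r\<^sup>2"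
  proof -
    have "((1 + r) / 2)\<^sup>2 * m\<^sup>2 = (1 - r)\<^sup>2 * m\<^sup>2 / 4 + r * m\<^sup>2"
      by (simp add: power2_eq_square field_simps)
    then show ?thesis using \<open>(1 - r)\<^sup>2 * m\<^sup>2 \<le> (1 - r)\<^sup>2 * 4\<close> unfolding ell_arg m(2)[symmetric] by linarith
  qed
  have pos: "0 < ((1 + r) / 2)\<^sup>2 * m\<^sup>2"
    by (intro mult_pos_pos zero_less_power) (use assms(1) m(1) in auto)
  have le': "((1 + r) / 2 * m)\<^sup>2 \<le> 1 - 2 * r * cos t + r\<^sup>2" "0 < ((1 + r) / 2 * m)\<^sup>2"
    using le pos by (simp_all only: power_mult_distrib)
  then have "0 < 1 - 2 * r * cos t + r\<^sup>2" by linarith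
  with le' have "ln (((1 + r) / 2 * m)\<^sup>2) \<le> ln (1 - 2 * r * cos t + r\<^sup>2)"
    by (simp only: ln_le_cancel_iff)
  then have "ln ((1 + r) / 2 * m) \<le> ell r t"
    using ln_realpow[of "(1 + r) / 2 * m" 2] assms m by (simp add: ell_def)
  moreover have "ln ((1 + r) / 2 * m) = ln ((1 + r) / 2) + ln m" using assms m by (intro ln_mult_pos) auto
  moreover have "- ln ((1 + r) / 2) \<le> 1 - r"
  proof -
    have "- ln ((1 + r) / 2) = ln (2 / (1 + r))" using assms by (simp add: ln_div)
    also have "\<dots> \<le> 2 / (1 + r) - 1" using assms by (intro ln_le_minus_one) auto
    also have "\<dots> = (1 - r) / (1 + r)" using assms by (simp add: field_simps)
    also have "\<dots> \<le> 1 - r" using assms by (simp add: divide_le_eq mult_le_cancel_left1)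
    finally show ?thesis .
  qed
  ultimately show ?thesis unfolding m_def[symmetric] by linarith
qed

text \<open>Rests on |1 - r e^(it)| \<le> |1 - e^(it)| + (1 - r); here the error is singular in t,
  and 1 + y \<le> (1 + sqrt y)^2 gives it the form of an inverse square root.\<close>

lemma ell_upper:
  assumes "0 < r" "r < 1" and c: "0 < c" "c \<le> \<bar>2 * sin (t / 2)\<bar>"
  shows "ell r t \<le> ln \<bar>2 * sin (t / 2)\<bar> + 2 * sqrt ((1 - r) / c)"
proof -
  define m where "m = \<bar>2 * sin (t / 2)\<bar>"
  have m: "0 < m" "m\<^sup>2 = 2 - 2 * cos t" "c \<le> m" using c by (auto simp: m_def ell_sin)
  define y where "y = (1 - r) / m"
  have y: "0 \<le> y" "m * (1 + y) = m + (1 - r)" using assms m by (auto simp: y_def field_simps)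
  have "r * m\<^sup>2 \<le> 1 * m\<^sup>2" using assms by (intro mult_right_mono) auto
  moreover have "(m + (1 - r))\<^sup>2 = m\<^sup>2 + 2 * m * (1 - r) + (1 - r)\<^sup>2" by (simp add: power2_eq_square algebra_simps)
  moreover have "0 \<le> 2 * m * (1 - r)" using m assms by simp
  ultimately have "1 - 2 * r * cos t + r\<^sup>2 \<le> (m * (1 + y))\<^sup>2"
    unfolding ell_arg m(2)[symmetric] y(2) by simp
  then have "ln (1 - 2 * r * cos t + r\<^sup>2) \<le> ln ((m * (1 + y))\<^sup>2)"
    using ell_arg_bounds(3)[of r t] assms m y by (subst ln_le_cancel_iff) auto
  also have "\<dots> = 2 * ln (m * (1 + y))" using ln_realpow[of "m * (1 + y)" 2] m y by simp
  also have "ln (m * (1 + y)) = ln m + ln (1 + y)" using m y by (intro ln_mult_pos) auto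
  finally have "ell r t \<le> ln m + ln (1 + y)" by (simp add: ell_def)
  also have "ln (1 + y) \<le> ln ((1 + sqrt y)\<^sup>2)"
    using y by (subst ln_le_cancel_iff) (auto simp: power2_eq_square algebra_simps intro: add_pos_nonneg)
  also have "\<dots> = 2 * ln (1 + sqrt y)" using ln_realpow[of "1 + sqrt y" 2] y by (simp add: add_pos_nonneg)
  also have "\<dots> \<le> 2 * sqrt y" using y by (simp add: ln_add_one_self_le_self)
  also have "\<dots> \<le> 2 * sqrt ((1 - r) / c)"
    unfolding y_def using m c assms by (simp add: divide_left_mono)
  finally show ?thesis unfolding m_def by simp
qed

lemma ln_cos_diff_le_lk:
  assumes "0 < r" "r < 1" "cos t \<noteq> cos u"
  shows "ln \<bar>2 * cos t - 2 * cos u\<bar> \<le> lk r t u + 2 * (1 - r)"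
proof -
  have "2 * cos t - 2 * cos u \<noteq> 0" using assms by simp
  then have n: "sin ((t - u) / 2) \<noteq> 0" "sin ((t + u) / 2) \<noteq> 0"
    using cos_diff_as_sin[of t u] by auto
  have "ln \<bar>2 * cos t - 2 * cos u\<bar> = ln \<bar>2 * sin ((t - u) / 2)\<bar> + ln \<bar>2 * sin ((t + u) / 2)\<bar>"
    unfolding cos_diff_as_sin using n by (intro ln_mult_pos) auto
  then show ?thesis
    using ell_lower[OF assms(1,2) n(1)] ell_lower[OF assms(1,2) n(2)] by (simp add: lk_def)
qed

lemma lk_le_ln_cos_diff:
  assumes "0 < r" "r < 1" and t: "0 \<le> t" "t \<le> pi" and u: "0 \<le> u" "u \<le> pi" and tu: "t \<noteq> u"
  shows "lk r t u \<le> ln \<bar>2 * cos t - 2 * cos u\<bar> + 4 * sqrt (2 * (1 - r) / \<bar>t - u\<bar>)"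
proof -
  have c0: "0 < \<bar>t - u\<bar> / 2" using tu by simp
  have c1: "\<bar>t - u\<bar> / 2 \<le> \<bar>2 * sin ((t - u) / 2)\<bar>" using t u by (intro sin_half_abs) auto
  have "\<bar>t - u\<bar> / 2 \<le> 2 * sin (\<bar>t - u\<bar> / 2)" using sin_half_abs[of "\<bar>t - u\<bar>"] t u
    sin_ge_zero[of "\<bar>t - u\<bar> / 2"] by auto
  then have c2: "\<bar>t - u\<bar> / 2 \<le> \<bar>2 * sin ((t + u) / 2)\<bar>" using sin_half_sum_ge[OF t u] by auto
  have n: "sin ((t - u) / 2) \<noteq> 0" "sin ((t + u) / 2) \<noteq> 0" using c0 c1 c2 by auto
  have "ln \<bar>2 * cos t - 2 * cos u\<bar> = ln \<bar>2 * sin ((t - u) / 2)\<bar> + ln \<bar>2 * sin ((t + u) / 2)\<bar>"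
    unfolding cos_diff_as_sin using n by (intro ln_mult_pos) auto
  moreover have e: "(1 - r) / (\<bar>t - u\<bar> / 2) = 2 * (1 - r) / \<bar>t - u\<bar>" by simp
  ultimately show ?thesis
    using ell_upper[OF assms(1,2) c0 c1] ell_upper[OF assms(1,2) c0 c2] unfolding lk_def e by linarith
qed

lemma ell_lipschitz:
  assumes "0 < r" "r < 1"
  shows "\<bar>ell r t - ell r u\<bar> \<le> \<bar>t - u\<bar> / (1 - r)\<^sup>2"
proof -
  have d: "(ell r has_real_derivative (r * sin x / (1 - 2 * r * cos x + r\<^sup>2))) (at x)" for x
    unfolding ell_def[abs_def] using ell_arg_bounds(3)[of r x] assms
    by (auto intro!: derivative_eq_intros simp: field_simps)
  have b: "\<bar>r * sin x / (1 - 2 * r * cos x + r\<^sup>2)\<bar> \<le> 1 / (1 - r)\<^sup>2" for x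
  proof -
    have "\<bar>r * sin x\<bar> \<le> 1 * 1" unfolding abs_mult using assms by (intro mult_mono) auto
    then have "\<bar>r * sin x\<bar> / \<bar>1 - 2 * r * cos x + r\<^sup>2\<bar> \<le> 1 / (1 - r)\<^sup>2"
      using ell_arg_bounds[of r x] assms by (intro frac_le) auto
    then show ?thesis by simp
  qed
  have "norm (ell r t - ell r u) \<le> 1 / (1 - r)\<^sup>2 * norm (t - u)"
    by (rule field_differentiable_bound[of UNIV, where f' = "\<lambda>x. r * sin x / (1 - 2 * r * cos x + r\<^sup>2)"])
      (use d b in \<open>auto intro: has_field_derivative_at_within\<close>)
  then show ?thesis by simp
qed

lemma lk_lipschitz:
  assumes "0 < r" "r < 1"
  shows "\<bar>lk r t u - lk r t' u'\<bar> \<le> 2 * (\<bar>t - t'\<bar> + \<bar>u - u'\<bar>) / (1 - r)\<^sup>2"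
proof -
  have "\<bar>ell r (t - u) - ell r (t' - u')\<bar> \<le> \<bar>(t - u) - (t' - u')\<bar> / (1 - r)\<^sup>2"
    by (rule ell_lipschitz[OF assms])
  also have "\<dots> \<le> (\<bar>t - t'\<bar> + \<bar>u - u'\<bar>) / (1 - r)\<^sup>2" by (intro divide_right_mono) auto
  finally have 1: "\<bar>ell r (t - u) - ell r (t' - u')\<bar> \<le> (\<bar>t - t'\<bar> + \<bar>u - u'\<bar>) / (1 - r)\<^sup>2" .
  have "\<bar>ell r (t + u) - ell r (t' + u')\<bar> \<le> \<bar>(t + u) - (t' + u')\<bar> / (1 - r)\<^sup>2"
    by (rule ell_lipschitz[OF assms])
  also have "\<dots> \<le> (\<bar>t - t'\<bar> + \<bar>u - u'\<bar>) / (1 - r)\<^sup>2" by (intro divide_right_mono) auto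
  finally have 2: "\<bar>ell r (t + u) - ell r (t' + u')\<bar> \<le> (\<bar>t - t'\<bar> + \<bar>u - u'\<bar>) / (1 - r)\<^sup>2" .
  have "\<bar>lk r t u - lk r t' u'\<bar> \<le> \<bar>ell r (t - u) - ell r (t' - u')\<bar> + \<bar>ell r (t + u) - ell r (t' + u')\<bar>"
    unfolding lk_def by linarith
  also have "\<dots> \<le> 2 * ((\<bar>t - t'\<bar> + \<bar>u - u'\<bar>) / (1 - r)\<^sup>2)" using 1 2 by linarith
  finally show ?thesis by simp
qed

text \<open>Real part of the Taylor series of - ln (1 - z) at z = r e^(it). The term k = 0 is 1/0 =
  0 in HOL, so the series effectively starts at 1.\<close>

lemma ell_sums:
  assumes "0 < r" "r < 1"
  shows "(\<lambda>k. r ^ k / real k * cos (real k * t)) sums (- ell r t)"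
proof -
  define z where "z = complex_of_real r * cis t"
  have nz: "norm (- z) < 1" using assms by (simp add: z_def norm_mult)
  have s0: "(\<lambda>n. (- 1) ^ Suc n / of_nat n * (- z) ^ n) sums Ln (1 + - z)" by (rule Ln_series[OF nz])
  have pw: "(- 1) ^ Suc n / of_nat n * (- z) ^ n = - (z ^ n / of_nat n)" for n
    by (cases "even n") (simp_all add: uminus_power_if)
  have "(\<lambda>n. - (z ^ n / of_nat n)) sums Ln (1 - z)" using s0 unfolding pw by simp
  then have S: "(\<lambda>n. Re (- (- (z ^ n / of_nat n)))) sums Re (- Ln (1 - z))"
    by (intro sums_Re sums_minus)
  have R: "Re (- (- (z ^ n / of_nat n))) = r ^ n / real n * cos (real n * t)" for n
  proof -
    have e: "z ^ n / of_nat n = complex_of_real (r ^ n / real n) * cis (real n * t)"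
      by (simp add: z_def power_mult_distrib Complex.DeMoivre)
    show ?thesis unfolding minus_minus e by (simp del: of_real_divide of_real_power)
  qed
  have "Re (Ln (1 - z)) = ell r t"
  proof -
    have "1 - z \<noteq> 0" using nz by auto
    moreover have "(cmod (1 - z))\<^sup>2 = 1 - 2 * r * cos t + r\<^sup>2"
    proof -
      have "(cmod (1 - z))\<^sup>2 = (1 - r * cos t)\<^sup>2 + (r * sin t)\<^sup>2"
        by (simp add: cmod_power2 z_def)
      also have "\<dots> = 1 - 2 * r * cos t + r\<^sup>2 * ((sin t)\<^sup>2 + (cos t)\<^sup>2)"
        unfolding power2_eq_square by (simp only: ring_distribs) simp
      finally show ?thesis unfolding sin_cos_squared_add by simp
    qed
    then have "ell r t = ln ((cmod (1 - z))\<^sup>2) / 2" by (simp add: ell_def)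
    ultimately show ?thesis using ln_realpow[of "cmod (1 - z)" 2] by simp
  qed
  then show ?thesis using S unfolding R by simp
qed

lemma lk_sums:
  assumes "0 < r" "r < 1"
  shows "(\<lambda>k. 2 * r ^ k / real k * (cos (real k * t) * cos (real k * u))) sums (- lk r t u)"
proof -
  have "(\<lambda>k. r ^ k / real k * cos (real k * (t - u)) + r ^ k / real k * cos (real k * (t + u)))
     sums (- ell r (t - u) + - ell r (t + u))"
    by (intro sums_add ell_sums assms)
  moreover have "r ^ k / real k * cos (real k * (t - u)) + r ^ k / real k * cos (real k * (t + u)) =
    2 * r ^ k / real k * (cos (real k * t) * cos (real k * u))" for k
    by (simp add: cos_add cos_diff algebra_simps)
  ultimately show ?thesis by (simp add: lk_def)
qed

text \<open>By \<open>lk_sums\<close> the form is minus a series of nonnegative squares, one for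
  each cosine mode. Keeping a single mode k gives the quantitative gap on which the exponential
  decay rests.\<close>

lemma lk_quadratic_form:
  fixes c t :: "'i \<Rightarrow> real"
  assumes "0 < r" "r < 1" "finite I"
  shows "(\<Sum>i\<in>I. \<Sum>j\<in>I. c i * c j * lk r (t i) (t j)) \<le> - (2 * r ^ k / real k * (\<Sum>i\<in>I. c i * cos (real k * t i))\<^sup>2)"
proof -
  define f where "f = (\<lambda>k. 2 * r ^ k / real k * (\<Sum>i\<in>I. c i * cos (real k * t i))\<^sup>2)"
  have "(\<lambda>k. \<Sum>i\<in>I. \<Sum>j\<in>I. c i * c j * (2 * r ^ k / real k * (cos (real k * t i) * cos (real k * t j))))
    sums (\<Sum>i\<in>I. \<Sum>j\<in>I. c i * c j * (- lk r (t i) (t j)))"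
    by (intro sums_sum sums_mult lk_sums assms)
  moreover have "(\<Sum>i\<in>I. \<Sum>j\<in>I. c i * c j * (2 * r ^ k / real k * (cos (real k * t i) * cos (real k * t j)))) = f k" for k
    unfolding f_def power2_eq_square sum_product by (simp add: sum_distrib_left mult_ac)
  moreover have "(\<Sum>i\<in>I. \<Sum>j\<in>I. c i * c j * (- lk r (t i) (t j))) = - (\<Sum>i\<in>I. \<Sum>j\<in>I. c i * c j * lk r (t i) (t j))"
    by (simp add: sum_negf)
  ultimately have s: "f sums (- (\<Sum>i\<in>I. \<Sum>j\<in>I. c i * c j * lk r (t i) (t j)))" by simp
  have nn: "0 \<le> f k" for k unfolding f_def using assms by simp
  have "(\<Sum>n\<in>{k}. f n) \<le> suminf f"
    using s nn by (intro sum_le_suminf) (auto simp: sums_iff)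
  then have "f k \<le> - (\<Sum>i\<in>I. \<Sum>j\<in>I. c i * c j * lk r (t i) (t j))" using s by (simp add: sums_iff)
  then show ?thesis unfolding f_def by linarith
qed

lemma lk_measurable [measurable]:
  "(\<lambda>x. lk r (f x) (g x)) \<in> borel_measurable M" if [measurable]: "f \<in> borel_measurable M" "g \<in> borel_measurable M"
  unfolding lk_def ell_def by measurable

subsection \<open>Sums over lattice sites\<close>

lemma sum_inverse_sqrt_le: "(\<Sum>k=1..m. 1 / sqrt (real k)) \<le> 2 * sqrt (real m)"
proof (induction m)
  case (Suc m)
  have "1 / sqrt (real (Suc m)) \<le> 2 * (sqrt (real (Suc m)) - sqrt (real m))"
  proof -
    define a where "a = sqrt (real (Suc m))"
    define b where "b = sqrt (real m)"
    have "a\<^sup>2 - b\<^sup>2 = 1" "0 < a" "0 \<le> b" by (auto simp: a_def b_def)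
    then have "1 = (a - b) * (a + b)" "b \<le> a" by (auto simp: power2_eq_square algebra_simps a_def b_def)
    moreover have "(a - b) * (a + b) \<le> (a - b) * (2 * a)" using \<open>b \<le> a\<close> by (intro mult_left_mono) auto
    ultimately show ?thesis unfolding a_def[symmetric] b_def[symmetric] using \<open>0 < a\<close>
      by (simp add: divide_le_eq mult_ac)
  qed
  then show ?case using Suc by simp
qed simp

lemma sum_inverse_sqrt_dist:
  assumes "T \<subseteq> {0..M}"
  shows "(\<Sum>t\<in>T - {s}. 1 / sqrt \<bar>real s - real t\<bar>) \<le> 4 * sqrt (real (M + s))"
proof -
  have fin: "finite T" using assms finite_subset by blast
  have "(\<Sum>t\<in>T - {s}. 1 / sqrt \<bar>real s - real t\<bar>) \<le> (\<Sum>t\<in>({..<s} \<union> {s<..M + s}). 1 / sqrt \<bar>real s - real t\<bar>)"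
    using assms by (intro sum_mono2) auto
  also have "\<dots> = (\<Sum>t\<in>{..<s}. 1 / sqrt \<bar>real s - real t\<bar>) + (\<Sum>t\<in>{s<..M + s}. 1 / sqrt \<bar>real s - real t\<bar>)"
    by (intro sum.union_disjoint) auto
  also have "(\<Sum>t\<in>{..<s}. 1 / sqrt \<bar>real s - real t\<bar>) = (\<Sum>k=1..s. 1 / sqrt (real k))"
    by (rule sum.reindex_bij_witness[of _ "\<lambda>k. s - k" "\<lambda>t. s - t"]) (auto simp: of_nat_diff)
  also have "(\<Sum>t\<in>{s<..M + s}. 1 / sqrt \<bar>real s - real t\<bar>) = (\<Sum>k=1..M. 1 / sqrt (real k))"
    by (rule sum.reindex_bij_witness[of _ "\<lambda>k. s + k" "\<lambda>t. t - s"]) (auto simp: of_nat_diff)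
  also have "(\<Sum>k=1..s. 1 / sqrt (real k)) + (\<Sum>k=1..M. 1 / sqrt (real k)) \<le> 2 * sqrt (real s) + 2 * sqrt (real M)"
    by (intro add_mono sum_inverse_sqrt_le)
  also have "\<dots> \<le> 2 * sqrt (real (M + s)) + 2 * sqrt (real (M + s))" by (intro add_mono mult_left_mono) auto
  finally show ?thesis by simp
qed

lemma borel_bounded_integrable:
  fixes g :: "real \<Rightarrow> real"
  assumes [measurable]: "g \<in> borel_measurable borel" and b: "\<And>x. x \<in> {a..b} \<Longrightarrow> \<bar>g x\<bar> \<le> B"
  shows "g integrable_on {a..b}"
proof (rule measurable_bounded_by_integrable_imp_integrable)
  show "g \<in> borel_measurable (lebesgue_on {a..b})"
    by (rule measurable_restrict_space1) (simp add: measurable_completion)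
  show "(\<lambda>x. B) integrable_on {a..b}" by (rule integrable_const_ivl)
qed (use b in auto)

lemma lipschitz_borel:
  fixes f :: "real \<Rightarrow> real"
  assumes "\<And>x y. \<bar>f x - f y\<bar> \<le> K * \<bar>x - y\<bar>"
  shows "f \<in> borel_measurable borel"
proof (rule borel_measurable_continuous_onI)
  have "0 \<le> K" using assms[of 0 1] by (smt (verit) abs_ge_zero mult_cancel_left2)
  then have "K-lipschitz_on UNIV f"
    using assms by (intro lipschitz_onI) (auto simp: dist_real_def)
  then show "continuous_on UNIV f" by (rule lipschitz_on_continuous_on)
qed

lemma integral_abs_bound:
  fixes g :: "real \<Rightarrow> real"
  assumes "g integrable_on {a..b}" "a \<le> b" "\<And>x. x \<in> {a..b} \<Longrightarrow> \<bar>g x\<bar> \<le> B"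
  shows "\<bar>integral {a..b} g\<bar> \<le> B * (b - a)"
  using integral_bound[of a b g B] assms
  by (metis has_integral_bound_real has_integral_const_real integrable_integral integral_norm_bound_integral
      integrable_const_ivl integral_const_real measure_lborel_Icc mult.commute real_norm_def real_scaleR_def)

text \<open>Selecting the sites at which \<open>\<lfloor>n R\<rfloor>\<close> jumps, where \<open>R\<close> is the distribution function of \<open>\<rho> \<le> 1\<close>,
  gives distinct sites distributed according to \<open>\<rho>\<close> up to a bounded error.\<close>

lemma floor_selection_sum:
  fixes \<rho> f :: "real \<Rightarrow> real" and n :: nat and \<alpha> \<beta> K B :: real
  assumes [measurable]: "\<rho> \<in> borel_measurable borel" and rho: "\<And>x. 0 \<le> \<rho> x" "\<And>x. \<rho> x \<le> 1"
    and lip: "\<And>x y. \<bar>f x - f y\<bar> \<le> K * \<bar>x - y\<bar>" and bnd: "\<And>x. \<bar>f x\<bar> \<le> B"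
    and ab: "0 \<le> \<alpha>" "\<alpha> \<le> \<beta>" and n: "0 < n"
  defines "D \<equiv> \<lambda>s::nat. \<lfloor>real n * integral {0..real s / real n} \<rho>\<rfloor>"
  defines "T \<equiv> {s::nat. \<alpha> * real n \<le> real s \<and> real s \<le> \<beta> * real n \<and> D (Suc s) \<noteq> D s}"
  shows "\<bar>(\<Sum>s\<in>T. f (real s / real n)) - real n * integral {\<alpha>..\<beta>} (\<lambda>x. \<rho> x * f x)\<bar> \<le> 4 * B + 2 * K * (\<beta> - \<alpha> + 1)"
proof -
  have [measurable]: "f \<in> borel_measurable borel" by (rule lipschitz_borel[OF lip])
  have K: "0 \<le> K" using lip[of 0 1] by (smt (verit) abs_ge_zero mult_cancel_left2)
  have B: "0 \<le> B" using bnd[of 0] by linarith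
  define g where "g = (\<lambda>x. \<rho> x * f x)"
  have g_b: "\<bar>g x\<bar> \<le> B" for x
    unfolding g_def abs_mult using mult_mono[of "\<bar>\<rho> x\<bar>" 1 "\<bar>f x\<bar>" B] rho[of x] bnd[of x] by simp
  have gi: "g integrable_on {u..v}" for u v
    by (rule borel_bounded_integrable[where B = B]) (auto simp: g_def g_b[unfolded g_def])
  have ri: "\<rho> integrable_on {u..v}" for u v
    by (rule borel_bounded_integrable[where B = 1]) (auto simp: rho abs_le_iff intro: order_trans[OF _ rho(1)])
  define x where "x = (\<lambda>s::nat. real s / real n)"
  have x_mono: "x s \<le> x (Suc s)" "x (Suc s) = x s + 1 / real n" "0 \<le> x s" for s
    using n by (auto simp: x_def field_simps)
  have x_le: "x s \<le> x t" if "s \<le> t" for s t using that n by (simp add: x_def divide_right_mono)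
  define G where "G = (\<lambda>s. real n * integral {0..x s} \<rho>)"
  have Gdiff: "G (Suc s) - G s = real n * integral {x s..x (Suc s)} \<rho>" for s
  proof -
    have c: "integral {0..x s} \<rho> + integral {x s..x (Suc s)} \<rho> = integral {0..x (Suc s)} \<rho>"
      by (rule Henstock_Kurzweil_Integration.integral_combine[OF x_mono(3) x_mono(1) ri])
    show ?thesis unfolding G_def c[symmetric] by (simp add: distrib_left)
  qed
  have Gstep: "0 \<le> G (Suc s) - G s" "G (Suc s) - G s \<le> 1" for s
  proof -
    have "0 \<le> integral {x s..x (Suc s)} \<rho>" by (rule integral_nonneg[OF ri]) (use rho in auto)
    then show "0 \<le> G (Suc s) - G s" unfolding Gdiff by simp
    have "integral {x s..x (Suc s)} \<rho> \<le> integral {x s..x (Suc s)} (\<lambda>_. 1)"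
      by (rule integral_le[OF ri]) (use rho in auto)
    also have "\<dots> = 1 / real n" using x_mono[of s] n by simp
    finally have "real n * integral {x s..x (Suc s)} \<rho> \<le> real n * (1 / real n)" by (intro mult_left_mono) auto
    then show "G (Suc s) - G s \<le> 1" unfolding Gdiff using n by simp
  qed
  have D: "D s = \<lfloor>G s\<rfloor>" for s by (simp add: D_def G_def x_def)
  \<comment> \<open>Here \<rho> \<le> 1 is essential: G grows by at most 1 per site, so the jump of
    the floor is itself the indicator of selection.\<close>
  have Dstep: "D (Suc s) = D s \<or> D (Suc s) = D s + 1" for s
    using Gstep[of s] unfolding D by linarith
  define E where "E = (\<lambda>s. G s - real_of_int (D s))"
  have E: "0 \<le> E s" "E s \<le> 1" for s unfolding E_def D by linarith+
  define F where "F = (\<lambda>s. f (x s))"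
  have F: "\<bar>F s\<bar> \<le> B" "\<bar>F (Suc s) - F s\<bar> \<le> K / real n" for s
    using bnd lip[of "x (Suc s)" "x s"] x_mono(2)[of s] by (auto simp: F_def)
  show ?thesis
  proof (cases "nat \<lceil>\<alpha> * real n\<rceil> \<le> nat \<lfloor>\<beta> * real n\<rfloor>")
    case False
    have "T = {}"
    proof (rule ccontr)
      assume "T \<noteq> {}"
      then obtain s where s: "\<alpha> * real n \<le> real s" "real s \<le> \<beta> * real n" unfolding T_def by auto
      then have "\<lceil>\<alpha> * real n\<rceil> \<le> int s" "int s \<le> \<lfloor>\<beta> * real n\<rfloor>" by (simp_all add: ceiling_le_iff le_floor_iff)
      then show False using False by linarith
    qed
    moreover have "real n * (\<beta> - \<alpha>) \<le> 1"
    proof -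
      have "\<lfloor>\<beta> * real n\<rfloor> < \<lceil>\<alpha> * real n\<rceil>" using False by linarith
      then show ?thesis by (simp add: algebra_simps) linarith
    qed
    moreover have "\<bar>integral {\<alpha>..\<beta>} g\<bar> \<le> B * (\<beta> - \<alpha>)" by (rule integral_abs_bound[OF gi ab(2) g_b])
    then have "real n * \<bar>integral {\<alpha>..\<beta>} g\<bar> \<le> real n * (B * (\<beta> - \<alpha>))" by (intro mult_left_mono) auto
    moreover have "real n * (B * (\<beta> - \<alpha>)) = B * (real n * (\<beta> - \<alpha>))" by simp
    moreover have "B * (real n * (\<beta> - \<alpha>)) \<le> B * 1" using B calculation(2) by (intro mult_left_mono) auto
    moreover have "0 \<le> 2 * K * (\<beta> - \<alpha> + 1)" using K ab by simp
    ultimately show ?thesis unfolding g_def[symmetric] using B by (simp add: abs_mult)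
  next
    case True
    define a where "a = nat \<lceil>\<alpha> * real n\<rceil>"
    define b where "b = nat \<lfloor>\<beta> * real n\<rfloor>"
    have ab': "a \<le> b" using True by (simp add: a_def b_def)
    have nn: "0 \<le> \<alpha> * real n" "0 \<le> \<beta> * real n" using ab by auto
    have ra: "\<alpha> * real n \<le> real a" "real a \<le> \<alpha> * real n + 1" and rb: "real b \<le> \<beta> * real n" "\<beta> * real n \<le> real b + 1"
      unfolding a_def b_def using nn by linarith+
    have T: "T = {s \<in> {a..b}. D (Suc s) \<noteq> D s}"
    proof -
      have "\<alpha> * real n \<le> real s \<longleftrightarrow> a \<le> s" "real s \<le> \<beta> * real n \<longleftrightarrow> s \<le> b" for s
        unfolding a_def b_def using nn by (simp_all add: ceiling_le_iff le_floor_iff nat_le_iff le_nat_iff)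
      then show ?thesis unfolding T_def by auto
    qed
    have "(\<Sum>s\<in>T. f (real s / real n)) = (\<Sum>s\<in>{a..b}. if D (Suc s) \<noteq> D s then F s else 0)"
      unfolding T F_def x_def by (rule sum.inter_filter) simp
    also have "\<dots> = (\<Sum>s\<in>{a..b}. F s * (real_of_int (D (Suc s)) - real_of_int (D s)))"
    proof (rule sum.cong[OF refl])
      fix s show "(if D (Suc s) \<noteq> D s then F s else 0) = F s * (real_of_int (D (Suc s)) - real_of_int (D s))"
        using Dstep[of s] by auto
    qed
    also have "\<dots> = (\<Sum>s\<in>{a..b}. F s * (G (Suc s) - G s)) - (\<Sum>s\<in>{a..b}. F s * (E (Suc s) - E s))"
      unfolding sum_subtractf[symmetric] by (rule sum.cong) (auto simp: E_def algebra_simps)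
    finally have s1: "(\<Sum>s\<in>T. f (real s / real n)) = (\<Sum>s\<in>{a..b}. F s * (G (Suc s) - G s)) - (\<Sum>s\<in>{a..b}. F s * (E (Suc s) - E s))" .
    \<comment> \<open>Summation by parts: the fractional part E stays in [0, 1], so its contribution
      is controlled by the bound and the variation of f and not by the number of sites.\<close>
    have abel: "\<bar>(\<Sum>s\<in>{a..c}. F s * (E (Suc s) - E s)) - F c * E (Suc c)\<bar> \<le> B + K / real n * (real c - real a)" if "a \<le> c" for c
      using that
    proof (induction c rule: dec_induct)
      case base
      have "\<bar>F a * E a\<bar> \<le> B * 1" unfolding abs_mult using F(1)[of a] E[of a] by (intro mult_mono) auto
      then show ?case by (simp add: algebra_simps)
    next
      case (step c)
      have "(\<Sum>s\<in>{a..Suc c}. F s * (E (Suc s) - E s)) - F (Suc c) * E (Suc (Suc c)) =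
        ((\<Sum>s\<in>{a..c}. F s * (E (Suc s) - E s)) - F c * E (Suc c)) - (F (Suc c) - F c) * E (Suc c)"
        using step by (simp add: algebra_simps)
      moreover have "\<bar>(F (Suc c) - F c) * E (Suc c)\<bar> \<le> K / real n * 1"
        unfolding abs_mult using F(2)[of c] E[of "Suc c"] K by (intro mult_mono) auto
      moreover have "K / real n * (real (Suc c) - real a) = K / real n * (real c - real a) + K / real n * 1"
        by (simp add: algebra_simps add_divide_distrib)
      ultimately show ?case using step.IH by linarith
    qed
    have FE: "\<bar>F b * E (Suc b)\<bar> \<le> B * 1" unfolding abs_mult using F(1)[of b] E[of "Suc b"] by (intro mult_mono) auto
    have Kba: "K / real n * (real b - real a) \<le> K * (\<beta> - \<alpha>)"
    proof -
      have "real b - real a \<le> real n * (\<beta> - \<alpha>)" using ra rb by (simp add: algebra_simps)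
      then have "K / real n * (real b - real a) \<le> K / real n * (real n * (\<beta> - \<alpha>))" using K by (intro mult_left_mono) auto
      then show ?thesis using n by simp
    qed
    have s2: "\<bar>\<Sum>s\<in>{a..b}. F s * (E (Suc s) - E s)\<bar> \<le> 2 * B + K * (\<beta> - \<alpha>)"
      using abel[OF ab'] FE Kba by linarith
    have cell: "\<bar>F s * (G (Suc s) - G s) - real n * integral {x s..x (Suc s)} g\<bar> \<le> K / real n" for s
    proof -
      have Fr: "(\<lambda>y. F s * \<rho> y) integrable_on {u..v}" for u v
        using integrable_on_cmult_left[OF ri, of "F s"] by simp
      have "F s * integral {x s..x (Suc s)} \<rho> - integral {x s..x (Suc s)} g = integral {x s..x (Suc s)} (\<lambda>y. F s * \<rho> y - g y)"
        by (simp only: Henstock_Kurzweil_Integration.integral_diff[OF Fr gi] integral_mult_right)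
      moreover have "\<bar>integral {x s..x (Suc s)} (\<lambda>y. F s * \<rho> y - g y)\<bar> \<le> (K / real n) * (x (Suc s) - x s)"
      proof (rule integral_abs_bound)
        show "(\<lambda>y. F s * \<rho> y - g y) integrable_on {x s..x (Suc s)}"
          by (intro integrable_diff gi Fr)
        show "x s \<le> x (Suc s)" by (rule x_mono)
        fix y assume y: "y \<in> {x s..x (Suc s)}"
        have "F s * \<rho> y - g y = \<rho> y * (f (x s) - f y)" by (simp add: F_def g_def algebra_simps)
        also have "\<bar>\<dots>\<bar> \<le> 1 * (K * \<bar>x s - y\<bar>)" unfolding abs_mult using rho[of y] lip K by (intro mult_mono) auto
        also have "\<dots> \<le> K * (1 / real n)" unfolding mult_1 using y x_mono(2)[of s] K by (intro mult_left_mono) auto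
        finally show "\<bar>F s * \<rho> y - g y\<bar> \<le> K / real n" by simp
      qed
      ultimately have "\<bar>F s * integral {x s..x (Suc s)} \<rho> - integral {x s..x (Suc s)} g\<bar> \<le> (K / real n) * (1 / real n)"
        using x_mono(2)[of s] by simp
      then have "real n * \<bar>F s * integral {x s..x (Suc s)} \<rho> - integral {x s..x (Suc s)} g\<bar> \<le> real n * ((K / real n) * (1 / real n))"
        by (intro mult_left_mono) auto
      moreover have "F s * (G (Suc s) - G s) - real n * integral {x s..x (Suc s)} g = real n * (F s * integral {x s..x (Suc s)} \<rho> - integral {x s..x (Suc s)} g)"
        unfolding Gdiff by (simp add: algebra_simps)
      ultimately show ?thesis using n by (simp add: abs_mult)
    qed
    have comb: "(\<Sum>s\<in>{a..c}. integral {x s..x (Suc s)} g) = integral {x a..x (Suc c)} g" if "a \<le> c" for c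
      using that
    proof (induction c rule: dec_induct)
      case (step c)
      have "integral {x a..x (Suc c)} g + integral {x (Suc c)..x (Suc (Suc c))} g = integral {x a..x (Suc (Suc c))} g"
        by (rule Henstock_Kurzweil_Integration.integral_combine[OF _ _ gi]) (use step in \<open>auto intro!: x_le\<close>)
      then show ?case using step by simp
    qed simp
    have "\<bar>(\<Sum>s\<in>{a..b}. F s * (G (Suc s) - G s)) - real n * integral {x a..x (Suc b)} g\<bar> =
      \<bar>\<Sum>s\<in>{a..b}. F s * (G (Suc s) - G s) - real n * integral {x s..x (Suc s)} g\<bar>"
      unfolding comb[OF ab', symmetric] sum_distrib_left sum_subtractf ..
    also have "\<dots> \<le> (\<Sum>s\<in>{a..b}. K / real n)" by (rule order_trans[OF sum_abs sum_mono[OF cell]])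
    also have "\<dots> = K / real n * (real b - real a) + K / real n" using ab' by (simp add: of_nat_diff algebra_simps add_divide_distrib)
    also have "\<dots> \<le> K * (\<beta> - \<alpha>) + K"
    proof -
      have "K / real n \<le> K / 1" using K n by (intro divide_left_mono) auto
      then show ?thesis using Kba by simp
    qed
    finally have s3: "\<bar>(\<Sum>s\<in>{a..b}. F s * (G (Suc s) - G s)) - real n * integral {x a..x (Suc b)} g\<bar> \<le> K * (\<beta> - \<alpha>) + K" .
    have xa: "\<alpha> \<le> x a" "x a \<le> \<alpha> + 1 / real n" and xb: "\<beta> \<le> x (Suc b)" "x (Suc b) \<le> \<beta> + 1 / real n"
      using ra rb n by (auto simp: x_def field_simps)
    have "integral {\<alpha>..x a} g + integral {x a..x (Suc b)} g = integral {\<alpha>..x (Suc b)} g"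
      by (rule Henstock_Kurzweil_Integration.integral_combine[OF xa(1) _ gi]) (use ab' in \<open>auto intro: x_le\<close>)
    moreover have "integral {\<alpha>..\<beta>} g + integral {\<beta>..x (Suc b)} g = integral {\<alpha>..x (Suc b)} g"
      by (rule Henstock_Kurzweil_Integration.integral_combine[OF ab(2) xb(1) gi])
    moreover have i1: "\<bar>integral {\<alpha>..x a} g\<bar> \<le> B * (1 / real n)"
      by (rule order_trans[OF integral_abs_bound[OF gi xa(1) g_b] mult_left_mono[OF _ B]]) (use xa in auto)
    moreover have i2: "\<bar>integral {\<beta>..x (Suc b)} g\<bar> \<le> B * (1 / real n)"
      by (rule order_trans[OF integral_abs_bound[OF gi xb(1) g_b] mult_left_mono[OF _ B]]) (use xb in auto)
    ultimately have "\<bar>integral {x a..x (Suc b)} g - integral {\<alpha>..\<beta>} g\<bar> \<le> 2 * (B * (1 / real n))" by linarith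
    then have "real n * \<bar>integral {x a..x (Suc b)} g - integral {\<alpha>..\<beta>} g\<bar> \<le> real n * (2 * (B * (1 / real n)))"
      by (intro mult_left_mono) auto
    then have s4: "\<bar>real n * integral {x a..x (Suc b)} g - real n * integral {\<alpha>..\<beta>} g\<bar> \<le> 2 * B"
      using n by (simp add: abs_mult right_diff_distrib[symmetric])
    have "2 * K * (\<beta> - \<alpha> + 1) = 2 * (K * (\<beta> - \<alpha>)) + 2 * K" by (simp add: algebra_simps)
    then show ?thesis unfolding g_def[symmetric] using s1 s2 s3 s4 K by linarith
  qed
qed

subsection \<open>The regularized potential\<close>

text \<open>\<open>ln (C/A)\<close> may be unbounded at the ends, so it is only bounded at distance
  \<epsilon> from them, at the rate \<open>CV / sqrt \<epsilon>\<close>. The additive constant of V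
  is immaterial, as configurations of equal size are compared; it is fixed at the midpoint.\<close>

locale racah_potential = racah_band +
  fixes V :: "real \<Rightarrow> real" and CV :: real
  assumes V: "\<And>x. 0 < x \<Longrightarrow> x < L \<Longrightarrow> (V has_real_derivative ln (cC h L a p s x / cA h L a p s x)) (at x)"
    and CV: "\<And>\<epsilon> x. 0 < \<epsilon> \<Longrightarrow> \<epsilon> \<le> x \<Longrightarrow> x \<le> L - \<epsilon> \<Longrightarrow> \<bar>ln (cC h L a p s x / cA h L a p s x)\<bar> \<le> CV / sqrt \<epsilon>"
    and V0: "V (L / 2) = 0"
begin

lemma rho_total: "integral {0..L} rho = 1"
  using set_borel_integral_eq_integral(2)[of "{0..L}" rho] rho_integrable rho_integral
  by (simp add: set_integrable_def set_lebesgue_integral_def)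

definition th :: "real \<Rightarrow> real" where "th x = p + 2 * h * x"

lemma th_diff: "\<bar>th x - th y\<bar> = 2 * h * \<bar>x - y\<bar>"
proof -
  have "th x - th y = 2 * h * (x - y)" by (simp add: th_def algebra_simps)
  then show ?thesis using h by (simp add: abs_mult)
qed

lemma CV_nonneg: "0 \<le> CV"
proof -
  have "0 \<le> \<bar>ln (cC h L a p s (L / 2) / cA h L a p s (L / 2))\<bar>" by simp
  also have "\<dots> \<le> CV / sqrt (L / 2)" using L by (intro CV) auto
  finally show ?thesis using L by (simp add: zero_le_divide_iff)
qed

lemma V_lipschitz:
  assumes "0 < \<epsilon>" "x \<in> {\<epsilon>..L - \<epsilon>}" "y \<in> {\<epsilon>..L - \<epsilon>}"
  shows "\<bar>V x - V y\<bar> \<le> CV / sqrt \<epsilon> * \<bar>x - y\<bar>"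
proof -
  have "norm (V x - V y) \<le> CV / sqrt \<epsilon> * norm (x - y)"
  proof (rule field_differentiable_bound[of "{\<epsilon>..L - \<epsilon>}", where f' = "\<lambda>x. ln (cC h L a p s x / cA h L a p s x)"])
    show "(V has_field_derivative ln (cC h L a p s z / cA h L a p s z)) (at z within {\<epsilon>..L - \<epsilon>})"
      if "z \<in> {\<epsilon>..L - \<epsilon>}" for z
      using V[of z] that assms(1) by (auto intro: has_field_derivative_at_within)
    show "norm (ln (cC h L a p s z / cA h L a p s z)) \<le> CV / sqrt \<epsilon>" if "z \<in> {\<epsilon>..L - \<epsilon>}" for z
      using CV[of \<epsilon> z] that assms(1) by auto
  qed (use assms in auto)
  then show ?thesis by simp
qed

lemma V_bound:
  assumes "0 < \<epsilon>" "x \<in> {\<epsilon>..L - \<epsilon>}"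
  shows "\<bar>V x\<bar> \<le> CV * L / sqrt \<epsilon>"
proof -
  have m: "L / 2 \<in> {\<epsilon>..L - \<epsilon>}" using assms by auto
  have "\<bar>V x\<bar> \<le> CV / sqrt \<epsilon> * \<bar>x - L / 2\<bar>" using V_lipschitz[OF assms m] V0 by simp
  also have "\<dots> \<le> CV / sqrt \<epsilon> * L"
  proof (rule mult_left_mono)
    show "\<bar>x - L / 2\<bar> \<le> L" using assms by (auto simp: abs_le_iff)
    show "0 \<le> CV / sqrt \<epsilon>" using CV_nonneg assms(1) by simp
  qed
  finally show ?thesis by simp
qed

definition Ur :: "real \<Rightarrow> real \<Rightarrow> real" where
  "Ur r x = integral {0..L} (\<lambda>y. rho y * lk r (th x) (th y))"

text \<open>The bound on |\<open>lk r\<close>| from \<open>lk_bounds\<close>; it grows only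
  logarithmically as r tends to 1.\<close>

definition Lam :: "real \<Rightarrow> real" where "Lam r = 2 - 2 * ln (1 - r)"

lemma rho_lk_integrable:
  assumes "0 < r" "r < 1"
  shows "(\<lambda>y. rho y * lk r t (th y)) integrable_on {u..v}"
proof (rule borel_bounded_integrable)
  show "(\<lambda>y. rho y * lk r t (th y)) \<in> borel_measurable borel" unfolding th_def by measurable
  have "\<bar>rho y * lk r t (th y)\<bar> \<le> 1 * Lam r" for y
    unfolding abs_mult Lam_def using rho_bounds[of y] lk_bounds(3)[of r t "th y"] assms by (intro mult_mono) auto
  then show "\<bar>rho y * lk r t (th y)\<bar> \<le> Lam r" for y by simp
qed

lemma Ulog_integral:
  assumes "x0 \<in> {0..L}"
  shows "(\<lambda>x. rho x * ln \<bar>X x - X x0\<bar>) integrable_on {0..L}"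
    and "Ulog x0 = integral {0..L} (\<lambda>x. rho x * ln \<bar>X x - X x0\<bar>)"
proof -
  have "set_integrable lborel {0..L} (\<lambda>x. rho x * ln \<bar>X x - X x0\<bar>)"
    using rho_ln_integrable[OF assms] by (simp add: set_integrable_def)
  from set_borel_integral_eq_integral[OF this]
  show "(\<lambda>x. rho x * ln \<bar>X x - X x0\<bar>) integrable_on {0..L}"
    "Ulog x0 = integral {0..L} (\<lambda>x. rho x * ln \<bar>X x - X x0\<bar>)"
    by (auto simp: Ulog_def set_lebesgue_integral_def)
qed

text \<open>Both one-sided comparisons of \<open>lk\<close> with the logarithm are integrated. The
  singular one contributes sqrt ((1 - r)/h) times an integrable inverse square root, so the error is
  O(sqrt (1 - r)).\<close>

lemma Ur_close:
  assumes x0: "x0 \<in> {0..L}" and r: "0 < r" "r < 1"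
  shows "\<bar>Ur r x0 - Ulog x0\<bar> \<le> 2 * (1 - r) * L + 16 * sqrt ((1 - r) / h) * sqrt L"
proof -
  define g where "g = (\<lambda>x. 2 * (1 - r) + 4 * sqrt ((1 - r) / h) * (1 / sqrt \<bar>x - x0\<bar>))"
  define f where "f = (\<lambda>x. if x = x0 then 0 else rho x * lk r (th x0) (th x) - rho x * ln \<bar>X x - X x0\<bar>)"
  have gi1: "(\<lambda>x. 4 * sqrt ((1 - r) / h) * (1 / sqrt \<bar>x - x0\<bar>)) integrable_on {0..L}"
    using integrable_on_cmult_left[OF inverse_sqrt_integral_bound(1)[of 0 L x0], of "4 * sqrt ((1 - r) / h)"] L by simp
  have gi: "g integrable_on {0..L}" unfolding g_def by (intro integrable_add integrable_const_ivl gi1)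
  have di: "((\<lambda>x. rho x * lk r (th x0) (th x) - rho x * ln \<bar>X x - X x0\<bar>) has_integral (Ur r x0 - Ulog x0)) {0..L}"
    unfolding Ur_def Ulog_integral(2)[OF x0]
    by (intro has_integral_diff integrable_integral rho_lk_integrable[OF r] Ulog_integral(1)[OF x0])
  have fi: "(f has_integral (Ur r x0 - Ulog x0)) {0..L}"
    by (rule has_integral_spike_finite[of "{x0}", OF _ _ di]) (auto simp: f_def)
  have b: "norm (f x) \<le> g x" if x: "x \<in> {0..L}" for x
  proof (cases "x = x0")
    case True
    then show ?thesis using r h by (simp add: f_def g_def)
  next
    case False
    have t: "0 \<le> th x" "th x \<le> pi" "0 \<le> th x0" "th x0 \<le> pi"
      using ang[of x] ang[of x0] x x0 by (auto simp: th_def)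
    have ne: "th x \<noteq> th x0" using False h by (simp add: th_def)
    have Xe: "X x - X x0 = 2 * cos (th x) - 2 * cos (th x0)" by (simp add: X_def th_def)
    have cn: "cos (th x) \<noteq> cos (th x0)" using t ne cos_inj_pi by blast
    have 1: "ln \<bar>X x - X x0\<bar> \<le> lk r (th x0) (th x) + 2 * (1 - r)"
      using ln_cos_diff_le_lk[OF r cn] unfolding Xe lk_commute[of r "th x0"] .
    have "lk r (th x0) (th x) \<le> ln \<bar>X x - X x0\<bar> + 4 * sqrt (2 * (1 - r) / \<bar>th x - th x0\<bar>)"
      using lk_le_ln_cos_diff[OF r t ne] unfolding Xe lk_commute[of r "th x0"] .
    also have "2 * (1 - r) / \<bar>th x - th x0\<bar> = (1 - r) / h * (1 / \<bar>x - x0\<bar>)"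
    proof -
      have "2 * (1 - r) / (2 * (h * d)) = (1 - r) / h * (1 / d)" for d :: real
        by (subst mult_divide_mult_cancel_left) auto
      then show ?thesis unfolding th_diff mult.assoc .
    qed
    finally have 2: "lk r (th x0) (th x) \<le> ln \<bar>X x - X x0\<bar> + 4 * sqrt ((1 - r) / h) * (1 / sqrt \<bar>x - x0\<bar>)"
      unfolding real_sqrt_mult real_sqrt_divide[of 1] by simp
    have "0 \<le> 4 * sqrt ((1 - r) / h) * (1 / sqrt \<bar>x - x0\<bar>)" using r h by simp
    moreover have "\<bar>l - y\<bar> \<le> e + q" if "0 \<le> q" "y \<le> l + e" "l \<le> y + q" "0 \<le> e" for l y e q :: real
      using that by linarith
    ultimately have "\<bar>lk r (th x0) (th x) - ln \<bar>X x - X x0\<bar>\<bar> \<le> g x"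
      unfolding g_def using 1 2 r by simp
    moreover have "f x = rho x * (lk r (th x0) (th x) - ln \<bar>X x - X x0\<bar>)" using False by (simp add: f_def algebra_simps)
    moreover have "\<bar>rho x\<bar> * \<bar>lk r (th x0) (th x) - ln \<bar>X x - X x0\<bar>\<bar> \<le> 1 * \<bar>lk r (th x0) (th x) - ln \<bar>X x - X x0\<bar>\<bar>"
      using rho_bounds[of x] by (intro mult_right_mono) auto
    ultimately show ?thesis by (simp add: abs_mult)
  qed
  have "norm (integral {0..L} f) \<le> integral {0..L} g"
    by (rule integral_norm_bound_integral) (use fi gi b in auto)
  also have "integral {0..L} g = 2 * (1 - r) * L + integral {0..L} (\<lambda>x. 4 * sqrt ((1 - r) / h) * (1 / sqrt \<bar>x - x0\<bar>))"
    unfolding g_def using L by (subst Henstock_Kurzweil_Integration.integral_add[OF integrable_const_ivl gi1]) simp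
  also have "integral {0..L} (\<lambda>x. 4 * sqrt ((1 - r) / h) * (1 / sqrt \<bar>x - x0\<bar>)) = 4 * sqrt ((1 - r) / h) * integral {0..L} (\<lambda>x. 1 / sqrt \<bar>x - x0\<bar>)"
    by (simp only: integral_mult_right)
  also have "\<dots> \<le> 4 * sqrt ((1 - r) / h) * (4 * sqrt (L - 0))"
    using r h L by (intro mult_left_mono inverse_sqrt_integral_bound) auto
  finally have "norm (integral {0..L} f) \<le> 2 * (1 - r) * L + 16 * sqrt ((1 - r) / h) * sqrt L" by simp
  then show ?thesis using integral_unique[OF fi] by simp
qed

lemma Ulog_bound:
  assumes x0: "x0 \<in> {0..L}"
  shows "\<bar>Ulog x0\<bar> \<le> 2 * L + 24 * sqrt L / sqrt (2 * h)"
proof -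
  define g where "g = (\<lambda>x. 2 + 6 / sqrt (2 * h) * (1 / sqrt \<bar>x - x0\<bar>))"
  have gi1: "(\<lambda>x. 6 / sqrt (2 * h) * (1 / sqrt \<bar>x - x0\<bar>)) integrable_on {0..L}"
    using integrable_on_cmult_left[OF inverse_sqrt_integral_bound(1)[of 0 L x0], of "6 / sqrt (2 * h)"] L by simp
  have gi: "g integrable_on {0..L}" unfolding g_def by (intro integrable_add integrable_const_ivl gi1)
  have "norm (integral {0..L} (\<lambda>x. rho x * ln \<bar>X x - X x0\<bar>)) \<le> integral {0..L} g"
  proof (rule integral_norm_bound_integral[OF Ulog_integral(1)[OF x0] gi])
    fix x assume x: "x \<in> {0..L}"
    have "\<bar>rho x\<bar> * \<bar>ln \<bar>X x - X x0\<bar>\<bar> \<le> 1 * \<bar>ln \<bar>X x - X x0\<bar>\<bar>"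
      using rho_bounds[of x] by (intro mult_right_mono) auto
    then show "norm (rho x * ln \<bar>X x - X x0\<bar>) \<le> g x" using ln_X_bound[OF x x0] by (simp add: g_def abs_mult)
  qed
  also have "integral {0..L} g = 2 * L + integral {0..L} (\<lambda>x. 6 / sqrt (2 * h) * (1 / sqrt \<bar>x - x0\<bar>))"
    unfolding g_def using L by (subst Henstock_Kurzweil_Integration.integral_add[OF integrable_const_ivl gi1]) simp
  also have "integral {0..L} (\<lambda>x. 6 / sqrt (2 * h) * (1 / sqrt \<bar>x - x0\<bar>)) = 6 / sqrt (2 * h) * integral {0..L} (\<lambda>x. 1 / sqrt \<bar>x - x0\<bar>)"
    by (simp only: integral_mult_right)
  also have "\<dots> \<le> 6 / sqrt (2 * h) * (4 * sqrt (L - 0))"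
    using h L by (intro mult_left_mono inverse_sqrt_integral_bound) auto
  finally show ?thesis unfolding Ulog_integral(2)[OF x0] by simp
qed

lemma Ur_bound:
  assumes r: "0 < r" "r < 1"
  shows "\<bar>Ur r x\<bar> \<le> Lam r * L"
proof -
  have "\<bar>integral {0..L} (\<lambda>y. rho y * lk r (th x) (th y))\<bar> \<le> Lam r * (L - 0)"
  proof (rule integral_abs_bound[OF rho_lk_integrable[OF r]])
    fix y
    have "\<bar>rho y * lk r (th x) (th y)\<bar> \<le> 1 * Lam r"
      unfolding abs_mult Lam_def using rho_bounds[of y] lk_bounds(3)[of r "th x" "th y"] r by (intro mult_mono) auto
    then show "\<bar>rho y * lk r (th x) (th y)\<bar> \<le> Lam r" by simp
  qed (use L in auto)
  then show ?thesis by (simp add: Ur_def)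
qed

lemma Ur_lipschitz:
  assumes r: "0 < r" "r < 1"
  shows "\<bar>Ur r x - Ur r y\<bar> \<le> 4 * h * L / (1 - r)\<^sup>2 * \<bar>x - y\<bar>"
proof -
  have "Ur r x - Ur r y = integral {0..L} (\<lambda>z. rho z * lk r (th x) (th z) - rho z * lk r (th y) (th z))"
    unfolding Ur_def by (rule Henstock_Kurzweil_Integration.integral_diff[symmetric]) (intro rho_lk_integrable r)+
  also have "\<bar>\<dots>\<bar> \<le> (2 * (2 * h * \<bar>x - y\<bar>) / (1 - r)\<^sup>2) * (L - 0)"
  proof (rule integral_abs_bound)
    show "(\<lambda>z. rho z * lk r (th x) (th z) - rho z * lk r (th y) (th z)) integrable_on {0..L}"
      by (intro integrable_diff rho_lk_integrable r)
    fix z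
    have "rho z * lk r (th x) (th z) - rho z * lk r (th y) (th z) = rho z * (lk r (th x) (th z) - lk r (th y) (th z))"
      by (simp add: algebra_simps)
    also have "\<bar>\<dots>\<bar> \<le> 1 * (2 * (\<bar>th x - th y\<bar> + \<bar>th z - th z\<bar>) / (1 - r)\<^sup>2)"
      unfolding abs_mult using rho_bounds[of z] by (intro mult_mono lk_lipschitz r) auto
    finally show "\<bar>rho z * lk r (th x) (th z) - rho z * lk r (th y) (th z)\<bar> \<le> 2 * (2 * h * \<bar>x - y\<bar>) / (1 - r)\<^sup>2"
      by (simp add: th_diff)
  qed (use L in auto)
  finally show ?thesis by (simp add: mult_ac)
qed

text \<open>Clamping the argument makes V globally Lipschitz and bounded, as the lattice sum lemmas
  demand, without changing it on {\<epsilon>..L - \<epsilon>}.\<close>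

definition Vc :: "real \<Rightarrow> real \<Rightarrow> real" where "Vc \<epsilon> x = V (max \<epsilon> (min (L - \<epsilon>) x))"

lemma Vc_lipschitz:
  assumes "0 < \<epsilon>" "\<epsilon> < L / 2"
  shows "\<bar>Vc \<epsilon> x - Vc \<epsilon> y\<bar> \<le> CV / sqrt \<epsilon> * \<bar>x - y\<bar>"
proof -
  have "\<bar>Vc \<epsilon> x - Vc \<epsilon> y\<bar> \<le> CV / sqrt \<epsilon> * \<bar>max \<epsilon> (min (L - \<epsilon>) x) - max \<epsilon> (min (L - \<epsilon>) y)\<bar>"
    unfolding Vc_def using assms by (intro V_lipschitz) auto
  also have "\<dots> \<le> CV / sqrt \<epsilon> * \<bar>x - y\<bar>"
    using CV_nonneg assms by (intro mult_left_mono) auto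
  finally show ?thesis .
qed

lemma Vc_bound: "0 < \<epsilon> \<Longrightarrow> \<epsilon> < L / 2 \<Longrightarrow> \<bar>Vc \<epsilon> x\<bar> \<le> CV * L / sqrt \<epsilon>"
  unfolding Vc_def by (intro V_bound) auto

text \<open>The Euler--Lagrange conditions in the form needed for comparing sums over occupied sites.\<close>

lemma effective_potential:
  assumes \<epsilon>: "0 < \<epsilon>" "\<epsilon> < 1 / 2" and r: "0 < r" "r < 1"
  defines "\<eta> \<equiv> 2 * (2 * (1 - r) * L + 16 * sqrt ((1 - r) / h) * sqrt L)"
  obtains l where "\<bar>l\<bar> \<le> 2 * (2 * L + 24 * sqrt L / sqrt (2 * h)) + CV * L / sqrt \<epsilon>"
    "\<And>x. x \<in> {\<epsilon>..L - \<epsilon>} \<Longrightarrow>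
      max 0 (2 * Ur r x - Vc \<epsilon> x - l) \<le> rho x * (2 * Ur r x - Vc \<epsilon> x - l) + 2 * \<eta>"
proof -
  define \<Psi> where "\<Psi> = (\<lambda>x. 2 * Ulog x - V x)"
  define P where "P = {x \<in> {\<epsilon>..L - \<epsilon>}. 0 < rho x}"
  \<comment> \<open>The Lagrange multiplier: \<open>Euler_Lagrange\<close> places every value of
    \<Psi> at an unsaturated point below every value at a point of positive density, and the infimum
    separates them.\<close>
  define l where "l = Inf (\<Psi> ` P)"
  have eL: "\<epsilon> < L / 2" using \<epsilon> L1 by simp
  define K where "K = 2 * (2 * L + 24 * sqrt L / sqrt (2 * h)) + CV * L / sqrt \<epsilon>"
  have \<Psi>b: "\<bar>\<Psi> x\<bar> \<le> K" if "x \<in> {\<epsilon>..L - \<epsilon>}" for x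
  proof -
    have "\<bar>\<Psi> x\<bar> \<le> 2 * \<bar>Ulog x\<bar> + \<bar>V x\<bar>" unfolding \<Psi>_def by linarith
    then show ?thesis using Ulog_bound[of x] V_bound[OF \<epsilon>(1) that] that \<epsilon> unfolding K_def by auto
  qed
  \<comment> \<open>Otherwise the whole mass 1 of \<open>rho\<close> would sit in two end intervals
    of total length 2 \<epsilon> < 1.\<close>
  have ne: "P \<noteq> {}"
  proof
    assume "P = {}"
    then have z: "rho x = 0" if "x \<in> {\<epsilon>..L - \<epsilon>}" for x
      using rho_bounds[of x] that by (force simp: P_def)
    have "1 = (LINT x|lborel. indicator {0..L} x * rho x)" using rho_integral by simp
    also have "\<dots> \<le> (LINT x|lborel. indicator {0..\<epsilon>} x + indicator {L - \<epsilon>..L} x :: real)"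
    proof (rule integral_mono[OF rho_integrable])
      show "integrable lborel (\<lambda>x. indicator {0..\<epsilon>} x + indicator {L - \<epsilon>..L} x :: real)"
        by (intro Bochner_Integration.integrable_add integrable_real_indicator) (use \<epsilon> in auto)
      fix x
      show "indicator {0..L} x * rho x \<le> indicator {0..\<epsilon>} x + indicator {L - \<epsilon>..L} x"
      proof (cases "x \<in> {\<epsilon>..L - \<epsilon>}")
        case True
        then show ?thesis using z by simp
      next
        case False
        then show ?thesis using rho_bounds[of x] by (auto simp: indicator_def)
      qed
    qed
    also have "\<dots> = 2 * \<epsilon>" using \<epsilon> by simp
    finally show False using \<epsilon> by simp
  qed
  have bb: "bdd_below (\<Psi> ` P)" using \<Psi>b by (intro bdd_belowI2[of _ "- K"]) (force simp: P_def abs_le_iff)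
  have lP: "l \<le> \<Psi> x" if "x \<in> P" for x unfolding l_def using that bb by (intro cInf_lower) auto
  have lN: "\<Psi> x \<le> l" if "x \<in> {\<epsilon>..L - \<epsilon>}" "rho x < 1" for x
    unfolding l_def using ne
  proof (intro cInf_greatest)
    fix y assume "y \<in> \<Psi> ` P"
    then obtain x1 where x1: "x1 \<in> P" "y = \<Psi> x1" by auto
    have "2 * Ulog x - V x \<le> 2 * Ulog x1 - V x1"
      by (rule Euler_Lagrange[OF V]) (use x1 that \<epsilon> in \<open>auto simp: P_def\<close>)
    then show "\<Psi> x \<le> y" by (simp add: x1 \<Psi>_def)
  qed auto
  have lb: "\<bar>l\<bar> \<le> K"
  proof -
    obtain x1 where x1: "x1 \<in> P" using ne by auto
    then have "l \<le> K" using lP[OF x1] \<Psi>b[of x1] by (auto simp: P_def)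
    moreover have "- K \<le> l" unfolding l_def using ne \<Psi>b by (intro cInf_greatest) (force simp: P_def abs_le_iff)+
    ultimately show ?thesis by (simp add: abs_le_iff)
  qed
  have \<eta>: "0 \<le> \<eta>" using r h L by (simp add: \<eta>_def)
  have main: "max 0 (2 * Ur r x - Vc \<epsilon> x - l) \<le> rho x * (2 * Ur r x - Vc \<epsilon> x - l) + 2 * \<eta>" if x: "x \<in> {\<epsilon>..L - \<epsilon>}" for x
  proof -
    define f where "f = 2 * Ur r x - Vc \<epsilon> x - l"
    have xL: "x \<in> {0..L}" using x \<epsilon> by auto
    have "Vc \<epsilon> x = V x" using x by (simp add: Vc_def)
    then have "f - (\<Psi> x - l) = 2 * (Ur r x - Ulog x)" by (simp add: f_def \<Psi>_def)
    then have "\<bar>f - (\<Psi> x - l)\<bar> = 2 * \<bar>Ur r x - Ulog x\<bar>" by (simp only: abs_mult abs_numeral)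
    also have "\<dots> \<le> \<eta>"
      unfolding \<eta>_def by (intro mult_left_mono Ur_close[OF xL r]) simp
    finally have "\<bar>f - (\<Psi> x - l)\<bar> \<le> \<eta>" .
    then have up: "rho x < 1 \<Longrightarrow> f \<le> \<eta>" and lo: "0 < rho x \<Longrightarrow> - \<eta> \<le> f"
      using lN[OF x] lP[of x] x by (auto simp: P_def abs_le_iff)
    \<comment> \<open>Up to \<eta>, f is nonpositive in voids, zero in bands and nonnegative in
      saturated regions; in each case max 0 f is nearly rho f.\<close>
    consider "rho x = 0" | "0 < rho x" "rho x < 1" | "rho x = 1" using rho_bounds[of x] by fastforce
    then have "max 0 f \<le> rho x * f + 2 * \<eta>"
    proof cases
      case 1
      then show ?thesis using up \<eta> by simp
    next
      case 2
      then have "f \<le> \<eta>" "- \<eta> \<le> f" using up lo by auto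
      then have "\<bar>rho x * f\<bar> \<le> 1 * \<eta>" unfolding abs_mult using rho_bounds[of x] by (intro mult_mono) (auto simp: abs_le_iff)
      then show ?thesis using \<open>f \<le> \<eta>\<close> \<eta> by (auto simp: abs_le_iff)
    next
      case 3
      then show ?thesis using lo \<eta> by auto
    qed
    then show ?thesis by (simp add: f_def)
  qed
  show ?thesis by (rule that[of l]) (use lb main in \<open>auto simp: K_def\<close>)
qed

end

subsection \<open>Comparison of lattice configurations\<close>

lemma sin_between:
  fixes v e :: real
  assumes "0 \<le> e" "e \<le> v" "v \<le> pi - e"
  shows "sin e \<le> sin v"
proof (cases "v \<le> pi / 2")
  case True
  then show ?thesis using assms by (intro sin_monotone_2pi_le) auto
next
  case False
  then have "sin e \<le> sin (pi - v)" using assms by (intro sin_monotone_2pi_le) auto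
  then show ?thesis by simp
qed

lemma sum_remove_diag:
  fixes f :: "'a \<Rightarrow> 'a \<Rightarrow> real"
  assumes "finite S"
  shows "(\<Sum>s\<in>S. \<Sum>t\<in>S - {s}. f s t) = (\<Sum>s\<in>S. \<Sum>t\<in>S. f s t) - (\<Sum>s\<in>S. f s s)"
  unfolding sum_subtractf[symmetric] by (rule sum.cong) (use assms in \<open>simp_all add: sum_diff1\<close>)

lemma sum_abs_le_card:
  fixes f :: "'a \<Rightarrow> real"
  assumes "\<And>s. s \<in> S \<Longrightarrow> \<bar>f s\<bar> \<le> B" "real (card S) \<le> m" "0 \<le> B"
  shows "\<bar>\<Sum>s\<in>S. f s\<bar> \<le> m * B"
proof -
  have "\<bar>\<Sum>s\<in>S. f s\<bar> \<le> (\<Sum>s\<in>S. B)" by (rule order_trans[OF sum_abs sum_mono]) (use assms in auto)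
  also have "\<dots> = real (card S) * B" by simp
  also have "\<dots> \<le> m * B" using assms by (intro mult_right_mono) auto
  finally show ?thesis .
qed

context racah_curve
begin

text \<open>n \<open>C1\<close> / sqrt \<epsilon> bounds the negative part of the interaction of one
  particle with particles on middle sites (\<open>lnd_cross_lower\<close>); n^2 \<open>C2\<close>
  \<epsilon> is the price of regularizing the energy (\<open>energy_lower\<close>).\<close>

definition C1 :: real where "C1 = 4 / h + 8 * sqrt (2 * (L + 1))"

definition C2 :: real where "C2 = 16 * sqrt (2 * (L + 1)) / sqrt h"

end

text \<open>One fixed n. \<epsilon> cuts off the ends, \<delta> is the error of the angle, \<eta>
  that of the logarithmic weights per n, and \<kappa> a constant common to all sites. The bound
  \<delta> \<le> h \<epsilon> / 4 keeps the true angles of the middle sites in [0, \<pi>].\<close>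

locale racah_lattice = racah_potential +
  fixes n M :: nat and pn \<delta> \<epsilon> \<kappa> \<eta> :: real and w :: "nat \<Rightarrow> real"
  assumes n0: "0 < n" and eps: "0 < \<epsilon>" "\<epsilon> < 1 / 4" and n_big: "4 \<le> \<epsilon> * real n"
    and pn: "\<bar>pn - p\<bar> \<le> \<delta>" "\<delta> \<le> h * \<epsilon> / 4"
    and M_up: "real M \<le> (L + \<epsilon> / 2) * real n" and M_lo: "(L - \<epsilon>) * real n \<le> real M"
    and hM: "h * real M \<le> pi / 2 * real n"
    and wts: "\<And>i. \<epsilon> * real n \<le> real i \<Longrightarrow> real i \<le> (L - \<epsilon>) * real n \<Longrightarrow>
        w i \<noteq> 0 \<and> \<bar>ln \<bar>w i\<bar> - \<kappa> + real n * V (real i / real n)\<bar> \<le> \<eta> * real n"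
begin

text \<open>\<open>tn\<close> is the angle of a site in the ensemble of size n, \<open>ts\<close>
  the one in the limit; they differ by the constant pn - p.\<close>

definition tn :: "nat \<Rightarrow> real" where "tn i = pn + 2 * h * (real i / real n)"
definition ts :: "nat \<Rightarrow> real" where "ts i = th (real i / real n)"
definition lnd :: "nat \<Rightarrow> nat \<Rightarrow> real" where "lnd i t = ln \<bar>2 * cos (tn i) - 2 * cos (tn t)\<bar>"
definition Mid :: "nat set" where "Mid = {i. \<epsilon> * real n \<le> real i \<and> real i \<le> (L - \<epsilon>) * real n}"
definition EN :: "nat set \<Rightarrow> real" where
  "EN S = (\<Sum>i\<in>S. \<Sum>t\<in>S - {i}. lnd i t) + (\<Sum>i\<in>S. ln \<bar>w i\<bar>)"
text \<open>With 1 - r = \<epsilon>^2 the error sqrt (1 - r) of \<open>Ur_close\<close> is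
  \<epsilon>, while \<open>Lam r\<close> stays below 10 / sqrt \<epsilon>.\<close>

definition r :: real where "r = 1 - \<epsilon>\<^sup>2"

lemma nn: "0 < real n" using n0 by simp

lemma r01: "0 < r" "r < 1" "1 - r = \<epsilon>\<^sup>2"
proof -
  have "\<epsilon>\<^sup>2 < 1\<^sup>2" using eps by (intro power_strict_mono) auto
  then show "0 < r" by (simp add: r_def)
  show "r < 1" "1 - r = \<epsilon>\<^sup>2" using eps by (auto simp: r_def)
qed

lemma d0: "0 \<le> \<delta>" using pn by linarith

lemma eta0: "0 \<le> \<eta>"
proof -
  define i where "i = nat \<lceil>\<epsilon> * real n\<rceil>"
  have "0 \<le> \<epsilon> * real n" using n_big by simp
  then have i: "\<epsilon> * real n \<le> real i" "real i \<le> \<epsilon> * real n + 1" unfolding i_def by linarith+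
  have "1 \<le> (L - 2 * \<epsilon>) * real n"
  proof -
    have "\<epsilon> * real n \<le> (L - 2 * \<epsilon>) * real n" using eps L1 nn by (intro mult_right_mono) auto
    then show ?thesis using n_big by linarith
  qed
  then have "real i \<le> (L - \<epsilon>) * real n" using i by (simp add: algebra_simps)
  from wts[OF i(1) this] have "0 \<le> \<eta> * real n" by linarith
  then show ?thesis using nn by (simp add: zero_le_mult_iff)
qed

lemma M_bound: "real M \<le> (L + 1) * real n"
proof -
  have "(L + \<epsilon> / 2) * real n \<le> (L + 1) * real n" using eps nn by (intro mult_right_mono) linarith+
  then show ?thesis using M_up by linarith
qed

lemma Mid_x: "i \<in> Mid \<Longrightarrow> real i / real n \<in> {\<epsilon>..L - \<epsilon>}"
  using nn by (auto simp: Mid_def field_simps)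

lemma Mid_sub: "Mid \<subseteq> {0..M}"
proof
  fix i assume "i \<in> Mid"
  then have "real i \<le> real M" using M_lo unfolding Mid_def by simp
  then show "i \<in> {0..M}" by simp
qed

lemma Mid_fin: "finite Mid" using Mid_sub finite_subset by blast

lemma tn_diff: "\<bar>tn i - tn t\<bar> = 2 * h * \<bar>real i - real t\<bar> / real n"
proof -
  have "tn i - tn t = 2 * h / real n * (real i - real t)"
    by (simp add: tn_def right_diff_distrib diff_divide_distrib)
  then show ?thesis using h nn by (simp add: abs_mult)
qed

lemma tn_ts: "\<bar>tn i - ts i\<bar> \<le> \<delta>"
  using pn by (simp add: tn_def ts_def th_def)

lemma tn_range: assumes "i \<in> Mid" shows "0 \<le> tn i" "tn i \<le> pi"
proof -
  have x: "\<epsilon> \<le> real i / real n" "real i / real n \<le> L - \<epsilon>" using Mid_x[OF assms] by auto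
  have "h * \<epsilon> \<le> h * (real i / real n)" "h * (real i / real n) \<le> h * (L - \<epsilon>)"
    by (intro mult_left_mono; use x h in linarith)+
  then have *: "h * \<epsilon> \<le> h * (real i / real n)" "h * (real i / real n) \<le> h * L - h * \<epsilon>" by (simp_all add: algebra_simps)
  have he: "0 < h * \<epsilon>" using h eps by simp
  have pi': "p + 2 * (h * L) \<le> pi" and te: "tn i = pn + 2 * (h * (real i / real n))" using pL by (simp_all add: tn_def)
  have pn': "- \<delta> \<le> pn - p" "pn - p \<le> \<delta>" using pn(1) by (auto simp: abs_le_iff)
  have gen: "0 \<le> q + 2 * z \<and> q + 2 * z \<le> pi"
    if "e \<le> z" "z \<le> l - e" "0 < e" "d \<le> e / 4" "p + 2 * l \<le> pi" "- d \<le> q - p" "q - p \<le> d" for q z e l d :: real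
    using that p0 by auto
  show "0 \<le> tn i" "tn i \<le> pi" unfolding te using gen[OF * he pn(2) pi' pn'] by blast+
qed

text \<open>A site near the ends may have an angle near or beyond 0 or \<pi>, but averaged with the
  angle of a middle site it stays h \<epsilon> / 4 away from both. So the half-sum sine is bounded
  below and the distance is linear in |i - t|; \<open>hM\<close> keeps the difference of angles
  below \<pi>.\<close>

lemma sep:
  assumes t: "t \<in> Mid" and i: "i \<le> M"
  shows "h\<^sup>2 / 4 * \<epsilon> * (\<bar>real i - real t\<bar> / real n) \<le> \<bar>2 * cos (tn i) - 2 * cos (tn t)\<bar>"
proof -
  have x: "\<epsilon> \<le> real t / real n" "real t / real n \<le> L - \<epsilon>" using Mid_x[OF t] by auto
  have tM: "t \<le> M" using Mid_sub t by auto
  have he: "0 < h * \<epsilon>" using h eps by simp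
  have 1: "h * (\<bar>real i - real t\<bar> / real n) \<le> \<bar>2 * sin ((tn i - tn t) / 2)\<bar>"
  proof -
    have "\<bar>real i - real t\<bar> \<le> real M" using i tM by auto
    then have "h * \<bar>real i - real t\<bar> \<le> h * real M" using h by (intro mult_left_mono) auto
    then have "2 * h * \<bar>real i - real t\<bar> / real n \<le> pi" using hM nn by (simp add: divide_le_eq)
    then have "\<bar>tn i - tn t\<bar> \<le> pi" unfolding tn_diff .
    from sin_half_abs[OF this] show ?thesis unfolding tn_diff by simp
  qed
  have 2: "h * \<epsilon> / 4 \<le> \<bar>2 * sin ((tn i + tn t) / 2)\<bar>"
  proof -
    have te: "(tn i + tn t) / 2 = pn + h * (real i / real n) + h * (real t / real n)" by (simp add: tn_def algebra_simps add_divide_distrib)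
    have i0: "0 \<le> h * (real i / real n)" using h by simp
    have "h * (real i / real n) \<le> h * (L + \<epsilon> / 2)"
    proof (intro mult_left_mono)
      have "real i \<le> (L + \<epsilon> / 2) * real n" using i M_up by linarith
      then show "real i / real n \<le> L + \<epsilon> / 2" using nn by (simp add: divide_le_eq)
    qed (use h in auto)
    then have i1: "h * (real i / real n) \<le> h * L + h * \<epsilon> / 2" by (simp add: algebra_simps)
    have t0: "h * \<epsilon> \<le> h * (real t / real n)" and "h * (real t / real n) \<le> h * (L - \<epsilon>)"
      by (intro mult_left_mono; use x h in linarith)+
    then have t1: "h * (real t / real n) \<le> h * L - h * \<epsilon>" by (simp add: algebra_simps)
    have pi': "p + 2 * (h * L) \<le> pi" using pL by simp
    have pn': "- \<delta> \<le> pn - p" "pn - p \<le> \<delta>" using pn(1) by (auto simp: abs_le_iff)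
    have gen: "e / 4 \<le> q + z + v \<and> q + z + v \<le> pi - e / 4"
      if "0 \<le> z" "z \<le> l + e / 2" "e \<le> v" "v \<le> l - e" "p + 2 * l \<le> pi" "- d \<le> q - p" "q - p \<le> d" "d \<le> e / 4"
        "0 < e" for q z v e l d :: real
      using that p0 by auto
    have b: "h * \<epsilon> / 4 \<le> (tn i + tn t) / 2" "(tn i + tn t) / 2 \<le> pi - h * \<epsilon> / 4"
      unfolding te using gen[OF i0 i1 t0 t1 pi' pn' pn(2) he] by blast+
    have "h * \<epsilon> / 4 / 2 \<le> sin (h * \<epsilon> / 4)" using b he by (intro sin_ge_half) linarith+
    also have "\<dots> \<le> sin ((tn i + tn t) / 2)" using b he by (intro sin_between) linarith+
    finally show ?thesis using he by linarith
  qed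
  have "h\<^sup>2 / 4 * \<epsilon> * (\<bar>real i - real t\<bar> / real n) = (h * (\<bar>real i - real t\<bar> / real n)) * (h * \<epsilon> / 4)"
    by (simp add: power2_eq_square mult_ac)
  also have "\<dots> \<le> \<bar>2 * sin ((tn i - tn t) / 2)\<bar> * \<bar>2 * sin ((tn i + tn t) / 2)\<bar>"
    using 1 2 he by (intro mult_mono) auto
  finally show ?thesis unfolding cos_diff_as_sin .
qed

lemma sep_ne:
  assumes t: "t \<in> Mid" and i: "i \<le> M" and ne: "i \<noteq> t"
  shows "cos (tn i) \<noteq> cos (tn t)"
proof -
  have "0 < h\<^sup>2 / 4 * \<epsilon> * (\<bar>real i - real t\<bar> / real n)" using h eps ne nn by simp
  then show ?thesis using sep[OF t i] by auto
qed

lemma lnd_commute: "lnd i t = lnd t i"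
  unfolding lnd_def by (simp add: abs_minus_commute)

lemma site_sum: assumes "i \<le> M" "T \<subseteq> {0..M}"
  shows "(\<Sum>t\<in>T - {i}. 1 / sqrt \<bar>real i - real t\<bar>) \<le> 4 * sqrt (2 * (L + 1)) * sqrt (real n)"
proof -
  have "(\<Sum>t\<in>T - {i}. 1 / sqrt \<bar>real i - real t\<bar>) \<le> 4 * sqrt (real (M + i))"
    by (rule sum_inverse_sqrt_dist[OF assms(2)])
  also have "real (M + i) \<le> 2 * (L + 1) * real n"
  proof -
    have "real i \<le> real M" using assms(1) by simp
    moreover have "2 * (L + 1) * real n = 2 * ((L + 1) * real n)" by simp
    ultimately show ?thesis using M_bound unfolding of_nat_add by linarith
  qed
  then have "4 * sqrt (real (M + i)) \<le> 4 * sqrt (2 * (L + 1) * real n)" by simp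
  finally show ?thesis by (simp add: real_sqrt_mult)
qed

lemma lnd_cross_lower:
  assumes T: "T \<subseteq> Mid" "card T \<le> n" and i: "i \<le> M" "i \<notin> T"
  shows "- (real n * (C1 / sqrt \<epsilon>)) \<le> (\<Sum>t\<in>T. lnd i t)"
proof -
  have "- lnd i t \<le> 4 / h / sqrt \<epsilon> + 2 * sqrt (real n) * (1 / sqrt \<bar>real i - real t\<bar>)" if "t \<in> T" for t
  proof -
    have tM: "t \<in> Mid" "i \<noteq> t" using that T i by auto
    define y where "y = \<bar>real i - real t\<bar> / real n"
    define c where "c = h\<^sup>2 / 4 * \<epsilon>"
    have y: "0 < y" using tM nn by (simp add: y_def)
    have c: "0 < c" using h eps by (simp add: c_def)
    have "c * y \<le> \<bar>2 * cos (tn i) - 2 * cos (tn t)\<bar>" using sep[OF tM(1) i(1)] by (simp add: y_def c_def)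
    moreover have cy: "0 < c * y" using c y by (rule mult_pos_pos)
    ultimately have "ln (c * y) \<le> lnd i t" unfolding lnd_def
      by (subst ln_le_cancel_iff) linarith+
    moreover have "ln (c * y) = ln c + ln y" using c y by (intro ln_mult_pos)
    ultimately have "- lnd i t \<le> 2 / sqrt c + 2 / sqrt y"
      using ln_ge_minus_sqrt[OF c] ln_ge_minus_sqrt[OF y] by linarith
    moreover have "2 / sqrt c = 4 / h / sqrt \<epsilon>"
      unfolding c_def using h by (simp add: real_sqrt_mult real_sqrt_divide)
    moreover have "2 / sqrt y = 2 * sqrt (real n) * (1 / sqrt \<bar>real i - real t\<bar>)"
      unfolding y_def by (simp add: real_sqrt_divide)
    ultimately show ?thesis by simp
  qed
  then have "- (\<Sum>t\<in>T. lnd i t) \<le> (\<Sum>t\<in>T. 4 / h / sqrt \<epsilon> + 2 * sqrt (real n) * (1 / sqrt \<bar>real i - real t\<bar>))"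
    unfolding sum_negf[symmetric] by (intro sum_mono) auto
  also have "\<dots> = real (card T) * (4 / h / sqrt \<epsilon>) + 2 * sqrt (real n) * (\<Sum>t\<in>T - {i}. 1 / sqrt \<bar>real i - real t\<bar>)"
    using i(2) by (simp add: sum.distrib sum_distrib_left)
  also have "\<dots> \<le> real n * (4 / h / sqrt \<epsilon>) + 2 * sqrt (real n) * (4 * sqrt (2 * (L + 1)) * sqrt (real n))"
    using T Mid_sub h eps i by (intro add_mono mult_right_mono mult_left_mono site_sum) auto
  also have "2 * sqrt (real n) * (4 * sqrt (2 * (L + 1)) * sqrt (real n)) = real n * (8 * sqrt (2 * (L + 1)))"
  proof -
    have "sqrt (real n) * sqrt (real n) = real n" by simp
    then show ?thesis by (simp add: mult_ac)
  qed
  also have "real n * (4 / h / sqrt \<epsilon>) + real n * (8 * sqrt (2 * (L + 1))) \<le> real n * (C1 / sqrt \<epsilon>)"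
  proof -
    have "sqrt \<epsilon> \<le> 1" "0 < sqrt \<epsilon>" using eps by auto
    then have "8 * sqrt (2 * (L + 1)) \<le> 8 * sqrt (2 * (L + 1)) / sqrt \<epsilon>"
      using L by (simp add: le_divide_eq mult_left_le)
    then have "4 / h / sqrt \<epsilon> + 8 * sqrt (2 * (L + 1)) \<le> C1 / sqrt \<epsilon>" by (simp add: C1_def add_divide_distrib)
    then have "real n * (4 / h / sqrt \<epsilon> + 8 * sqrt (2 * (L + 1))) \<le> real n * (C1 / sqrt \<epsilon>)" by (intro mult_left_mono) auto
    then show ?thesis by (simp add: distrib_left)
  qed
  finally show ?thesis by linarith
qed

lemma lnd_upper: "lnd i t \<le> 2"
proof (cases "2 * cos (tn i) - 2 * cos (tn t) = 0")
  case False
  have "\<bar>2 * cos (tn i) - 2 * cos (tn t)\<bar> \<le> 4"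
    using cos_le_one[of "tn i"] cos_le_one[of "tn t"] cos_ge_minus_one[of "tn i"] cos_ge_minus_one[of "tn t"] by linarith
  then have "lnd i t \<le> ln 4" unfolding lnd_def using False by (subst ln_le_cancel_iff) auto
  also have "ln 4 = 2 * ln (2::real)" using ln_realpow[of "2::real" 2] by simp
  finally show ?thesis using ln_2_less_1 by linarith
qed (simp add: lnd_def)

text \<open>Passing from the logarithm to \<open>lk\<close> costs 2 \<epsilon>^2 per pair;
  completing the double sum by its diagonal, which the quadratic form needs, costs at most
  \<open>Lam r\<close> per particle.\<close>

lemma energy_upper:
  assumes S: "finite S" "card S \<le> n" and inj: "inj_on (\<lambda>i. cos (tn i)) S"
  shows "(\<Sum>i\<in>S. \<Sum>t\<in>S - {i}. lnd i t) \<le>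
    (\<Sum>i\<in>S. \<Sum>t\<in>S. lk r (tn i) (tn t)) + real n * Lam r + (real n)\<^sup>2 * (2 * \<epsilon>\<^sup>2)"
proof -
  have "(\<Sum>i\<in>S. \<Sum>t\<in>S - {i}. lnd i t) \<le> (\<Sum>i\<in>S. \<Sum>t\<in>S - {i}. lk r (tn i) (tn t) + 2 * \<epsilon>\<^sup>2)"
  proof (intro sum_mono)
    fix i t assume "i \<in> S" "t \<in> S - {i}"
    then have "cos (tn i) \<noteq> cos (tn t)" using inj by (auto dest: inj_onD)
    then show "lnd i t \<le> lk r (tn i) (tn t) + 2 * \<epsilon>\<^sup>2"
      unfolding lnd_def using ln_cos_diff_le_lk[OF r01(1,2)] r01(3) by simp
  qed
  also have "\<dots> = (\<Sum>i\<in>S. \<Sum>t\<in>S. lk r (tn i) (tn t) + 2 * \<epsilon>\<^sup>2) - (\<Sum>i\<in>S. lk r (tn i) (tn i) + 2 * \<epsilon>\<^sup>2)"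
    by (rule sum_remove_diag[OF S(1)])
  also have "(\<Sum>i\<in>S. \<Sum>t\<in>S. lk r (tn i) (tn t) + 2 * \<epsilon>\<^sup>2) = (\<Sum>i\<in>S. \<Sum>t\<in>S. lk r (tn i) (tn t)) + (real (card S))\<^sup>2 * (2 * \<epsilon>\<^sup>2)"
    by (simp add: sum.distrib power2_eq_square)
  also have "- (\<Sum>i\<in>S. lk r (tn i) (tn i) + 2 * \<epsilon>\<^sup>2) \<le> real n * Lam r"
  proof -
    have "- (lk r (tn i) (tn i) + 2 * \<epsilon>\<^sup>2) \<le> Lam r" for i
    proof -
      have "\<bar>lk r (tn i) (tn i)\<bar> \<le> Lam r" unfolding Lam_def by (rule lk_bounds(3)) (use r01 in auto)
      moreover have "0 \<le> 2 * \<epsilon>\<^sup>2" by simp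
      ultimately show ?thesis by linarith
    qed
    then have "(\<Sum>i\<in>S. - (lk r (tn i) (tn i) + 2 * \<epsilon>\<^sup>2)) \<le> (\<Sum>i\<in>S. Lam r)" by (intro sum_mono) auto
    also have "\<dots> = real (card S) * Lam r" by simp
    also have "\<dots> \<le> real n * Lam r"
    proof (rule mult_right_mono)
      have "\<bar>lk r 0 0\<bar> \<le> Lam r" unfolding Lam_def by (rule lk_bounds(3)) (use r01 in auto)
      then show "0 \<le> Lam r" by linarith
    qed (use S in auto)
    finally show ?thesis unfolding sum_negf .
  qed
  then have "(\<Sum>i\<in>S. \<Sum>t\<in>S. lk r (tn i) (tn t)) + (real (card S))\<^sup>2 * (2 * \<epsilon>\<^sup>2) - (\<Sum>i\<in>S. lk r (tn i) (tn i) + 2 * \<epsilon>\<^sup>2)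
     \<le> (\<Sum>i\<in>S. \<Sum>t\<in>S. lk r (tn i) (tn t)) + (real (card S))\<^sup>2 * (2 * \<epsilon>\<^sup>2) + real n * Lam r" by linarith
  also have "(real (card S))\<^sup>2 * (2 * \<epsilon>\<^sup>2) \<le> (real n)\<^sup>2 * (2 * \<epsilon>\<^sup>2)"
    using S by (intro mult_right_mono power_mono) auto
  finally show ?thesis by linarith
qed

text \<open>In this direction the error is singular, of size \<epsilon> sqrt (n / |i - t|) for a
  pair; \<open>site_sum\<close> adds it up to O(\<epsilon> n) per particle. The comparison needs
  both angles in [0, \<pi>], hence sites in \<open>Mid\<close>.\<close>

lemma energy_lower:
  assumes T: "T \<subseteq> Mid" "card T \<le> n"
  shows "(\<Sum>i\<in>T. \<Sum>t\<in>T. lk r (tn i) (tn t)) - 2 * real n - (real n)\<^sup>2 * (C2 * \<epsilon>)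
    \<le> (\<Sum>i\<in>T. \<Sum>t\<in>T - {i}. lnd i t)"
proof -
  have fT: "finite T" using T Mid_fin finite_subset by blast
  have b: "lk r (tn i) (tn t) - lnd i t \<le> 4 * \<epsilon> / sqrt h * sqrt (real n) * (1 / sqrt \<bar>real i - real t\<bar>)"
    if "i \<in> T" "t \<in> T - {i}" for i t
  proof -
    have sm: "i \<in> Mid" "t \<in> Mid" "i \<noteq> t" using that T by auto
    have ne: "tn i \<noteq> tn t"
    proof
      assume "tn i = tn t"
      then have "2 * h * \<bar>real i - real t\<bar> / real n = 0" using tn_diff[of i t] by simp
      then show False using h nn sm by simp
    qed
    have "lk r (tn i) (tn t) \<le> lnd i t + 4 * sqrt (2 * (1 - r) / \<bar>tn i - tn t\<bar>)"
      unfolding lnd_def by (rule lk_le_ln_cos_diff[OF r01(1,2) tn_range[OF sm(1)] tn_range[OF sm(2)] ne])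
    also have "2 * (1 - r) / \<bar>tn i - tn t\<bar> = \<epsilon>\<^sup>2 / h * (real n * (1 / \<bar>real i - real t\<bar>))"
      unfolding tn_diff r01(3) using h nn by (simp add: divide_simps)
    also have "4 * sqrt (\<epsilon>\<^sup>2 / h * (real n * (1 / \<bar>real i - real t\<bar>))) = 4 * \<epsilon> / sqrt h * sqrt (real n) * (1 / sqrt \<bar>real i - real t\<bar>)"
      unfolding real_sqrt_mult real_sqrt_divide using eps by simp
    finally show ?thesis by simp
  qed
  have "(\<Sum>i\<in>T. \<Sum>t\<in>T - {i}. lk r (tn i) (tn t)) - (\<Sum>i\<in>T. \<Sum>t\<in>T - {i}. lnd i t)
    \<le> (\<Sum>i\<in>T. \<Sum>t\<in>T - {i}. 4 * \<epsilon> / sqrt h * sqrt (real n) * (1 / sqrt \<bar>real i - real t\<bar>))"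
    unfolding sum_subtractf[symmetric] by (intro sum_mono b) auto
  also have "\<dots> = (\<Sum>i\<in>T. 4 * \<epsilon> / sqrt h * sqrt (real n) * (\<Sum>t\<in>T - {i}. 1 / sqrt \<bar>real i - real t\<bar>))"
    by (simp only: sum_distrib_left)
  also have "\<dots> \<le> (\<Sum>i\<in>T. 4 * \<epsilon> / sqrt h * sqrt (real n) * (4 * sqrt (2 * (L + 1)) * sqrt (real n)))"
    using T Mid_sub eps h by (intro sum_mono mult_left_mono site_sum) auto
  also have "\<dots> = real (card T) * (real n * (C2 * \<epsilon>))"
  proof -
    have "sqrt (real n) * sqrt (real n) = real n" by simp
    then have "4 * \<epsilon> / sqrt h * sqrt (real n) * (4 * sqrt (2 * (L + 1)) * sqrt (real n)) = real n * (C2 * \<epsilon>)"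
      by (simp add: C2_def mult_ac)
    then show ?thesis by simp
  qed
  also have "\<dots> \<le> real n * (real n * (C2 * \<epsilon>))"
    using T L h eps by (intro mult_right_mono) (auto simp: C2_def)
  finally have 1: "(\<Sum>i\<in>T. \<Sum>t\<in>T - {i}. lk r (tn i) (tn t)) - (\<Sum>i\<in>T. \<Sum>t\<in>T - {i}. lnd i t) \<le> (real n)\<^sup>2 * (C2 * \<epsilon>)"
    by (simp add: power2_eq_square)
  have "(\<Sum>i\<in>T. lk r (tn i) (tn i)) \<le> (\<Sum>i\<in>T. 2)"
  proof (rule sum_mono)
    fix i
    have "lk r (tn i) (tn i) \<le> 2 * ln 2" by (rule lk_bounds(2)) (use r01 in auto)
    then show "lk r (tn i) (tn i) \<le> 2" using ln_2_less_1 by linarith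
  qed
  also have "\<dots> = 2 * real (card T)" by simp
  also have "\<dots> \<le> 2 * real n" using T by simp
  finally show ?thesis using 1 unfolding sum_remove_diag[OF fT] by linarith
qed

text \<open>The Lipschitz constant of \<open>lk\<close> is of order (1 - r)^-2 = \<epsilon>^-4, so
  \<delta> has to be small compared with \<epsilon>^4.\<close>

lemma lk_shift:
  assumes "card S \<le> n"
  shows "\<bar>(\<Sum>i\<in>S. \<Sum>t\<in>S. lk r (tn i) (tn t)) - (\<Sum>i\<in>S. \<Sum>t\<in>S. lk r (ts i) (ts t))\<bar> \<le> (real n)\<^sup>2 * (4 * \<delta> / \<epsilon>^4)"
proof -
  have e4: "(1 - r)\<^sup>2 = \<epsilon>^4" unfolding r01(3) by (simp add: power2_eq_square power4_eq_xxxx)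
  have "(\<Sum>i\<in>S. \<Sum>t\<in>S. lk r (tn i) (tn t)) - (\<Sum>i\<in>S. \<Sum>t\<in>S. lk r (ts i) (ts t)) = (\<Sum>i\<in>S. \<Sum>t\<in>S. lk r (tn i) (tn t) - lk r (ts i) (ts t))"
    by (simp add: sum_subtractf)
  also have "\<bar>\<dots>\<bar> \<le> real n * (real n * (4 * \<delta> / \<epsilon>^4))"
  proof (rule sum_abs_le_card)
    fix i show "\<bar>\<Sum>t\<in>S. lk r (tn i) (tn t) - lk r (ts i) (ts t)\<bar> \<le> real n * (4 * \<delta> / \<epsilon>^4)"
    proof (rule sum_abs_le_card)
      fix t
      have "\<bar>lk r (tn i) (tn t) - lk r (ts i) (ts t)\<bar> \<le> 2 * (\<bar>tn i - ts i\<bar> + \<bar>tn t - ts t\<bar>) / (1 - r)\<^sup>2"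
        by (rule lk_lipschitz[OF r01(1,2)])
      also have "\<dots> \<le> 4 * \<delta> / (1 - r)\<^sup>2" using tn_ts[of i] tn_ts[of t] by (intro divide_right_mono) auto
      finally show "\<bar>lk r (tn i) (tn t) - lk r (ts i) (ts t)\<bar> \<le> 4 * \<delta> / \<epsilon>^4" unfolding e4 .
    qed (use assms d0 eps in auto)
  qed (use assms d0 eps in auto)
  finally show ?thesis by (simp add: power2_eq_square mult_ac)
qed

text \<open>The two sets have equal cardinality, so the unknown constant \<kappa> drops out.\<close>

lemma weight_compare:
  assumes S: "S \<subseteq> Mid" "T \<subseteq> Mid" "card S = card T" "card T \<le> n"
  shows "(\<Sum>i\<in>S. ln \<bar>w i\<bar>) - (\<Sum>i\<in>T. ln \<bar>w i\<bar>) \<le>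
    - real n * ((\<Sum>i\<in>S. V (real i / real n)) - (\<Sum>i\<in>T. V (real i / real n))) + 2 * (real n)\<^sup>2 * \<eta>"
proof -
  have b: "\<bar>(\<Sum>i\<in>A. ln \<bar>w i\<bar>) - real (card A) * \<kappa> + real n * (\<Sum>i\<in>A. V (real i / real n))\<bar> \<le> real n * (\<eta> * real n)"
    if "A \<subseteq> Mid" "card A \<le> n" for A
  proof -
    have "(\<Sum>i\<in>A. ln \<bar>w i\<bar>) - real (card A) * \<kappa> + real n * (\<Sum>i\<in>A. V (real i / real n))
       = (\<Sum>i\<in>A. ln \<bar>w i\<bar> - \<kappa> + real n * V (real i / real n))"
      by (simp add: sum.distrib sum_subtractf sum_distrib_left)
    also have "\<bar>\<dots>\<bar> \<le> real n * (\<eta> * real n)"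
      by (rule sum_abs_le_card) (use that wts eta0 in \<open>auto simp: Mid_def\<close>)
    finally show ?thesis .
  qed
  have "\<bar>(\<Sum>i\<in>S. ln \<bar>w i\<bar>) - real (card T) * \<kappa> + real n * (\<Sum>i\<in>S. V (real i / real n))\<bar> \<le> real n * (\<eta> * real n)"
    using b[of S] S by simp
  moreover have "\<bar>(\<Sum>i\<in>T. ln \<bar>w i\<bar>) - real (card T) * \<kappa> + real n * (\<Sum>i\<in>T. V (real i / real n))\<bar> \<le> real n * (\<eta> * real n)"
    using b[of T] S by simp
  moreover have "real n * (\<eta> * real n) = (real n)\<^sup>2 * \<eta>" "2 * (real n)\<^sup>2 * \<eta> = 2 * ((real n)\<^sup>2 * \<eta>)"
    by (simp_all add: power2_eq_square)
  ultimately show ?thesis unfolding right_diff_distrib minus_mult_left[symmetric] by linarith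
qed

end

lemma sum_indicator_diff:
  fixes f :: "'i \<Rightarrow> real"
  assumes "finite I" "S \<subseteq> I" "T \<subseteq> I"
  shows "(\<Sum>i\<in>I. (indicator S i - indicator T i) * f i) = sum f S - sum f T"
proof -
  have e: "(\<Sum>i\<in>I. indicator A i * f i) = sum f A" if "A \<subseteq> I" for A
  proof -
    have "(\<Sum>i\<in>I. indicator A i * f i) = (\<Sum>i\<in>I. if i \<in> A then f i else 0)"
      by (intro sum.cong) (auto simp: indicator_def)
    also have "\<dots> = sum f (I \<inter> A)" by (rule sum.inter_restrict[symmetric, OF assms(1)])
    finally show ?thesis using that by (simp add: Int_absorb1)
  qed
  show ?thesis unfolding left_diff_distrib sum_subtractf e[OF assms(2)] e[OF assms(3)] ..
qed

text \<open>Expansion of a quadratic form around T: the square of the difference plus twice the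
  linear term in which T generates the potential.\<close>

lemma quadratic_sum_compare:
  fixes k :: "'i \<Rightarrow> 'i \<Rightarrow> real"
  assumes I: "finite I" "S \<subseteq> I" "T \<subseteq> I" and sym: "\<And>i j. k i j = k j i"
  defines "c \<equiv> \<lambda>i. indicator S i - indicator T i :: real"
  shows "(\<Sum>i\<in>S. \<Sum>j\<in>S. k i j) - (\<Sum>i\<in>T. \<Sum>j\<in>T. k i j) =
    (\<Sum>i\<in>I. \<Sum>j\<in>I. c i * c j * k i j) + 2 * ((\<Sum>i\<in>S. \<Sum>j\<in>T. k i j) - (\<Sum>i\<in>T. \<Sum>j\<in>T. k i j))"
proof -
  have "(\<Sum>i\<in>I. \<Sum>j\<in>I. c i * c j * k i j) = (\<Sum>i\<in>I. c i * ((\<Sum>j\<in>S. k i j) - (\<Sum>j\<in>T. k i j)))"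
  proof (rule sum.cong[OF refl])
    fix i
    have "(\<Sum>j\<in>I. c i * c j * k i j) = c i * (\<Sum>j\<in>I. c j * k i j)" by (simp add: sum_distrib_left mult.assoc)
    also have "(\<Sum>j\<in>I. c j * k i j) = (\<Sum>j\<in>S. k i j) - (\<Sum>j\<in>T. k i j)"
      unfolding c_def by (rule sum_indicator_diff[OF I])
    finally show "(\<Sum>j\<in>I. c i * c j * k i j) = c i * ((\<Sum>j\<in>S. k i j) - (\<Sum>j\<in>T. k i j))" .
  qed
  also have "\<dots> = (\<Sum>i\<in>S. (\<Sum>j\<in>S. k i j) - (\<Sum>j\<in>T. k i j)) - (\<Sum>i\<in>T. (\<Sum>j\<in>S. k i j) - (\<Sum>j\<in>T. k i j))"
    unfolding c_def by (rule sum_indicator_diff[OF I])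
  also have "\<dots> = (\<Sum>i\<in>S. \<Sum>j\<in>S. k i j) - (\<Sum>i\<in>S. \<Sum>j\<in>T. k i j) - ((\<Sum>i\<in>T. \<Sum>j\<in>S. k i j) - (\<Sum>i\<in>T. \<Sum>j\<in>T. k i j))"
    by (simp only: sum_subtractf)
  also have "(\<Sum>i\<in>T. \<Sum>j\<in>S. k i j) = (\<Sum>i\<in>S. \<Sum>j\<in>T. k i j)"
    by (subst sum.swap) (intro sum.cong refl sym)
  finally show ?thesis by simp
qed

text \<open>The selected sites need not have the required cardinality. A set nested with them can be
  corrected to it, and sums then change by at most the number of corrected sites
  (\<open>comparable_sum_diff\<close>).\<close>

lemma obtain_comparable_subset:
  assumes "finite A" "B \<subseteq> A" "m \<le> card A"
  obtains T where "T \<subseteq> A" "card T = m" "T \<subseteq> B \<or> B \<subseteq> T"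
proof (cases "m \<le> card B")
  case True
  then obtain T where "T \<subseteq> B" "card T = m" using obtain_subset_with_card_n by metis
  then show ?thesis using that[of T] assms by auto
next
  case False
  have fB: "finite B" using assms finite_subset by blast
  then have "m - card B \<le> card (A - B)" using assms by (simp add: card_Diff_subset)
  then obtain C where C: "C \<subseteq> A - B" "card C = m - card B" using obtain_subset_with_card_n by metis
  have "finite C" using C assms finite_subset by blast
  then have "card (B \<union> C) = m" using C fB False by (subst card_Un_disjoint) auto
  then show ?thesis using that[of "B \<union> C"] C assms by auto
qed

lemma comparable_sum_diff:
  fixes f :: "'i \<Rightarrow> real"
  assumes "finite T" "finite U" "T \<subseteq> U \<or> U \<subseteq> T" "\<bar>real (card T) - real (card U)\<bar> \<le> m" "\<And>i. \<bar>f i\<bar> \<le> B" "0 \<le> B"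
  shows "\<bar>sum f T - sum f U\<bar> \<le> m * B"
proof -
  have *: "\<bar>sum f W - sum f T\<bar> \<le> m * B" if "finite W" "T \<subseteq> W" "\<bar>real (card T) - real (card W)\<bar> \<le> m" for W T
  proof -
    have "sum f W - sum f T = sum f (W - T)" using that by (simp add: sum_diff)
    moreover have "real (card (W - T)) \<le> m"
      using that by (simp add: card_Diff_subset finite_subset card_mono of_nat_diff)
    ultimately show ?thesis using sum_abs_le_card[of "W - T" f B m] assms by auto
  qed
  show ?thesis using *[of U T] *[of T U] assms by (auto simp: abs_minus_commute)
qed

section \<open>Linear statistics of the selected sites\<close>

context racah_lattice
begin

definition sites :: "nat set" where
  "sites = {i. \<epsilon> * real n \<le> real i \<and> real i \<le> (L - \<epsilon>) * real n \<and>
     \<lfloor>real n * integral {0..real (Suc i) / real n} rho\<rfloor> \<noteq> \<lfloor>real n * integral {0..real i / real n} rho\<rfloor>}"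

lemma sites_Mid: "sites \<subseteq> Mid" by (auto simp: sites_def Mid_def)

lemma sites_fin: "finite sites" using sites_Mid Mid_fin finite_subset by blast

lemma rho_mult_integrable:
  assumes "\<And>x y. \<bar>f x - f y\<bar> \<le> K * \<bar>x - y\<bar>" "\<And>x. \<bar>f x\<bar> \<le> B"
  shows "(\<lambda>x. rho x * f x) integrable_on {u..v}" "\<bar>rho x * f x\<bar> \<le> B"
proof -
  have [measurable]: "f \<in> borel_measurable borel" by (rule lipschitz_borel[OF assms(1)])
  have b: "\<bar>rho x * f x\<bar> \<le> B" for x
    unfolding abs_mult using mult_mono[of "\<bar>rho x\<bar>" 1 "\<bar>f x\<bar>" B] rho_bounds[of x] assms(2)[of x] by simp
  then show "\<bar>rho x * f x\<bar> \<le> B" .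
  show "(\<lambda>x. rho x * f x) integrable_on {u..v}"
    by (rule borel_bounded_integrable[where B = B]) (auto simp: b)
qed

lemma eL: "\<epsilon> < L / 2" using eps L1 by simp

lemma sites_sum_mid:
  assumes f: "\<And>x y. \<bar>f x - f y\<bar> \<le> K * \<bar>x - y\<bar>" "\<And>x. \<bar>f x\<bar> \<le> B"
  shows "\<bar>(\<Sum>i\<in>sites. f (real i / real n)) - real n * integral {\<epsilon>..L - \<epsilon>} (\<lambda>x. rho x * f x)\<bar> \<le> 4 * B + 2 * K * (L + 1)"
proof -
  have K: "0 \<le> K" using f(1)[of 0 1] by (smt (verit) abs_ge_zero mult_cancel_left2)
  have "\<bar>(\<Sum>i\<in>sites. f (real i / real n)) - real n * integral {\<epsilon>..L - \<epsilon>} (\<lambda>x. rho x * f x)\<bar> \<le> 4 * B + 2 * K * (L - \<epsilon> - \<epsilon> + 1)"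
    unfolding sites_def by (rule floor_selection_sum) (use rho_bounds f eps eL n0 in auto)
  also have "\<dots> \<le> 4 * B + 2 * K * (L + 1)" using K eps by (intro add_left_mono mult_left_mono) auto
  finally show ?thesis .
qed

lemma Mid_sum:
  assumes f: "\<And>x y. \<bar>f x - f y\<bar> \<le> K * \<bar>x - y\<bar>" "\<And>x. \<bar>f x\<bar> \<le> B"
  shows "\<bar>(\<Sum>i\<in>Mid. f (real i / real n)) - real n * integral {\<epsilon>..L - \<epsilon>} f\<bar> \<le> 4 * B + 2 * K * (L + 1)"
proof -
  have K: "0 \<le> K" using f(1)[of 0 1] by (smt (verit) abs_ge_zero mult_cancel_left2)
  \<comment> \<open>For the density 1 the floor jumps at every site, so
    \<open>floor_selection_sum\<close> also covers the sum over all middle sites.\<close>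
  have M: "Mid = {i. \<epsilon> * real n \<le> real i \<and> real i \<le> (L - \<epsilon>) * real n \<and>
     \<lfloor>real n * integral {0..real (Suc i) / real n} (\<lambda>_. 1)\<rfloor> \<noteq> \<lfloor>real n * integral {0..real i / real n} (\<lambda>_. 1)\<rfloor>}"
    using nn by (simp add: Mid_def)
  have "\<bar>(\<Sum>i\<in>Mid. f (real i / real n)) - real n * integral {\<epsilon>..L - \<epsilon>} (\<lambda>x. 1 * f x)\<bar> \<le> 4 * B + 2 * K * (L - \<epsilon> - \<epsilon> + 1)"
    unfolding M by (rule floor_selection_sum) (use f eps eL n0 in auto)
  also have "\<dots> \<le> 4 * B + 2 * K * (L + 1)" using K eps by (intro add_left_mono mult_left_mono) auto
  finally show ?thesis by simp
qed

lemma rho_mult_outer: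
  assumes f: "\<And>x y. \<bar>f x - f y\<bar> \<le> K * \<bar>x - y\<bar>" "\<And>x. \<bar>f x\<bar> \<le> B"
  shows "\<bar>integral {0..L} (\<lambda>x. rho x * f x) - integral {\<epsilon>..L - \<epsilon>} (\<lambda>x. rho x * f x)\<bar> \<le> 2 * \<epsilon> * B"
proof -
  note i = rho_mult_integrable[OF f]
  have "integral {0..\<epsilon>} (\<lambda>x. rho x * f x) + integral {\<epsilon>..L} (\<lambda>x. rho x * f x) = integral {0..L} (\<lambda>x. rho x * f x)"
    by (rule Henstock_Kurzweil_Integration.integral_combine[OF _ _ i(1)]) (use eps eL in auto)
  moreover have "integral {\<epsilon>..L-\<epsilon>} (\<lambda>x. rho x * f x) + integral {L-\<epsilon>..L} (\<lambda>x. rho x * f x) = integral {\<epsilon>..L} (\<lambda>x. rho x * f x)"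
    by (rule Henstock_Kurzweil_Integration.integral_combine[OF _ _ i(1)]) (use eps eL in auto)
  moreover have "\<bar>integral {0..\<epsilon>} (\<lambda>x. rho x * f x)\<bar> \<le> B * (\<epsilon> - 0)"
    by (rule integral_abs_bound[OF i(1) _ i(2)]) (use eps in auto)
  moreover have "\<bar>integral {L-\<epsilon>..L} (\<lambda>x. rho x * f x)\<bar> \<le> B * (L - (L - \<epsilon>))"
    by (rule integral_abs_bound[OF i(1) _ i(2)]) (use eps in auto)
  ultimately show ?thesis by (simp add: mult.commute)
qed

lemma sites_card: "\<bar>real (card sites) - real n\<bar> \<le> 3 * \<epsilon> * real n" "real (card sites) \<le> real n + \<epsilon> * real n"
proof -
  define I where "I = integral {\<epsilon>..L - \<epsilon>} rho"
  have 1: "\<bar>real (card sites) - real n * I\<bar> \<le> 4"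
    using sites_sum_mid[of "\<lambda>_. 1" 0 1] by (simp add: I_def)
  have 2: "\<bar>1 - I\<bar> \<le> 2 * \<epsilon>"
    using rho_mult_outer[of "\<lambda>_. 1" 0 1] by (simp add: I_def rho_total)
  have "I \<le> 1"
  proof -
    have "integral {\<epsilon>..L - \<epsilon>} rho \<le> integral {0..L} rho"
      using rho_mult_integrable(1)[of "\<lambda>_. 1" 0 1] rho_bounds eps by (intro integral_subset_le) auto
    then show ?thesis by (simp add: I_def rho_total)
  qed
  then have "real n * I \<le> real n * 1" using nn by (intro mult_left_mono) auto
  moreover have "real n * (1 - 2 * \<epsilon>) \<le> real n * I" using 2 nn by (intro mult_left_mono) auto
  then have "real n - 2 * (\<epsilon> * real n) \<le> real n * I" by (simp add: algebra_simps)
  ultimately show "real (card sites) \<le> real n + \<epsilon> * real n" "\<bar>real (card sites) - real n\<bar> \<le> 3 * \<epsilon> * real n"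
    using 1 n_big by linarith+
qed

lemma outside_card: "real (card ({0..M} - Mid)) \<le> 3 * \<epsilon> * real n"
proof -
  define u where "u = nat \<lceil>\<epsilon> * real n\<rceil>"
  define v where "v = nat \<lfloor>(L - \<epsilon>) * real n\<rfloor>"
  have p: "0 \<le> \<epsilon> * real n" "0 \<le> (L - \<epsilon>) * real n" using eps eL by auto
  have u: "real u \<le> \<epsilon> * real n + 1" and v: "(L - \<epsilon>) * real n - 1 \<le> real v" "real v \<le> (L - \<epsilon>) * real n"
    unfolding u_def v_def using p by linarith+
  have vM: "v \<le> M" using v M_lo by linarith
  have "{0..M} - Mid \<subseteq> {..<u} \<union> {v<..M}"
  proof
    fix i assume i: "i \<in> {0..M} - Mid"
    then have "real i < \<epsilon> * real n \<or> (L - \<epsilon>) * real n < real i" by (auto simp: Mid_def)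
    then have "i < u \<or> v < i"
    proof
      assume "real i < \<epsilon> * real n"
      moreover have "\<epsilon> * real n \<le> real u" unfolding u_def using p by linarith
      ultimately show ?thesis by simp
    qed (use v in linarith)
    then show "i \<in> {..<u} \<union> {v<..M}" using i by auto
  qed
  then have "card ({0..M} - Mid) \<le> card ({..<u} \<union> {v<..M})" by (intro card_mono) auto
  also have "\<dots> \<le> u + (M - v)" using card_Un_le[of "{..<u}" "{v<..M}"] by simp
  finally have "real (card ({0..M} - Mid)) \<le> real u + (real M - real v)" using vM by (simp add: of_nat_diff flip: of_nat_add)
  also have "\<dots> \<le> (\<epsilon> * real n + 1) + ((L + \<epsilon> / 2) * real n - ((L - \<epsilon>) * real n - 1))" using u v M_up by linarith
  \<comment> \<open>The constant 2 is at most \<epsilon> n / 2 because 4 \<le> \<epsilon> n.\<close>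
  also have "\<dots> = 5 / 2 * (\<epsilon> * real n) + 2" by (simp add: algebra_simps)
  finally show ?thesis using n_big by linarith
qed

lemma lin_stat:
  assumes T: "finite T" "T \<subseteq> sites \<or> sites \<subseteq> T" "\<bar>real (card T) - real (card sites)\<bar> \<le> 4 * \<epsilon> * real n"
    and f: "\<And>x y. \<bar>f x - f y\<bar> \<le> K * \<bar>x - y\<bar>" "\<And>x. \<bar>f x\<bar> \<le> B"
  shows "\<bar>(\<Sum>i\<in>T. f (real i / real n)) - real n * integral {\<epsilon>..L - \<epsilon>} (\<lambda>x. rho x * f x)\<bar>
      \<le> 4 * \<epsilon> * real n * B + 4 * B + 2 * K * (L + 1)"
    and "\<bar>(\<Sum>i\<in>T. f (real i / real n)) - real n * integral {0..L} (\<lambda>x. rho x * f x)\<bar>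
      \<le> 6 * \<epsilon> * real n * B + 4 * B + 2 * K * (L + 1)"
proof -
  have B: "0 \<le> B" using f(2)[of 0] by linarith
  have "\<bar>(\<Sum>i\<in>T. f (real i / real n)) - (\<Sum>i\<in>sites. f (real i / real n))\<bar> \<le> 4 * \<epsilon> * real n * B"
    by (rule comparable_sum_diff) (use T sites_fin f B in auto)
  then show 1: "\<bar>(\<Sum>i\<in>T. f (real i / real n)) - real n * integral {\<epsilon>..L - \<epsilon>} (\<lambda>x. rho x * f x)\<bar>
      \<le> 4 * \<epsilon> * real n * B + 4 * B + 2 * K * (L + 1)"
    using sites_sum_mid[OF f] by linarith
  have "real n * \<bar>integral {0..L} (\<lambda>x. rho x * f x) - integral {\<epsilon>..L - \<epsilon>} (\<lambda>x. rho x * f x)\<bar> \<le> real n * (2 * \<epsilon> * B)"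
    using rho_mult_outer[OF f] by (intro mult_left_mono) auto
  then have "\<bar>real n * integral {0..L} (\<lambda>x. rho x * f x) - real n * integral {\<epsilon>..L - \<epsilon>} (\<lambda>x. rho x * f x)\<bar> \<le> 2 * \<epsilon> * real n * B"
    by (simp add: abs_mult right_diff_distrib[symmetric] mult_ac)
  then show "\<bar>(\<Sum>i\<in>T. f (real i / real n)) - real n * integral {0..L} (\<lambda>x. rho x * f x)\<bar>
      \<le> 6 * \<epsilon> * real n * B + 4 * B + 2 * K * (L + 1)"
    using 1 by linarith
qed

lemma Lam_pos: "0 \<le> Lam r"
proof -
  have "\<bar>lk r 0 0\<bar> \<le> Lam r" unfolding Lam_def by (rule lk_bounds(3)) (use r01 in auto)
  then show ?thesis by linarith
qed

lemma e4: "(1 - r)\<^sup>2 = \<epsilon>^4" unfolding r01(3) by (simp add: power2_eq_square power4_eq_xxxx)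

lemma lk_stat:
  assumes T: "finite T" "T \<subseteq> sites \<or> sites \<subseteq> T" "\<bar>real (card T) - real (card sites)\<bar> \<le> 4 * \<epsilon> * real n"
  shows "\<bar>(\<Sum>t\<in>T. lk r (ts i) (ts t)) - real n * Ur r (real i / real n)\<bar>
      \<le> 6 * \<epsilon> * real n * Lam r + 4 * Lam r + 8 * h * (L + 1) / \<epsilon>^4"
proof -
  have "\<bar>lk r (ts i) (th x) - lk r (ts i) (th y)\<bar> \<le> 4 * h / \<epsilon>^4 * \<bar>x - y\<bar>" for x y
  proof -
    have "\<bar>lk r (ts i) (th x) - lk r (ts i) (th y)\<bar> \<le> 2 * (\<bar>ts i - ts i\<bar> + \<bar>th x - th y\<bar>) / (1 - r)\<^sup>2"
      by (rule lk_lipschitz[OF r01(1,2)])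
    then show ?thesis unfolding e4 th_diff by simp
  qed
  moreover have "\<bar>lk r (ts i) (th x)\<bar> \<le> Lam r" for x
    unfolding Lam_def by (rule lk_bounds(3)) (use r01 in auto)
  ultimately have "\<bar>(\<Sum>t\<in>T. lk r (ts i) (th (real t / real n))) - real n * integral {0..L} (\<lambda>x. rho x * lk r (ts i) (th x))\<bar>
      \<le> 6 * \<epsilon> * real n * Lam r + 4 * Lam r + 2 * (4 * h / \<epsilon>^4) * (L + 1)"
    by (intro lin_stat(2)[OF T])
  then show ?thesis by (simp add: Ur_def ts_def)
qed

end

lemma abs_cos_diff_le: "\<bar>cos u - cos v\<bar> \<le> \<bar>u - v\<bar>" for u v :: real
proof -
  have "cos u - cos v = 2 * sin ((u + v) / 2) * sin ((v - u) / 2)" by (rule cos_diff_cos)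
  also have "\<bar>\<dots>\<bar> \<le> 2 * 1 * \<bar>(v - u) / 2\<bar>"
    unfolding abs_mult by (intro mult_mono abs_sin_x_le_abs_x) auto
  finally show ?thesis by simp
qed

section \<open>Energy comparison with the selected configuration\<close>

context racah_potential
begin

text \<open>\<open>C\<Phi>\<close> / sqrt \<epsilon> bounds the effective potential 2 U - V - l: the
  summands come from \<open>Lam_le\<close>, from V and from the bound on l in
  \<open>effective_potential\<close>.\<close>

definition C\<Phi> :: real where
  "C\<Phi> = 20 * L + 2 * CV * L + 2 * (2 * L + 24 * sqrt L / sqrt (2 * h))"

text \<open>Coefficient of n^2 sqrt \<epsilon> in the total error: 2 from
  \<open>energy_upper\<close>, \<open>C2\<close> from \<open>energy_lower\<close>, 240 from
  \<open>lk_stat\<close>, the next two terms from \<open>potential_compare\<close>, and 12 + 6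
  \<open>C1\<close> from the particles outside \<open>Mid\<close>.\<close>

definition E0 :: real where
  "E0 = 2 + C2 + 240 + 2 * L * (4 * L + 32 * sqrt L / sqrt h) + 4 * C\<Phi> + 12 + 6 * C1"

text \<open>The terms of order n. They blow up as \<epsilon> tends to 0, which does no harm since
  \<epsilon> is fixed before n grows.\<close>

definition E1 :: "real \<Rightarrow> real" where
  "E1 \<epsilon> = 170 / sqrt \<epsilon> + 2 + 32 * h * (L + 1) / \<epsilon>^4 + 8 * C\<Phi> / sqrt \<epsilon>
     + 4 * (8 * h * L / \<epsilon>^4 + CV / sqrt \<epsilon>) * (L + 1)"

lemma C\<Phi>_nonneg: "0 \<le> C\<Phi>" unfolding C\<Phi>_def using L CV_nonneg h by simp

end

context racah_lattice
begin

lemma sqrt_eps: "0 < sqrt \<epsilon>" "sqrt \<epsilon> \<le> 1" "\<epsilon> / sqrt \<epsilon> = sqrt \<epsilon>" "\<epsilon> \<le> sqrt \<epsilon>" "1 \<le> 1 / sqrt \<epsilon>"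
proof -
  show 1: "0 < sqrt \<epsilon>" "sqrt \<epsilon> \<le> 1" using eps by auto
  show "\<epsilon> / sqrt \<epsilon> = sqrt \<epsilon>" using eps by (simp add: real_div_sqrt)
  have "sqrt \<epsilon> * sqrt \<epsilon> \<le> sqrt \<epsilon> * 1" using 1 by (intro mult_left_mono) auto
  then show "\<epsilon> \<le> sqrt \<epsilon>" using eps by simp
  show "1 \<le> 1 / sqrt \<epsilon>" using 1 by simp
qed

lemma Lam_le: "Lam r \<le> 10 / sqrt \<epsilon>"
proof -
  have "Lam r = 2 + 4 * (- ln \<epsilon>)" using eps by (simp add: Lam_def r01(3) ln_realpow)
  also have "\<dots> \<le> 2 + 4 * (2 / sqrt \<epsilon>)" using ln_ge_minus_sqrt[OF eps(1)] by linarith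
  finally show ?thesis using sqrt_eps(5) by linarith
qed

text \<open>Bathtub principle: the sum of the effective potential over any S is at most the sum of
  its positive part over all middle sites. This is about n times the integral of max 0 \<phi>, hence
  by the Euler-Lagrange conditions about n times that of rho \<phi>, which is what T
  attains.\<close>

lemma potential_compare:
  assumes S: "S \<subseteq> Mid" "card S = card T"
    and T: "T \<subseteq> Mid" "T \<subseteq> sites \<or> sites \<subseteq> T" "\<bar>real (card T) - real (card sites)\<bar> \<le> 4 * \<epsilon> * real n"
  shows "(\<Sum>i\<in>S. 2 * Ur r (real i / real n) - V (real i / real n)) - (\<Sum>i\<in>T. 2 * Ur r (real i / real n) - V (real i / real n))
    \<le> real n * ((2 * L * (4 * L + 32 * sqrt L / sqrt h) + 4 * C\<Phi>) * sqrt \<epsilon>)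
      + 8 * C\<Phi> / sqrt \<epsilon> + 4 * (8 * h * L / \<epsilon>^4 + CV / sqrt \<epsilon>) * (L + 1)"
proof -
  define \<eta>' where "\<eta>' = 2 * (2 * (1 - r) * L + 16 * sqrt ((1 - r) / h) * sqrt L)"
  have e2: "\<epsilon> < 1 / 2" using eps by simp
  obtain l where l: "\<bar>l\<bar> \<le> 2 * (2 * L + 24 * sqrt L / sqrt (2 * h)) + CV * L / sqrt \<epsilon>"
    "\<And>x. x \<in> {\<epsilon>..L - \<epsilon>} \<Longrightarrow>
      max 0 (2 * Ur r x - Vc \<epsilon> x - l) \<le> rho x * (2 * Ur r x - Vc \<epsilon> x - l) + 2 * \<eta>'"
    using effective_potential[OF eps(1) e2 r01(1,2)] unfolding \<eta>'_def by blast
  define \<phi> where "\<phi> = (\<lambda>x. 2 * Ur r x - Vc \<epsilon> x - l)"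
  define K where "K = 8 * h * L / \<epsilon>^4 + CV / sqrt \<epsilon>"
  define B where "B = C\<Phi> / sqrt \<epsilon>"
  have \<phi>_lip: "\<bar>\<phi> x - \<phi> y\<bar> \<le> K * \<bar>x - y\<bar>" for x y
  proof -
    have "\<bar>\<phi> x - \<phi> y\<bar> \<le> 2 * \<bar>Ur r x - Ur r y\<bar> + \<bar>Vc \<epsilon> x - Vc \<epsilon> y\<bar>"
    proof -
      have "\<phi> x - \<phi> y = 2 * (Ur r x - Ur r y) - (Vc \<epsilon> x - Vc \<epsilon> y)" by (simp add: \<phi>_def)
      also have "\<bar>\<dots>\<bar> \<le> \<bar>2 * (Ur r x - Ur r y)\<bar> + \<bar>Vc \<epsilon> x - Vc \<epsilon> y\<bar>" by (rule abs_triangle_ineq4)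
      finally show ?thesis by (simp only: abs_mult abs_numeral)
    qed
    also have "\<dots> \<le> 2 * (4 * h * L / \<epsilon>^4 * \<bar>x - y\<bar>) + CV / sqrt \<epsilon> * \<bar>x - y\<bar>"
      using Ur_lipschitz[OF r01(1,2), of x y] Vc_lipschitz[OF eps(1) eL, of x y] unfolding e4
      by (intro add_mono mult_left_mono) simp_all
    also have "\<dots> = K * \<bar>x - y\<bar>" by (simp add: K_def distrib_right)
    finally show ?thesis .
  qed
  have \<phi>_bnd: "\<bar>\<phi> x\<bar> \<le> B" for x
  proof -
    have "\<bar>\<phi> x\<bar> \<le> 2 * \<bar>Ur r x\<bar> + \<bar>Vc \<epsilon> x\<bar> + \<bar>l\<bar>" unfolding \<phi>_def by linarith
    also have "\<dots> \<le> 2 * (Lam r * L) + CV * L / sqrt \<epsilon> + (2 * (2 * L + 24 * sqrt L / sqrt (2 * h)) + CV * L / sqrt \<epsilon>)"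
      using Ur_bound[OF r01(1,2), of x] Vc_bound[OF eps(1) eL, of x] l(1) by linarith
    also have "2 * (Lam r * L) \<le> 2 * (10 / sqrt \<epsilon> * L)" using Lam_le L by (intro mult_left_mono mult_right_mono) auto
    also have "2 * (2 * L + 24 * sqrt L / sqrt (2 * h)) \<le> 2 * (2 * L + 24 * sqrt L / sqrt (2 * h)) * (1 / sqrt \<epsilon>)"
      using mult_left_mono[OF sqrt_eps(5), of "2 * (2 * L + 24 * sqrt L / sqrt (2 * h))"] L h by simp
    finally show ?thesis unfolding B_def C\<Phi>_def by (simp add: add_divide_distrib)
  qed
  have m_lip: "\<bar>max 0 (\<phi> x) - max 0 (\<phi> y)\<bar> \<le> K * \<bar>x - y\<bar>" for x y using \<phi>_lip[of x y] by linarith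
  have m_bnd: "\<bar>max 0 (\<phi> x)\<bar> \<le> B" for x using \<phi>_bnd[of x] by linarith
  have fin: "finite S" "finite T" using S T Mid_fin finite_subset by auto
  have eq: "(\<Sum>i\<in>A. 2 * Ur r (real i / real n) - V (real i / real n)) = (\<Sum>i\<in>A. \<phi> (real i / real n)) + real (card A) * l"
    if "A \<subseteq> Mid" for A
  proof -
    have "(\<Sum>i\<in>A. 2 * Ur r (real i / real n) - V (real i / real n)) = (\<Sum>i\<in>A. \<phi> (real i / real n) + l)"
    proof (rule sum.cong[OF refl])
      fix i assume "i \<in> A"
      then have "Vc \<epsilon> (real i / real n) = V (real i / real n)" using that Mid_x[of i] by (auto simp: Vc_def)
      then show "2 * Ur r (real i / real n) - V (real i / real n) = \<phi> (real i / real n) + l" by (simp add: \<phi>_def)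
    qed
    then show ?thesis by (simp add: sum.distrib)
  qed
  have 1: "(\<Sum>i\<in>S. \<phi> (real i / real n)) \<le> (\<Sum>i\<in>Mid. max 0 (\<phi> (real i / real n)))"
  proof -
    have "(\<Sum>i\<in>S. \<phi> (real i / real n)) \<le> (\<Sum>i\<in>S. max 0 (\<phi> (real i / real n)))" by (intro sum_mono) auto
    also have "\<dots> \<le> (\<Sum>i\<in>Mid. max 0 (\<phi> (real i / real n)))" by (rule sum_mono2[OF Mid_fin S(1)]) auto
    finally show ?thesis .
  qed
  have "\<bar>(\<Sum>i\<in>Mid. max 0 (\<phi> (real i / real n))) - real n * integral {\<epsilon>..L - \<epsilon>} (\<lambda>x. max 0 (\<phi> x))\<bar> \<le> 4 * B + 2 * K * (L + 1)"
    by (rule Mid_sum[of "\<lambda>x. max 0 (\<phi> x)", OF m_lip m_bnd])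
  moreover have "\<bar>(\<Sum>i\<in>T. \<phi> (real i / real n)) - real n * integral {\<epsilon>..L - \<epsilon>} (\<lambda>x. rho x * \<phi> x)\<bar>
      \<le> 4 * \<epsilon> * real n * B + 4 * B + 2 * K * (L + 1)"
    by (rule lin_stat(1)[OF fin(2) T(2,3) \<phi>_lip \<phi>_bnd])
  moreover have "real n * integral {\<epsilon>..L - \<epsilon>} (\<lambda>x. max 0 (\<phi> x)) \<le> real n * (integral {\<epsilon>..L - \<epsilon>} (\<lambda>x. rho x * \<phi> x) + 2 * \<eta>' * L)"
  proof (rule mult_left_mono)
    note ri = rho_mult_integrable(1)[OF \<phi>_lip \<phi>_bnd]
    have "integral {\<epsilon>..L - \<epsilon>} (\<lambda>x. max 0 (\<phi> x)) \<le> integral {\<epsilon>..L - \<epsilon>} (\<lambda>x. rho x * \<phi> x + 2 * \<eta>')"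
    proof (rule integral_le)
      show "(\<lambda>x. max 0 (\<phi> x)) integrable_on {\<epsilon>..L - \<epsilon>}"
        by (rule borel_bounded_integrable[OF lipschitz_borel[OF m_lip] m_bnd])
      show "(\<lambda>x. rho x * \<phi> x + 2 * \<eta>') integrable_on {\<epsilon>..L - \<epsilon>}" by (intro integrable_add ri integrable_const_ivl)
    qed (use l(2) in \<open>auto simp: \<phi>_def\<close>)
    also have "\<dots> = integral {\<epsilon>..L - \<epsilon>} (\<lambda>x. rho x * \<phi> x) + 2 * \<eta>' * (L - 2 * \<epsilon>)"
      using eL eps by (subst Henstock_Kurzweil_Integration.integral_add[OF ri integrable_const_ivl]) simp
    also have "2 * \<eta>' * (L - 2 * \<epsilon>) \<le> 2 * \<eta>' * L"
      using eps r01 h L by (intro mult_left_mono) (auto simp: \<eta>'_def)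
    finally show "integral {\<epsilon>..L - \<epsilon>} (\<lambda>x. max 0 (\<phi> x)) \<le> integral {\<epsilon>..L - \<epsilon>} (\<lambda>x. rho x * \<phi> x) + 2 * \<eta>' * L" by simp
  qed simp
  ultimately have 2: "(\<Sum>i\<in>S. \<phi> (real i / real n)) - (\<Sum>i\<in>T. \<phi> (real i / real n))
    \<le> real n * (2 * \<eta>' * L) + 4 * \<epsilon> * real n * B + 8 * B + 4 * K * (L + 1)"
    using 1 unfolding distrib_left by linarith
  have \<eta>b: "\<eta>' \<le> (4 * L + 32 * sqrt L / sqrt h) * sqrt \<epsilon>"
  proof -
    have "sqrt ((1 - r) / h) = \<epsilon> / sqrt h" unfolding r01(3) using eps by (simp add: real_sqrt_divide)
    then have "\<eta>' = 4 * L * (\<epsilon> * \<epsilon>) + 32 * sqrt L / sqrt h * \<epsilon>"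
      by (simp add: \<eta>'_def r01(3) power2_eq_square)
    also have "\<dots> \<le> 4 * L * sqrt \<epsilon> + 32 * sqrt L / sqrt h * sqrt \<epsilon>"
    proof (intro add_mono mult_left_mono)
      have "\<epsilon> * \<epsilon> \<le> 1 * \<epsilon>" using eps by (intro mult_right_mono) auto
      then show "\<epsilon> * \<epsilon> \<le> sqrt \<epsilon>" using sqrt_eps(4) by linarith
    qed (use L h sqrt_eps in auto)
    finally show ?thesis by (simp add: distrib_right)
  qed
  have "real n * (2 * \<eta>' * L) \<le> real n * (2 * L * ((4 * L + 32 * sqrt L / sqrt h) * sqrt \<epsilon>))"
  proof (rule mult_left_mono)
    have "2 * L * \<eta>' \<le> 2 * L * ((4 * L + 32 * sqrt L / sqrt h) * sqrt \<epsilon>)" using \<eta>b L by (intro mult_left_mono) auto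
    then show "2 * \<eta>' * L \<le> 2 * L * ((4 * L + 32 * sqrt L / sqrt h) * sqrt \<epsilon>)" by (simp add: mult_ac)
  qed simp
  moreover have "4 * \<epsilon> * real n * B = real n * (4 * C\<Phi> * sqrt \<epsilon>)"
  proof -
    have "4 * \<epsilon> * real n * B = real n * (4 * C\<Phi> * (\<epsilon> / sqrt \<epsilon>))" by (simp add: B_def)
    then show ?thesis using sqrt_eps(3) by simp
  qed
  ultimately have 3: "real n * (2 * \<eta>' * L) + 4 * \<epsilon> * real n * B
    \<le> real n * ((2 * L * (4 * L + 32 * sqrt L / sqrt h) + 4 * C\<Phi>) * sqrt \<epsilon>)"
    by (simp only: distrib_left distrib_right mult.assoc add_le_cancel_left add_le_cancel_right)
  show ?thesis unfolding eq[OF S(1)] eq[OF T(1)] S(2) using 2 3 by (simp add: B_def K_def)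
qed

text \<open>In \<open>quadratic_sum_compare\<close> the linear term is the potential of T, replaced
  by n \<open>Ur\<close> through \<open>lk_stat\<close>; the quadratic term is negative and supplies
  the gap in mode k.\<close>

lemma lk_energy_compare:
  assumes S: "S \<subseteq> Mid" "card S = card T" "card T \<le> n"
    and T: "T \<subseteq> Mid" "T \<subseteq> sites \<or> sites \<subseteq> T" "\<bar>real (card T) - real (card sites)\<bar> \<le> 4 * \<epsilon> * real n"
  shows "(\<Sum>i\<in>S. \<Sum>t\<in>S. lk r (ts i) (ts t)) - (\<Sum>i\<in>T. \<Sum>t\<in>T. lk r (ts i) (ts t)) \<le>
    2 * real n * ((\<Sum>i\<in>S. Ur r (real i / real n)) - (\<Sum>i\<in>T. Ur r (real i / real n)))
    + 4 * real n * (6 * \<epsilon> * real n * Lam r + 4 * Lam r + 8 * h * (L + 1) / \<epsilon>^4)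
    - 2 * r ^ k / real k * ((\<Sum>i\<in>S. cos (real k * ts i)) - (\<Sum>i\<in>T. cos (real k * ts i)))\<^sup>2"
proof -
  define I where "I = {0..M}"
  define c where "c = (\<lambda>i. indicator S i - indicator T i :: real)"
  define E where "E = 6 * \<epsilon> * real n * Lam r + 4 * Lam r + 8 * h * (L + 1) / \<epsilon>^4"
  have E: "0 \<le> E" unfolding E_def using eps Lam_pos h L by simp
  have I: "finite I" "S \<subseteq> I" "T \<subseteq> I" using S T Mid_sub by (auto simp: I_def)
  have fT: "finite T" using I finite_subset by blast
  have q: "(\<Sum>i\<in>I. c i * cos (real k * ts i)) = (\<Sum>i\<in>S. cos (real k * ts i)) - (\<Sum>i\<in>T. cos (real k * ts i))"
    unfolding c_def by (rule sum_indicator_diff[OF I])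
  have "(\<Sum>i\<in>I. \<Sum>t\<in>I. c i * c t * lk r (ts i) (ts t))
      \<le> - (2 * r ^ k / real k * ((\<Sum>i\<in>S. cos (real k * ts i)) - (\<Sum>i\<in>T. cos (real k * ts i)))\<^sup>2)"
    using lk_quadratic_form[OF r01(1,2) I(1), of c ts k] unfolding q .
  moreover have "(\<Sum>i\<in>S. \<Sum>t\<in>S. lk r (ts i) (ts t)) - (\<Sum>i\<in>T. \<Sum>t\<in>T. lk r (ts i) (ts t)) =
    (\<Sum>i\<in>I. \<Sum>t\<in>I. c i * c t * lk r (ts i) (ts t)) + 2 * ((\<Sum>i\<in>S. \<Sum>t\<in>T. lk r (ts i) (ts t)) - (\<Sum>i\<in>T. \<Sum>t\<in>T. lk r (ts i) (ts t)))"
    unfolding c_def by (rule quadratic_sum_compare[OF I]) (rule lk_commute)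
  moreover have "\<bar>(\<Sum>i\<in>A. \<Sum>t\<in>T. lk r (ts i) (ts t)) - real n * (\<Sum>i\<in>A. Ur r (real i / real n))\<bar> \<le> real n * E"
    if "card A \<le> n" for A
  proof -
    have "(\<Sum>i\<in>A. \<Sum>t\<in>T. lk r (ts i) (ts t)) - real n * (\<Sum>i\<in>A. Ur r (real i / real n)) =
      (\<Sum>i\<in>A. (\<Sum>t\<in>T. lk r (ts i) (ts t)) - real n * Ur r (real i / real n))"
      by (simp add: sum_subtractf sum_distrib_left)
    also have "\<bar>\<dots>\<bar> \<le> real n * E"
      by (rule sum_abs_le_card) (use lk_stat[OF fT T(2,3)] E that in \<open>auto simp: E_def\<close>)
    finally show ?thesis .
  qed
  from this[of S] this[of T] S have
    "\<bar>(\<Sum>i\<in>S. \<Sum>t\<in>T. lk r (ts i) (ts t)) - real n * (\<Sum>i\<in>S. Ur r (real i / real n))\<bar> \<le> real n * E"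
    "\<bar>(\<Sum>i\<in>T. \<Sum>t\<in>T. lk r (ts i) (ts t)) - real n * (\<Sum>i\<in>T. Ur r (real i / real n))\<bar> \<le> real n * E" by auto
  ultimately have "(\<Sum>i\<in>S. \<Sum>t\<in>S. lk r (ts i) (ts t)) - (\<Sum>i\<in>T. \<Sum>t\<in>T. lk r (ts i) (ts t)) \<le>
    2 * real n * ((\<Sum>i\<in>S. Ur r (real i / real n)) - (\<Sum>i\<in>T. Ur r (real i / real n))) + 4 * real n * E
    - 2 * r ^ k / real k * ((\<Sum>i\<in>S. cos (real k * ts i)) - (\<Sum>i\<in>T. cos (real k * ts i)))\<^sup>2"
    unfolding mult.assoc right_diff_distrib by linarith
  then show ?thesis unfolding E_def .
qed

lemma mid_energy_compare:
  assumes S: "S \<subseteq> Mid" "card S = card T" "card T \<le> n" "inj_on (\<lambda>i. cos (tn i)) S"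
    and T: "T \<subseteq> Mid" "T \<subseteq> sites \<or> sites \<subseteq> T" "\<bar>real (card T) - real (card sites)\<bar> \<le> 4 * \<epsilon> * real n"
  shows "EN S - EN T \<le> (real n)\<^sup>2 * ((2 + C2 + 240 + 2 * L * (4 * L + 32 * sqrt L / sqrt h) + 4 * C\<Phi>) * sqrt \<epsilon> + 8 * \<delta> / \<epsilon>^4 + 2 * \<eta>)
    + real n * E1 \<epsilon> - 2 * r ^ k / real k * ((\<Sum>i\<in>S. cos (real k * ts i)) - (\<Sum>i\<in>T. cos (real k * ts i)))\<^sup>2"
proof -
  define D where "D = 2 * r ^ k / real k * ((\<Sum>i\<in>S. cos (real k * ts i)) - (\<Sum>i\<in>T. cos (real k * ts i)))\<^sup>2"
  define Q where "Q = 2 * L * (4 * L + 32 * sqrt L / sqrt h) + 4 * C\<Phi>"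
  define R where "R = 8 * C\<Phi> / sqrt \<epsilon> + 4 * (8 * h * L / \<epsilon>^4 + CV / sqrt \<epsilon>) * (L + 1)"
  define G where "G = 32 * h * (L + 1) / \<epsilon>^4"
  have fS: "finite S" using S Mid_fin finite_subset by blast
  have cS: "card S \<le> n" using S by simp
  note 1 = energy_upper[OF fS cS S(4)]
  note 2 = energy_lower[OF T(1) S(3)]
  note 3 = lk_shift[OF cS]
  note 4 = lk_shift[OF S(3)]
  note 5 = lk_energy_compare[OF S(1-3) T, of k, folded D_def]
  note 6 = weight_compare[OF S(1) T(1) S(2,3)]
  have 7: "real n * ((\<Sum>i\<in>S. 2 * Ur r (real i / real n) - V (real i / real n)) - (\<Sum>i\<in>T. 2 * Ur r (real i / real n) - V (real i / real n)))
    \<le> real n * (real n * (Q * sqrt \<epsilon>) + R)"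
    using potential_compare[OF S(1,2) T] by (intro mult_left_mono) (auto simp: Q_def R_def add.assoc)
  \<comment> \<open>The linear terms of the interaction and of the weights combine to n (2 U - V),
    the quantity controlled by \<open>potential_compare\<close>.\<close>
  have 7: "2 * real n * ((\<Sum>i\<in>S. Ur r (real i / real n)) - (\<Sum>i\<in>T. Ur r (real i / real n)))
     + - real n * ((\<Sum>i\<in>S. V (real i / real n)) - (\<Sum>i\<in>T. V (real i / real n))) \<le> (real n)\<^sup>2 * (Q * sqrt \<epsilon>) + real n * R"
    using 7 unfolding sum_subtractf sum_distrib_left[symmetric] by (simp add: algebra_simps power2_eq_square)
  \<comment> \<open>\<open>Lam r\<close> \<le> 10 / sqrt \<epsilon> turns 24 \<epsilon> into 240
    sqrt \<epsilon>, and 17 = 4 times 4 + 1 into 170.\<close>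
  have 8: "4 * real n * (6 * \<epsilon> * real n * Lam r + 4 * Lam r + 8 * h * (L + 1) / \<epsilon>^4) + real n * Lam r
     \<le> (real n)\<^sup>2 * (240 * sqrt \<epsilon>) + real n * (170 / sqrt \<epsilon>) + real n * G"
  proof -
    have "4 * real n * (6 * \<epsilon> * real n * Lam r + 4 * Lam r + 8 * h * (L + 1) / \<epsilon>^4) + real n * Lam r
      = ((real n)\<^sup>2 * 24 * \<epsilon> + 17 * real n) * Lam r + real n * G"
      by (simp add: G_def algebra_simps power2_eq_square)
    also have "((real n)\<^sup>2 * 24 * \<epsilon> + 17 * real n) * Lam r \<le> ((real n)\<^sup>2 * 24 * \<epsilon> + 17 * real n) * (10 / sqrt \<epsilon>)"
      using Lam_le eps by (intro mult_left_mono) auto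
    also have "\<dots> = (real n)\<^sup>2 * (240 * (\<epsilon> / sqrt \<epsilon>)) + real n * (170 / sqrt \<epsilon>)" by (simp add: algebra_simps)
    finally show ?thesis using sqrt_eps(3) by simp
  qed
  have 9: "(real n)\<^sup>2 * (2 * \<epsilon>\<^sup>2) \<le> (real n)\<^sup>2 * (2 * sqrt \<epsilon>)"
  proof (intro mult_left_mono)
    have "\<epsilon> * \<epsilon> \<le> 1 * \<epsilon>" using eps by (intro mult_right_mono) auto
    then show "\<epsilon>\<^sup>2 \<le> sqrt \<epsilon>" using sqrt_eps(4) by (simp add: power2_eq_square)
  qed auto
  have 10: "(real n)\<^sup>2 * (C2 * \<epsilon>) \<le> (real n)\<^sup>2 * (C2 * sqrt \<epsilon>)"
    using sqrt_eps(4) L h by (intro mult_left_mono) (auto simp: C2_def)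
  have E: "EN S - EN T = ((\<Sum>i\<in>S. \<Sum>t\<in>S - {i}. lnd i t) - (\<Sum>i\<in>T. \<Sum>t\<in>T - {i}. lnd i t)) + ((\<Sum>i\<in>S. ln \<bar>w i\<bar>) - (\<Sum>i\<in>T. ln \<bar>w i\<bar>))"
    by (simp add: EN_def)
  have "EN S - EN T \<le> ((real n)\<^sup>2 * (2 * sqrt \<epsilon>) + (real n)\<^sup>2 * (C2 * sqrt \<epsilon>) + (real n)\<^sup>2 * (240 * sqrt \<epsilon>) + (real n)\<^sup>2 * (Q * sqrt \<epsilon>)
    + 2 * ((real n)\<^sup>2 * (4 * \<delta> / \<epsilon>^4)) + 2 * (real n)\<^sup>2 * \<eta>) + (2 * real n + real n * (170 / sqrt \<epsilon>) + real n * G + real n * R) - D"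
    unfolding E using 1 2 3 4 5 6 7 8 9 10 by linarith
  also have "2 * real n + real n * (170 / sqrt \<epsilon>) + real n * G + real n * R = real n * E1 \<epsilon>"
    by (simp add: E1_def G_def R_def algebra_simps)
  also have "(real n)\<^sup>2 * (2 * sqrt \<epsilon>) + (real n)\<^sup>2 * (C2 * sqrt \<epsilon>) + (real n)\<^sup>2 * (240 * sqrt \<epsilon>) + (real n)\<^sup>2 * (Q * sqrt \<epsilon>)
    + 2 * ((real n)\<^sup>2 * (4 * \<delta> / \<epsilon>^4)) + 2 * (real n)\<^sup>2 * \<eta>
    = (real n)\<^sup>2 * ((2 + C2 + 240 + Q) * sqrt \<epsilon> + 8 * \<delta> / \<epsilon>^4 + 2 * \<eta>)"
    by (simp add: algebra_simps)
  finally show ?thesis by (simp add: D_def Q_def add.assoc)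
qed

lemma EN_Un:
  assumes "finite S" "finite B" "S \<inter> B = {}"
  shows "EN (S \<union> B) = EN S + EN B + 2 * (\<Sum>i\<in>B. \<Sum>t\<in>S. lnd i t)"
proof -
  have 1: "(\<Sum>i\<in>S. \<Sum>t\<in>S \<union> B - {i}. lnd i t) = (\<Sum>i\<in>S. \<Sum>t\<in>S - {i}. lnd i t) + (\<Sum>i\<in>S. \<Sum>t\<in>B. lnd i t)"
    unfolding sum.distrib[symmetric]
  proof (rule sum.cong[OF refl])
    fix i assume "i \<in> S"
    then have "S \<union> B - {i} = (S - {i}) \<union> B" "(S - {i}) \<inter> B = {}" using assms by auto
    then show "(\<Sum>t\<in>S \<union> B - {i}. lnd i t) = (\<Sum>t\<in>S - {i}. lnd i t) + (\<Sum>t\<in>B. lnd i t)"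
      using assms by (simp add: sum.union_disjoint)
  qed
  have 2: "(\<Sum>i\<in>B. \<Sum>t\<in>S \<union> B - {i}. lnd i t) = (\<Sum>i\<in>B. \<Sum>t\<in>B - {i}. lnd i t) + (\<Sum>i\<in>B. \<Sum>t\<in>S. lnd i t)"
    unfolding sum.distrib[symmetric]
  proof (rule sum.cong[OF refl])
    fix i assume "i \<in> B"
    then have "S \<union> B - {i} = (B - {i}) \<union> S" "(B - {i}) \<inter> S = {}" using assms by auto
    then show "(\<Sum>t\<in>S \<union> B - {i}. lnd i t) = (\<Sum>t\<in>B - {i}. lnd i t) + (\<Sum>t\<in>S. lnd i t)"
      using assms by (simp add: sum.union_disjoint)
  qed
  have 3: "(\<Sum>i\<in>S. \<Sum>t\<in>B. lnd i t) = (\<Sum>i\<in>B. \<Sum>t\<in>S. lnd i t)"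
    by (subst sum.swap) (simp add: lnd_commute)
  show ?thesis unfolding EN_def sum.union_disjoint[OF assms] 1 2 3 by simp
qed

text \<open>Replacing the particles on the middle sites by the selected sites, and keeping the others,
  increases the probability unless the particles already follow \<open>rho\<close>.\<close>

lemma configuration_compare:
  assumes Y: "Y \<subseteq> {0..M}" "card Y = n" "inj_on (\<lambda>i. cos (tn i)) Y" "\<And>i. i \<in> Y \<Longrightarrow> w i \<noteq> 0"
  obtains Z where "Z \<subseteq> {0..M}" "card Z = n" "inj_on (\<lambda>i. cos (tn i)) Z" "\<And>i. i \<in> Z \<Longrightarrow> w i \<noteq> 0"
    "\<And>k. EN Y - EN Z \<le> (real n)\<^sup>2 * (E0 * sqrt \<epsilon> + 8 * \<delta> / \<epsilon>^4 + 2 * \<eta>) + real n * E1 \<epsilon>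
      - 2 * r ^ k / real k * ((\<Sum>i\<in>Y. cos (real k * ts i)) - (\<Sum>i\<in>Z. cos (real k * ts i)))\<^sup>2"
    "\<And>k. \<bar>(\<Sum>i\<in>Z. cos (real k * ts i)) - real n * integral {0..L} (\<lambda>x. rho x * cos (real k * th x))\<bar>
      \<le> 9 * \<epsilon> * real n + 4 + 4 * h * real k * (L + 1)"
proof -
  define S where "S = Y \<inter> Mid"
  define B where "B = Y - Mid"
  have fY: "finite Y" using Y finite_subset by blast
  have fin: "finite S" "finite B" "S \<inter> B = {}" and YSB: "Y = S \<union> B" using fY by (auto simp: S_def B_def)
  have SM: "S \<subseteq> Mid" by (simp add: S_def)
  have Bc: "real (card B) \<le> 3 * \<epsilon> * real n"
  proof -
    have "card B \<le> card ({0..M} - Mid)" using Y by (intro card_mono) (auto simp: B_def)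
    then have "real (card B) \<le> real (card ({0..M} - Mid))" by simp
    then show ?thesis using outside_card by linarith
  qed
  have Sc: "card S + card B = n" using Y(2) fin unfolding YSB by (simp add: card_Un_disjoint)
  obtain T where T: "T \<subseteq> Mid" "card T = card S" "T \<subseteq> sites \<or> sites \<subseteq> T"
    using obtain_comparable_subset[OF Mid_fin sites_Mid card_mono[OF Mid_fin SM]] by metis
  have fT: "finite T" using T Mid_fin finite_subset by blast
  \<comment> \<open>At most 3 \<epsilon> n particles are outside \<open>Mid\<close>, and
    \<open>sites\<close> exceeds n by at most \<epsilon> n; together 4 \<epsilon> n.\<close>
  have Tc: "\<bar>real (card T) - real (card sites)\<bar> \<le> 4 * \<epsilon> * real n"
  proof -
    have "real (card S) + real (card B) = real n" using Sc by (simp flip: of_nat_add)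
    moreover have "0 \<le> \<epsilon> * real n" using eps by simp
    ultimately show ?thesis using Bc sites_card unfolding T(2) mult.assoc by linarith
  qed
  have cT: "card T \<le> n" using Sc T by simp
  define Z where "Z = T \<union> B"
  have TB: "T \<inter> B = {}" using T by (auto simp: B_def)
  show ?thesis
  proof (rule that[of Z])
    show "Z \<subseteq> {0..M}" using T Mid_sub Y by (auto simp: Z_def B_def)
    show "card Z = n" unfolding Z_def using fT fin TB T(2) Sc by (simp add: card_Un_disjoint)
    \<comment> \<open>A pair containing a middle site is separated by \<open>sep_ne\<close>, a pair
      of kept sites by the hypothesis on Y.\<close>
    show "inj_on (\<lambda>i. cos (tn i)) Z"
    proof (rule inj_onI)
      fix i t assume it: "i \<in> Z" "t \<in> Z" "cos (tn i) = cos (tn t)"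
      have le: "i \<le> M" "t \<le> M" using it \<open>Z \<subseteq> {0..M}\<close> by auto
      show "i = t"
      proof (rule ccontr)
        assume ne: "i \<noteq> t"
        then have "i \<notin> Mid" "t \<notin> Mid" using sep_ne[of t i] sep_ne[of i t] it(3) le by metis+
        then have "i \<in> Y" "t \<in> Y" using it T by (auto simp: Z_def B_def)
        then show False using Y(3) it(3) ne by (auto dest: inj_onD)
      qed
    qed
    show "w i \<noteq> 0" if "i \<in> Z" for i
      using that Y(4)[of i] T(1) wts[of i] by (auto simp: Z_def B_def Mid_def)
    have BY: "B \<subseteq> {0..M}" "B \<inter> Mid = {}" using Y by (auto simp: B_def)
    have x1: "(\<Sum>i\<in>B. \<Sum>t\<in>S. lnd i t) \<le> 6 * \<epsilon> * (real n)\<^sup>2"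
    proof -
      have "(\<Sum>i\<in>B. \<Sum>t\<in>S. lnd i t) \<le> (\<Sum>i\<in>B. \<Sum>t\<in>S. 2)" by (intro sum_mono lnd_upper)
      also have "\<dots> = real (card B) * (real (card S) * 2)" by simp
      also have "\<dots> \<le> (3 * \<epsilon> * real n) * (real n * 2)" using Bc Sc eps by (intro mult_mono) auto
      finally show ?thesis by (simp add: power2_eq_square mult_ac)
    qed
    have C1: "0 \<le> C1" unfolding C1_def using h L by simp
    have x2: "- (3 * C1 * sqrt \<epsilon> * (real n)\<^sup>2) \<le> (\<Sum>i\<in>B. \<Sum>t\<in>T. lnd i t)"
    proof -
      have "- (\<Sum>i\<in>B. \<Sum>t\<in>T. lnd i t) \<le> (\<Sum>i\<in>B. real n * (C1 / sqrt \<epsilon>))"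
        unfolding sum_negf[symmetric]
      proof (rule sum_mono)
        fix i assume "i \<in> B"
        then have "i \<le> M" "i \<notin> T" using BY T by auto
        from lnd_cross_lower[OF T(1) cT this] show "(\<Sum>t\<in>T. - lnd i t) \<le> real n * (C1 / sqrt \<epsilon>)"
          unfolding sum_negf by linarith
      qed
      also have "\<dots> = real (card B) * (real n * (C1 / sqrt \<epsilon>))" by simp
      also have "\<dots> \<le> (3 * \<epsilon> * real n) * (real n * (C1 / sqrt \<epsilon>))" using Bc C1 eps by (intro mult_right_mono) auto
      also have "\<dots> = 3 * C1 * (\<epsilon> / sqrt \<epsilon>) * (real n)\<^sup>2" by (simp add: power2_eq_square)
      finally show ?thesis using sqrt_eps(3) by simp
    qed
    fix k
    have csum: "(\<Sum>i\<in>Z. cos (real k * ts i)) = (\<Sum>i\<in>T. cos (real k * ts i)) + (\<Sum>i\<in>B. cos (real k * ts i))"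
      unfolding Z_def by (rule sum.union_disjoint[OF fT fin(2) TB])
    have csumY: "(\<Sum>i\<in>Y. cos (real k * ts i)) = (\<Sum>i\<in>S. cos (real k * ts i)) + (\<Sum>i\<in>B. cos (real k * ts i))"
      unfolding YSB by (rule sum.union_disjoint[OF fin])
    have injS: "inj_on (\<lambda>i. cos (tn i)) S" using Y(3) unfolding YSB by (rule inj_on_subset) auto
    \<comment> \<open>\<open>EN B\<close> cancels, so nothing has to be known about weights and
      mutual distances of the sites near the ends.\<close>
    have e1: "EN Y - EN Z = (EN S - EN T) + 2 * (\<Sum>i\<in>B. \<Sum>t\<in>S. lnd i t) - 2 * (\<Sum>i\<in>B. \<Sum>t\<in>T. lnd i t)"
      unfolding YSB Z_def EN_Un[OF fin] EN_Un[OF fT fin(2) TB] by simp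
    have e2: "12 * \<epsilon> * (real n)\<^sup>2 \<le> (real n)\<^sup>2 * (12 * sqrt \<epsilon>)"
      using mult_left_mono[OF sqrt_eps(4), of "12 * (real n)\<^sup>2"] by (simp add: mult_ac)
    have "EN Y - EN Z \<le> ((real n)\<^sup>2 * ((2 + C2 + 240 + 2 * L * (4 * L + 32 * sqrt L / sqrt h) + 4 * C\<Phi>) * sqrt \<epsilon> + 8 * \<delta> / \<epsilon>^4 + 2 * \<eta>)
      + (real n)\<^sup>2 * (12 * sqrt \<epsilon>) + (real n)\<^sup>2 * (6 * C1 * sqrt \<epsilon>))
      + real n * E1 \<epsilon> - 2 * r ^ k / real k * ((\<Sum>i\<in>S. cos (real k * ts i)) - (\<Sum>i\<in>T. cos (real k * ts i)))\<^sup>2"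
      using mid_energy_compare[OF SM T(2)[symmetric] cT injS T(1,3) Tc, of k] x1 x2 e2 unfolding e1 by (simp add: mult_ac)
    also have "(real n)\<^sup>2 * ((2 + C2 + 240 + 2 * L * (4 * L + 32 * sqrt L / sqrt h) + 4 * C\<Phi>) * sqrt \<epsilon> + 8 * \<delta> / \<epsilon>^4 + 2 * \<eta>)
      + (real n)\<^sup>2 * (12 * sqrt \<epsilon>) + (real n)\<^sup>2 * (6 * C1 * sqrt \<epsilon>) = (real n)\<^sup>2 * (E0 * sqrt \<epsilon> + 8 * \<delta> / \<epsilon>^4 + 2 * \<eta>)"
      unfolding E0_def by (simp only: distrib_left distrib_right add_ac)
    finally show "EN Y - EN Z \<le> (real n)\<^sup>2 * (E0 * sqrt \<epsilon> + 8 * \<delta> / \<epsilon>^4 + 2 * \<eta>) + real n * E1 \<epsilon>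
      - 2 * r ^ k / real k * ((\<Sum>i\<in>Y. cos (real k * ts i)) - (\<Sum>i\<in>Z. cos (real k * ts i)))\<^sup>2"
      unfolding csum csumY by simp
    have lip: "\<bar>cos (real k * th x) - cos (real k * th y)\<bar> \<le> 2 * h * real k * \<bar>x - y\<bar>" for x y
    proof -
      have "\<bar>cos (real k * th x) - cos (real k * th y)\<bar> \<le> \<bar>real k * th x - real k * th y\<bar>"
        by (rule abs_cos_diff_le)
      also have "\<dots> = real k * \<bar>th x - th y\<bar>" by (simp add: right_diff_distrib[symmetric] abs_mult)
      finally show ?thesis by (simp add: th_diff mult_ac)
    qed
    have "\<bar>(\<Sum>i\<in>T. cos (real k * th (real i / real n))) - real n * integral {0..L} (\<lambda>x. rho x * cos (real k * th x))\<bar>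
      \<le> 6 * \<epsilon> * real n * 1 + 4 * 1 + 2 * (2 * h * real k) * (L + 1)"
      by (rule lin_stat(2)[OF fT T(3) Tc lip]) simp
    moreover have "\<bar>\<Sum>i\<in>B. cos (real k * ts i)\<bar> \<le> (3 * \<epsilon> * real n) * 1"
      by (rule sum_abs_le_card) (use Bc in auto)
    ultimately show "\<bar>(\<Sum>i\<in>Z. cos (real k * ts i)) - real n * integral {0..L} (\<lambda>x. rho x * cos (real k * th x))\<bar>
      \<le> 9 * \<epsilon> * real n + 4 + 4 * h * real k * (L + 1)"
      unfolding csum ts_def[symmetric] mult.assoc by linarith
  qed
qed

end

lemma sum_off_diagonal:
  fixes f :: "nat \<Rightarrow> nat \<Rightarrow> real"
  assumes sym: "\<And>i j. f i j = f j i"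
  shows "(\<Sum>j\<in>{1..n}. \<Sum>i\<in>{1..n} - {j}. f j i) = 2 * (\<Sum>j\<in>{1..n}. \<Sum>i\<in>{1..<j}. f i j)"
proof (induction n)
  case (Suc n)
  have s: "{1..Suc n} = insert (Suc n) {1..n}" by auto
  have "(\<Sum>j\<in>{1..Suc n}. \<Sum>i\<in>{1..Suc n} - {j}. f j i) =
    (\<Sum>i\<in>{1..Suc n} - {Suc n}. f (Suc n) i) + (\<Sum>j\<in>{1..n}. \<Sum>i\<in>{1..Suc n} - {j}. f j i)"
    unfolding s by (subst sum.insert) auto
  also have "{1..Suc n} - {Suc n} = {1..n}" by auto
  also have "(\<Sum>j\<in>{1..n}. \<Sum>i\<in>{1..Suc n} - {j}. f j i) = (\<Sum>j\<in>{1..n}. (\<Sum>i\<in>{1..n} - {j}. f j i) + f j (Suc n))"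
  proof (rule sum.cong[OF refl])
    fix j assume "j \<in> {1..n}"
    then have "{1..Suc n} - {j} = insert (Suc n) ({1..n} - {j})" by auto
    then show "(\<Sum>i\<in>{1..Suc n} - {j}. f j i) = (\<Sum>i\<in>{1..n} - {j}. f j i) + f j (Suc n)"
      by (simp add: add.commute)
  qed
  also have "\<dots> = 2 * (\<Sum>j\<in>{1..n}. \<Sum>i\<in>{1..<j}. f i j) + (\<Sum>i\<in>{1..n}. f i (Suc n))"
    by (simp only: sum.distrib Suc.IH)
  also have "(\<Sum>i\<in>{1..n}. f (Suc n) i) = (\<Sum>i\<in>{1..n}. f i (Suc n))" by (intro sum.cong refl sym)
  finally have "(\<Sum>j\<in>{1..Suc n}. \<Sum>i\<in>{1..Suc n} - {j}. f j i) =
    2 * (\<Sum>j\<in>{1..n}. \<Sum>i\<in>{1..<j}. f i j) + 2 * (\<Sum>i\<in>{1..n}. f i (Suc n))" by simp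
  moreover have "(\<Sum>j\<in>{1..Suc n}. \<Sum>i\<in>{1..<j}. f i j) = (\<Sum>i\<in>{1..<Suc n}. f i (Suc n)) + (\<Sum>j\<in>{1..n}. \<Sum>i\<in>{1..<j}. f i j)"
    unfolding s by (subst sum.insert) auto
  moreover have "{1..<Suc n} = {1..n}" by auto
  ultimately show ?case by simp
qed simp

section \<open>From energies to weights of configurations\<close>

context racah_lattice
begin

definition CW :: "(nat \<Rightarrow> nat) \<Rightarrow> real" where
  "CW y = (\<Prod>j\<in>{1..n}. \<Prod>i\<in>{1..<j}. (2 * cos (tn (y i)) - 2 * cos (tn (y j)))\<^sup>2) * (\<Prod>j\<in>{1..n}. w (y j))"

lemma CW_nonzero:
  assumes "CW y \<noteq> 0"
  shows "inj_on (\<lambda>j. cos (tn (y j))) {1..n}" "\<And>j. j \<in> {1..n} \<Longrightarrow> w (y j) \<noteq> 0"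
proof -
  show "w (y j) \<noteq> 0" if "j \<in> {1..n}" for j
    using assms that unfolding CW_def by auto
  have *: "cos (tn (y i)) \<noteq> cos (tn (y j))" if "i \<in> {1..<j}" "j \<in> {1..n}" for i j
    using assms that unfolding CW_def by auto
  show "inj_on (\<lambda>j. cos (tn (y j))) {1..n}"
  proof (rule inj_onI)
    fix i j assume "i \<in> {1..n}" "j \<in> {1..n}" "cos (tn (y i)) = cos (tn (y j))"
    then show "i = j" using *[of i j] *[of j i] by (cases i j rule: linorder_cases) auto
  qed
qed

text \<open>\<open>EN\<close> sums over ordered pairs, which accounts for the squares of the
  Vandermonde factors.\<close>

lemma abs_CW:
  assumes inj: "inj_on (\<lambda>j. cos (tn (y j))) {1..n}" and w: "\<And>j. j \<in> {1..n} \<Longrightarrow> w (y j) \<noteq> 0"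
  shows "\<bar>CW y\<bar> = exp (EN (y ` {1..n}))"
proof -
  have iy: "inj_on y {1..n}" by (rule inj_onI) (use inj in \<open>metis inj_onD\<close>)
  have ne: "2 * cos (tn (y i)) - 2 * cos (tn (y j)) \<noteq> 0" if "i \<in> {1..<j}" "j \<in> {1..n}" for i j
    using inj_onD[OF inj, of i j] that by auto
  have 1: "\<bar>\<Prod>j\<in>{1..n}. \<Prod>i\<in>{1..<j}. (2 * cos (tn (y i)) - 2 * cos (tn (y j)))\<^sup>2\<bar>
    = exp (2 * (\<Sum>j\<in>{1..n}. \<Sum>i\<in>{1..<j}. lnd (y i) (y j)))"
  proof -
    have "\<bar>\<Prod>j\<in>{1..n}. \<Prod>i\<in>{1..<j}. (2 * cos (tn (y i)) - 2 * cos (tn (y j)))\<^sup>2\<bar>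
      = (\<Prod>j\<in>{1..n}. \<Prod>i\<in>{1..<j}. exp (2 * lnd (y i) (y j)))"
      unfolding abs_prod
    proof (intro prod.cong refl)
      fix i j assume "i \<in> {1..<j}" "j \<in> {1..n}"
      then have z: "2 * cos (tn (y i)) - 2 * cos (tn (y j)) \<noteq> 0" by (intro ne) auto
      have "exp (2 * ln \<bar>z\<bar>) = \<bar>z\<^sup>2\<bar>" if "z \<noteq> 0" for z :: real
        using that by (simp only: exp_double exp_ln zero_less_abs_iff) simp
      then show "\<bar>(2 * cos (tn (y i)) - 2 * cos (tn (y j)))\<^sup>2\<bar> = exp (2 * lnd (y i) (y j))"
        unfolding lnd_def using z by metis
    qed
    then show ?thesis by (simp add: exp_sum sum_distrib_left)
  qed
  have 2: "\<bar>\<Prod>j\<in>{1..n}. w (y j)\<bar> = exp (\<Sum>j\<in>{1..n}. ln \<bar>w (y j)\<bar>)"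
    unfolding abs_prod using w by (simp add: exp_sum)
  have "EN (y ` {1..n}) = (\<Sum>j\<in>{1..n}. \<Sum>t\<in>y ` {1..n} - {y j}. lnd (y j) t) + (\<Sum>j\<in>{1..n}. ln \<bar>w (y j)\<bar>)"
    unfolding EN_def by (simp only: sum.reindex[OF iy] o_def)
  also have "(\<Sum>j\<in>{1..n}. \<Sum>t\<in>y ` {1..n} - {y j}. lnd (y j) t) = (\<Sum>j\<in>{1..n}. \<Sum>i\<in>{1..n} - {j}. lnd (y j) (y i))"
  proof (rule sum.cong[OF refl])
    fix j assume j: "j \<in> {1..n}"
    have "y ` {1..n} - {y j} = y ` ({1..n} - {j})" using inj_on_image_set_diff[OF iy, of "{1..n}" "{j}"] j by simp
    moreover have "inj_on y ({1..n} - {j})" using iy by (rule inj_on_subset) auto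
    ultimately show "(\<Sum>t\<in>y ` {1..n} - {y j}. lnd (y j) t) = (\<Sum>i\<in>{1..n} - {j}. lnd (y j) (y i))"
      by (simp add: sum.reindex)
  qed
  also have "\<dots> = 2 * (\<Sum>j\<in>{1..n}. \<Sum>i\<in>{1..<j}. lnd (y i) (y j))" by (rule sum_off_diagonal) (rule lnd_commute)
  finally show ?thesis unfolding CW_def abs_mult 1 2 by (simp add: exp_add)
qed

lemma CW_compare:
  assumes y: "y \<in> configs n M" "CW y \<noteq> 0"
  obtains z where "z \<in> configs n M"
    "\<And>k. \<exists>c. \<bar>c - real n * integral {0..L} (\<lambda>x. rho x * cos (real k * th x))\<bar> \<le> 9 * \<epsilon> * real n + 4 + 4 * h * real k * (L + 1) \<and>
      \<bar>CW y\<bar> \<le> exp ((real n)\<^sup>2 * (E0 * sqrt \<epsilon> + 8 * \<delta> / \<epsilon>^4 + 2 * \<eta>) + real n * E1 \<epsilon>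
      - 2 * r ^ k / real k * ((\<Sum>j=1..n. cos (real k * ts (y j))) - c)\<^sup>2) * \<bar>CW z\<bar>"
proof -
  note ny = CW_nonzero[OF y(2)]
  have iy: "inj_on y {1..n}" by (rule inj_onI) (use ny(1) in \<open>metis inj_onD\<close>)
  define Y where "Y = y ` {1..n}"
  have cY: "card Y = n" unfolding Y_def card_image[OF iy] by simp
  have Y: "Y \<subseteq> {0..M}" "card Y = n" "inj_on (\<lambda>i. cos (tn i)) Y" "\<And>i. i \<in> Y \<Longrightarrow> w i \<noteq> 0"
    using y(1) ny inj_on_imageI[of "\<lambda>i. cos (tn i)" y "{1..n}"] unfolding Y_def configs_def
    using cY[unfolded Y_def] by (auto simp: o_def)
  from configuration_compare[OF Y] obtain Z where Z: "Z \<subseteq> {0..M}" "card Z = n" "inj_on (\<lambda>i. cos (tn i)) Z" "\<And>i. i \<in> Z \<Longrightarrow> w i \<noteq> 0"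
    "\<And>k. EN Y - EN Z \<le> (real n)\<^sup>2 * (E0 * sqrt \<epsilon> + 8 * \<delta> / \<epsilon>^4 + 2 * \<eta>) + real n * E1 \<epsilon>
      - 2 * r ^ k / real k * ((\<Sum>i\<in>Y. cos (real k * ts i)) - (\<Sum>i\<in>Z. cos (real k * ts i)))\<^sup>2"
    "\<And>k. \<bar>(\<Sum>i\<in>Z. cos (real k * ts i)) - real n * integral {0..L} (\<lambda>x. rho x * cos (real k * th x))\<bar>
      \<le> 9 * \<epsilon> * real n + 4 + 4 * h * real k * (L + 1)" by blast
  have "finite Z" using Z finite_subset by blast
  then obtain z0 where z0: "bij_betw z0 {1..n} Z"
    using finite_same_card_bij[of "{1..n}" Z] Z by auto
  define z where "z = restrict z0 {1..n}"
  have z: "bij_betw z {1..n} Z" using z0 unfolding z_def by (simp add: bij_betw_restrict_eq)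
  have zi: "z ` {1..n} = Z" using z by (rule bij_betw_imp_surj_on)
  have zc: "z \<in> configs n M" using zi Z(1) unfolding configs_def z_def by auto
  have zn: "\<bar>CW z\<bar> = exp (EN Z)"
    unfolding zi[symmetric]
  proof (rule abs_CW)
    show "inj_on (\<lambda>j. cos (tn (z j))) {1..n}"
      using comp_inj_on[OF bij_betw_imp_inj_on[OF z], of "\<lambda>i. cos (tn i)"] Z(3) zi by (simp add: o_def)
    show "w (z j) \<noteq> 0" if "j \<in> {1..n}" for j using Z(4) zi that by blast
  qed
  have yn: "\<bar>CW y\<bar> = exp (EN Y)" unfolding Y_def by (rule abs_CW[OF ny])
  have s: "(\<Sum>i\<in>Y. cos (real k * ts i)) = (\<Sum>j=1..n. cos (real k * ts (y j)))" for k
    unfolding Y_def by (simp only: sum.reindex[OF iy] o_def)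
  show ?thesis
  proof (rule that[OF zc], intro exI conjI)
    fix k
    show "\<bar>(\<Sum>i\<in>Z. cos (real k * ts i)) - real n * integral {0..L} (\<lambda>x. rho x * cos (real k * th x))\<bar>
      \<le> 9 * \<epsilon> * real n + 4 + 4 * h * real k * (L + 1)" by (rule Z(6))
    show "\<bar>CW y\<bar> \<le> exp ((real n)\<^sup>2 * (E0 * sqrt \<epsilon> + 8 * \<delta> / \<epsilon>^4 + 2 * \<eta>) + real n * E1 \<epsilon>
      - 2 * r ^ k / real k * ((\<Sum>j=1..n. cos (real k * ts (y j))) - (\<Sum>i\<in>Z. cos (real k * ts i)))\<^sup>2) * \<bar>CW z\<bar>"
      using Z(5)[of k] unfolding yn zn exp_add[symmetric] s by simp
  qed
qed

end

lemma eventually_mult_ge: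
  fixes c b :: real
  assumes "0 < c"
  shows "\<forall>\<^sub>F n in sequentially. b \<le> c * real n"
proof -
  have "filterlim (\<lambda>n. c * real n) at_top sequentially"
    by (rule filterlim_tendsto_pos_mult_at_top[OF tendsto_const assms filterlim_real_sequentially])
  then show ?thesis by (simp add: filterlim_at_top)
qed

context racah_potential
begin

text \<open>Bounding a weight by another weight, rather than by the sum of all weights, gives a
  probability bound without any estimate of the normalization.\<close>

lemma prob_decay:
  fixes M :: "nat \<Rightarrow> nat" and pn :: "nat \<Rightarrow> real" and w :: "nat \<Rightarrow> nat \<Rightarrow> real"
  assumes pn: "pn \<longlonglongrightarrow> p" and M: "(\<lambda>n. real (M n) / real n) \<longlonglongrightarrow> L"
    and hM: "\<forall>\<^sub>F n in sequentially. h * real (M n) \<le> pi / 2 * real n"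
    and w: "\<And>\<epsilon> \<eta>. 0 < \<epsilon> \<Longrightarrow> \<epsilon> < 1 / 4 \<Longrightarrow> 0 < \<eta> \<Longrightarrow> \<forall>\<^sub>F n in sequentially. \<exists>\<kappa>. \<forall>i.
       \<epsilon> * real n \<le> real i \<longrightarrow> real i \<le> (L - \<epsilon>) * real n \<longrightarrow>
         w n i \<noteq> 0 \<and> \<bar>ln \<bar>w n i\<bar> - \<kappa> + real n * V (real i / real n)\<bar> \<le> \<eta> * real n"
    and CW: "\<And>n y. CW n y = (\<Prod>j\<in>{1..n}. \<Prod>i\<in>{1..<j}. (2 * cos (pn n + 2 * h * (real (y i) / real n)) -
         2 * cos (pn n + 2 * h * (real (y j) / real n)))\<^sup>2) * (\<Prod>j\<in>{1..n}. w n (y j))"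
    and k: "1 \<le> k" and \<tau>: "0 < \<tau>"
  shows "\<exists>c>0. \<forall>\<^sub>F n in sequentially. \<forall>y\<in>configs n (M n).
    \<tau> * real n \<le> \<bar>(\<Sum>j=1..n. cos (real k * th (real (y j) / real n))) - real n * integral {0..L} (\<lambda>x. rho x * cos (real k * th x))\<bar>
     \<longrightarrow> (\<exists>z\<in>configs n (M n). \<bar>CW n y\<bar> \<le> exp (- c * (real n)\<^sup>2) * \<bar>CW n z\<bar>)"
proof -
  \<comment> \<open>The gap 2 r^k / k D^2 with r \<ge> 1/2 and |D| \<ge> \<tau> n / 2 is at least d
    n^2.\<close>
  define d where "d = \<tau>\<^sup>2 / (2 * real k * 2 ^ k)"
  have d: "0 < d" using \<tau> k by (simp add: d_def)
  have C: "0 \<le> E0"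
  proof -
    have "0 \<le> C1" "0 \<le> C2" using h L by (simp_all add: C1_def C2_def)
    then show ?thesis unfolding E0_def using L h C\<Phi>_nonneg by simp
  qed
  \<comment> \<open>Error budget in units of d n^2: 1/4 for the term with \<open>E0\<close>, 1/8
    each for 8 \<delta> / \<epsilon>^4 and 2 \<eta>, and 1/4 for the term with \<open>E1\<close>
    once n is large; a quarter of the gap remains. The bound \<tau> / 36 keeps the moment error 9
    \<epsilon> n of the comparison set below \<tau> n / 4.\<close>
  define \<epsilon> where "\<epsilon> = min (1 / 5) (min (\<tau> / 36) ((d / (4 * (E0 + 1)))\<^sup>2))"
  have e: "0 < \<epsilon>" "\<epsilon> < 1 / 4" "9 * \<epsilon> \<le> \<tau> / 4" using \<tau> d C by (auto simp: \<epsilon>_def)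
  have eE: "E0 * sqrt \<epsilon> \<le> d / 4"
  proof -
    have "sqrt \<epsilon> \<le> sqrt ((d / (4 * (E0 + 1)))\<^sup>2)" by (rule real_sqrt_le_mono) (simp add: \<epsilon>_def)
    also have "\<dots> = d / (4 * (E0 + 1))" using d C by simp
    finally have "E0 * sqrt \<epsilon> \<le> E0 * (d / (4 * (E0 + 1)))" using C by (rule mult_left_mono)
    also have "\<dots> \<le> d / 4" using d C by (simp add: field_simps)
    finally show ?thesis .
  qed
  define \<delta> where "\<delta> = min (h * \<epsilon> / 4) (d * \<epsilon>^4 / 64)"
  have \<delta>: "0 < \<delta>" "\<delta> \<le> h * \<epsilon> / 4" using h e d by (auto simp: \<delta>_def)
  have d8: "8 * \<delta> / \<epsilon>^4 \<le> d / 8"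
  proof -
    have "\<delta> \<le> d * \<epsilon>^4 / 64" by (simp add: \<delta>_def)
    then show ?thesis using e by (simp add: pos_divide_le_eq)
  qed
  define \<eta> where "\<eta> = d / 16"
  have \<eta>: "0 < \<eta>" using d by (simp add: \<eta>_def)
  have ev1: "\<forall>\<^sub>F n in sequentially. \<bar>pn n - p\<bar> \<le> \<delta>"
    using tendstoD[OF pn \<delta>(1)] by eventually_elim (simp add: dist_real_def)
  have ev2: "\<forall>\<^sub>F n in sequentially. \<bar>real (M n) / real n - L\<bar> < \<epsilon> / 2"
    using tendstoD[OF M, of "\<epsilon> / 2"] e by (auto simp: dist_real_def)
  have ev3: "\<forall>\<^sub>F n in sequentially. 4 \<le> \<epsilon> * real n" by (rule eventually_mult_ge[OF e(1)])
  have ev4: "\<forall>\<^sub>F n in sequentially. 4 + 4 * h * real k * (L + 1) \<le> \<tau> / 4 * real n"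
    by (rule eventually_mult_ge) (use \<tau> in simp)
  have ev5: "\<forall>\<^sub>F n in sequentially. E1 \<epsilon> \<le> d / 4 * real n" by (rule eventually_mult_ge) (use d in simp)
  have ev6: "\<forall>\<^sub>F n in sequentially. 0 < n" by (rule eventually_gt_at_top)
  show ?thesis
  proof (intro exI conjI)
    show "0 < d / 4" using d by simp
    show "\<forall>\<^sub>F n in sequentially. \<forall>y\<in>configs n (M n).
    \<tau> * real n \<le> \<bar>(\<Sum>j=1..n. cos (real k * th (real (y j) / real n))) - real n * integral {0..L} (\<lambda>x. rho x * cos (real k * th x))\<bar>
     \<longrightarrow> (\<exists>z\<in>configs n (M n). \<bar>CW n y\<bar> \<le> exp (- (d / 4) * (real n)\<^sup>2) * \<bar>CW n z\<bar>)"
      using ev1 ev2 ev3 ev4 ev5 ev6 hM w[OF e(1,2) \<eta>]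
    proof eventually_elim
      case (elim n)
      then obtain \<kappa> where \<kappa>: "\<And>i. \<epsilon> * real n \<le> real i \<Longrightarrow> real i \<le> (L - \<epsilon>) * real n \<Longrightarrow>
         w n i \<noteq> 0 \<and> \<bar>ln \<bar>w n i\<bar> - \<kappa> + real n * V (real i / real n)\<bar> \<le> \<eta> * real n" by blast
      have nn: "0 < real n" using elim by simp
      interpret lat: racah_lattice h L a p s V CV n "M n" "pn n" \<delta> \<epsilon> \<kappa> \<eta> "w n"
      proof unfold_locales
        have m: "real (M n) / real n \<le> L + \<epsilon> / 2" "L - \<epsilon> \<le> real (M n) / real n" using elim(2) e unfolding abs_less_iff by linarith+
        show "real (M n) \<le> (L + \<epsilon> / 2) * real n" using m(1) nn by (simp add: divide_le_eq)
        show "(L - \<epsilon>) * real n \<le> real (M n)" using m(2) nn by (simp add: le_divide_eq)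
      qed (use elim e \<delta> \<kappa> in auto)
      have CWe: "CW n = lat.CW" by (rule ext) (simp add: CW lat.CW_def lat.tn_def)
      show ?case
      proof (intro ballI impI)
        fix y assume y: "y \<in> configs n (M n)" and dev:
          "\<tau> * real n \<le> \<bar>(\<Sum>j=1..n. cos (real k * th (real (y j) / real n))) - real n * integral {0..L} (\<lambda>x. rho x * cos (real k * th x))\<bar>"
        show "\<exists>z\<in>configs n (M n). \<bar>CW n y\<bar> \<le> exp (- (d / 4) * (real n)\<^sup>2) * \<bar>CW n z\<bar>"
        proof (cases "CW n y = 0")
          case True
          then show ?thesis using y by (intro bexI[of _ y]) auto
        next
          case False
          then have "lat.CW y \<noteq> 0" by (simp add: CWe)
          from lat.CW_compare[OF y this] obtain z where z0: "z \<in> configs n (M n)"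
            "\<And>k. \<exists>c. \<bar>c - real n * integral {0..L} (\<lambda>x. rho x * cos (real k * th x))\<bar> \<le> 9 * \<epsilon> * real n + 4 + 4 * h * real k * (L + 1) \<and>
            \<bar>lat.CW y\<bar> \<le> exp ((real n)\<^sup>2 * (E0 * sqrt \<epsilon> + 8 * \<delta> / \<epsilon>^4 + 2 * \<eta>) + real n * E1 \<epsilon>
             - 2 * lat.r ^ k / real k * ((\<Sum>j=1..n. cos (real k * lat.ts (y j))) - c)\<^sup>2) * \<bar>lat.CW z\<bar>" by blast
          from z0(1) z0(2)[of k] obtain c where z: "z \<in> configs n (M n)"
            "\<bar>c - real n * integral {0..L} (\<lambda>x. rho x * cos (real k * th x))\<bar> \<le> 9 * \<epsilon> * real n + 4 + 4 * h * real k * (L + 1)"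
            "\<bar>lat.CW y\<bar> \<le> exp ((real n)\<^sup>2 * (E0 * sqrt \<epsilon> + 8 * \<delta> / \<epsilon>^4 + 2 * \<eta>) + real n * E1 \<epsilon>
             - 2 * lat.r ^ k / real k * ((\<Sum>j=1..n. cos (real k * lat.ts (y j))) - c)\<^sup>2) * \<bar>lat.CW z\<bar>"
            by blast
          define D where "D = (\<Sum>j=1..n. cos (real k * lat.ts (y j))) - c"
          have "9 * \<epsilon> * real n \<le> \<tau> / 4 * real n" using e by (intro mult_right_mono) auto
          then have "\<tau> / 2 * real n \<le> \<bar>D\<bar>"
            using dev z(2) elim(4) unfolding D_def lat.ts_def by linarith
          then have "(\<tau> / 2 * real n)\<^sup>2 \<le> \<bar>D\<bar>\<^sup>2" using \<tau> by (intro power_mono) auto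
          then have D2: "\<tau>\<^sup>2 / 4 * (real n)\<^sup>2 \<le> D\<^sup>2" by (simp add: power_mult_distrib power_divide)
          have "\<epsilon>\<^sup>2 \<le> (1 / 4)\<^sup>2" using e by (intro power_mono) auto
          then have "1 / 2 \<le> lat.r" unfolding lat.r_def by (simp add: power2_eq_square)
          then have "(1 / 2) ^ k \<le> lat.r ^ k" by (intro power_mono) auto
          then have "2 * (1 / 2) ^ k / real k * (\<tau>\<^sup>2 / 4 * (real n)\<^sup>2) \<le> 2 * lat.r ^ k / real k * D\<^sup>2"
            using D2 k lat.r01 by (intro mult_mono divide_right_mono) auto
          moreover have "2 * (1 / 2) ^ k / real k * (\<tau>\<^sup>2 / 4 * (real n)\<^sup>2) = d * (real n)\<^sup>2"
            using k by (simp add: d_def power_divide)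
          moreover have "(real n)\<^sup>2 * (E0 * sqrt \<epsilon> + 8 * \<delta> / \<epsilon>^4 + 2 * \<eta>) \<le> (real n)\<^sup>2 * (d / 2)"
            using eE d8 by (intro mult_left_mono) (auto simp: \<eta>_def)
          moreover have "real n * E1 \<epsilon> \<le> real n * (d / 4 * real n)" using elim(5) by (intro mult_left_mono) auto
          moreover have "real n * (d / 4 * real n) = d * (real n)\<^sup>2 / 4" by (simp add: power2_eq_square)
          moreover have "(real n)\<^sup>2 * (d / 2) = d * (real n)\<^sup>2 / 2" "- (d / 4) * (real n)\<^sup>2 = - (d * (real n)\<^sup>2 / 4)" by simp_all
          ultimately have "(real n)\<^sup>2 * (E0 * sqrt \<epsilon> + 8 * \<delta> / \<epsilon>^4 + 2 * \<eta>) + real n * E1 \<epsilon> - 2 * lat.r ^ k / real k * D\<^sup>2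
            \<le> - (d / 4) * (real n)\<^sup>2" by linarith
          then have "exp ((real n)\<^sup>2 * (E0 * sqrt \<epsilon> + 8 * \<delta> / \<epsilon>^4 + 2 * \<eta>) + real n * E1 \<epsilon> - 2 * lat.r ^ k / real k * D\<^sup>2) * \<bar>lat.CW z\<bar>
            \<le> exp (- (d / 4) * (real n)\<^sup>2) * \<bar>lat.CW z\<bar>" by (intro mult_right_mono) auto
          then show ?thesis using z(1,3) unfolding D_def CWe by (intro bexI[of _ z]) linarith+
        qed
      qed
    qed
  qed
qed

end

subsection \<open>The weight\<close>

lemma one_minus_cis: "1 - cis (2 * t) = (- 2 * \<i>) * (of_real (sin t) * cis t)"
  by (simp add: complex_eq_iff cos_double_sin sin_double power2_eq_square)

text \<open>Exponents of the four upper and the four lower parameters of the weight; the entry 0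
  stands for the lower parameter that equals the base.\<close>

definition angs :: "real \<Rightarrow> real \<Rightarrow> real \<Rightarrow> real \<Rightarrow> real list" where
  "angs ga gb gd gg = [ga, gb + gd, gg, gg + gd, 0, gg + gd - ga, gg - gb, gd]"

text \<open>Modulus and sign of the quotient of consecutive weights, apart from the factor 1 -
  \<gamma> \<delta> \<open>q^(2y+1)\<close>, after removal of all phases.\<close>

definition wratio :: "(nat \<Rightarrow> real) \<Rightarrow> real \<Rightarrow> real" where
  "wratio c t = (\<Prod>i<4. sin (c i + t)) / (\<Prod>i\<in>{4..<8}. sin (c i + t))"

lemma lessThan_4: "{..<4} = {0, 1, 2, 3::nat}" and atLeastLessThan_4_8: "{4..<8} = {4, 5, 6, 7::nat}"
  by auto

lemma qpow_power: "qpow gq (1 / real n) ^ k = cis (gq * (real k / real n))"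
  unfolding qpow_def Complex.DeMoivre by (rule arg_cong[of _ _ cis]) simp

lemma nu_tilde_real:
  "nu_tilde gq gd gg n y = of_real (2 * cos (gq / 2 * (gg + gd + 1 / real n) + gq * (real y / real n)))"
proof -
  define u where "u = gq / 2 * (gg + gd + 1 / real n) + gq * (real y / real n)"
  have 1: "qpow gq (- (gg + gd + 1 / real n) / 2) * inverse (qpow gq (1 / real n) ^ y) = cis (- u)"
    unfolding qpow_power unfolding qpow_def cis_inverse cis_mult u_def
    by (rule arg_cong[of _ _ cis]) (simp add: algebra_simps add_divide_distrib diff_divide_distrib)
  have 2: "qpow gq (- (gg + gd + 1 / real n) / 2) * (qpow gq gd * qpow gq gg * qpow gq (1 / real n) ^ (y + 1)) = cis u"
    unfolding qpow_power unfolding qpow_def cis_mult u_def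
    by (rule arg_cong[of _ _ cis]) (simp add: algebra_simps add_divide_distrib diff_divide_distrib)
  have "nu_tilde gq gd gg n y = cis (- u) + cis u"
    unfolding nu_tilde_def nu_def distrib_left 1 2 ..
  also have "\<dots> = of_real (2 * cos u)" by (simp add: complex_eq_iff)
  finally show ?thesis by (simp add: u_def)
qed

definition wreal :: "real \<Rightarrow> real \<Rightarrow> real \<Rightarrow> real \<Rightarrow> real \<Rightarrow> nat \<Rightarrow> nat \<Rightarrow> real" where
  "wreal h ga gb gd gg n y =
     (\<Prod>s<y. wratio (\<lambda>i. h * (angs ga gb gd gg ! i)) (h * (real (s + 1) / real n))) *
     sin (h * (gg + gd + 1 / real n) + 2 * h * (real y / real n)) / sin (h * (gg + gd + 1 / real n))"

lemma qpoch_4: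
  "qpoch [a, b, c, d] q y = (\<Prod>s<y. (1 - a * q ^ s) * (1 - b * q ^ s) * (1 - c * q ^ s) * (1 - d * q ^ s))"
  by (simp add: qpoch_def prod.distrib mult.assoc)

lemma cis_factors:
  "(1 - cis (2 * t0)) * (1 - cis (2 * t1)) * (1 - cis (2 * t2)) * (1 - cis (2 * t3)) =
    16 * of_real (sin t0 * sin t1 * sin t2 * sin t3) * cis (t0 + t1 + t2 + t3)"
proof -
  have k: "(k * a) * (k * b) * (k * c) * (k * d) = (k * k) * (k * k) * (a * b * c * d)" for k a b c d :: complex
    by (simp only: mult_ac)
  have k2: "(- 2 * \<i>) * (- 2 * \<i>) = - 4" by simp
  show ?thesis unfolding one_minus_cis k k2 cis_mult[symmetric] of_real_mult by (simp add: mult_ac)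
qed

text \<open>Each factor 1 - q^t is a sine times the phase of half the angle and a constant. Per step
  the phases leave cis (- 2 h / n), and the y-th power of this is cancelled by the phase of the last
  factor of the weight.\<close>

lemma w_n_real:
  assumes n: "0 < n"
  shows "w_n gq ga gb gd gg n y = of_real (wreal (gq / 2) ga gb gd gg n y)"
proof -
  define h where "h = gq / 2"
  define q where "q = qpow gq (1 / real n)"
  define F where "F = (\<lambda>s. wratio (\<lambda>i. h * (angs ga gb gd gg ! i)) (h * (real (s + 1) / real n)))"
  have gq: "gq = 2 * h" by (simp add: h_def)
  have qs: "qpow gq x * q * q ^ s = cis (2 * (h * x + h * (real (s + 1) / real n)))" for x s
    using qpow_power[of gq n "s + 1"] unfolding mult.assoc power_Suc[symmetric] q_def Suc_eq_plus1
    by (simp add: qpow_def cis_mult gq algebra_simps)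
  have qs0: "q * q ^ s = cis (2 * (h * 0 + h * (real (s + 1) / real n)))" for s
    using qs[of 0 s] by (simp add: qpow_def)
  have m: "qpow gq a * qpow gq b = qpow gq (a + b)" for a b by (simp add: qpow_def cis_mult algebra_simps)
  have mi: "inverse (qpow gq a) * qpow gq b = qpow gq (b - a)" for a b by (simp add: qpow_def cis_inverse cis_mult algebra_simps)
  have 1: "(\<Prod>s<y. (1 - qpow gq ga * q * q ^ s) * (1 - qpow gq gb * qpow gq gd * q * q ^ s) *
         (1 - qpow gq gg * q * q ^ s) * (1 - qpow gq gg * qpow gq gd * q * q ^ s)) /
      ((\<Prod>s<y. (1 - q * q ^ s) * (1 - inverse (qpow gq ga) * qpow gq gg * qpow gq gd * q * q ^ s) *
         (1 - inverse (qpow gq gb) * qpow gq gg * q * q ^ s) * (1 - qpow gq gd * q * q ^ s)) * (qpow gq ga * qpow gq gb * q) ^ y)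
      = of_real (\<Prod>s<y. F s) * cis (- (2 * h * (real y / real n)))"
  proof -
    have "(\<Prod>s<y. (1 - qpow gq ga * q * q ^ s) * (1 - qpow gq gb * qpow gq gd * q * q ^ s) *
         (1 - qpow gq gg * q * q ^ s) * (1 - qpow gq gg * qpow gq gd * q * q ^ s)) /
      ((\<Prod>s<y. (1 - q * q ^ s) * (1 - inverse (qpow gq ga) * qpow gq gg * qpow gq gd * q * q ^ s) *
         (1 - inverse (qpow gq gb) * qpow gq gg * q * q ^ s) * (1 - qpow gq gd * q * q ^ s)) * (qpow gq ga * qpow gq gb * q) ^ y)
      = (\<Prod>s<y. ((1 - qpow gq ga * q * q ^ s) * (1 - qpow gq gb * qpow gq gd * q * q ^ s) *
         (1 - qpow gq gg * q * q ^ s) * (1 - qpow gq gg * qpow gq gd * q * q ^ s)) /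
        ((1 - q * q ^ s) * (1 - inverse (qpow gq ga) * qpow gq gg * qpow gq gd * q * q ^ s) *
         (1 - inverse (qpow gq gb) * qpow gq gg * q * q ^ s) * (1 - qpow gq gd * q * q ^ s) * (qpow gq ga * qpow gq gb * q)))"
      by (simp add: prod_dividef prod.distrib)
    also have "\<dots> = (\<Prod>s<y. of_real (F s) * cis (- (2 * h / real n)))"
    proof (rule prod.cong[OF refl])
      fix s
      define t where "t = h * (real (s + 1) / real n)"
      have q1: "qpow gq ga * qpow gq gb * q = cis (2 * h * (ga + gb) + 2 * h / real n)"
        unfolding q_def by (simp add: qpow_def cis_mult gq algebra_simps)
      have c: "cis (h * ga + t + (h * (gb + gd) + t) + (h * gg + t) + (h * (gg + gd) + t)) /
        (cis (h * 0 + t + (h * (gg + gd - ga) + t) + (h * (gg - gb) + t) + (h * gd + t)) * cis (2 * h * (ga + gb) + 2 * h / real n))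
        = cis (- (2 * h / real n))"
        unfolding cis_mult cis_divide by (rule arg_cong[of _ _ cis]) (simp add: algebra_simps)
      have d: "(16 * A * X) / (16 * B * Y * Z) = A / B * (X / (Y * Z))" for A B X Y Z :: complex by simp
      have e: "h * gg + (t + h * (gd - ga)) = h * (gg + gd - ga) + t" by (simp add: algebra_simps)
      show "((1 - qpow gq ga * q * q ^ s) * (1 - qpow gq gb * qpow gq gd * q * q ^ s) *
         (1 - qpow gq gg * q * q ^ s) * (1 - qpow gq gg * qpow gq gd * q * q ^ s)) /
        ((1 - q * q ^ s) * (1 - inverse (qpow gq ga) * qpow gq gg * qpow gq gd * q * q ^ s) *
         (1 - inverse (qpow gq gb) * qpow gq gg * q * q ^ s) * (1 - qpow gq gd * q * q ^ s) * (qpow gq ga * qpow gq gb * q))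
        = of_real (F s) * cis (- (2 * h / real n))"
      proof -
        have i: "inverse (qpow gq ga) * qpow gq gg * qpow gq gd = qpow gq (gg + gd - ga)"
          unfolding mi m by (simp add: algebra_simps)
        have F: "F s = (sin (h * ga + t) * sin (h * (gb + gd) + t) * sin (h * gg + t) * sin (h * (gg + gd) + t)) /
           (sin (h * 0 + t) * sin (h * (gg + gd - ga) + t) * sin (h * (gg - gb) + t) * sin (h * gd + t))"
          unfolding F_def wratio_def lessThan_4 atLeastLessThan_4_8 t_def angs_def by simp
        show ?thesis
          unfolding q1 i unfolding m mi qs qs0 t_def[symmetric] cis_factors d c F of_real_divide ..
      qed
    qed
    also have "\<dots> = of_real (\<Prod>s<y. F s) * cis (- (2 * h * (real y / real n)))"
      by (simp add: prod.distrib Complex.DeMoivre mult_ac)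
    finally show ?thesis .
  qed
  have 2: "(1 - qpow gq gg * qpow gq gd * q ^ (2 * y + 1)) / (1 - qpow gq gg * qpow gq gd * q)
    = of_real (sin (h * (gg + gd + 1 / real n) + 2 * h * (real y / real n)) / sin (h * (gg + gd + 1 / real n))) * cis (2 * h * (real y / real n))"
  proof -
    define u where "u = h * (gg + gd + 1 / real n)"
    define v where "v = 2 * h * (real y / real n)"
    have a: "qpow gq gg * qpow gq gd * q ^ (2 * y + 1) = cis (2 * (u + v))"
      unfolding q_def qpow_power unfolding qpow_def cis_mult u_def v_def
      by (rule arg_cong[of _ _ cis]) (simp add: gq algebra_simps add_divide_distrib)
    have b: "qpow gq gg * qpow gq gd * q = cis (2 * u)"
      unfolding q_def qpow_def cis_mult u_def by (rule arg_cong[of _ _ cis]) (simp add: gq algebra_simps)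
    have "cis (u + v) / cis u = cis v" by (simp add: cis_divide)
    then have c: "of_real (sin (u + v)) * cis (u + v) / (of_real (sin u) * cis u) = (of_real (sin (u + v) / sin u) * cis v :: complex)"
      by (metis of_real_divide times_divide_times_eq)
    show ?thesis unfolding a b one_minus_cis u_def[symmetric] v_def[symmetric] c[symmetric]
      by (rule mult_divide_mult_cancel_left) simp
  qed
  have "w_n gq ga gb gd gg n y = (of_real (\<Prod>s<y. F s) * cis (- (2 * h * (real y / real n)))) *
    (of_real (sin (h * (gg + gd + 1 / real n) + 2 * h * (real y / real n)) / sin (h * (gg + gd + 1 / real n))) * cis (2 * h * (real y / real n)))"
    unfolding 1[symmetric] 2[symmetric] w_n_def qRacah_weight_def qpoch_4 q_def[symmetric] by simp
  also have "\<dots> = of_real (wreal h ga gb gd gg n y)"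
    unfolding wreal_def F_def[symmetric] by (simp add: cis_mult mult_ac)
  finally show ?thesis by (simp add: h_def)
qed

text \<open>Shifting the angle by a multiple of \<pi> multiplies all cosines by the same sign, which
  the squared differences do not see; this allows the reduced angle p in the limit.\<close>

lemma config_weight_real:
  assumes n: "0 < n"
  shows "config_weight gq ga gb gd gg n y =
    (\<Prod>j\<in>{1..n}. \<Prod>i\<in>{1..<j}. (2 * cos (gq / 2 * (gg + gd + 1 / real n) - pi * of_int k + 2 * (gq / 2) * (real (y i) / real n)) -
       2 * cos (gq / 2 * (gg + gd + 1 / real n) - pi * of_int k + 2 * (gq / 2) * (real (y j) / real n)))\<^sup>2) *
    (\<Prod>j\<in>{1..n}. wreal (gq / 2) ga gb gd gg n (y j))"
proof -
  have c: "(2 * cos (u - pi * of_int k + v) - 2 * cos (u - pi * of_int k + v'))\<^sup>2 = (2 * cos (u + v) - 2 * cos (u + v'))\<^sup>2" for u v v' :: real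
  proof -
    have s0: "sin (pi * of_int k) = 0" by (simp add: sin_zero_iff_int2 mult.commute)
    have e: "cos (u - pi * of_int k + v) = cos (pi * of_int k) * cos (u + v)" for v
      using cos_diff[of "u + v" "pi * of_int k"] s0 by (simp add: algebra_simps)
    have "2 * cos (u - pi * of_int k + v) - 2 * cos (u - pi * of_int k + v') =
      cos (pi * of_int k) * (2 * cos (u + v) - 2 * cos (u + v'))"
      unfolding e by (simp only: right_diff_distrib mult_ac)
    moreover have "(cos (pi * of_int k))\<^sup>2 = 1" using sin_cos_squared_add[of "pi * of_int k"] s0 by simp
    ultimately show ?thesis by (simp only: power_mult_distrib mult_1)
  qed
  show ?thesis unfolding config_weight_def c nu_tilde_real w_n_real[OF n]
    by (simp flip: of_real_prod of_real_diff of_real_power of_real_mult)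
qed

text \<open>Without zeros on (0, L) the angles stay between two consecutive multiples of \<pi>, and
  on {\<epsilon>..L - \<epsilon>} they keep the distance h \<epsilon> from both.\<close>

lemma abs_sin_ge_gap:
  fixes \<theta> h L x \<epsilon> :: real
  assumes h: "0 < h" and nz: "\<And>x. 0 < x \<Longrightarrow> x < L \<Longrightarrow> sin (\<theta> + h * x) \<noteq> 0"
    and x: "0 < \<epsilon>" "x \<in> {\<epsilon>..L - \<epsilon>}"
  shows "h * \<epsilon> / 2 \<le> \<bar>sin (\<theta> + h * x)\<bar>"
proof -
  define m where "m = \<lfloor>\<theta> / pi\<rfloor>"
  have m: "pi * of_int m \<le> \<theta>" "\<theta> < pi * of_int m + pi"
  proof -
    have "of_int m \<le> \<theta> / pi" "\<theta> / pi < of_int m + 1" using floor_correct[of "\<theta> / pi"] by (simp_all add: m_def)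
    then show "pi * of_int m \<le> \<theta>" "\<theta> < pi * of_int m + pi"
      unfolding pos_le_divide_eq[OF pi_gt_zero] pos_divide_less_eq[OF pi_gt_zero] by (simp_all add: algebra_simps)
  qed
  have top: "\<theta> + h * L \<le> pi * of_int m + pi"
  proof (rule ccontr)
    assume *: "\<not> ?thesis"
    define z where "z = (pi * of_int m + pi - \<theta>) / h"
    have "0 < z" "z < L" using m * h by (auto simp: z_def field_simps)
    moreover have "h * z = pi * of_int m + pi - \<theta>" using h by (simp add: z_def)
    then have "\<theta> + h * z = of_int (m + 1) * pi" by (simp add: algebra_simps)
    then have "sin (\<theta> + h * z) = 0" unfolding sin_zero_iff_int2 by blast
    ultimately show False using nz by blast
  qed
  define v where "v = \<theta> - pi * of_int m + h * x"
  have he: "h * \<epsilon> \<le> h * x" "h * x \<le> h * (L - \<epsilon>)" using x h by (auto intro!: mult_left_mono)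
  then have "h * x \<le> h * L - h * \<epsilon>" by (simp add: algebra_simps)
  then have v: "h * \<epsilon> \<le> v" "v \<le> pi - h * \<epsilon>" using m top he unfolding v_def by linarith+
  have h0: "0 < h * \<epsilon>" using h x by simp
  have "h * \<epsilon> / 2 \<le> sin (h * \<epsilon>)" using v h0 by (intro sin_ge_half) linarith+
  also have "\<dots> \<le> sin v" using v h0 by (intro sin_between) linarith+
  also have "\<dots> \<le> \<bar>sin v\<bar>" by simp
  also have "\<bar>sin v\<bar> = \<bar>sin (\<theta> + h * x)\<bar>"
  proof -
    have s0: "sin (pi * of_int m) = 0" by (simp add: sin_zero_iff_int2 mult.commute)
    then have "\<bar>cos (pi * of_int m)\<bar> = 1" using sin_zero_abs_cos_one by blast
    moreover have "sin v = sin (\<theta> + h * x) * cos (pi * of_int m)"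
      using sin_diff[of "\<theta> + h * x" "pi * of_int m"] s0 by (simp add: v_def algebra_simps)
    ultimately show ?thesis by (simp add: abs_mult)
  qed
  finally show ?thesis .
qed

lemma abs_ln_diff_le:
  fixes A B m d :: real
  assumes "m \<le> \<bar>B\<bar>" "\<bar>A - B\<bar> \<le> d" "d \<le> m / 2" "0 < m"
  shows "A \<noteq> 0" "\<bar>ln \<bar>A\<bar> - ln \<bar>B\<bar>\<bar> \<le> 2 * d / m"
proof -
  have A: "m / 2 \<le> \<bar>A\<bar>" using assms by linarith
  then show "A \<noteq> 0" using assms by auto
  have *: "ln x - ln y \<le> 2 * d / m" if "m / 2 \<le> x" "m / 2 \<le> y" "\<bar>x - y\<bar> \<le> d" for x y
  proof -
    have "ln x - ln y \<le> (x - y) / y" using that assms(4) by (intro ln_diff_le) auto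
    also have "\<dots> \<le> d / (m / 2)" using that assms(4) by (intro frac_le) auto
    finally show ?thesis by (simp add: mult.commute)
  qed
  have "\<bar>\<bar>A\<bar> - \<bar>B\<bar>\<bar> \<le> d" using assms by linarith
  then show "\<bar>ln \<bar>A\<bar> - ln \<bar>B\<bar>\<bar> \<le> 2 * d / m"
    using *[of "\<bar>A\<bar>" "\<bar>B\<bar>"] *[of "\<bar>B\<bar>" "\<bar>A\<bar>"] A assms by (simp add: abs_le_iff)
qed

definition lnratio :: "(nat \<Rightarrow> real) \<Rightarrow> real \<Rightarrow> real" where
  "lnratio c t = (\<Sum>i<4. ln \<bar>sin (c i + t)\<bar>) - (\<Sum>i\<in>{4..<8}. ln \<bar>sin (c i + t)\<bar>)"

lemma ln_abs_wratio:
  assumes "\<And>i. i < 8 \<Longrightarrow> sin (c i + t) \<noteq> 0"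
  shows "wratio c t \<noteq> 0" "ln \<bar>wratio c t\<bar> = lnratio c t"
proof -
  have nz: "(\<Prod>i<4. sin (c i + t)) \<noteq> 0" "(\<Prod>i\<in>{4..<8}. sin (c i + t)) \<noteq> 0"
    using assms by (auto simp: prod_zero_iff)
  then show "wratio c t \<noteq> 0" by (simp add: wratio_def)
  have "ln \<bar>wratio c t\<bar> = ln \<bar>\<Prod>i<4. sin (c i + t)\<bar> - ln \<bar>\<Prod>i\<in>{4..<8}. sin (c i + t)\<bar>"
    unfolding wratio_def abs_divide by (subst ln_div) (use nz in auto)
  also have "\<dots> = lnratio c t"
    unfolding lnratio_def abs_prod by (subst (1 2) ln_prod) (use assms in auto)
  finally show "ln \<bar>wratio c t\<bar> = lnratio c t" .
qed

lemma lnratio_diff_le: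
  assumes "\<And>i. i < 8 \<Longrightarrow> \<bar>ln \<bar>sin (c i + t)\<bar> - ln \<bar>sin (c' i + t')\<bar>\<bar> \<le> e"
  shows "\<bar>lnratio c t - lnratio c' t'\<bar> \<le> 8 * e"
proof -
  define f where "f = (\<lambda>i. ln \<bar>sin (c i + t)\<bar>)"
  define g where "g = (\<lambda>i. ln \<bar>sin (c' i + t')\<bar>)"
  have b: "\<bar>f i - g i\<bar> \<le> e" if "i < 8" for i using assms[OF that] by (simp only: f_def g_def)
  have e0: "0 \<le> e" using b[of 0] by linarith
  have 1: "\<bar>\<Sum>i<4. f i - g i\<bar> \<le> 4 * e"
    by (rule sum_abs_le_card) (use b e0 in auto)
  have 2: "\<bar>\<Sum>i\<in>{4..<8}. f i - g i\<bar> \<le> 4 * e"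
    by (rule sum_abs_le_card) (use b e0 in auto)
  have "lnratio c t - lnratio c' t' = (\<Sum>i<4. f i - g i) - (\<Sum>i\<in>{4..<8}. f i - g i)"
    unfolding lnratio_def f_def[symmetric] g_def[symmetric] sum_subtractf by (simp add: f_def g_def)
  then show ?thesis using 1 2 by linarith
qed

lemma lnratio_bound:
  assumes "\<And>i. i < 8 \<Longrightarrow> m \<le> \<bar>sin (c i + t)\<bar>" "0 < m"
  shows "\<bar>lnratio c t\<bar> \<le> 16 / sqrt m"
proof -
  define f where "f = (\<lambda>i. ln \<bar>sin (c i + t)\<bar>)"
  have b: "\<bar>f i\<bar> \<le> 2 / sqrt m" if "i < 8" for i
  proof -
    have s: "0 < \<bar>sin (c i + t)\<bar>" "m \<le> \<bar>sin (c i + t)\<bar>" using assms that by force+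
    have "- f i \<le> - ln m" using s assms(2) by (simp add: f_def)
    also have "\<dots> \<le> 2 / sqrt m" by (rule ln_ge_minus_sqrt[OF assms(2)])
    finally have "- f i \<le> 2 / sqrt m" .
    moreover have "f i \<le> 0" using s by (simp add: f_def)
    ultimately show ?thesis by linarith
  qed
  have 1: "\<bar>\<Sum>i<4. f i\<bar> \<le> 4 * (2 / sqrt m)"
    by (rule sum_abs_le_card) (use b assms in auto)
  have 2: "\<bar>\<Sum>i\<in>{4..<8}. f i\<bar> \<le> 4 * (2 / sqrt m)"
    by (rule sum_abs_le_card) (use b assms in auto)
  have "lnratio c t = (\<Sum>i<4. f i) - (\<Sum>i\<in>{4..<8}. f i)" by (simp only: lnratio_def f_def)
  then show ?thesis using 1 2 by linarith
qed

lemma abs_sin_diff_le: "\<bar>sin u - sin v\<bar> \<le> \<bar>u - v\<bar>" for u v :: real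
  using abs_cos_diff_le[of "pi / 2 - u" "pi / 2 - v"] by (simp add: cos_diff abs_minus_commute)

text \<open>From the first middle site on, the logarithms of consecutive quotients are matched with
  increments of V by the mean value theorem. Everything before that site, together with S n, goes
  into \<kappa>, so no asymptotics near 0 enter.\<close>

lemma weight_asymptotics:
  fixes h L p :: real and c :: "nat \<Rightarrow> real" and cn :: "nat \<Rightarrow> nat \<Rightarrow> real" and pn d S :: "nat \<Rightarrow> real"
    and V :: "real \<Rightarrow> real" and w :: "nat \<Rightarrow> nat \<Rightarrow> real"
  assumes h: "0 < h" and L: "1 \<le> L"
    and nz: "\<And>i x. i < 8 \<Longrightarrow> 0 < x \<Longrightarrow> x < L \<Longrightarrow> sin (c i + h * x) \<noteq> 0"
    and nzp: "\<And>x. 0 < x \<Longrightarrow> x < L \<Longrightarrow> sin (p + 2 * h * x) \<noteq> 0"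
    and cn: "\<forall>\<^sub>F n in sequentially. \<forall>i<8. \<bar>cn n i - c i\<bar> \<le> d n" and d: "d \<longlonglongrightarrow> 0"
    and pn: "pn \<longlonglongrightarrow> p"
    and V: "\<And>x. 0 < x \<Longrightarrow> x < L \<Longrightarrow> (V has_real_derivative - lnratio c (h * x)) (at x)"
    and w: "\<And>n y. w n y = (\<Prod>s<y. wratio (cn n) (h * (real (s + 1) / real n))) * sin (pn n + 2 * h * (real y / real n)) / S n"
    and ex: "\<forall>\<^sub>F n in sequentially. \<exists>y. n \<le> y + 1 \<and> w n y \<noteq> 0"
    and \<epsilon>: "0 < \<epsilon>" "\<epsilon> < 1 / 4" and \<eta>: "0 < \<eta>"
  shows "\<forall>\<^sub>F n in sequentially. \<exists>\<kappa>. \<forall>i.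
       \<epsilon> * real n \<le> real i \<longrightarrow> real i \<le> (L - \<epsilon>) * real n \<longrightarrow>
         w n i \<noteq> 0 \<and> \<bar>ln \<bar>w n i\<bar> - \<kappa> + real n * V (real i / real n)\<bar> \<le> \<eta> * real n"
proof -
  define m where "m = h * \<epsilon> / 2"
  have m: "0 < m" using h \<epsilon> by (simp add: m_def)
  \<comment> \<open>Error of the parameters plus one mesh width, the distance of the mean value
    point from the site.\<close>
  define d' where "d' = (\<lambda>n. d n + h * (1 / real n))"
  have "d' \<longlonglongrightarrow> 0 + h * 0" unfolding d'_def by (intro tendsto_add tendsto_mult tendsto_const d lim_1_over_n)
  then have d': "d' \<longlonglongrightarrow> 0" by simp
  define e where "e = min (m / 2) (\<eta> * m / (32 * L))"
  have e: "0 < e" using m \<eta> L by (simp add: e_def)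
  have ev1: "\<forall>\<^sub>F n in sequentially. d' n \<le> e"
    using tendstoD[OF d' e] by eventually_elim (simp add: dist_real_def abs_less_iff)
  have ev2: "\<forall>\<^sub>F n in sequentially. \<bar>pn n - p\<bar> \<le> m / 2"
    using tendstoD[OF pn, of "m / 2"] m by (auto simp: dist_real_def elim: eventually_mono)
  have ev3: "\<forall>\<^sub>F n in sequentially. 4 \<le> real n" using eventually_mult_ge[of 1 4] by simp
  have ev4: "\<forall>\<^sub>F n in sequentially. 2 / sqrt (m / 2) \<le> \<eta> / 2 * real n" by (rule eventually_mult_ge) (use \<eta> in simp)
  show ?thesis using ev1 ev2 ev3 ev4 cn ex
  proof eventually_elim
    case (elim n)
    have nn: "0 < real n" using elim by linarith
    obtain y where y: "n \<le> y + 1" "w n y \<noteq> 0" using elim by blast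
    define i0 where "i0 = nat \<lceil>\<epsilon> * real n\<rceil>"
    define W where "W = (\<lambda>y. \<Prod>s<y. wratio (cn n) (h * (real (s + 1) / real n)))"
    have i0: "\<epsilon> * real n \<le> real i0" "real i0 \<le> \<epsilon> * real n + 1"
    proof -
      have "0 \<le> \<epsilon> * real n" using \<epsilon> by simp
      then show "\<epsilon> * real n \<le> real i0" "real i0 \<le> \<epsilon> * real n + 1" unfolding i0_def by linarith+
    qed
    have i0min: "i0 \<le> i" if "\<epsilon> * real n \<le> real i" for i using that by (simp add: i0_def ceiling_le_iff nat_le_iff)
    have "\<epsilon> * real n \<le> 1 / 4 * real n" using \<epsilon> by (intro mult_right_mono) auto
    then have "real i0 \<le> real y" using i0 y(1) elim(3) by linarith
    then have i0y: "i0 \<le> y" by simp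
    have S: "S n \<noteq> 0" and Wy: "W y \<noteq> 0" using y(2) unfolding w W_def by auto
    \<comment> \<open>A zero factor before i0 would also annihilate the weight at y, since i0 \<le>
      n - 1 \<le> y.\<close>
    have W0: "W i0 \<noteq> 0"
    proof
      assume "W i0 = 0"
      then obtain s where "s < i0" "wratio (cn n) (h * (real (s + 1) / real n)) = 0" unfolding W_def by auto
      then have "W y = 0" using i0y unfolding W_def by (auto intro!: bexI[of _ s])
      then show False using Wy by simp
    qed
    have cell: "wratio (cn n) (h * (real (i + 1) / real n)) \<noteq> 0 \<and>
      \<bar>ln \<bar>wratio (cn n) (h * (real (i + 1) / real n))\<bar> + real n * (V (real (i + 1) / real n) - V (real i / real n))\<bar> \<le> 16 * d' n / m"
      if i: "i0 \<le> i" "real (i + 1) \<le> (L - \<epsilon>) * real n" for i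
    proof -
      have x: "\<epsilon> \<le> real i / real n" "real (i + 1) / real n \<le> L - \<epsilon>"
        using i i0 nn by (auto simp: pos_le_divide_eq pos_divide_le_eq)
      have lt: "real i / real n < real (i + 1) / real n" using nn by (simp add: divide_strict_right_mono)
      have xd: "real (i + 1) / real n - real i / real n = 1 / real n" by (simp add: add_divide_distrib)
      obtain z where z: "real i / real n < z" "z < real (i + 1) / real n"
        "V (real (i + 1) / real n) - V (real i / real n) = (real (i + 1) / real n - real i / real n) * - lnratio c (h * z)"
      proof -
        have "DERIV V u :> - lnratio c (h * u)" if "real i / real n \<le> u" "u \<le> real (i + 1) / real n" for u
          using that x \<epsilon> by (intro V) linarith+
        from MVT2[OF lt this] show ?thesis using that by blast
      qed
      have Ve: "real n * (V (real (i + 1) / real n) - V (real i / real n)) = - lnratio c (h * z)"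
        unfolding z(3) xd using nn by simp
      have sn: "sin (cn n t + h * (real (i + 1) / real n)) \<noteq> 0 \<and>
         \<bar>ln \<bar>sin (cn n t + h * (real (i + 1) / real n))\<bar> - ln \<bar>sin (c t + h * z)\<bar>\<bar> \<le> 2 * d' n / m" if t: "t < 8" for t
      proof -
        have 1: "m \<le> \<bar>sin (c t + h * z)\<bar>"
          unfolding m_def by (rule abs_sin_ge_gap[OF h nz[OF t] \<epsilon>(1)]) (use x z in auto)
        have "\<bar>sin (cn n t + h * (real (i + 1) / real n)) - sin (c t + h * z)\<bar>
          \<le> \<bar>(cn n t + h * (real (i + 1) / real n)) - (c t + h * z)\<bar>" by (rule abs_sin_diff_le)
        also have "\<dots> = \<bar>(cn n t - c t) + h * (real (i + 1) / real n - z)\<bar>" by (simp add: algebra_simps)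
        also have "\<dots> \<le> \<bar>cn n t - c t\<bar> + \<bar>h * (real (i + 1) / real n - z)\<bar>" by (rule abs_triangle_ineq)
        also have "\<dots> \<le> d n + h * (1 / real n)"
        proof (rule add_mono)
          show "\<bar>cn n t - c t\<bar> \<le> d n" using elim t by blast
          have "\<bar>real (i + 1) / real n - z\<bar> \<le> 1 / real n" using z xd by linarith
          then show "\<bar>h * (real (i + 1) / real n - z)\<bar> \<le> h * (1 / real n)"
            unfolding abs_mult using h by (intro mult_mono) auto
        qed
        finally have 2: "\<bar>sin (cn n t + h * (real (i + 1) / real n)) - sin (c t + h * z)\<bar> \<le> d' n" by (simp add: d'_def)
        have 3: "d' n \<le> m / 2" using elim(1) by (simp add: e_def)
        show ?thesis using abs_ln_diff_le[OF 1 2 3 m] by blast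
      qed
      have l: "ln \<bar>wratio (cn n) (h * (real (i + 1) / real n))\<bar> = lnratio (cn n) (h * (real (i + 1) / real n))"
        "wratio (cn n) (h * (real (i + 1) / real n)) \<noteq> 0"
        by (rule ln_abs_wratio; use sn in blast)+
      have "\<bar>lnratio (cn n) (h * (real (i + 1) / real n)) - lnratio c (h * z)\<bar> \<le> 8 * (2 * d' n / m)"
        by (rule lnratio_diff_le) (use sn in blast)
      then show ?thesis using l(2) unfolding l(1) Ve by simp
    qed
    have acc: "W i \<noteq> 0 \<and> \<bar>ln \<bar>W i\<bar> - ln \<bar>W i0\<bar> + real n * (V (real i / real n) - V (real i0 / real n))\<bar> \<le> (real i - real i0) * (16 * d' n / m)"
      if "i0 \<le> i" "real i \<le> (L - \<epsilon>) * real n" for i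
      using that
    proof (induction i rule: dec_induct)
      case base
      then show ?case using W0 by simp
    next
      case (step i)
      define R where "R = wratio (cn n) (h * (real (i + 1) / real n))"
      have Rn: "R \<noteq> 0" "\<bar>ln \<bar>R\<bar> + real n * (V (real (i + 1) / real n) - V (real i / real n))\<bar> \<le> 16 * d' n / m"
        using cell[of i] step.hyps step.prems unfolding R_def by simp_all
      have IH: "W i \<noteq> 0" "\<bar>ln \<bar>W i\<bar> - ln \<bar>W i0\<bar> + real n * (V (real i / real n) - V (real i0 / real n))\<bar> \<le> (real i - real i0) * (16 * d' n / m)"
        using step by auto
      have WS: "W (Suc i) = W i * R" by (simp add: W_def R_def)
      have lnS: "ln \<bar>W (Suc i)\<bar> = ln \<bar>W i\<bar> + ln \<bar>R\<bar>"
        unfolding WS abs_mult using IH Rn by (intro ln_mult_pos) auto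
      have e1: "(real (Suc i) - real i0) * (16 * d' n / m) = (real i - real i0) * (16 * d' n / m) + 16 * d' n / m"
      proof -
        have "real (Suc i) - real i0 = (real i - real i0) + 1" by simp
        then show ?thesis by (simp only: distrib_right mult_1)
      qed
      have e2: "real n * (V (real (Suc i) / real n) - V (real i0 / real n)) =
         real n * (V (real (i + 1) / real n) - V (real i / real n)) + real n * (V (real i / real n) - V (real i0 / real n))"
        by (simp add: algebra_simps)
      show ?case
      proof
        show "W (Suc i) \<noteq> 0" using IH Rn WS by simp
        show "\<bar>ln \<bar>W (Suc i)\<bar> - ln \<bar>W i0\<bar> + real n * (V (real (Suc i) / real n) - V (real i0 / real n))\<bar> \<le> (real (Suc i) - real i0) * (16 * d' n / m)"
          unfolding e1 e2 lnS using IH(2) Rn(2) by linarith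
      qed
    qed
    define v0 where "v0 = ln \<bar>W i0\<bar>"
    define \<kappa> where "\<kappa> = v0 + real n * V (real i0 / real n) - ln \<bar>S n\<bar>"
    show ?case
    proof (intro exI[of _ \<kappa>] allI impI)
      fix i assume i: "\<epsilon> * real n \<le> real i" "real i \<le> (L - \<epsilon>) * real n"
      note a = acc[OF i0min[OF i(1)] i(2)]
      have x: "real i / real n \<in> {\<epsilon>..L - \<epsilon>}" using i nn by (auto simp: pos_le_divide_eq pos_divide_le_eq)
      define sy where "sy = sin (pn n + 2 * h * (real i / real n))"
      have "m \<le> 2 * h * \<epsilon> / 2" using h \<epsilon> by (simp add: m_def)
      also have "\<dots> \<le> \<bar>sin (p + 2 * h * (real i / real n))\<bar>"
        by (rule abs_sin_ge_gap[OF _ nzp \<epsilon>(1) x]) (use h in auto)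
      finally have 1: "m \<le> \<bar>sin (p + 2 * h * (real i / real n))\<bar>" .
      have "\<bar>sy - sin (p + 2 * h * (real i / real n))\<bar> \<le> \<bar>(pn n + 2 * h * (real i / real n)) - (p + 2 * h * (real i / real n))\<bar>"
        unfolding sy_def by (rule abs_sin_diff_le)
      then have "\<bar>sy - sin (p + 2 * h * (real i / real n))\<bar> \<le> m / 2" using elim(2) by simp
      then have sy: "m / 2 \<le> \<bar>sy\<bar>" using 1 by linarith
      have ls: "\<bar>ln \<bar>sy\<bar>\<bar> \<le> \<eta> / 2 * real n"
      proof -
        have "0 < \<bar>sy\<bar>" "\<bar>sy\<bar> \<le> 1" using sy m by (simp_all add: sy_def)
        then have "ln \<bar>sy\<bar> \<le> 0" by simp
        moreover have "- ln \<bar>sy\<bar> \<le> - ln (m / 2)" using sy m by simp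
        moreover have "- ln (m / 2) \<le> 2 / sqrt (m / 2)" using m by (intro ln_ge_minus_sqrt) simp
        ultimately show ?thesis using elim(4) by linarith
      qed
      have sy0: "sy \<noteq> 0" using sy m by auto
      have we: "w n i = W i * sy / S n" unfolding w W_def sy_def ..
      have lnw: "ln \<bar>w n i\<bar> = ln \<bar>W i\<bar> + ln \<bar>sy\<bar> - ln \<bar>S n\<bar>"
        unfolding we abs_mult abs_divide using a sy0 S by (simp add: ln_div ln_mult_pos)
      have small: "(real i - real i0) * (16 * d' n / m) \<le> \<eta> / 2 * real n"
      proof -
        have "0 \<le> d' n"
        proof -
          have "0 \<le> \<bar>cn n 0 - c 0\<bar>" by simp
          also have "\<dots> \<le> d n" using elim by force
          finally show ?thesis using h by (simp add: d'_def)
        qed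
        have "(real i - real i0) \<le> L * real n"
        proof -
          have "real i \<le> L * real n - \<epsilon> * real n" using i(2) by (simp add: algebra_simps)
          moreover have "0 < \<epsilon> * real n" using \<epsilon> nn by simp
          ultimately show ?thesis by linarith
        qed
        then have "(real i - real i0) * (16 * d' n / m) \<le> (L * real n) * (16 * d' n / m)"
          using \<open>0 \<le> d' n\<close> m by (intro mult_right_mono) auto
        also have "\<dots> \<le> (L * real n) * (16 * (\<eta> * m / (32 * L)) / m)"
          using elim(1) L m nn unfolding e_def by (intro mult_left_mono divide_right_mono) auto
        also have "\<dots> = \<eta> / 2 * real n" using L m by (simp add: field_simps)
        finally show ?thesis .
      qed
      define x where "x = ln \<bar>w n i\<bar>"
      define v where "v = ln \<bar>W i\<bar>"
      define u where "u = ln \<bar>sy\<bar>"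
      have "x - \<kappa> + real n * V (real i / real n) = (v - v0 + real n * (V (real i / real n) - V (real i0 / real n))) + u"
        using lnw unfolding \<kappa>_def v0_def v_def u_def x_def right_diff_distrib by linarith
      moreover have "\<bar>v - v0 + real n * (V (real i / real n) - V (real i0 / real n))\<bar> \<le> \<eta> / 2 * real n"
        using a small unfolding v_def v0_def by linarith
      moreover have "\<bar>u\<bar> \<le> \<eta> / 2 * real n" using ls by (simp only: u_def)
      ultimately have "\<bar>x - \<kappa> + real n * V (real i / real n)\<bar> \<le> \<eta> * real n" by linarith
      moreover have "w n i \<noteq> 0" unfolding we using a sy0 S by simp
      ultimately show "w n i \<noteq> 0 \<and> \<bar>ln \<bar>w n i\<bar> - \<kappa> + real n * V (real i / real n)\<bar> \<le> \<eta> * real n"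
        unfolding x_def by blast
    qed
  qed
qed

subsection \<open>Almost sure convergence\<close>

text \<open>As x/0 = 0, normalized weights sum to 1 or all vanish; the second case is excluded by
  total probability 1. Since the truncations max 0 (p y) also sum to 1, no p y is negative. Signs of
  the weights are thus obtained from the existence of Y.\<close>

lemma distributed_finite:
  fixes p :: "'a \<Rightarrow> real"
  assumes P: "prob_space P" and C: "finite C"
    and D: "distributed P (count_space C) Y (\<lambda>y. ennreal (p y))" and sum1: "(\<Sum>y\<in>C. p y) = 1 \<or> (\<forall>y\<in>C. p y = 0)"
  shows "(\<Sum>y\<in>C. p y) = 1" "\<And>y. y \<in> C \<Longrightarrow> 0 \<le> p y \<and> p y \<le> 1"
    "\<And>A. A \<subseteq> C \<Longrightarrow> Y -` A \<inter> space P \<in> sets P \<and> measure P (Y -` A \<inter> space P) = (\<Sum>y\<in>A. p y)"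
    "\<And>\<omega>. \<omega> \<in> space P \<Longrightarrow> Y \<omega> \<in> C"
proof -
  interpret prob_space P by fact
  have Ym: "Y \<in> measurable P (count_space C)" using D by (simp add: distributed_def)
  show "Y \<omega> \<in> C" if "\<omega> \<in> space P" for \<omega> using measurable_space[OF Ym that] by simp
  have em: "emeasure P (Y -` A \<inter> space P) = (\<Sum>y\<in>A. ennreal (p y))" if "A \<subseteq> C" for A
  proof -
    have "emeasure P (Y -` A \<inter> space P) = (\<integral>\<^sup>+ y. ennreal (p y) * indicator A y \<partial>count_space C)"
      by (rule distributed_emeasure[OF D]) (use that in simp)
    also have "\<dots> = (\<Sum>y\<in>C. ennreal (p y) * indicator A y)" by (rule nn_integral_count_space_finite[OF C])
    also have "\<dots> = (\<Sum>y\<in>C. if y \<in> A then ennreal (p y) else 0)" by (intro sum.cong) (auto simp: indicator_def)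
    also have "\<dots> = (\<Sum>y\<in>C \<inter> A. ennreal (p y))" by (rule sum.inter_restrict[symmetric, OF C])
    finally show ?thesis using that by (simp add: Int_absorb1)
  qed
  have "Y -` C \<inter> space P = space P" using measurable_space[OF Ym] by auto
  then have t: "(\<Sum>y\<in>C. ennreal (p y)) = 1" using em[of C] emeasure_space_1 by simp
  have t': "(\<Sum>y\<in>C. max 0 (p y)) = 1"
  proof -
    have "(\<Sum>y\<in>C. ennreal (p y)) = (\<Sum>y\<in>C. ennreal (max 0 (p y)))" by (intro sum.cong) (auto simp: max_def ennreal_neg)
    also have "\<dots> = ennreal (\<Sum>y\<in>C. max 0 (p y))" by (rule sum_ennreal) auto
    finally show ?thesis using t by (simp add: ennreal_eq_1)
  qed
  show s: "(\<Sum>y\<in>C. p y) = 1"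
    using sum1
  proof
    assume "\<forall>y\<in>C. p y = 0"
    then have "(\<Sum>y\<in>C. max 0 (p y)) = 0" by (intro sum.neutral) auto
    then show ?thesis using t' by simp
  qed
  have "(\<Sum>y\<in>C. max 0 (p y) - p y) = 0" using s t' by (simp add: sum_subtractf)
  then have z: "\<And>y. y \<in> C \<Longrightarrow> max 0 (p y) - p y = 0" using sum_nonneg_eq_0_iff[OF C, of "\<lambda>y. max 0 (p y) - p y"] by simp
  show p: "0 \<le> p y \<and> p y \<le> 1" if "y \<in> C" for y
  proof -
    have p0: "\<And>y. y \<in> C \<Longrightarrow> 0 \<le> p y" using z by (smt (verit))
    then have "p y \<le> (\<Sum>y\<in>C. p y)" using that C by (intro member_le_sum) auto
    then show ?thesis using p0[OF that] s by simp
  qed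
  fix A assume A: "A \<subseteq> C"
  have "emeasure P (Y -` A \<inter> space P) = ennreal (\<Sum>y\<in>A. p y)" unfolding em[OF A] by (rule sum_ennreal) (use p A in auto)
  moreover have "0 \<le> (\<Sum>y\<in>A. p y)" using p A by (intro sum_nonneg) auto
  ultimately show "Y -` A \<inter> space P \<in> sets P \<and> measure P (Y -` A \<inter> space P) = (\<Sum>y\<in>A. p y)"
    using measurable_sets[OF Ym, of A] A by (simp add: measure_def)
qed

text \<open>The count is exp (O(n ln n)), so half of the exponent c n^2 absorbs it.\<close>

lemma exp_square_beats_count:
  fixes M :: "nat \<Rightarrow> nat" and L c :: real
  assumes M: "(\<lambda>n. real (M n) / real n) \<longlonglongrightarrow> L" and c: "0 < c"
  shows "\<forall>\<^sub>F n in sequentially. real (M n + 1) ^ n * exp (- c * (real n)\<^sup>2) \<le> exp (- (c / 2)) ^ n"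
proof -
  have K: "0 < \<bar>L\<bar> + 1" by linarith
  have ev1: "\<forall>\<^sub>F n in sequentially. real (M n) / real n < \<bar>L\<bar> + 1" by (rule order_tendstoD(2)[OF M]) linarith
  have ev2: "\<forall>\<^sub>F n in sequentially. ln (\<bar>L\<bar> + 2) \<le> c / 4 * real n" by (rule eventually_mult_ge) (use c in simp)
  have ev3: "\<forall>\<^sub>F n in sequentially. ln (real n) / real n < c / 4"
    by (rule order_tendstoD(2)[OF lim_ln_over_n]) (use c in simp)
  show ?thesis using ev1 ev2 ev3 eventually_gt_at_top[of 0]
  proof eventually_elim
    case (elim n)
    have n1: "1 \<le> real n" using elim by simp
    have "real (M n) \<le> (\<bar>L\<bar> + 1) * real n" using elim by (simp add: pos_divide_less_eq)
    then have "real (M n + 1) \<le> (\<bar>L\<bar> + 2) * real n" using n1 by (simp add: distrib_right)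
    then have "ln (real (M n + 1)) \<le> ln ((\<bar>L\<bar> + 2) * real n)" by (subst ln_le_cancel_iff) (use n1 in \<open>auto intro!: mult_pos_pos\<close>)
    also have "\<dots> = ln (\<bar>L\<bar> + 2) + ln (real n)" using n1 by (intro ln_mult_pos) auto
    also have "\<dots> \<le> c / 4 * real n + c / 4 * real n"
      using elim(2,3) n1 by (intro add_mono) (auto simp: pos_divide_less_eq)
    finally have "ln (real (M n + 1)) \<le> c / 2 * real n" by simp
    then have "exp (ln (real (M n + 1))) \<le> exp (c / 2 * real n)" by (simp only: exp_le_cancel_iff)
    then have "real (M n + 1) \<le> exp (c / 2 * real n)" by simp
    then have "real (M n + 1) ^ n \<le> exp (c / 2 * real n) ^ n" by (intro power_mono) auto
    also have "\<dots> = exp (c / 2 * (real n)\<^sup>2)" by (simp add: exp_of_nat_mult[symmetric] power2_eq_square mult_ac)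
    finally have "real (M n + 1) ^ n * exp (- c * (real n)\<^sup>2) \<le> exp (c / 2 * (real n)\<^sup>2) * exp (- c * (real n)\<^sup>2)"
      by (intro mult_right_mono) auto
    also have "\<dots> = exp (- (c / 2) * (real n)\<^sup>2)" by (simp add: exp_add[symmetric])
    also have "\<dots> \<le> exp (- (c / 2) * real n)"
    proof -
      have "real n \<le> (real n)\<^sup>2" using n1 by (simp add: power2_eq_square)
      then have "c / 2 * real n \<le> c / 2 * (real n)\<^sup>2" using c by (intro mult_left_mono) auto
      then show ?thesis by simp
    qed
    also have "\<dots> = exp (- (c / 2)) ^ n" by (simp add: exp_of_nat_mult[symmetric] mult.commute)
    finally show ?case .
  qed
qed

context racah_potential
begin

text \<open>Cosine moments determine the averages of polynomials in cos (th x), and on {0..L} every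
  continuous function is a continuous function of this cosine, because th maps into
  [0, \<pi>].\<close>

lemma weierstrass_conclusion:
  fixes y :: "nat \<Rightarrow> nat \<Rightarrow> nat" and M :: "nat \<Rightarrow> nat" and f :: "real \<Rightarrow> real"
  assumes M: "(\<lambda>n. real (M n) / real n) \<longlonglongrightarrow> L"
    and y: "\<forall>\<^sub>F n in sequentially. \<forall>j\<in>{1..n}. y n j \<le> M n"
    and lim: "\<And>k. 1 \<le> k \<Longrightarrow> (\<lambda>n. 1 / real n * (\<Sum>j=1..n. cos (real k * th (real (y n j) / real n))))
      \<longlonglongrightarrow> integral {0..L} (\<lambda>x. rho x * cos (real k * th x))"
    and f: "continuous_on UNIV f"
  shows "(\<lambda>n. 1 / real n * (\<Sum>j=1..n. f (real (y n j) / real n))) \<longlonglongrightarrow> integral {0..L} (\<lambda>x. rho x * f x)"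
proof -
  define A where "A = (\<lambda>f n. 1 / real n * (\<Sum>j=1..n. f (real (y n j) / real n) :: real))"
  define I where "I = (\<lambda>f. integral {0..L} (\<lambda>x. rho x * f x))"
  have cth: "continuous_on S (\<lambda>x. th x)" for S unfolding th_def by (intro continuous_intros)
  have ri: "(\<lambda>x. rho x * g x) integrable_on {0..L}" if g: "continuous_on UNIV g" for g
  proof -
    have [measurable]: "g \<in> borel_measurable borel" by (rule borel_measurable_continuous_onI[OF g])
    have "compact (g ` {0..L})" using g by (intro compact_continuous_image) (auto intro: continuous_on_subset)
    then have "bounded (g ` {0..L})" by (rule compact_imp_bounded)
    then obtain B where B: "\<forall>x\<in>{0..L}. \<bar>g x\<bar> \<le> B" by (auto simp: bounded_iff)
    show ?thesis
    proof (rule borel_bounded_integrable[where B = B])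
      show "\<bar>rho x * g x\<bar> \<le> B" if "x \<in> {0..L}" for x
        unfolding abs_mult using mult_mono[of "\<bar>rho x\<bar>" 1 "\<bar>g x\<bar>" B] rho_bounds[of x] B that by auto
    qed measurable
  qed
  have rho_i: "rho integrable_on {0..L}" using ri[of "\<lambda>_. 1"] by simp
  note rho1 = rho_total
  have cosc: "continuous_on UNIV (\<lambda>x. cos (th x) ^ i * cos (real k * th x))" for i k
    by (intro continuous_intros cth)
  \<comment> \<open>A power of the cosine is traded for the modes k + 1 and k - 1; k = 0 is treated
    apart, where k - 1 would be negative.\<close>
  have pw: "A (\<lambda>x. cos (th x) ^ i * cos (real k * th x)) \<longlonglongrightarrow> I (\<lambda>x. cos (th x) ^ i * cos (real k * th x))" for i k
  proof (induction i arbitrary: k)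
    case 0
    show ?case
    proof (cases "k = 0")
      case True
      have "\<forall>\<^sub>F n in sequentially. 1 = A (\<lambda>x. 1) n"
        using eventually_gt_at_top[of 0] by eventually_elim (simp add: A_def)
      then have "A (\<lambda>x. 1) \<longlonglongrightarrow> 1" by (rule tendsto_eventually[OF eventually_mono]) simp
      then show ?thesis using True rho1 by (simp add: I_def)
    next
      case False
      then show ?thesis using lim[of k] by (simp add: A_def I_def)
    qed
  next
    case (Suc i)
    show ?case
    proof (cases k)
      case 0
      have "(\<lambda>x. cos (th x) ^ Suc i * cos (real k * th x)) = (\<lambda>x. cos (th x) ^ i * cos (real 1 * th x))"
        by (simp add: 0 mult.commute)
      then show ?thesis using Suc[of 1] by simp
    next
      case (Suc k')
      have e: "(\<lambda>x. cos (th x) ^ Suc i * cos (real k * th x)) =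
        (\<lambda>x. 1 / 2 * (cos (th x) ^ i * cos (real (Suc k) * th x)) + 1 / 2 * (cos (th x) ^ i * cos (real k' * th x)))"
      proof
        fix x
        have "cos (th x) * cos (real k * th x) = (cos (real (Suc k) * th x) + cos (real k' * th x)) / 2"
          using cos_times_cos[of "real k * th x" "th x"] unfolding Suc by (simp add: algebra_simps)
        moreover have "c * b * d = 1 / 2 * (b * u) + 1 / 2 * (b * v)" if "c * d = (u + v) / 2" for b c d u v :: real
        proof -
          have "c * b * d = b * (c * d)" by simp
          then show ?thesis unfolding that by (simp add: distrib_left add_divide_distrib)
        qed
        ultimately show "cos (th x) ^ Suc i * cos (real k * th x) = 1 / 2 * (cos (th x) ^ i * cos (real (Suc k) * th x)) + 1 / 2 * (cos (th x) ^ i * cos (real k' * th x))"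
          unfolding power_Suc by blast
      qed
      have a: "A (\<lambda>x. 1 / 2 * g x + 1 / 2 * g' x) = (\<lambda>n. 1 / 2 * A g n + 1 / 2 * A g' n)" for g g'
        by (rule ext) (simp add: A_def sum.distrib sum_divide_distrib[symmetric] algebra_simps add_divide_distrib)
      have b: "I (\<lambda>x. 1 / 2 * g x + 1 / 2 * g' x) = 1 / 2 * I g + 1 / 2 * I g'" if "continuous_on UNIV g" "continuous_on UNIV g'" for g g'
      proof -
        have "(\<lambda>x. rho x * (1 / 2 * g x + 1 / 2 * g' x)) = (\<lambda>x. 1 / 2 * (rho x * g x) + 1 / 2 * (rho x * g' x))"
          by (rule ext) (simp add: algebra_simps)
        moreover have "((\<lambda>x. 1 / 2 * (rho x * g x) + 1 / 2 * (rho x * g' x)) has_integral (1 / 2 * I g + 1 / 2 * I g')) {0..L}"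
          unfolding I_def by (intro has_integral_add has_integral_mult_right integrable_integral ri that)
        ultimately show ?thesis unfolding I_def by (simp add: integral_unique)
      qed
      show ?thesis unfolding e a b[OF cosc cosc]
        by (intro tendsto_add tendsto_mult tendsto_const Suc.IH)
    qed
  qed
  have lin: "A (\<lambda>x. \<Sum>i\<le>N. co i * cos (th x) ^ i) \<longlonglongrightarrow> I (\<lambda>x. \<Sum>i\<le>N. co i * cos (th x) ^ i)" for co :: "nat \<Rightarrow> real" and N
  proof -
    have 1: "A (\<lambda>x. \<Sum>i\<le>N. co i * cos (th x) ^ i) = (\<lambda>n. \<Sum>i\<le>N. co i * A (\<lambda>x. cos (th x) ^ i * cos (real 0 * th x)) n)"
    proof
      fix n
      have "(\<Sum>j=1..n. \<Sum>i\<le>N. co i * cos (th (real (y n j) / real n)) ^ i) = (\<Sum>i\<le>N. \<Sum>j=1..n. co i * cos (th (real (y n j) / real n)) ^ i)"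
        by (rule sum.swap)
      then show "A (\<lambda>x. \<Sum>i\<le>N. co i * cos (th x) ^ i) n = (\<Sum>i\<le>N. co i * A (\<lambda>x. cos (th x) ^ i * cos (real 0 * th x)) n)"
        unfolding A_def by (simp add: sum_distrib_left mult_ac)
    qed
    have 2: "((\<lambda>x. \<Sum>i\<le>N. co i * (rho x * (cos (th x) ^ i * cos (real 0 * th x)))) has_integral (\<Sum>i\<le>N. co i * I (\<lambda>x. cos (th x) ^ i * cos (real 0 * th x)))) {0..L}"
      unfolding I_def by (intro has_integral_sum has_integral_mult_right integrable_integral ri cosc) auto
    have "(\<lambda>x. rho x * (\<Sum>i\<le>N. co i * cos (th x) ^ i)) = (\<lambda>x. \<Sum>i\<le>N. co i * (rho x * (cos (th x) ^ i * cos (real 0 * th x))))"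
      by (rule ext) (simp add: sum_distrib_left mult_ac)
    then have 3: "I (\<lambda>x. \<Sum>i\<le>N. co i * cos (th x) ^ i) = (\<Sum>i\<le>N. co i * I (\<lambda>x. cos (th x) ^ i * cos (real 0 * th x)))"
      using integral_unique[OF 2] by (simp add: I_def)
    show ?thesis unfolding 1 3 by (intro tendsto_sum tendsto_mult tendsto_const pw)
  qed
  have "A f \<longlonglongrightarrow> I f"
  proof (rule tendstoI)
    fix e :: real assume e: "0 < e"
    define g where "g = (\<lambda>c. f ((arccos c - p) / (2 * h)))"
    have gc: "continuous_on {-1..1} g"
      unfolding g_def by (rule continuous_on_compose2[OF f]) (use h in \<open>auto intro!: continuous_intros continuous_on_arccos'\<close>)
    obtain q where q: "real_polynomial_function q" "\<And>c. c \<in> {-1..1} \<Longrightarrow> \<bar>g c - q c\<bar> < e / 8"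
      using Stone_Weierstrass_real_polynomial_function[OF _ gc, of "e / 8"] e by auto
    obtain co N where qe: "q = (\<lambda>x. \<Sum>i\<le>N. co i * x ^ i)" using q(1) unfolding real_polynomial_function_iff_sum by blast
    define F where "F = (\<lambda>x. q (cos (th x)))"
    have F: "F = (\<lambda>x. \<Sum>i\<le>N. co i * cos (th x) ^ i)" by (simp add: F_def qe)
    have Fc: "continuous_on UNIV F" unfolding F by (intro continuous_intros cth)
    have FfL: "\<bar>f x - F x\<bar> \<le> e / 8" if "x \<in> {0..L}" for x
    proof -
      have t: "0 \<le> th x" "th x \<le> pi" using ang[of x] that by (auto simp: th_def)
      have "g (cos (th x)) = f x" using h t by (simp add: g_def arccos_cos) (simp add: th_def)
      then show ?thesis using q(2)[of "cos (th x)"] by (auto simp: F_def)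
    qed
    \<comment> \<open>M n / n only tends to L, so particles may lie slightly beyond L, where the
      approximation holds only by continuity at L.\<close>
    have "isCont (\<lambda>x. f x - F x) L" using f Fc by (intro continuous_intros) (auto simp: continuous_on_eq_continuous_at)
    then obtain \<delta> where \<delta>: "0 < \<delta>" "\<And>x. \<bar>x - L\<bar> < \<delta> \<Longrightarrow> \<bar>(f x - F x) - (f L - F L)\<bar> < e / 8"
      using e unfolding continuous_at_eps_delta by (metis dist_real_def zero_less_divide_iff zero_less_numeral)
    have Ff: "\<bar>f x - F x\<bar> \<le> e / 4" if "0 \<le> x" "x < L + \<delta>" for x
    proof (cases "x \<le> L")
      case True
      then show ?thesis using FfL[of x] that e by auto
    next
      case False
      then have "\<bar>(f x - F x) - (f L - F L)\<bar> < e / 8" using \<delta>(2)[of x] that by auto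
      moreover have "\<bar>f L - F L\<bar> \<le> e / 8" using FfL[of L] L by auto
      moreover have "\<bar>u\<bar> \<le> e / 4" if "\<bar>u - v\<bar> < e / 8" "\<bar>v\<bar> \<le> e / 8" for u v :: real using that by linarith
      ultimately show ?thesis by blast
    qed
    have ev1: "\<forall>\<^sub>F n in sequentially. real (M n) / real n < L + \<delta>" by (rule order_tendstoD(2)[OF M]) (use \<delta> in simp)
    have ev2: "\<forall>\<^sub>F n in sequentially. \<bar>A F n - I F\<bar> < e / 4"
      using tendstoD[OF lin[of co N, folded F], of "e / 4"] e by (auto simp: dist_real_def)
    have iF: "\<bar>I f - I F\<bar> \<le> e / 8"
    proof -
      have 1: "((\<lambda>x. rho x * f x - rho x * F x) has_integral (I f - I F)) {0..L}"
        unfolding I_def by (intro has_integral_diff integrable_integral ri f Fc)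
      have 2: "((\<lambda>x. e / 8 * rho x) has_integral (e / 8 * 1)) {0..L}"
        unfolding rho1[symmetric] by (intro has_integral_mult_right integrable_integral rho_i)
      have "norm (integral {0..L} (\<lambda>x. rho x * f x - rho x * F x)) \<le> integral {0..L} (\<lambda>x. e / 8 * rho x)"
      proof (rule integral_norm_bound_integral)
        fix x assume x: "x \<in> {0..L}"
        have "\<bar>rho x * f x - rho x * F x\<bar> = rho x * \<bar>f x - F x\<bar>"
          using rho_bounds[of x] by (simp add: right_diff_distrib[symmetric] abs_mult)
        also have "\<dots> \<le> rho x * (e / 8)" using rho_bounds[of x] FfL[OF x] by (intro mult_left_mono) auto
        finally show "norm (rho x * f x - rho x * F x) \<le> e / 8 * rho x" by (simp add: mult.commute)
      qed (use 1 2 in auto)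
      then have "norm (I f - I F) \<le> e / 8 * 1" unfolding integral_unique[OF 1] integral_unique[OF 2] .
      then show ?thesis by simp
    qed
    show "\<forall>\<^sub>F n in sequentially. dist (A f n) (I f) < e"
      using ev1 ev2 y eventually_gt_at_top[of 0]
    proof eventually_elim
      case (elim n)
      have "A f n - A F n = 1 / real n * (\<Sum>j=1..n. f (real (y n j) / real n) - F (real (y n j) / real n))"
        by (simp only: A_def sum_subtractf right_diff_distrib)
      also have "\<bar>\<dots>\<bar> \<le> 1 / real n * (real n * (e / 4))"
      proof -
        have "\<bar>\<Sum>j=1..n. f (real (y n j) / real n) - F (real (y n j) / real n)\<bar> \<le> real n * (e / 4)"
        proof (rule sum_abs_le_card)
          fix j assume "j \<in> {1..n}"
          then have "real (y n j) / real n \<le> real (M n) / real n" using elim by (intro divide_right_mono) auto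
          then show "\<bar>f (real (y n j) / real n) - F (real (y n j) / real n)\<bar> \<le> e / 4" using elim by (intro Ff) auto
        qed (use e in auto)
        then show ?thesis unfolding abs_mult by (intro mult_mono) auto
      qed
      also have "\<dots> = e / 4" using elim by simp
      finally have "\<bar>A f n - A F n\<bar> \<le> e / 4" .
      then show ?case using elim(2) iF e unfolding dist_real_def by linarith
    qed
  qed
  then show ?thesis by (simp only: A_def I_def)
qed

text \<open>Borel-Cantelli is applied to countably many pairs of a mode k and a tolerance 1/(j+1).
  The resulting null set serves all continuous f at once.\<close>

lemma almost_sure_limit:
  fixes P :: "'w measure" and Y :: "nat \<Rightarrow> 'w \<Rightarrow> nat \<Rightarrow> nat" and M :: "nat \<Rightarrow> nat" and CW :: "nat \<Rightarrow> (nat \<Rightarrow> nat) \<Rightarrow> real"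
  assumes P: "prob_space P"
    and Y: "\<And>n. N \<le> n \<Longrightarrow> distributed P (count_space (configs n (M n))) (Y n)
      (\<lambda>y. ennreal (CW n y / (\<Sum>z\<in>configs n (M n). CW n z)))"
    and M: "(\<lambda>n. real (M n) / real n) \<longlonglongrightarrow> L"
    and decay: "\<And>k \<tau>. 1 \<le> k \<Longrightarrow> 0 < \<tau> \<Longrightarrow> \<exists>c>0. \<forall>\<^sub>F n in sequentially. \<forall>y\<in>configs n (M n).
      \<tau> * real n \<le> \<bar>(\<Sum>j=1..n. cos (real k * th (real (y j) / real n))) - real n * integral {0..L} (\<lambda>x. rho x * cos (real k * th x))\<bar>
       \<longrightarrow> (\<exists>z\<in>configs n (M n). \<bar>CW n y\<bar> \<le> exp (- c * (real n)\<^sup>2) * \<bar>CW n z\<bar>)"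
  shows "AE \<omega> in P. \<forall>f. continuous_on UNIV f \<longrightarrow>
    (\<lambda>n. 1 / real n * (\<Sum>j=1..n. f (real (Y n \<omega> j) / real n))) \<longlonglongrightarrow> integral {0..L} (\<lambda>x. rho x * f x)"
proof -
  interpret prob_space P by fact
  define C where "C = (\<lambda>n. configs n (M n))"
  define pr where "pr = (\<lambda>n y. CW n y / (\<Sum>z\<in>C n. CW n z))"
  define I where "I = (\<lambda>k. integral {0..L} (\<lambda>x. rho x * cos (real k * th x)))"
  define St where "St = (\<lambda>k n (y :: nat \<Rightarrow> nat). \<Sum>j=1..n. cos (real k * th (real (y j) / real n)))"
  have fC: "finite (C n)" for n unfolding C_def configs_def by (intro finite_PiE) auto
  have cC: "card (C n) = (M n + 1) ^ n" for n unfolding C_def configs_def by (simp add: card_PiE)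
  have s01: "(\<Sum>y\<in>C n. pr n y) = 1 \<or> (\<forall>y\<in>C n. pr n y = 0)" for n
    unfolding pr_def sum_divide_distrib[symmetric] by (cases "(\<Sum>z\<in>C n. CW n z) = 0") auto
  have D: "distributed P (count_space (C n)) (Y n) (\<lambda>y. ennreal (pr n y))" if "N \<le> n" for n
    using Y[OF that] by (simp add: C_def pr_def)
  note fin = distributed_finite[OF P fC D s01]
  have ae: "AE \<omega> in P. \<forall>\<^sub>F n in sequentially. \<bar>St k n (Y n \<omega>) - real n * I k\<bar> < \<tau> * real n" if k: "1 \<le> k" and \<tau>: "0 < \<tau>" for k \<tau>
  proof -
    obtain c where c: "0 < c" and ev: "\<forall>\<^sub>F n in sequentially. \<forall>y\<in>C n. \<tau> * real n \<le> \<bar>St k n y - real n * I k\<bar>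
       \<longrightarrow> (\<exists>z\<in>C n. \<bar>CW n y\<bar> \<le> exp (- c * (real n)\<^sup>2) * \<bar>CW n z\<bar>)"
      using decay[OF k \<tau>] unfolding C_def St_def I_def by blast
    define Bad where "Bad = (\<lambda>n. {y \<in> C n. \<tau> * real n \<le> \<bar>St k n y - real n * I k\<bar>})"
    define A where "A = (\<lambda>n. if N \<le> n then Y n -` Bad n \<inter> space P else {})"
    have BC: "Bad n \<subseteq> C n" for n by (auto simp: Bad_def)
    have As: "A n \<in> sets P" for n using fin(3)[OF _ BC, of n] by (auto simp: A_def)
    have bound: "\<forall>\<^sub>F n in sequentially. norm (measure P (A n)) \<le> exp (- (c / 2)) ^ n"
      using ev exp_square_beats_count[OF M c] eventually_ge_at_top[of N]
    proof eventually_elim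
      case (elim n)
      have "measure P (A n) = (\<Sum>y\<in>Bad n. pr n y)" using fin(3)[OF elim(3) BC] elim by (simp add: A_def)
      also have "\<dots> \<le> (\<Sum>y\<in>Bad n. exp (- c * (real n)\<^sup>2))"
      proof (rule sum_mono)
        fix y assume y: "y \<in> Bad n"
        then obtain z where z: "z \<in> C n" "\<bar>CW n y\<bar> \<le> exp (- c * (real n)\<^sup>2) * \<bar>CW n z\<bar>"
          using elim(1) by (auto simp: Bad_def)
        define t where "t = \<bar>\<Sum>z\<in>C n. CW n z\<bar>"
        have "pr n y \<le> \<bar>pr n y\<bar>" by simp
        also have "\<dots> = \<bar>CW n y\<bar> / t" by (simp add: pr_def t_def)
        also have "\<dots> \<le> exp (- c * (real n)\<^sup>2) * \<bar>CW n z\<bar> / t" using z by (intro divide_right_mono) (auto simp: t_def)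
        also have "\<dots> = exp (- c * (real n)\<^sup>2) * \<bar>pr n z\<bar>" by (simp add: pr_def t_def)
        also have "\<dots> \<le> exp (- c * (real n)\<^sup>2) * 1" using fin(2)[OF elim(3) z(1)] by (intro mult_left_mono) auto
        finally show "pr n y \<le> exp (- c * (real n)\<^sup>2)" by simp
      qed
      also have "\<dots> = real (card (Bad n)) * exp (- c * (real n)\<^sup>2)" by simp
      also have "\<dots> \<le> real (M n + 1) ^ n * exp (- c * (real n)\<^sup>2)"
      proof (rule mult_right_mono)
        have "card (Bad n) \<le> (M n + 1) ^ n" using card_mono[OF fC BC, of n] cC by simp
        then have "real (card (Bad n)) \<le> real ((M n + 1) ^ n)" by (simp only: of_nat_le_iff)
        then show "real (card (Bad n)) \<le> real (M n + 1) ^ n" by (simp only: of_nat_power)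
      qed simp
      also have "\<dots> \<le> exp (- (c / 2)) ^ n" by (rule elim(2))
      finally show ?case by simp
    qed
    have "summable (\<lambda>n. exp (- (c / 2)) ^ n)" using c by (intro summable_geometric) simp
    then have "summable (\<lambda>n. measure P (A n))" using bound by (rule summable_comparison_test_ev[rotated])
    then have "AE \<omega> in P. \<forall>\<^sub>F n in sequentially. \<omega> \<in> space P - A n"
      by (intro borel_cantelli_AE1[OF As]) (simp_all add: emeasure_eq_measure)
    then show ?thesis
    proof (rule AE_mp, intro AE_I2 impI)
      fix \<omega> assume w: "\<omega> \<in> space P" "\<forall>\<^sub>F n in sequentially. \<omega> \<in> space P - A n"
      show "\<forall>\<^sub>F n in sequentially. \<bar>St k n (Y n \<omega>) - real n * I k\<bar> < \<tau> * real n"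
        using w(2) eventually_ge_at_top[of N]
      proof eventually_elim
        case (elim n)
        then show ?case using w(1) fin(4)[OF elim(2) w(1)] by (auto simp: A_def Bad_def not_le)
      qed
    qed
  qed
  have "AE \<omega> in P. \<forall>k\<ge>1. \<forall>j. \<forall>\<^sub>F n in sequentially. \<bar>St k n (Y n \<omega>) - real n * I k\<bar> < 1 / real (Suc j) * real n"
    unfolding AE_all_countable
  proof
    fix k :: nat
    show "AE \<omega> in P. 1 \<le> k \<longrightarrow> (\<forall>j. \<forall>\<^sub>F n in sequentially. \<bar>St k n (Y n \<omega>) - real n * I k\<bar> < 1 / real (Suc j) * real n)"
    proof (cases "1 \<le> k")
      case True
      have "AE \<omega> in P. \<forall>j. \<forall>\<^sub>F n in sequentially. \<bar>St k n (Y n \<omega>) - real n * I k\<bar> < 1 / real (Suc j) * real n"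
        unfolding AE_all_countable by (intro allI ae[OF True]) simp
      then show ?thesis by (rule AE_mp) (intro AE_I2 impI)
    qed simp
  qed
  then show ?thesis
  proof (rule AE_mp, intro AE_I2 impI allI)
    fix \<omega> f
    assume w: "\<omega> \<in> space P" "\<forall>k\<ge>1. \<forall>j. \<forall>\<^sub>F n in sequentially. \<bar>St k n (Y n \<omega>) - real n * I k\<bar> < 1 / real (Suc j) * real n"
      and f: "continuous_on UNIV (f :: real \<Rightarrow> real)"
    show "(\<lambda>n. 1 / real n * (\<Sum>j=1..n. f (real (Y n \<omega> j) / real n))) \<longlonglongrightarrow> integral {0..L} (\<lambda>x. rho x * f x)"
    proof (rule weierstrass_conclusion[OF M _ _ f])
      show "\<forall>\<^sub>F n in sequentially. \<forall>j\<in>{1..n}. Y n \<omega> j \<le> M n"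
        using eventually_ge_at_top[of N]
      proof eventually_elim
        case (elim n)
        then show ?case using fin(4)[OF elim w(1)] by (auto simp: C_def configs_def PiE_iff)
      qed
      fix k :: nat assume k: "1 \<le> k"
      have "(\<lambda>n. 1 / real n * St k n (Y n \<omega>)) \<longlonglongrightarrow> I k"
      proof (rule tendstoI)
        fix e :: real assume "0 < e"
        then obtain j where j: "1 / real (Suc j) < e" using nat_approx_posE by (metis inverse_eq_divide)
        have "\<forall>\<^sub>F n in sequentially. \<bar>St k n (Y n \<omega>) - real n * I k\<bar> < 1 / real (Suc j) * real n" using w(2) k by blast
        then show "\<forall>\<^sub>F n in sequentially. dist (1 / real n * St k n (Y n \<omega>)) (I k) < e"
          using eventually_gt_at_top[of 0]
        proof eventually_elim
          case (elim n)
          have "1 / real n * St k n (Y n \<omega>) - I k = (St k n (Y n \<omega>) - real n * I k) / real n"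
            using elim by (simp add: diff_divide_distrib)
          then have "dist (1 / real n * St k n (Y n \<omega>)) (I k) = \<bar>St k n (Y n \<omega>) - real n * I k\<bar> / real n"
            by (simp add: dist_real_def)
          also have "\<dots> < 1 / real (Suc j)" using elim by (simp add: pos_divide_less_eq)
          finally show ?case using j by simp
        qed
      qed
      then show "(\<lambda>n. 1 / real n * (\<Sum>j=1..n. cos (real k * th (real (Y n \<omega> j) / real n)))) \<longlonglongrightarrow> integral {0..L} (\<lambda>x. rho x * cos (real k * th x))"
        by (simp only: I_def St_def)
    qed
  qed
qed

end

subsection \<open>Reduction of the angles\<close>

lemma sin_pi_int: "sin (pi * of_int k) = 0"
  by (simp add: sin_zero_iff_int2 mult.commute)

lemma cos_pi_int_square: "cos (pi * of_int k) * cos (pi * of_int k) = 1"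
  using sin_cos_squared_add[of "pi * of_int k"] by (simp add: sin_pi_int power2_eq_square)

lemma sin_shift: "v = t + pi * of_int k \<Longrightarrow> sin v = cos (pi * of_int k) * sin t"
  by (simp add: sin_add sin_pi_int)

lemma cos_shift: "v = t + pi * of_int k \<Longrightarrow> cos v = cos (pi * of_int k) * cos t"
  by (simp add: cos_add sin_pi_int)

lemma cos_pi_int_add: "cos (pi * of_int (j + k)) = cos (pi * of_int j) * cos (pi * of_int k)"
  by (simp add: distrib_left cos_add sin_pi_int)

lemma cos_pi_int_diff: "cos (pi * of_int (j - k)) = cos (pi * of_int j) * cos (pi * of_int k)"
  by (simp add: right_diff_distrib cos_diff sin_pi_int)

text \<open>The multiples of \<pi> discarded in the reduction survive only as the signs
  \<open>K1\<close>, \<open>K2\<close> and \<open>KA\<close>.\<close>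

locale reduced_angles =
  fixes h L a p s ga gb gd gg :: real and k1 k2 ia :: int
  assumes gg: "gg = - L" and hp: "h * (gg + gd) = p + pi * of_int k2"
    and hs: "h * (ga + gb) = s + pi * of_int k1" and ha: "h * ga = a + pi * of_int ia"
begin

abbreviation "K1 \<equiv> cos (pi * of_int k1)"
abbreviation "K2 \<equiv> cos (pi * of_int k2)"
abbreviation "KA \<equiv> cos (pi * of_int ia)"

lemma hgd: "h * gd = p + h * L + pi * of_int k2"
  using hp by (simp add: gg algebra_simps)

lemma hgb: "h * gb = s - a + pi * of_int (k1 - ia)"
  using hs ha by (simp add: algebra_simps)

lemma sins:
  "sin (h * (ga + x)) = KA * sin (a + h * x)"
  "sin (h * (gb + gd + x)) = K1 * KA * K2 * sin (p + s + h * L - a + h * x)"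
  "sin (h * (gg + x)) = - sin (h * (L - x))"
  "sin (h * (gg + gd + x)) = K2 * sin (p + h * x)"
  "sin (h * (gg + gd - ga + x)) = K2 * KA * sin (p - a + h * x)"
  "sin (h * (gg - gb + x)) = - (K1 * KA * sin (h * L + s - a - h * x))"
  "sin (h * (gd + x)) = K2 * sin (p + h * L + h * x)"
  "sin (h * (ga + gb + x)) = K1 * sin (s + h * x)"
  "sin (h * (gb + x)) = K1 * KA * sin (s - a + h * x)"
  "sin (h * (ga - gd + x)) = - (KA * K2 * sin (h * L + p - a - h * x))"
  "sin (h * (ga + gb - gg + x)) = K1 * sin (s + h * L + h * x)"
proof -
  show "sin (h * (ga + x)) = KA * sin (a + h * x)"
    by (rule sin_shift) (use ha in \<open>simp add: algebra_simps\<close>)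
  show "sin (h * (gb + gd + x)) = K1 * KA * K2 * sin (p + s + h * L - a + h * x)"
  proof -
    have e: "K1 * KA * K2 = cos (pi * of_int (k1 - ia + k2))" by (simp only: cos_pi_int_add cos_pi_int_diff)
    show ?thesis unfolding e by (rule sin_shift) (use hgb hgd in \<open>simp add: algebra_simps\<close>)
  qed
  have "h * (gg + x) = - (h * (L - x))" by (simp add: gg algebra_simps)
  then show "sin (h * (gg + x)) = - sin (h * (L - x))" by simp
  show "sin (h * (gg + gd + x)) = K2 * sin (p + h * x)"
    by (rule sin_shift) (use hp in \<open>simp add: algebra_simps\<close>)
  show "sin (h * (gg + gd - ga + x)) = K2 * KA * sin (p - a + h * x)"
    unfolding cos_pi_int_diff[symmetric]
    by (rule sin_shift) (use hp ha in \<open>simp add: algebra_simps\<close>)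
  have "h * (gg - gb + x) = - (h * L + s - a - h * x + pi * of_int (k1 - ia))"
    using hgb by (simp add: gg algebra_simps)
  then have "sin (h * (gg - gb + x)) = - sin (h * L + s - a - h * x + pi * of_int (k1 - ia))" by (simp only: sin_minus)
  then show "sin (h * (gg - gb + x)) = - (K1 * KA * sin (h * L + s - a - h * x))"
    unfolding sin_shift[OF refl] cos_pi_int_diff .
  show "sin (h * (gd + x)) = K2 * sin (p + h * L + h * x)"
    by (rule sin_shift) (use hgd in \<open>simp add: algebra_simps\<close>)
  show "sin (h * (ga + gb + x)) = K1 * sin (s + h * x)"
    by (rule sin_shift) (use hs in \<open>simp add: algebra_simps\<close>)
  show "sin (h * (gb + x)) = K1 * KA * sin (s - a + h * x)"
    unfolding cos_pi_int_diff[symmetric]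
    by (rule sin_shift) (use hgb in \<open>simp add: algebra_simps\<close>)
  have "h * (ga - gd + x) = - (h * L + p - a - h * x) + pi * of_int (ia - k2)"
    using ha hgd by (simp add: algebra_simps)
  then have "sin (h * (ga - gd + x)) = cos (pi * of_int (ia - k2)) * sin (- (h * L + p - a - h * x))" by (rule sin_shift)
  then show "sin (h * (ga - gd + x)) = - (KA * K2 * sin (h * L + p - a - h * x))"
    unfolding cos_pi_int_diff sin_minus by simp
  show "sin (h * (ga + gb - gg + x)) = K1 * sin (s + h * L + h * x)"
    by (rule sin_shift) (use hs in \<open>simp add: gg algebra_simps\<close>)
qed

lemma squares: "K1 * K1 = 1" "K2 * K2 = 1" "KA * KA = 1"
  "K1 * (K1 * x) = x" "K2 * (K2 * x) = x" "KA * (KA * x) = x"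
  using cos_pi_int_square[of k1] cos_pi_int_square[of k2] cos_pi_int_square[of ia]
  by (simp_all add: mult.assoc[symmetric])

lemma cis_hp: "cis (h * (gg + gd)) = of_real K2 * cis p"
  unfolding hp by (simp add: complex_eq_iff cos_add sin_add sin_pi_int)

lemma qp: "qpow (2 * h) x = cis (2 * (h * x))" by (simp add: qpow_def mult.assoc)

lemma qp_mult: "qpow (2 * h) x * qpow (2 * h) y = qpow (2 * h) (x + y)"
  by (simp add: qpow_def cis_mult distrib_left)

text \<open>The recurrence coefficients of the limit live in the variable \<xi>, hence the order
  \<open>s p\<close> of the arguments. The half-angle phases combine to cis (h (gg + gd)), which is
  \<open>K2\<close> cis p, and the sines supply a second \<open>K2\<close>.\<close>

lemma lim_A_eq: "lim_A (2 * h) ga gb gd gg \<xi> = cis p * of_real (cA h L a s p \<xi>)"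
proof -
  define S where "S = sin (h * (gg + \<xi>)) * sin (h * (ga + \<xi>)) * sin (h * (ga + gb + \<xi>)) * sin (h * (gb + gd + \<xi>))"
  define D where "D = sin (h * (ga + gb + 2 * \<xi>))"
  have d: "(16 * X * Y) / ((- 2 * \<i>) * (Z * W))\<^sup>2 = (- 4 * (X / Z\<^sup>2)) * (Y / W\<^sup>2)" for X Y Z W :: complex
    by (simp add: power_mult_distrib mult_ac)
  have c: "cis (h * (gg + \<xi>) + h * (ga + \<xi>) + h * (ga + gb + \<xi>) + h * (gb + gd + \<xi>)) / (cis (h * (ga + gb + 2 * \<xi>)))\<^sup>2 = cis (h * (gg + gd))"
    unfolding power2_eq_square cis_mult cis_divide by (rule arg_cong[of _ _ cis]) (simp add: algebra_simps)
  have "lim_A (2 * h) ga gb gd gg \<xi> = (16 * of_real S * cis (h * (gg + \<xi>) + h * (ga + \<xi>) + h * (ga + gb + \<xi>) + h * (gb + gd + \<xi>)))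
     / ((- 2 * \<i>) * (of_real D * cis (h * (ga + gb + 2 * \<xi>))))\<^sup>2"
  proof -
    have f: "qpow (2 * h) gg * qpow (2 * h) \<xi> = cis (2 * (h * (gg + \<xi>)))" "qpow (2 * h) ga * qpow (2 * h) \<xi> = cis (2 * (h * (ga + \<xi>)))"
      "qpow (2 * h) ga * qpow (2 * h) gb * qpow (2 * h) \<xi> = cis (2 * (h * (ga + gb + \<xi>)))"
      "qpow (2 * h) gb * qpow (2 * h) gd * qpow (2 * h) \<xi> = cis (2 * (h * (gb + gd + \<xi>)))"
      unfolding qp_mult unfolding qp by simp_all
    have q2: "qpow (2 * h) ga * qpow (2 * h) gb * (qpow (2 * h) \<xi>)\<^sup>2 = cis (2 * (h * (ga + gb + 2 * \<xi>)))"
      unfolding power2_eq_square mult.assoc[symmetric] qp_mult unfolding qp by (simp add: algebra_simps)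
    show ?thesis
      unfolding S_def D_def cis_factors[symmetric] one_minus_cis[symmetric] lim_A_def Let_def q2 f ..
  qed
  also have "\<dots> = of_real (- 4 * (S / D\<^sup>2)) * cis (h * (gg + gd))" unfolding d c by simp
  also have "- 4 * (S / D\<^sup>2) = K2 * cA h L a s p \<xi>"
    unfolding S_def D_def sins cA_def using squares by (simp add: power_mult_distrib power2_eq_square mult_ac add_ac)
  finally show ?thesis unfolding cis_hp using squares
    by (simp flip: of_real_mult mult.assoc)
qed

text \<open>The factors \<delta> and \<gamma>, pulled out of the two differences, contribute the
  phase by which the result gets the same common phase cis p as \<open>lim_A\<close>.\<close>

lemma lim_C_eq: "lim_C (2 * h) ga gb gd gg \<xi> = cis p * of_real (cC h L a s p \<xi>)"
proof -
  define S where "S = sin (h * (0 + \<xi>)) * sin (h * (gb + \<xi>)) * sin (h * (ga - gd + \<xi>)) * sin (h * (ga + gb - gg + \<xi>))"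
  define D where "D = sin (h * (ga + gb + 2 * \<xi>))"
  have d: "U * (16 * X * Y) / ((- 2 * \<i>) * (Z * W))\<^sup>2 = (- 4 * (X / Z\<^sup>2)) * (U * Y / W\<^sup>2)" for U X Y Z W :: complex
    by (simp add: power_mult_distrib mult_ac)
  have c: "cis (2 * (h * (gg + gd))) * cis (h * (0 + \<xi>) + h * (gb + \<xi>) + h * (ga - gd + \<xi>) + h * (ga + gb - gg + \<xi>)) / (cis (h * (ga + gb + 2 * \<xi>)))\<^sup>2 = cis (h * (gg + gd))"
    unfolding power2_eq_square cis_mult cis_divide by (rule arg_cong[of _ _ cis]) (simp add: algebra_simps)
  have e: "qpow (2 * h) x - qpow (2 * h) y = qpow (2 * h) x * (1 - qpow (2 * h) (y - x))" for x y
    by (simp add: right_diff_distrib qp_mult)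
  have "lim_C (2 * h) ga gb gd gg \<xi> = cis (2 * (h * (gg + gd))) * (16 * of_real S * cis (h * (0 + \<xi>) + h * (gb + \<xi>) + h * (ga - gd + \<xi>) + h * (ga + gb - gg + \<xi>)))
     / ((- 2 * \<i>) * (of_real D * cis (h * (ga + gb + 2 * \<xi>))))\<^sup>2"
  proof -
    have g: "cis (2 * (h * (gg + gd))) = qpow (2 * h) gd * qpow (2 * h) gg" unfolding qp_mult unfolding qp by (simp add: add.commute)
    have q2: "qpow (2 * h) ga * qpow (2 * h) gb * (qpow (2 * h) \<xi>)\<^sup>2 = cis (2 * (h * (ga + gb + 2 * \<xi>)))"
      unfolding power2_eq_square mult.assoc[symmetric] qp_mult unfolding qp by (simp add: algebra_simps)
    have f1: "qpow (2 * h) \<xi> = cis (2 * (h * (0 + \<xi>)))" "qpow (2 * h) gb * qpow (2 * h) \<xi> = cis (2 * (h * (gb + \<xi>)))"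
      unfolding qp_mult unfolding qp by simp_all
    have f2: "qpow (2 * h) gd - qpow (2 * h) ga * qpow (2 * h) \<xi> = qpow (2 * h) gd * (1 - cis (2 * (h * (ga - gd + \<xi>))))"
      unfolding qp_mult e unfolding qp by (simp add: algebra_simps)
    have f3: "qpow (2 * h) gg - qpow (2 * h) ga * qpow (2 * h) gb * qpow (2 * h) \<xi> = qpow (2 * h) gg * (1 - cis (2 * (h * (ga + gb - gg + \<xi>))))"
      unfolding qp_mult e unfolding qp by (simp add: algebra_simps)
    show ?thesis
      unfolding S_def D_def cis_factors[symmetric] one_minus_cis[symmetric] lim_C_def Let_def q2 f1(2) f2 f3 g
      by (subst (1) f1(1)) (simp only: mult_ac)
  qed
  also have "\<dots> = of_real (- 4 * (S / D\<^sup>2)) * cis (h * (gg + gd))" unfolding d c by simp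
  also have "- 4 * (S / D\<^sup>2) = K2 * cC h L a s p \<xi>"
    unfolding S_def D_def sins cC_def using squares by (simp add: power_mult_distrib power2_eq_square mult_ac add_ac)
  finally show ?thesis unfolding cis_hp using squares
    by (simp flip: of_real_mult mult.assoc)
qed

lemma K2_cos: "K2 * cos (p + t) = cos (h * (gg + gd) + t)"
  by (rule cos_shift[symmetric]) (use hp in simp)

lemma cis_sum: "cis (- v) + cis (2 * u + v) = cis u * of_real (2 * cos (u + v))"
proof -
  have "cis (- v) + cis (2 * u + v) = cis u * (cis (- (u + v)) + cis (u + v))"
    by (simp add: distrib_left cis_mult algebra_simps)
  also have "cis (- t) + cis t = of_real (2 * cos t)" for t by (simp add: complex_eq_iff)
  finally show ?thesis .
qed

lemma mu_eq: "mu (2 * h) gd gg x = cis p * of_real (2 * cos (p + 2 * h * x))"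
proof -
  have "mu (2 * h) gd gg x = cis (- (2 * h * x)) + cis (2 * (h * (gg + gd)) + 2 * h * x)"
    unfolding mu_def qp_mult unfolding qp by (simp add: algebra_simps)
  also have "\<dots> = of_real K2 * cis p * of_real (2 * (K2 * cos (p + 2 * h * x)))"
    unfolding cis_sum cis_hp K2_cos ..
  also have "\<dots> = cis p * of_real (2 * (K2 * (K2 * cos (p + 2 * h * x))))" by simp
  finally show ?thesis unfolding squares .
qed

lemma lim_b_eq: "lim_b (2 * h) ga gb gd gg \<xi> = cis p * of_real (cB h L a s p \<xi>)"
proof -
  have "1 + qpow (2 * h) gg * qpow (2 * h) gd = mu (2 * h) gd gg 0" by (simp add: mu_def qpow_def)
  also have "\<dots> = cis p * of_real (2 * cos p)" unfolding mu_eq by simp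
  finally show ?thesis unfolding lim_b_def lim_A_eq lim_C_eq cB_def by (simp add: algebra_simps)
qed

text \<open>A, C, b and \<mu> all carry the phase cis p, so the complex equation is a real one times
  (cis p)^2.\<close>

lemma lim_disc_zero_iff:
  assumes "sin (p + 2 * h * x) \<noteq> 0" "sin (s + 2 * h * \<xi>) \<noteq> 0"
  shows "4 * lim_a_sq (2 * h) ga gb gd gg \<xi> - (mu (2 * h) gd gg x - lim_b (2 * h) ga gb gd gg \<xi>)\<^sup>2 = 0
    \<longleftrightarrow> disc h L a p s x \<xi> = 0"
proof -
  define E where "E = 4 * cA h L a s p \<xi> * cC h L a s p \<xi> - (2 * cos (p + 2 * h * x) - cB h L a s p \<xi>)\<^sup>2"
  have "4 * lim_a_sq (2 * h) ga gb gd gg \<xi> - (mu (2 * h) gd gg x - lim_b (2 * h) ga gb gd gg \<xi>)\<^sup>2 = (cis p)\<^sup>2 * of_real E"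
    unfolding lim_a_sq_def lim_A_eq lim_C_eq lim_b_eq mu_eq E_def by (simp add: power2_eq_square algebra_simps)
  moreover have "disc h L a p s x \<xi> = (sin (s + 2 * h * \<xi>))\<^sup>2 * E"
    by (subst disc_dual[OF assms]) (simp only: disc_def E_def)
  ultimately show ?thesis using assms(2) by simp
qed

text \<open>Translates \<mu>' \<noteq> 0 into sin (p + 2 h x) \<noteq> 0, the condition under which
  \<open>cA\<close> and \<open>cC\<close> are regular at x.\<close>

lemma mu_deriv: "vector_derivative (mu (2 * h) gd gg) (at x) = cis p * of_real (- 4 * h * sin (p + 2 * h * x))"
proof (rule vector_derivative_at)
  have "((\<lambda>x. 2 * cos (p + 2 * h * x)) has_real_derivative - 4 * h * sin (p + 2 * h * x)) (at x)"
    by (auto intro!: derivative_eq_intros)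
  then have "((\<lambda>x. cis p * of_real (2 * cos (p + 2 * h * x))) has_vector_derivative cis p * of_real (- 4 * h * sin (p + 2 * h * x))) (at x)"
    by (intro has_vector_derivative_mult_right has_vector_derivative_of_real)
  then show "(mu (2 * h) gd gg has_vector_derivative cis p * of_real (- 4 * h * sin (p + 2 * h * x))) (at x)"
    by (subst ext[of "mu (2 * h) gd gg", OF mu_eq])
qed

lemma y_tilde_eq: "y_tilde (2 * h) ga gb \<xi> = K1 * (2 * cos (s + 2 * h * \<xi>))"
proof -
  have "cos (2 * h * ((ga + gb) / 2 + \<xi>)) = K1 * cos (s + 2 * h * \<xi>)"
    by (rule cos_shift) (use hs in \<open>simp add: algebra_simps\<close>)
  then show ?thesis by (simp add: y_tilde_def)
qed

lemma abs_wratio: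
  "\<bar>wratio (\<lambda>i. h * (angs ga gb gd gg ! i)) (h * x)\<bar> =
    \<bar>sin (h * (L - x)) * sin (a + h * x) * sin (p + h * x) * sin (p + s + h * L - a + h * x)\<bar> /
    \<bar>sin (h * x) * sin (p + h * L + h * x) * sin (h * L + s - a - h * x) * sin (p - a + h * x)\<bar>"
proof -
  have K: "\<bar>K1\<bar> = 1" "\<bar>K2\<bar> = 1" "\<bar>KA\<bar> = 1" by (rule sin_zero_abs_cos_one[OF sin_pi_int])+
  have e: "wratio (\<lambda>i. h * (angs ga gb gd gg ! i)) (h * x) =
    (sin (h * (ga + x)) * sin (h * (gb + gd + x)) * sin (h * (gg + x)) * sin (h * (gg + gd + x))) /
    (sin (h * (0 + x)) * sin (h * (gg + gd - ga + x)) * sin (h * (gg - gb + x)) * sin (h * (gd + x)))"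
    unfolding wratio_def lessThan_4 atLeastLessThan_4_8 angs_def
    by (simp add: distrib_left[symmetric] mult.assoc)
  show ?thesis unfolding e sins abs_divide abs_mult abs_minus K mult_1 add_0 by (simp only: mult_ac)
qed

end

lemma sin_shifted_bounds:
  fixes h L t x :: real
  assumes "0 < h" "0 \<le> t" "t \<le> pi - h * L"
  shows "0 \<le> x \<Longrightarrow> x \<le> L \<Longrightarrow> 0 \<le> sin (t + h * x)" "0 < x \<Longrightarrow> x < L \<Longrightarrow> 0 < sin (t + h * x)"
proof -
  show "0 \<le> sin (t + h * x)" if "0 \<le> x" "x \<le> L"
  proof -
    have "0 \<le> h * x" "h * x \<le> h * L" using that assms(1) by (auto intro!: mult_left_mono)
    then show ?thesis using assms by (intro sin_ge_zero) linarith+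
  qed
  show "0 < sin (t + h * x)" if "0 < x" "x < L"
  proof -
    have "0 < h * x" "h * x < h * L" using that assms(1) by auto
    then show ?thesis using assms by (intro sin_gt_zero) linarith+
  qed
qed

text \<open>The last assumption has two alternatives: both sines of the product are nonnegative, or
  both become so after a shift of their angles by \<pi> in opposite directions, which leaves the
  product unchanged.\<close>

lemma racah_band_intro:
  fixes h L a p s :: real
  assumes hL: "0 < h" "1 \<le> L" and p: "0 \<le> p" "p + 2 * (h * L) \<le> pi" and s: "0 < s" "s + 2 * (h * L) < pi"
    and sa: "0 \<le> s - a" "s - a \<le> pi - h * L" and pa: "0 \<le> p - a" "p - a \<le> pi - h * L"
    and a: "0 \<le> a \<and> a \<le> pi - h * L \<and> 0 \<le> p + s + h * L - a \<and> p + s + h * L - a \<le> pi - h * L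
      \<or> 0 \<le> a + pi \<and> a + pi \<le> pi - h * L \<and> 0 \<le> p + s + h * L - a - pi \<and> p + s + h * L - a - pi \<le> pi - h * L"
  shows "racah_band h L a p s"
proof -
  have flip: "sin v = - sin (v - pi)" "sin v = - sin (v + pi)" for v :: real by (simp_all add: sin_diff)
  have e: "a + h * x + pi = (a + pi) + h * x" "p + s + h * L - a + h * x - pi = (p + s + h * L - a - pi) + h * x" for x by simp_all
  have prod: "(0 \<le> x \<longrightarrow> x \<le> L \<longrightarrow> 0 \<le> sin (a + h * x) * sin (p + s + h * L - a + h * x)) \<and>
    (0 < x \<longrightarrow> x < L \<longrightarrow> 0 < sin (a + h * x) * sin (p + s + h * L - a + h * x))" for x
    using a
  proof
    assume *: "0 \<le> a \<and> a \<le> pi - h * L \<and> 0 \<le> p + s + h * L - a \<and> p + s + h * L - a \<le> pi - h * L"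
    show ?thesis
      using sin_shifted_bounds[OF hL(1), of a L x] sin_shifted_bounds[OF hL(1), of "p + s + h * L - a" L x] *
      by (intro conjI impI mult_nonneg_nonneg mult_pos_pos) blast+
  next
    assume *: "0 \<le> a + pi \<and> a + pi \<le> pi - h * L \<and> 0 \<le> p + s + h * L - a - pi \<and> p + s + h * L - a - pi \<le> pi - h * L"
    have "sin (a + h * x) * sin (p + s + h * L - a + h * x) = sin ((a + pi) + h * x) * sin ((p + s + h * L - a - pi) + h * x)"
      unfolding e[symmetric] by (subst flip(2)[of "a + h * x"], subst flip(1)[of "p + s + h * L - a + h * x"]) (rule minus_mult_minus)
    then show ?thesis
      using sin_shifted_bounds[OF hL(1), of "a + pi" L x] sin_shifted_bounds[OF hL(1), of "p + s + h * L - a - pi" L x] *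
      by (metis mult_nonneg_nonneg mult_pos_pos)
  qed
  show ?thesis
  proof unfold_locales
    fix x :: real
    show "0 \<le> x \<Longrightarrow> x \<le> L \<Longrightarrow> 0 \<le> sin (a + h * x) * sin (p + s + h * L - a + h * x)"
      "0 < x \<Longrightarrow> x < L \<Longrightarrow> 0 < sin (a + h * x) * sin (p + s + h * L - a + h * x)" using prod by blast+
    show "0 \<le> x \<Longrightarrow> x \<le> L \<Longrightarrow> 0 \<le> sin (s - a + h * x)" "0 < x \<Longrightarrow> x < L \<Longrightarrow> 0 < sin (s - a + h * x)"
      using sin_shifted_bounds[OF hL(1) sa] by blast+
    show "0 \<le> x \<Longrightarrow> x \<le> L \<Longrightarrow> 0 \<le> sin (p - a + h * x)" "0 < x \<Longrightarrow> x < L \<Longrightarrow> 0 < sin (p - a + h * x)"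
      using sin_shifted_bounds[OF hL(1) pa] by blast+
  qed (use hL p s in auto)
qed

lemma of_int_pi_less: "pi * of_int z < pi * of_int z' + c \<Longrightarrow> c \<le> pi \<Longrightarrow> z \<le> z'"
proof -
  assume "pi * of_int z < pi * of_int z' + c" "c \<le> pi"
  then have "pi * of_int z < pi * of_int (z' + 1)" by (simp add: distrib_left)
  then have "real_of_int z < of_int (z' + 1)" by (subst (asm) mult_less_cancel_left_pos) auto
  then show "z \<le> z'" by linarith
qed

text \<open>The parity of \<open>l - m\<close> leaves two possible positions of the angles modulo \<open>\<pi>\<close>,
  according to the parity of \<open>k1\<close>.\<close>

lemma angle_cases:
  fixes h L ga gb gd :: real and j l m k1 k2 :: int
  assumes hL: "0 < h" "1 \<le> L"
    and A: "pi * of_int j \<le> h * ga" "h * ga \<le> pi * of_int j + pi - h * L"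
    and B: "pi * of_int j \<le> h * gb" "h * gb \<le> pi * of_int j + pi - h * L"
    and l: "pi * of_int l \<le> h * gb + h * gd" "h * gb + h * gd \<le> pi * of_int l + pi - h * L"
    and m: "pi * of_int m \<le> h * ga - h * gd" "h * ga - h * gd \<le> pi * of_int m + pi - h * L"
    and lm: "odd (l + m)"
    and k1: "pi * of_int k1 < h * ga + h * gb" "h * ga + h * gb < pi * of_int k1 + pi - 2 * (h * L)"
    and k2: "pi * of_int k2 \<le> h * gd - h * L" "h * gd - h * L \<le> pi * of_int k2 + pi - 2 * (h * L)"
  obtains ia where "racah_band h L (h * ga - pi * of_int ia) (h * gd - h * L - pi * of_int k2) (h * ga + h * gb - pi * of_int k1)"
proof -
  have lam: "0 < h * L" using hL by simp
  have k2': "pi * of_int k2 + h * L \<le> h * gd" "h * gd \<le> pi * of_int k2 + pi - h * L" using k2 by linarith+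
  \<comment> \<open>ga + gb is located twice modulo multiples of \<pi>, by adding the bounds on ga
    and gb, and by adding those on gb + gd and ga - gd; each leaves two values for k1.\<close>
  have z1: "k1 = 2 * j \<or> k1 = 2 * j + 1"
  proof -
    have "2 * j \<le> k1" by (rule of_int_pi_less[of _ _ pi]) (use A B k1 lam in \<open>auto simp: distrib_left\<close>)
    moreover have "k1 \<le> 2 * j + 1" by (rule of_int_pi_less[of _ _ pi]) (use A B k1 lam in \<open>auto simp: distrib_left\<close>)
    ultimately show ?thesis by linarith
  qed
  have z2: "k1 = l + m \<or> k1 = l + m + 1"
  proof -
    have "l + m \<le> k1" by (rule of_int_pi_less[of _ _ pi]) (use l m k1 lam in \<open>auto simp: distrib_left\<close>)
    moreover have "k1 \<le> l + m + 1" by (rule of_int_pi_less[of _ _ pi]) (use l m k1 lam in \<open>auto simp: distrib_left\<close>)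
    ultimately show ?thesis by linarith
  qed
  from z1 show ?thesis
  proof
    assume k: "k1 = 2 * j"
    \<comment> \<open>k1 is even and l + m odd, so k1 = l + m + 1. The bounds k2 + j \<le> l and j -
      k2 \<le> m + 1 then add up to an equality, so both are equalities.\<close>
    have "k1 \<noteq> l + m" using k lm by (metis dvd_triv_left)
    then have lm2: "l + m + 1 = 2 * j" using z2 k by linarith
    have "k2 + j \<le> l" by (rule of_int_pi_less[of _ _ pi]) (use B l k2' lam in \<open>auto simp: distrib_left\<close>)
    moreover have "j - k2 \<le> m + 1"
      by (rule of_int_pi_less[of _ _ pi]) (use A m k2' lam in \<open>auto simp: distrib_left right_diff_distrib\<close>)
    ultimately have eq: "l = k2 + j" "m = j - k2 - 1" using lm2 by linarith+
    have pe: "pi * of_int k1 = 2 * (pi * of_int j)" "pi * of_int l = pi * of_int k2 + pi * of_int j" "pi * of_int m = pi * of_int j - pi * of_int k2 - pi"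
      unfolding k eq by (simp_all add: distrib_left right_diff_distrib)
    show ?thesis
      by (rule that[of j], rule racah_band_intro[OF hL]) (use A B l m k1 k2 lam in \<open>simp_all add: pe\<close>)
  next
    assume k: "k1 = 2 * j + 1"
    \<comment> \<open>Now k1 = l + m, and upper bounds on l and m add up to an equality. The choice
      ia = j + 1 leads to the second alternative of \<open>racah_band_intro\<close>.\<close>
    have "l + m \<noteq> 2 * j" using lm by (metis dvd_triv_left)
    then have lm2: "l + m = 2 * j + 1" using z2 k by linarith
    have "l \<le> k2 + j + 1" by (rule of_int_pi_less[of _ _ pi]) (use B l k2' lam in \<open>auto simp: distrib_left\<close>)
    moreover have "m \<le> j - k2"
      by (rule of_int_pi_less[of _ _ pi]) (use A m k2' lam in \<open>auto simp: distrib_left right_diff_distrib\<close>)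
    ultimately have eq: "l = k2 + j + 1" "m = j - k2" using lm2 by linarith+
    have pe: "pi * of_int k1 = 2 * (pi * of_int j) + pi" "pi * of_int l = pi * of_int k2 + pi * of_int j + pi" "pi * of_int m = pi * of_int j - pi * of_int k2"
      "pi * of_int (j + 1) = pi * of_int j + pi"
      unfolding k eq by (simp_all add: distrib_left right_diff_distrib)
    show ?thesis
      by (rule that[of "j + 1"], rule racah_band_intro[OF hL]) (use A B l m k1 k2 lam in \<open>simp_all only: pe, auto\<close>)
  qed
qed

context racah_curve
begin

text \<open>The integrand is continuous on the open interval only, so the primitive is based at the
  midpoint.\<close>

lemma obtain_potential:
  obtains V where "\<And>x. 0 < x \<Longrightarrow> x < L \<Longrightarrow> (V has_real_derivative ln (cC h L a p s x / cA h L a p s x)) (at x)" "V (L / 2) = 0"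
proof -
  define G where "G = (\<lambda>x. ln (cC h L a p s x / cA h L a p s x))"
  have G: "continuous_on {0<..<L} G"
    unfolding G_def using cA_pos cC_pos
    by (intro continuous_on_ln continuous_on_divide cont_cA cont_cC) (auto simp: less_imp_neq[symmetric])
  define V where "V = (\<lambda>x. LBINT y=L/2..x. G y)"
  have "(V has_real_derivative G x) (at x)" if x: "0 < x" "x < L" for x
  proof -
    define u where "u = min x (L / 2) / 2"
    define v where "v = (max x (L / 2) + L) / 2"
    have uv: "0 < u" "u < x" "x < v" "v < L" "u \<le> L / 2" "L / 2 \<le> v" using x L by (auto simp: u_def v_def min_def max_def)
    have "continuous_on {u..v} G" by (rule continuous_on_subset[OF G]) (use uv in auto)
    then have d: "((\<lambda>t. LBINT y=L/2..t. G y) has_vector_derivative G x) (at x within {u..v})"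
      by (rule interval_integral_FTC2[rotated 2]) (use uv in linarith)+
    have at: "at x within {u..v} = at x" by (rule at_within_interior) (simp add: uv)
    show ?thesis
      unfolding V_def by (rule has_real_derivative_iff_has_vector_derivative[THEN iffD2]) (rule d[unfolded at])
  qed
  moreover have "V (L / 2) = 0" unfolding V_def by (rule interval_integral_endpoints_same)
  ultimately show ?thesis using that[of V] unfolding G_def by blast
qed

end

section \<open>The ensembles in reduced angles\<close>

locale racah_model = racah_band h L a p s + reduced_angles h L a p s ga gb gd gg k1 k2 ia
  for h L a p s ga gb gd gg :: real and k1 k2 ia :: int
begin

definition ca :: "nat \<Rightarrow> real" where "ca i = h * (angs ga gb gd gg ! i)"

text \<open>Explains V' = \<open>ln (C/A)\<close>: the limit of the quotient of consecutive weights
  is the quotient of the recurrence coefficients of the dual variable x.\<close>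

lemma abs_wratio_eq:
  assumes "0 < x" "x < L"
  shows "\<bar>wratio ca (h * x)\<bar> = cA h L a p s x / cC h L a p s x"
proof -
  define N where "N = sin (h * (L - x)) * sin (a + h * x) * sin (p + h * x) * sin (p + s + h * L - a + h * x)"
  define D where "D = sin (h * x) * sin (p + h * L + h * x) * sin (h * L + s - a - h * x) * sin (p - a + h * x)"
  have s2: "0 < (sin (p + 2 * h * x))\<^sup>2" using sin_pos[OF assms] by simp
  have A: "cA h L a p s x = 4 * N / (sin (p + 2 * h * x))\<^sup>2" by (simp add: cA_def N_def mult_ac)
  have C: "cC h L a p s x = 4 * D / (sin (p + 2 * h * x))\<^sup>2" by (simp add: cC_def D_def mult_ac)
  have N: "0 < N" using cA_pos[OF assms] s2 unfolding A by (simp add: zero_less_divide_iff)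
  have D: "0 < D" using cC_pos[OF assms] s2 unfolding C by (simp add: zero_less_divide_iff)
  have "wratio ca (h * x) = wratio (\<lambda>i. h * (angs ga gb gd gg ! i)) (h * x)" by (simp add: ca_def[abs_def])
  then have "\<bar>wratio ca (h * x)\<bar> = N / D" using N D abs_wratio[of x, folded N_def D_def] by simp
  also have "\<dots> = cA h L a p s x / cC h L a p s x" unfolding A C using s2 D by (simp add: field_simps)
  finally show ?thesis .
qed

text \<open>A vanishing sine in the numerator or, by x/0 = 0, in the denominator would make
  \<open>wratio\<close> zero, against the positivity of A / C.\<close>

lemma ca_nonzero:
  assumes "i < 8" "0 < x" "x < L"
  shows "sin (ca i + h * x) \<noteq> 0"
proof
  assume z: "sin (ca i + h * x) = 0"
  have "wratio ca (h * x) = 0"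
  proof (cases "i < 4")
    case True
    then have "(\<Prod>i<4. sin (ca i + h * x)) = 0" using z by (intro prod_zero) auto
    then show ?thesis by (simp add: wratio_def)
  next
    case False
    then have "(\<Prod>i\<in>{4..<8}. sin (ca i + h * x)) = 0" using z assms(1) by (intro prod_zero) auto
    then show ?thesis by (simp add: wratio_def)
  qed
  then show False using abs_wratio_eq[OF assms(2,3)] cA_pos[OF assms(2,3)] cC_pos[OF assms(2,3)] by simp
qed

lemma ln_cC_cA:
  assumes "0 < x" "x < L"
  shows "ln (cC h L a p s x / cA h L a p s x) = - lnratio ca (h * x)"
proof -
  have "lnratio ca (h * x) = ln \<bar>wratio ca (h * x)\<bar>"
    by (rule ln_abs_wratio(2)[symmetric]) (rule ca_nonzero[OF _ assms])
  also have "\<dots> = ln (cA h L a p s x / cC h L a p s x)" by (simp only: abs_wratio_eq[OF assms])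
  finally show ?thesis using cA_pos[OF assms] cC_pos[OF assms] by (simp add: ln_div)
qed

lemma ln_cC_cA_bound:
  assumes "0 < \<epsilon>" "\<epsilon> \<le> x" "x \<le> L - \<epsilon>"
  shows "\<bar>ln (cC h L a p s x / cA h L a p s x)\<bar> \<le> 16 / sqrt (h / 2) / sqrt \<epsilon>"
proof -
  have x: "0 < x" "x < L" using assms by auto
  have "\<bar>lnratio ca (h * x)\<bar> \<le> 16 / sqrt (h * \<epsilon> / 2)"
  proof (rule lnratio_bound)
    fix i :: nat assume "i < 8"
    from abs_sin_ge_gap[OF h ca_nonzero[OF this] assms(1), of L x]
    show "h * \<epsilon> / 2 \<le> \<bar>sin (ca i + h * x)\<bar>" using assms by simp
  qed (use h assms in simp)
  also have "sqrt (h * \<epsilon> / 2) = sqrt (h / 2) * sqrt \<epsilon>" by (simp add: real_sqrt_mult[symmetric])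
  finally show ?thesis unfolding ln_cC_cA[OF x] by simp
qed

text \<open>\<open>K1\<close> is the parity sign of k1. It occurs once in \<open>y_tilde\<close> and
  once as the sign in \<open>lim_rho\<close>, so the arccos formula always sees the decreasing
  function 2 cos (s + 2 h \<xi>).\<close>

lemma lim_rho_eq:
  assumes "0 < x" "x < L"
  shows "lim_rho k1 (2 * h) ga gb (level (rtp h L a p s x)) (level (rtm h L a p s x)) = rho x"
proof -
  define u where "u = rtm h L a p s x"
  define v where "v = rtp h L a p s x"
  define c where "c = 2 * cos (s + 2 * h * 1)"
  have x: "0 \<le> x" "x \<le> L" "sin (p + 2 * h * x) \<noteq> 0" using assms sin_pos[OF assms] by auto
  have uv: "u < v" unfolding u_def v_def by (rule roots_less[OF assms])
  have ur: "2 * cos (s + 2 * h * L) \<le> u" "u \<le> 2 * cos s" and vr: "2 * cos (s + 2 * h * L) \<le> v" "v \<le> 2 * cos s"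
    using root_lower[OF x] root_upper[OF x(1,2)] uv unfolding u_def v_def by auto
  note lu = level[OF ur] and lv = level[OF vr]
  have o: "0 \<le> (1::real)" "1 \<le> L" using L1 by auto
  have iff: "1 < level u \<longleftrightarrow> u < c" "level v < 1 \<longleftrightarrow> c < v" "level u \<le> 1 \<longleftrightarrow> c \<le> u"
    using cos_mono_iff(1)[OF lu(1,2) o] cos_mono_iff(1)[OF o lv(1,2)] cos_mono_iff(3)[OF o lu(1,2)]
    unfolding lu(3) lv(3) c_def by auto
  have lvu: "level v < level u"
    using cos_mono_iff(1)[OF lu(1,2) lv(1,2)] uv unfolding lu(3) lv(3) by auto
  have Kk: "K1 = (if even k1 then 1 else - 1)" by (auto elim!: evenE oddE simp: cos_npi_int mult.commute)
  have Y: "y_tilde (2 * h) ga gb (level v) = K1 * v" "y_tilde (2 * h) ga gb (level u) = K1 * u" "y_tilde (2 * h) ga gb 1 = K1 * c"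
    unfolding y_tilde_eq lu(3) lv(3) c_def by simp_all
  have K1a: "\<bar>K1\<bar> = 1" by (rule sin_zero_abs_cos_one[OF sin_pi_int])
  define q where "q = (2 * c - u - v) / (v - u)"
  have q: "(if even k1 then 1 else - 1) * ((2 * y_tilde (2 * h) ga gb 1 - y_tilde (2 * h) ga gb (level v) - y_tilde (2 * h) ga gb (level u)) /
     \<bar>y_tilde (2 * h) ga gb (level v) - y_tilde (2 * h) ga gb (level u)\<bar>) = q"
  proof -
    have n: "2 * (K * c) - K * v - K * u = K * (2 * c - u - v)" for K by (simp add: algebra_simps)
    have d: "\<bar>K1 * v - K1 * u\<bar> = v - u"
      using uv by (simp only: right_diff_distrib[symmetric] abs_mult K1a mult_1)
    have "K1 * (K1 * (2 * c - u - v) / (v - u)) = K1 * (K1 * ((2 * c - u - v) / (v - u)))" by (simp only: times_divide_eq_right)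
    then show ?thesis unfolding Y n d Kk[symmetric] q_def squares .
  qed
  have qx: "qx x 1 = q" unfolding qx_def qq_def q_def u_def[symmetric] v_def[symmetric] c_def ..
  consider "c \<le> u" | "u < c" "c < v" | "v \<le> c" using uv by linarith
  then show ?thesis
  proof cases
    case 1
    have "q \<le> - 1" unfolding q_def using 1 uv by (simp add: pos_divide_le_eq)
    then have "clamp1 q = - 1" by (simp add: clamp1_def)
    then have "rho x = 1" by (simp add: rho_def qx)
    moreover have "level u \<le> 1" using iff 1 by simp
    ultimately show ?thesis unfolding lim_rho_def Let_def u_def[symmetric] v_def[symmetric] using lvu by simp
  next
    case 2
    have "- 1 \<le> q" "q \<le> 1" unfolding q_def using 2 uv by (auto simp: pos_divide_le_eq pos_le_divide_eq)
    then have "clamp1 q = q" by (simp add: clamp1_def)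
    then have "rho x = arccos q / pi" by (simp add: rho_def qx)
    then show ?thesis unfolding lim_rho_def Let_def u_def[symmetric] v_def[symmetric] q using iff 2 by auto
  next
    case 3
    have "1 \<le> q" unfolding q_def using 3 uv by (simp add: pos_le_divide_eq)
    then have "clamp1 q = 1" by (simp add: clamp1_def)
    then have "rho x = 0" by (simp add: rho_def qx)
    moreover have "\<not> level v < 1" using iff 3 by simp
    moreover have "\<not> level u \<le> 1" using iff 3 uv by simp
    ultimately show ?thesis unfolding lim_rho_def Let_def u_def[symmetric] v_def[symmetric] by simp
  qed
qed

lemma solution_set:
  assumes x: "x \<in> {0..L}" and mu: "vector_derivative (mu (2 * h) gd gg) (at x) \<noteq> 0"
  shows "level (rtp h L a p s x) \<le> level (rtm h L a p s x)"
    and "{\<xi>\<in>{0..L}. 4 * lim_a_sq (2 * h) ga gb gd gg \<xi> - (mu (2 * h) gd gg x - lim_b (2 * h) ga gb gd gg \<xi>)\<^sup>2 = 0}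
      = {level (rtp h L a p s x), level (rtm h L a p s x)}"
proof -
  have nz: "sin (p + 2 * h * x) \<noteq> 0" using mu unfolding mu_deriv by auto
  have x': "0 \<le> x" "x \<le> L" using x by auto
  show "level (rtp h L a p s x) \<le> level (rtm h L a p s x)" by (rule disc_zero_set(2)[OF x' nz])
  have "{\<xi>\<in>{0..L}. 4 * lim_a_sq (2 * h) ga gb gd gg \<xi> - (mu (2 * h) gd gg x - lim_b (2 * h) ga gb gd gg \<xi>)\<^sup>2 = 0}
    = {\<xi>\<in>{0..L}. disc h L a p s x \<xi> = 0}"
  proof (rule Collect_cong, rule conj_cong[OF refl])
    fix \<xi> assume "\<xi> \<in> {0..L}"
    then have "sin (s + 2 * h * \<xi>) \<noteq> 0" using sin_s_pos[of \<xi>] by auto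
    then show "4 * lim_a_sq (2 * h) ga gb gd gg \<xi> - (mu (2 * h) gd gg x - lim_b (2 * h) ga gb gd gg \<xi>)\<^sup>2 = 0
      \<longleftrightarrow> disc h L a p s x \<xi> = 0" by (rule lim_disc_zero_iff[OF nz])
  qed
  then show "{\<xi>\<in>{0..L}. 4 * lim_a_sq (2 * h) ga gb gd gg \<xi> - (mu (2 * h) gd gg x - lim_b (2 * h) ga gb gd gg \<xi>)\<^sup>2 = 0}
      = {level (rtp h L a p s x), level (rtm h L a p s x)}"
    using disc_zero_set(1)[OF x' nz] by simp
qed

end

context racah_model
begin

lemma ensemble_limit:
  fixes P :: "'w measure" and Y :: "nat \<Rightarrow> 'w \<Rightarrow> nat \<Rightarrow> nat" and M :: "nat \<Rightarrow> nat" and g_n :: "nat \<Rightarrow> real"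
  assumes P: "prob_space P" and N: "1 \<le> N"
    and g_n: "\<And>n. N \<le> n \<Longrightarrow> - real n * g_n n = real (M n) + 1" and g_lim: "g_n \<longlonglongrightarrow> gg"
    and low: "\<And>n. N \<le> n \<Longrightarrow> - pi / (2 * h) \<le> g_n n"
    and Y: "\<And>n. N \<le> n \<Longrightarrow> is_qRacah_ensemble P (2 * h) ga gb gd (g_n n) n (M n) (Y n)"
  shows "AE \<omega> in P. \<forall>f. continuous_on UNIV f \<longrightarrow>
    (\<lambda>n. 1 / real n * (\<Sum>j=1..n. f (real (Y n \<omega> j) / real n))) \<longlonglongrightarrow> integral {0..L} (\<lambda>x. rho x * f x)"
proof -
  obtain V where V: "\<And>x. 0 < x \<Longrightarrow> x < L \<Longrightarrow> (V has_real_derivative ln (cC h L a p s x / cA h L a p s x)) (at x)" "V (L / 2) = 0"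
    using obtain_potential by blast
  interpret pot: racah_potential h L a p s V "16 / sqrt (h / 2)"
    by unfold_locales (use V ln_cC_cA_bound in blast)+
  define w where "w = (\<lambda>n y. wreal h ga gb gd (g_n n) n y)"
  define pn0 where "pn0 = (\<lambda>n. h * (g_n n + gd + 1 / real n))"
  define pn where "pn = (\<lambda>n. pn0 n - pi * of_int k2)"
  define CW where "CW = (\<lambda>n y. (\<Prod>j\<in>{1..n}. \<Prod>i\<in>{1..<j}. (2 * cos (pn n + 2 * h * (real (y i) / real n)) -
         2 * cos (pn n + 2 * h * (real (y j) / real n)))\<^sup>2) * (\<Prod>j\<in>{1..n}. w n (y j)))"
  have n0: "0 < n" if "N \<le> n" for n using that N by simp
  have cw: "config_weight (2 * h) ga gb gd (g_n n) n = CW n" if "N \<le> n" for n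
  proof
    fix y
    have hh: "2 * h / 2 = h" by simp
    show "config_weight (2 * h) ga gb gd (g_n n) n y = CW n y"
      unfolding config_weight_real[OF n0[OF that], of "2 * h" ga gb gd "g_n n" y k2] hh CW_def w_def pn_def pn0_def ..
  qed
  have D: "distributed P (count_space (configs n (M n))) (Y n)
      (\<lambda>y. ennreal (CW n y / (\<Sum>z\<in>configs n (M n). CW n z)))" if "N \<le> n" for n
    using Y[OF that] unfolding is_qRacah_ensemble_def ensemble_prob_def cw[OF that] .
  have l0: "(\<lambda>n. 1 / real n) \<longlonglongrightarrow> 0" by (rule lim_1_over_n)
  have pn0_lim: "pn0 \<longlonglongrightarrow> h * (gg + gd)"
  proof -
    have "pn0 \<longlonglongrightarrow> h * (gg + gd + 0)" unfolding pn0_def by (intro tendsto_intros g_lim l0)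
    then show ?thesis by simp
  qed
  have pn_lim: "pn \<longlonglongrightarrow> p"
  proof -
    have "pn \<longlonglongrightarrow> h * (gg + gd) - pi * of_int k2" unfolding pn_def by (intro tendsto_intros pn0_lim)
    then show ?thesis unfolding hp by simp
  qed
  have M: "(\<lambda>n. real (M n) / real n) \<longlonglongrightarrow> L"
  proof (rule Lim_transform_eventually)
    have "(\<lambda>n. - g_n n - 1 / real n) \<longlonglongrightarrow> - gg - 0" by (intro tendsto_intros g_lim l0)
    then show "(\<lambda>n. - g_n n - 1 / real n) \<longlonglongrightarrow> L" by (simp add: gg)
    show "\<forall>\<^sub>F n in sequentially. - g_n n - 1 / real n = real (M n) / real n"
      using eventually_ge_at_top[of N]
    proof eventually_elim
      case (elim n)
      have "real (M n) = - real n * g_n n - 1" using g_n[OF elim] by linarith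
      then show ?case using n0[OF elim] by (simp add: diff_divide_distrib)
    qed
  qed
  \<comment> \<open>The bound - \<pi> / gq \<le> g_n limits h M to \<pi> n / 2, so that no two
    angles of the ensemble differ by more than \<pi>.\<close>
  have hM: "\<forall>\<^sub>F n in sequentially. h * real (M n) \<le> pi / 2 * real n"
    using eventually_ge_at_top[of N]
  proof eventually_elim
    case (elim n)
    have "- g_n n \<le> pi / (2 * h)" using low[OF elim] by simp
    then have "h * - g_n n \<le> pi / 2" using h by (simp add: pos_le_divide_eq mult_ac)
    then have 1: "real n * (h * - g_n n) \<le> real n * (pi / 2)" by (intro mult_left_mono) auto
    have "h * real (M n) \<le> h * (- real n * g_n n)" using g_n[OF elim] h by (intro mult_left_mono) auto
    also have "\<dots> = real n * (h * - g_n n)" by simp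
    also note 1
    finally show ?case by (simp add: mult.commute)
  qed
  \<comment> \<open>Total probability 1 forces some configuration to have nonzero weight; among its
    n distinct sites one is at least n - 1, and the weight there is nonzero.\<close>
  have ex: "\<forall>\<^sub>F n in sequentially. \<exists>y. n \<le> y + 1 \<and> w n y \<noteq> 0"
    using eventually_ge_at_top[of N]
  proof eventually_elim
    case (elim n)
    have fC: "finite (configs n (M n))" unfolding configs_def by (intro finite_PiE) auto
    have s01: "(\<Sum>y\<in>configs n (M n). CW n y / (\<Sum>z\<in>configs n (M n). CW n z)) = 1 \<or>
      (\<forall>y\<in>configs n (M n). CW n y / (\<Sum>z\<in>configs n (M n). CW n z) = 0)"
      unfolding sum_divide_distrib[symmetric] by (cases "(\<Sum>z\<in>configs n (M n). CW n z) = 0") auto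
    have "(\<Sum>y\<in>configs n (M n). CW n y / (\<Sum>z\<in>configs n (M n). CW n z)) = 1"
      by (rule distributed_finite(1)[OF P fC D[OF elim] s01])
    then have "\<exists>y\<in>configs n (M n). CW n y / (\<Sum>z\<in>configs n (M n). CW n z) \<noteq> 0"
      using sum.neutral[of "configs n (M n)" "\<lambda>y. CW n y / (\<Sum>z\<in>configs n (M n). CW n z)"] by (metis zero_neq_one)
    then obtain y where y: "CW n y \<noteq> 0" by auto
    have wy: "w n (y j) \<noteq> 0" if "j \<in> {1..n}" for j using y that unfolding CW_def by auto
    have ne: "y i \<noteq> y j" if "i \<in> {1..<j}" "j \<in> {1..n}" for i j
    proof
      assume "y i = y j"
      then have "(\<Prod>i\<in>{1..<j}. (2 * cos (pn n + 2 * h * (real (y i) / real n)) - 2 * cos (pn n + 2 * h * (real (y j) / real n)))\<^sup>2) = 0"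
        using that by (intro prod_zero) (auto intro!: bexI[of _ i])
      then have "(\<Prod>j\<in>{1..n}. \<Prod>i\<in>{1..<j}. (2 * cos (pn n + 2 * h * (real (y i) / real n)) - 2 * cos (pn n + 2 * h * (real (y j) / real n)))\<^sup>2) = 0"
        using that by (intro prod_zero) auto
      then show False using y by (simp add: CW_def)
    qed
    have inj: "inj_on y {1..n}"
    proof (rule inj_onI)
      fix i j assume "i \<in> {1..n}" "j \<in> {1..n}" "y i = y j"
      then show "i = j" using ne[of i j] ne[of j i] by (cases i j rule: linorder_cases) auto
    qed
    have "\<exists>j\<in>{1..n}. n \<le> y j + 1"
    proof (rule ccontr)
      assume "\<not> ?thesis"
      then have "y ` {1..n} \<subseteq> {..<n - 1}" by auto
      then have "card (y ` {1..n}) \<le> card {..<n - 1}" by (intro card_mono) auto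
      then show False unfolding card_image[OF inj] using n0[OF elim] by simp
    qed
    then show ?case using wy by blast
  qed
  have cn: "\<forall>\<^sub>F n in sequentially. \<forall>i<8. \<bar>h * (angs ga gb gd (g_n n) ! i) - ca i\<bar> \<le> h * \<bar>g_n n - gg\<bar>"
  proof (rule always_eventually, intro allI impI)
    fix n i :: nat assume "i < 8"
    then have i: "i \<in> {0, 1, 2, 3, 4, 5, 6, 7}" by auto
    have "\<bar>angs ga gb gd (g_n n) ! i - angs ga gb gd gg ! i\<bar> \<le> \<bar>g_n n - gg\<bar>"
      using i by (auto simp: angs_def)
    then have "h * \<bar>angs ga gb gd (g_n n) ! i - angs ga gb gd gg ! i\<bar> \<le> h * \<bar>g_n n - gg\<bar>" using h by (intro mult_left_mono) auto
    then show "\<bar>h * (angs ga gb gd (g_n n) ! i) - ca i\<bar> \<le> h * \<bar>g_n n - gg\<bar>"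
      unfolding ca_def right_diff_distrib[symmetric] abs_mult using h by simp
  qed
  have d0: "(\<lambda>n. h * \<bar>g_n n - gg\<bar>) \<longlonglongrightarrow> 0"
  proof -
    have "(\<lambda>n. h * \<bar>g_n n - gg\<bar>) \<longlonglongrightarrow> h * \<bar>gg - gg\<bar>" by (intro tendsto_intros g_lim)
    then show ?thesis by simp
  qed
  have nzp: "sin (h * (gg + gd) + 2 * h * x) \<noteq> 0" if x: "0 < x" "x < L" for x
  proof -
    have "sin (h * (gg + gd) + 2 * h * x) = K2 * sin (p + 2 * h * x)" by (rule sin_shift) (simp add: hp)
    moreover have "K2 \<noteq> 0" using squares(2) by fastforce
    ultimately show ?thesis using sin_pos[OF x] by auto
  qed
  have wts: "\<forall>\<^sub>F n in sequentially. \<exists>\<kappa>. \<forall>i.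
       \<epsilon> * real n \<le> real i \<longrightarrow> real i \<le> (L - \<epsilon>) * real n \<longrightarrow>
         w n i \<noteq> 0 \<and> \<bar>ln \<bar>w n i\<bar> - \<kappa> + real n * V (real i / real n)\<bar> \<le> \<eta> * real n"
    if "0 < \<epsilon>" "\<epsilon> < 1 / 4" "0 < \<eta>" for \<epsilon> \<eta>
  proof (rule weight_asymptotics[OF h L1 ca_nonzero nzp cn d0 pn0_lim _ _ ex that])
    show "(V has_real_derivative - lnratio ca (h * x)) (at x)" if "0 < x" "x < L" for x
      using V(1)[OF that] unfolding ln_cC_cA[OF that] .
    show "w n y = (\<Prod>s<y. wratio (\<lambda>i. h * (angs ga gb gd (g_n n) ! i)) (h * (real (s + 1) / real n))) *
       sin (pn0 n + 2 * h * (real y / real n)) / sin (pn0 n)" for n y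
      unfolding w_def wreal_def pn0_def ..
  qed
  show ?thesis
  proof (rule pot.almost_sure_limit[OF P D M])
    fix k :: nat and \<tau> :: real assume k: "1 \<le> k" "0 < \<tau>"
    show "\<exists>c>0. \<forall>\<^sub>F n in sequentially. \<forall>y\<in>configs n (M n).
      \<tau> * real n \<le> \<bar>(\<Sum>j=1..n. cos (real k * pot.th (real (y j) / real n))) - real n * integral {0..L} (\<lambda>x. rho x * cos (real k * pot.th x))\<bar>
       \<longrightarrow> (\<exists>z\<in>configs n (M n). \<bar>CW n y\<bar> \<le> exp (- c * (real n)\<^sup>2) * \<bar>CW n z\<bar>)"
      by (rule pot.prob_decay[OF pn_lim M hM wts _ k]) (simp_all only: CW_def)
  qed
qed

lemma rho_integral_eq:
  assumes f: "continuous_on UNIV f" and R: "\<And>x. 0 < x \<Longrightarrow> x < L \<Longrightarrow> R x = rho x"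
  shows "(LINT x:{0..L}|lborel. f x * R x) = integral {0..L} (\<lambda>x. rho x * f x)"
proof -
  have [measurable]: "f \<in> borel_measurable borel" by (rule borel_measurable_continuous_onI[OF f])
  have "compact (f ` {0..L})" using f by (intro compact_continuous_image) (auto intro: continuous_on_subset)
  then have "bounded (f ` {0..L})" by (rule compact_imp_bounded)
  then obtain B where B: "\<forall>x\<in>{0..L}. \<bar>f x\<bar> \<le> B" by (auto simp: bounded_iff)
  have b: "\<bar>rho x * f x\<bar> \<le> B" if "x \<in> {0..L}" for x
    unfolding abs_mult using mult_mono[of "\<bar>rho x\<bar>" 1 "\<bar>f x\<bar>" B] rho_bounds[of x] B that by auto
  have int: "integrable lborel (\<lambda>x. indicator {0..L} x * (rho x * f x))"
    by (rule integrableI_bounded_set[where A = "{0..L}" and B = B]) (use b in \<open>auto simp: indicator_def emeasure_lborel_Icc_eq\<close>)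
  have pt: "integrable lborel (\<lambda>x. indicator {c} x * d)" "(LINT x|lborel. indicator {c} x * d) = 0" for c d :: real
  proof -
    have "integrable lborel (indicator {c} :: real \<Rightarrow> real)" by (intro integrable_real_indicator) auto
    then show "integrable lborel (\<lambda>x. indicator {c} x * d)" by (rule integrable_mult_left)
    show "(LINT x|lborel. indicator {c} x * d) = 0" by simp
  qed
  \<comment> \<open>Nothing is known about R at the two end points, not even agreement with
    \<open>rho\<close>; their contributions are split off as explicit null functions.\<close>
  have e: "indicator {0..L} x *\<^sub>R (f x * R x) =
    indicator {0..L} x * (rho x * f x) + (indicator {0} x * (f 0 * (R 0 - rho 0)) + indicator {L} x * (f L * (R L - rho L)))" for x
    using R[of x] L by (cases "x = 0"; cases "x = L"; auto simp: indicator_def algebra_simps)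
  have "(LINT x:{0..L}|lborel. f x * R x) = (LINT x|lborel. indicator {0..L} x * (rho x * f x))"
    unfolding set_lebesgue_integral_def e
    using int pt by (subst Bochner_Integration.integral_add) simp_all
  also have "\<dots> = integral {0..L} (\<lambda>x. rho x * f x)"
    using set_borel_integral_eq_integral(2)[of "{0..L}" "\<lambda>x. rho x * f x"] int
    by (simp add: set_integrable_def set_lebesgue_integral_def)
  finally show ?thesis .
qed

end

theorem theorem3p2:
  fixes P :: "'w measure"
    and Y :: "nat \<Rightarrow> 'w \<Rightarrow> nat \<Rightarrow> nat"
    and M :: "nat \<Rightarrow> nat" and N :: nat
    and g_n :: "nat \<Rightarrow> real"
    and gq ga gb gd gg :: real
    and j k l m k1 k2 :: int
  assumes gq: "0 < gq" "gq < pi"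
    and N: "1 \<le> N"
    and M: "\<And>n. N \<le> n \<Longrightarrow> n \<le> M n"
    and g_n: "\<And>n. N \<le> n \<Longrightarrow> - real n * g_n n = real (M n) + 1"
    and g_lim: "g_n \<longlonglongrightarrow> gg" "- pi / gq < gg" "gg < 0"
    and restr_g: "\<And>n. N \<le> n \<Longrightarrow> - pi / gq \<le> g_n n \<and> g_n n \<le> - 1"
    and restr_a: "\<And>n. N \<le> n \<Longrightarrow>
          2 * pi * j / gq \<le> ga \<and> ga \<le> g_n n + 2 * pi * (j + 1) / gq"
    and restr_b: "\<And>n. N \<le> n \<Longrightarrow>
          2 * pi * j / gq \<le> gb \<and> gb \<le> g_n n + 2 * pi * (j + 1) / gq"
    and restr_ab: "\<And>n. N \<le> n \<Longrightarrow>
          2 * pi * k / gq \<le> ga + gb \<and> ga + gb \<le> 2 * g_n n + 2 * pi * (k + 1) / gq"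
    and restr_bd: "2 * pi * l / gq \<le> gb + gd" "gb + gd \<le> 2 * pi * (l + 1) / gq + gg"
    and restr_ad: "2 * pi * m / gq \<le> ga - gd" "ga - gd \<le> 2 * pi * (m + 1) / gq + gg"
    and lm: "odd \<bar>l - m\<bar>"
    and P: "prob_space P"
    and Y: "\<And>n. N \<le> n \<Longrightarrow> is_qRacah_ensemble P gq ga gb gd (g_n n) n (M n) (Y n)"
    and k1: "2 * k1 * pi / gq < ga + gb" "ga + gb < 2 * pi * (k1 + 1) / gq + 2 * gg"
    and k2: "2 * k2 * pi / gq \<le> gg + gd" "gg + gd \<le> 2 * pi * (k2 + 1) / gq + 2 * gg"
  shows "\<exists>\<xi>m \<xi>p :: real \<Rightarrow> real.
     (\<forall>x\<in>{0..- gg}. vector_derivative (mu gq gd gg) (at x) \<noteq> 0 \<longrightarrow>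
        \<xi>m x \<le> \<xi>p x \<and>
        {\<xi>\<in>{0..- gg}. 4 * lim_a_sq gq ga gb gd gg \<xi>
                         - (mu gq gd gg x - lim_b gq ga gb gd gg \<xi>)\<^sup>2 = 0} = {\<xi>m x, \<xi>p x}) \<and>
     has_limiting_density P Y (- gg) (\<lambda>x. lim_rho k1 gq ga gb (\<xi>m x) (\<xi>p x))"
proof -
  define h where "h = gq / 2"
  define L where "L = - gg"
  have h: "0 < h" and gqh: "gq = 2 * h" and ggL: "gg = - L" using gq by (simp_all add: h_def L_def)
  \<comment> \<open>Puts the filling {0..1} inside {0..L}.\<close>
  have L1: "1 \<le> L"
  proof -
    have "gg \<le> - 1" by (rule LIMSEQ_le_const2[OF g_lim(1)]) (use restr_g in blast)
    then show ?thesis by (simp add: L_def)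
  qed
  \<comment> \<open>The restrictions that involve g_n hold for all n \<ge> N and pass to the limit,
    so that from here on only gg enters the angles.\<close>
  have lim_le: "v \<le> gg + c" if "\<And>n. N \<le> n \<Longrightarrow> v \<le> g_n n + c" for v c
    by (rule LIMSEQ_le_const[OF tendsto_add[OF g_lim(1) tendsto_const]]) (use that in blast)
  have lo: "pi * z \<le> h * v" if "2 * pi * z / gq \<le> v" for z v
    using that h unfolding gqh by (simp add: pos_divide_le_eq mult_ac)
  have up: "h * v \<le> h * u + pi * z" if "v \<le> u + 2 * pi * z / gq" for z v u
  proof -
    have "h * v \<le> h * (u + 2 * pi * z / gq)" using that h by (intro mult_left_mono) auto
    also have "\<dots> = h * u + pi * z" using h by (simp add: gqh distrib_left)
    finally show ?thesis .
  qed
  have lo': "pi * z < h * v" if "2 * pi * z / gq < v" for z v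
    using that h unfolding gqh by (simp add: pos_divide_less_eq mult_ac)
  have up': "h * v < h * u + pi * z" if "v < 2 * pi * z / gq + u" for z v u
  proof -
    have "h * v < h * (2 * pi * z / gq + u)" using that h by (intro mult_strict_left_mono) auto
    also have "\<dots> = h * u + pi * z" using h by (simp add: gqh distrib_left)
    finally show ?thesis .
  qed
  have A: "pi * of_int j \<le> h * ga" "h * ga \<le> pi * of_int j + pi - h * L"
    using lo[of "of_int j" ga] up[OF lim_le[of ga "2 * pi * (of_int j + 1) / gq"]] restr_a by (auto simp: ggL distrib_left)
  have B: "pi * of_int j \<le> h * gb" "h * gb \<le> pi * of_int j + pi - h * L"
    using lo[of "of_int j" gb] up[OF lim_le[of gb "2 * pi * (of_int j + 1) / gq"]] restr_b by (auto simp: ggL distrib_left)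
  have bd: "pi * of_int l \<le> h * gb + h * gd" "h * gb + h * gd \<le> pi * of_int l + pi - h * L"
    using lo[of "of_int l" "gb + gd"] up[of "gb + gd" gg "of_int l + 1"] restr_bd by (auto simp: ggL distrib_left add.commute)
  have ad: "pi * of_int m \<le> h * ga - h * gd" "h * ga - h * gd \<le> pi * of_int m + pi - h * L"
    using lo[of "of_int m" "ga - gd"] up[of "ga - gd" gg "of_int m + 1"] restr_ad by (auto simp: ggL distrib_left right_diff_distrib add.commute)
  have lm': "odd (l + m)" using lm by simp
  have k1': "2 * pi * of_int k1 / gq < ga + gb" and k2': "2 * pi * of_int k2 / gq \<le> gg + gd"
    using k1(1) k2(1) by (simp_all add: mult_ac)
  have kk1: "pi * of_int k1 < h * ga + h * gb" "h * ga + h * gb < pi * of_int k1 + pi - 2 * (h * L)"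
    using lo'[OF k1'] up'[of "ga + gb" "of_int k1 + 1" "2 * gg"] k1(2) by (auto simp: ggL distrib_left)
  have kk2: "pi * of_int k2 \<le> h * gd - h * L" "h * gd - h * L \<le> pi * of_int k2 + pi - 2 * (h * L)"
    using lo[of "of_int k2" "gg + gd"] up[of "gg + gd" "2 * gg" "of_int k2 + 1"] k2(2) k2'
    by (auto simp: ggL distrib_left right_diff_distrib add.commute mult.commute mult.left_commute)
  obtain ia where band: "racah_band h L (h * ga - pi * of_int ia) (h * gd - h * L - pi * of_int k2) (h * ga + h * gb - pi * of_int k1)"
    by (rule angle_cases[OF h L1 A B bd ad lm' kk1 kk2])
  define a where "a = h * ga - pi * of_int ia"
  define p where "p = h * gd - h * L - pi * of_int k2"
  define s where "s = h * ga + h * gb - pi * of_int k1"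
  interpret racah_band h L a p s using band unfolding a_def p_def s_def .
  interpret racah_model h L a p s ga gb gd gg k1 k2 ia
    by unfold_locales (simp_all add: ggL a_def p_def s_def algebra_simps)
  \<comment> \<open>The cosine decreases, so the upper band edge yields the smaller
    solution.\<close>
  define \<xi>m where "\<xi>m = (\<lambda>x. level (rtp h L a p s x))"
  define \<xi>p where "\<xi>p = (\<lambda>x. level (rtm h L a p s x))"
  have "AE \<omega> in P. \<forall>f. continuous_on UNIV f \<longrightarrow>
    (\<lambda>n. 1 / real n * (\<Sum>j=1..n. f (real (Y n \<omega> j) / real n))) \<longlonglongrightarrow> integral {0..L} (\<lambda>x. rho x * f x)"
    by (rule ensemble_limit[OF P N g_n g_lim(1)]) (use restr_g Y in \<open>auto simp: gqh\<close>)
  then have "has_limiting_density P Y L (\<lambda>x. lim_rho k1 (2 * h) ga gb (\<xi>m x) (\<xi>p x))"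
    unfolding has_limiting_density_def
    by eventually_elim (use rho_integral_eq lim_rho_eq in \<open>simp add: \<xi>m_def \<xi>p_def\<close>)
  moreover have "\<xi>m x \<le> \<xi>p x \<and> {\<xi>\<in>{0..L}. 4 * lim_a_sq (2 * h) ga gb gd gg \<xi>
      - (mu (2 * h) gd gg x - lim_b (2 * h) ga gb gd gg \<xi>)\<^sup>2 = 0} = {\<xi>m x, \<xi>p x}"
    if "x \<in> {0..L}" "vector_derivative (mu (2 * h) gd gg) (at x) \<noteq> 0" for x
    using solution_set[OF that] unfolding \<xi>m_def \<xi>p_def by blast
  ultimately show ?thesis unfolding L_def[symmetric] gqh by blast
qed

end
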